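(* Let $N,m\ge1$ and $\ell\ge0$ be integers. Let $\mathscr{A}=(-1)^m\sum_{|\alpha|=|\beta|=m}a_{\alpha,\beta}\,\partial^\beta\partial^\alpha$ be an operator of order $2m$ on $\mathbb{R}^N$ with constant real symmetric coefficients satisfying the ellipticity condition (see context). Let $u\in H^m(B(0,1))$ be a weak solution of $\mathscr{A}u=f$ in $B^+(0,1)$ with $f\in H^\ell(B^+(0,1))$, and such that $u=0$ a.e. in $B(0,1)\cap\{x_N<0\}$. Then $u\in H^{2m+\ell}(B^+(0,1/2))$ and $$\|u\|_{H^{2m+\ell}(B^+(0,\frac12))}\le C\left(\|\nabla^m u\|_{L^2(B^+(0,1))}+\|f\|_{H^\ell(B^+(0,1))}\right),$$ where $C>0$ is a constant that depends on $N$, $\max_{\alpha,\beta}|a_{\alpha,\beta}|$, $\ell$ and $m$.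
   Context: $B(0,r)$ is the open ball in $\mathbb{R}^N$ centered at $0$ of radius $r$, and $B^+(0,r)=B(0,r)\cap\{x_N>0\}$. $\nabla^m u=(\partial^\alpha u)_{|\alpha|=m}$. $H^k(U)$ is the Sobolev space with norm $\|u\|_{H^k(U)}^2=\sum_{|\alpha|\le k}\|\partial^\alpha u\|_{L^2(U)}^2$, and $H^k_0(U)$ is the closure in $H^k(U)$ of the $C^\infty$ functions with compact support in $U$. Operator: the coefficients $a_{\alpha,\beta}\in\mathbb{R}$ are indexed by multi-indices of length $m$, are symmetric ($a_{\alpha,\beta}=a_{\beta,\alpha}$), and satisfy the ellipticity condition: there is a constant $c>0$ such that $\sum_{|\alpha|=|\beta|=m}a_{\alpha,\beta}\xi_\alpha\xi_\beta\ge c\sum_{|\alpha|=m}|\xi_\alpha|^2$ for all real vectors $\xi=(\xi_\alpha)_{|\alpha|=m}$. Weak solution of $\mathscr{A}u=f$ in $B^+(0,1)$: $\int_{B^+(0,1)}\sum_{|\alpha|=|\beta|=m}a_{\alpha,\beta}\,\partial^\alpha u\,\partial^\beta\varphi\,dx=\int_{B^+(0,1)}f\varphi\,dx$ for every $\varphi\in H^m_0(B^+(0,1))$.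
   Formalization: The constant C may depend also on the ellipticity constant c, besides N, max|a|, ℓ and m; without this the claim fails (N=2, m=1, ℓ=0, −∂²_{x_N}−n⁻²∂²_y, u=sin(ny)sin(x_N) for x_N>0: f=2u bounded, |∇u|~n, |D²u|~n²). *)

theory Defs
  imports "HOL-Analysis.Analysis"
begin

text \<open>
  \<open>\<real>\<^sup>N\<close> is \<open>real ^ 'n\<close> with \<open>N = CARD('n)\<close>. The index type is linearly ordered, so its
  elements play the role of \<open>1, \<dots>, N\<close> and the last coordinate \<open>x\<^sub>N\<close> is \<open>x $ Max UNIV\<close>.
  Functions on an open set \<open>U\<close> are total functions of which only the values on \<open>U\<close> matter.
\<close>

type_synonym 'n multi_index = "'n \<Rightarrow> nat"

definition mi_length :: "'n::finite multi_index \<Rightarrow> nat" where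
  "mi_length \<alpha> = (\<Sum>i\<in>UNIV. \<alpha> i)"

lemma finite_mi_length_le: "finite {\<alpha>::'n::finite multi_index. mi_length \<alpha> \<le> k}"
proof (rule finite_subset)
  show "{\<alpha>::'n multi_index. mi_length \<alpha> \<le> k} \<subseteq> (UNIV::'n set) \<rightarrow>\<^sub>E {..k}"
    unfolding mi_length_def PiE_UNIV_domain
    by (auto intro: order_trans[OF member_le_sum[of _ UNIV]])
  show "finite ((UNIV::'n set) \<rightarrow>\<^sub>E {..k})"
    by (intro finite_PiE) auto
qed

lemma finite_mi_length_eq: "finite {\<alpha>::'n::finite multi_index. mi_length \<alpha> = k}"
  by (rule finite_subset[OF _ finite_mi_length_le[of k]]) auto


subsection \<open>Classical derivatives and test functions\<close>

definition partial :: "'n::finite \<Rightarrow> (real^'n::_ \<Rightarrow> real) \<Rightarrow> real^'n::_ \<Rightarrow> real" where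
  "partial i f x = frechet_derivative f (at x) (axis i 1)"

text \<open>The order of differentiation is fixed by the order of the indices; it is immaterial for
  the smooth functions to which \<open>mi_partial\<close> is applied.\<close>

definition mi_partial ::
  "'n::{finite,wellorder} multi_index \<Rightarrow> (real^'n::_ \<Rightarrow> real) \<Rightarrow> real^'n::_ \<Rightarrow> real" where
  "mi_partial \<alpha> f = foldr (\<lambda>i. partial i ^^ \<alpha> i) (sorted_list_of_set UNIV) f"

primrec C_k :: "nat \<Rightarrow> (real^'n::finite \<Rightarrow> real) \<Rightarrow> bool" where
  "C_k 0 f \<longleftrightarrow> continuous_on UNIV f"
| "C_k (Suc k) f \<longleftrightarrow> (\<forall>x. f differentiable (at x)) \<and> (\<forall>i. C_k k (partial i f))"

definition C_infinity :: "(real^'n::finite \<Rightarrow> real) \<Rightarrow> bool" where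
  "C_infinity f \<longleftrightarrow> (\<forall>k. C_k k f)"

text \<open>A smooth function with compact support in \<open>U\<close> is identified with its extension by zero.\<close>

definition test_functions :: "(real^'n::finite) set \<Rightarrow> (real^'n::_ \<Rightarrow> real) set" where
  "test_functions U =
     {\<phi>. C_infinity \<phi> \<and> compact (closure {x. \<phi> x \<noteq> 0}) \<and> closure {x. \<phi> x \<noteq> 0} \<subseteq> U}"


subsection \<open>Square-integrable functions and weak derivatives\<close>

definition L2 :: "(real^'n::finite) set \<Rightarrow> (real^'n::_ \<Rightarrow> real) set" where
  "L2 U = {u. u \<in> borel_measurable (lebesgue_on U) \<and> integrable (lebesgue_on U) (\<lambda>x. (u x)\<^sup>2)}"

definition L2_norm_on :: "(real^'n::finite) set \<Rightarrow> (real^'n::_ \<Rightarrow> real) \<Rightarrow> real" where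
  "L2_norm_on U u = sqrt (LINT x|lebesgue_on U. (u x)\<^sup>2)"

definition L1_loc :: "(real^'n::finite) set \<Rightarrow> (real^'n::_ \<Rightarrow> real) set" where
  "L1_loc U = {u. \<forall>K. compact K \<and> K \<subseteq> U \<longrightarrow> integrable (lebesgue_on K) u}"

definition is_weak_deriv :: "(real^'n::{finite,wellorder}) set \<Rightarrow> 'n multi_index \<Rightarrow>
    (real^'n::_ \<Rightarrow> real) \<Rightarrow> (real^'n::_ \<Rightarrow> real) \<Rightarrow> bool" where
  "is_weak_deriv U \<alpha> u v \<longleftrightarrow> u \<in> L1_loc U \<and> v \<in> L1_loc U \<and>
     (\<forall>\<phi>\<in>test_functions U.
        (LINT x|lebesgue_on U. u x * mi_partial \<alpha> \<phi> x) =
        (-1) ^ mi_length \<alpha> * (LINT x|lebesgue_on U. v x * \<phi> x))"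

text \<open>Weak derivatives are unique up to null sets, so the choice of a representative has no
  influence on the integrals and norms below. The value is arbitrary if there is none.\<close>

definition weak_deriv :: "(real^'n::{finite,wellorder}) set \<Rightarrow> 'n multi_index \<Rightarrow>
    (real^'n::_ \<Rightarrow> real) \<Rightarrow> real^'n::_ \<Rightarrow> real" where
  "weak_deriv U \<alpha> u = (SOME v. is_weak_deriv U \<alpha> u v)"


subsection \<open>Sobolev spaces\<close>

definition sobolev :: "nat \<Rightarrow> (real^'n::{finite,wellorder}) set \<Rightarrow> (real^'n::_ \<Rightarrow> real) set" where
  "sobolev k U = {u \<in> L2 U. \<forall>\<alpha>. mi_length \<alpha> \<le> k \<longrightarrow> (\<exists>v\<in>L2 U. is_weak_deriv U \<alpha> u v)}"

definition sobolev_norm ::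
  "nat \<Rightarrow> (real^'n::{finite,wellorder}) set \<Rightarrow> (real^'n::_ \<Rightarrow> real) \<Rightarrow> real" where
  "sobolev_norm k U u =
     sqrt (\<Sum>\<alpha> | mi_length \<alpha> \<le> k. (L2_norm_on U (weak_deriv U \<alpha> u))\<^sup>2)"

definition sobolev_zero ::
  "nat \<Rightarrow> (real^'n::{finite,wellorder}) set \<Rightarrow> (real^'n::_ \<Rightarrow> real) set" where
  "sobolev_zero k U = {\<phi> \<in> sobolev k U.
     \<forall>\<epsilon>>0. \<exists>\<psi>\<in>test_functions U. sobolev_norm k U (\<lambda>x. \<phi> x - \<psi> x) < \<epsilon>}"

text \<open>\<open>\<parallel>\<nabla>\<^sup>m u\<parallel>\<close> in \<open>L\<^sup>2(U)\<close>, where \<open>\<nabla>\<^sup>m u\<close> is the vector of all weak derivatives of order \<open>m\<close>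
  with its Euclidean norm.\<close>

definition grad_L2_norm ::
  "nat \<Rightarrow> (real^'n::{finite,wellorder}) set \<Rightarrow> (real^'n::_ \<Rightarrow> real) \<Rightarrow> real" where
  "grad_L2_norm m U u =
     sqrt (LINT x|lebesgue_on U. (\<Sum>\<alpha> | mi_length \<alpha> = m. (weak_deriv U \<alpha> u x)\<^sup>2))"


subsection \<open>The operator and its weak solutions\<close>

text \<open>Only the coefficients \<open>a \<alpha> \<beta>\<close> with \<open>|\<alpha>| = |\<beta>| = m\<close> are relevant.\<close>

type_synonym 'n coeffs = "'n multi_index \<Rightarrow> 'n multi_index \<Rightarrow> real"

definition symmetric_coeffs :: "nat \<Rightarrow> 'n::finite coeffs \<Rightarrow> bool" where
  "symmetric_coeffs m a \<longleftrightarrow>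
     (\<forall>\<alpha> \<beta>. mi_length \<alpha> = m \<and> mi_length \<beta> = m \<longrightarrow> a \<alpha> \<beta> = a \<beta> \<alpha>)"

text \<open>The ellipticity constant \<open>c\<close> is kept explicit: regularity estimates that are uniform in the
  coefficients degenerate as \<open>c\<close> tends to \<open>0\<close> with \<open>max_coeff\<close> fixed.\<close>

definition elliptic_with :: "nat \<Rightarrow> real \<Rightarrow> 'n::finite coeffs \<Rightarrow> bool" where
  "elliptic_with m c a \<longleftrightarrow> (\<forall>\<xi>::'n multi_index \<Rightarrow> real.
     (\<Sum>\<alpha> | mi_length \<alpha> = m. \<Sum>\<beta> | mi_length \<beta> = m. a \<alpha> \<beta> * \<xi> \<alpha> * \<xi> \<beta>)
       \<ge> c * (\<Sum>\<alpha> | mi_length \<alpha> = m. \<bar>\<xi> \<alpha>\<bar>\<^sup>2))"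

definition max_coeff :: "nat \<Rightarrow> 'n::finite coeffs \<Rightarrow> real" where
  "max_coeff m a = Max {\<bar>a \<alpha> \<beta>\<bar> | \<alpha> \<beta>. mi_length \<alpha> = m \<and> mi_length \<beta> = m}"

definition weak_solution :: "nat \<Rightarrow> 'n::{finite,wellorder} coeffs \<Rightarrow> (real^'n::_) set \<Rightarrow>
    (real^'n::_ \<Rightarrow> real) \<Rightarrow> (real^'n::_ \<Rightarrow> real) \<Rightarrow> bool" where
  "weak_solution m a U u f \<longleftrightarrow> (\<forall>\<phi>\<in>sobolev_zero m U.
     (LINT x|lebesgue_on U. (\<Sum>\<alpha> | mi_length \<alpha> = m. \<Sum>\<beta> | mi_length \<beta> = m.
        a \<alpha> \<beta> * weak_deriv U \<alpha> u x * weak_deriv U \<beta> \<phi> x)) =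
     (LINT x|lebesgue_on U. f x * \<phi> x))"

definition half_ball :: "real \<Rightarrow> (real^'n::{finite,wellorder}) set" where
  "half_ball r = ball 0 r \<inter> {x. x $ Max UNIV > 0}"

end

theory Submission
  imports Defs "HOL-Computational_Algebra.Polynomial"
begin

text \<open>
  Since \<open>u\<close> vanishes below the flat boundary and lies in \<open>H\<^sup>m\<close> of the whole
  ball, its weak derivatives up to order \<open>m\<close> exist across the boundary. Derivatives in the directions
  \<open>x\<^sub>1, \<dots>, x\<^sub>N\<^sub>-\<^sub>1\<close> do not leave this situation, so they are obtained by Nirenberg's difference
  quotients. Derivatives in the direction \<open>x\<^sub>N\<close> have to come from the equation.

  The equation holds for all test functions that vanish below the boundary
  (\<open>weak_equation_extend\<close>: translate upwards, then mollify), in particular for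
  \<open>D\<^sub>-\<^sub>h (\<eta>\<^sup>2\<^sup>m D\<^sub>h u)\<close>. Ellipticity with constant coefficients bounds \<open>\<eta>\<^sup>m D\<^sub>h \<nabla>\<^sup>m u\<close> in \<open>L\<^sup>2\<close> uniformly
  in \<open>h\<close> (\<open>difference_quotient_estimate\<close>), which gives one tangential derivative of \<open>\<nabla>\<^sup>m u\<close>
  (\<open>tangential_step\<close>). The derivatives of lower order are bounded by those of order \<open>m\<close> because \<open>u\<close>
  vanishes on one side (\<open>Poincare\<close>). The step can be repeated \<open>l\<close> times with derivatives of \<open>f\<close>
  on the right-hand side and \<open>m\<close> further times with tangential derivatives left on the test function.
  The result is \<open>tangential_regularity\<close>: every derivative of order at most \<open>2m + l\<close> that contains at
  most \<open>m\<close> normal ones is in \<open>L\<^sup>2\<close>.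

  Ellipticity makes the coefficient of \<open>\<partial>\<^sub>N\<^sup>2\<^sup>m\<close> at least \<open>c\<close>, but solving the equation
  for \<open>\<partial>\<^sub>N\<^sup>2\<^sup>m u\<close> requires the derivatives with \<open>m + 1, \<dots>, 2m - 1\<close> normal ones, which are not known
  either. For a smooth function all of them are bounded by a small multiple of \<open>\<partial>\<^sub>N\<^sup>2\<^sup>m\<close> plus the
  derivatives with at most \<open>m\<close> normal ones. These interpolation inequalities hold in the half-space
  without boundary conditions, since the boundary terms of a function and of a reflected copy cancel
  (\<open>normal_parts\<close>, \<open>interpolate_normal\<close>, \<open>interpolate_mixed\<close>). Inserting the equation and absorbing
  the small multiple gives an a priori estimate for smooth functions (\<open>normal_estimate\<close>).
  It is applied to mollifications of \<open>u\<close> with kernels supported in \<open>z\<^sub>N < 0\<close>: at a point of the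
  half-ball they average \<open>u\<close> over points above it, where the equation holds. So the bounds are uniform, and
  by duality (\<open>Riesz_representation\<close>, \<open>wd_from_bound\<close>) they pass to weak derivatives of \<open>u\<close> in
  \<open>half_ball_regularity\<close>.

  The estimates are carried out for Borel functions on the whole space that are square-integrable with
  respect to \<open>lborel\<close>. Sobolev functions on an open set are related to them by \<open>agrees\<close>, and the
  uniqueness of weak derivatives shows that the representatives do not matter.
\<close>

section \<open>Smooth functions\<close>

type_synonym 'n rfun = "(real, 'n) vec => real"

abbreviation len :: "'n::finite multi_index => nat" where "len == mi_length"

abbreviation ind :: "'a set => 'a => real" where "ind == indicator"

lemma partial_eqI:
 "(f has_derivative D) (at x) ==> partial i f x = D (axis i 1)"
 unfolding partial_def by (metis frechet_derivative_at)

lemma differentiable_partial_sum: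
 fixes f :: "'n::finite rfun"
 assumes "f differentiable at x"
 shows "(f has_derivative (%h. \<Sum>i\<in>UNIV. h $ i * partial i f x)) (at x)"
proof -
 obtain D where D: "(f has_derivative D) (at x)" using assms by (auto simp: differentiable_def)
 then have lin: "linear D" by (rule has_derivative_linear)
 have "D h = (\<Sum>i\<in>UNIV. h $ i * partial i f x)" for h
 proof -
  have "D h = D (\<Sum>i\<in>UNIV. (h $ i) *\<^sub>R axis i 1)"
   by (rule arg_cong[of _ _ D]) (simp add: vec_eq_iff axis_def sum.delta' if_distrib cong: if_cong)
  also have "\<dots> = (\<Sum>i\<in>UNIV. h $ i * D (axis i 1))"
   using lin by (simp add: linear_sum linear_cmul)
  finally show ?thesis using partial_eqI[OF D] by simp
 qed
 then show ?thesis using D by (metis (no_types, lifting) ext)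
qed

lemma C_k_mono: "C_k (Suc k) f ==> C_k k f"
proof (induction k arbitrary: f)
 case 0
 then show ?case
  by (auto simp: continuous_on_eq_continuous_at intro: differentiable_imp_continuous_within)
next
 case (Suc k)
 then show ?case by (metis C_k.simps(2))
qed

lemma C_infinity_iff:
 "C_infinity f \<longleftrightarrow> (\<forall>x. f differentiable (at x)) \<and> (\<forall>i. C_infinity (partial i f))"
 unfolding C_infinity_def by (metis C_k.simps(2) C_k_mono)

lemma C_infinity_differentiable: "C_infinity f ==> f differentiable (at x)"
 and C_infinity_partial: "C_infinity f ==> C_infinity (partial i f)"
 using C_infinity_iff by auto

lemma C_infinity_has_derivative:
 "C_infinity f ==> (f has_derivative (%h. \<Sum>i\<in>UNIV. h $ i * partial i f x)) (at x)"
 by (simp add: C_infinity_differentiable differentiable_partial_sum)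

lemma C_infinity_continuous: "C_infinity f ==> continuous_on S f"
 by (metis C_infinity_def C_k.simps(1) continuous_on_subset subset_UNIV)

lemma C_infinity_borel: "C_infinity f ==> f \<in> borel_measurable borel"
 using C_infinity_continuous[of f UNIV] by (rule borel_measurable_continuous_onI)

lemma partial_const: "partial i (%x. c) = (%x. 0)"
 by (rule ext, rule partial_eqI[where D="%_. 0", simplified]) simp

lemma C_infinity_const: "C_infinity (%x::real^'n::finite. c)"
proof -
 have "C_k k (%x::real^'n. c)" for k c by (induction k arbitrary: c) (simp_all add: partial_const)
 then show ?thesis by (simp add: C_infinity_def)
qed

lemma partial_add:
 assumes "f differentiable at x" "g differentiable at x"
 shows "partial i (%x. f x + g x) x = partial i f x + partial i g x"
proof -
 obtain Df Dg where D: "(f has_derivative Df) (at x)" "(g has_derivative Dg) (at x)"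
  using assms by (auto simp: differentiable_def)
 show ?thesis
  unfolding partial_eqI[OF D(1)] partial_eqI[OF D(2)] partial_eqI[OF has_derivative_add[OF D]] ..
qed

lemma partial_mult:
 assumes "f differentiable at x" "g differentiable at x"
 shows "partial i (%x. f x * g x) x = f x * partial i g x + partial i f x * g x"
proof -
 obtain Df Dg where D: "(f has_derivative Df) (at x)" "(g has_derivative Dg) (at x)"
  using assms by (auto simp: differentiable_def)
 show ?thesis
  unfolding partial_eqI[OF D(1)] partial_eqI[OF D(2)] partial_eqI[OF has_derivative_mult[OF D]] ..
qed

lemma C_k_add: "C_k k f ==> C_k k g ==> C_k k (%x. f x + g x)"
proof (induction k arbitrary: f g)
 case 0 then show ?case by (auto intro: continuous_on_add)
next
 case (Suc k)
 then have "partial i (%x. f x + g x) = (%x. partial i f x + partial i g x)" for i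
  by (auto simp: partial_add)
 with Suc show ?case by (auto intro: differentiable_add)
qed

lemma C_k_mult: "C_k k f ==> C_k k g ==> C_k k (%x. f x * g x)"
proof (induction k arbitrary: f g)
 case 0 then show ?case by (auto intro: continuous_on_mult)
next
 case (Suc k)
 from Suc.prems have "partial i (%x. f x * g x) = (%x. f x * partial i g x + partial i f x * g x)" for i
  by (auto simp: partial_mult)
 moreover have "C_k k f" "C_k k g" using Suc.prems C_k_mono by blast+
 ultimately show ?case using Suc by (auto intro!: differentiable_mult C_k_add)
qed

lemma C_infinity_add: "C_infinity f ==> C_infinity g ==> C_infinity (%x. f x + g x)"
 and C_infinity_mult: "C_infinity f ==> C_infinity g ==> C_infinity (%x. f x * g x)"
 by (auto simp: C_infinity_def C_k_add C_k_mult)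

lemma partial_cmult:
 "f differentiable at x ==> partial i (%x. c * f x) x = c * partial i f x"
 using partial_mult[of "%x. c" x f i] by (simp add: partial_const)

lemma C_infinity_cmult: "C_infinity f ==> C_infinity (%x. c * f x)"
 by (intro C_infinity_mult C_infinity_const)

lemma C_infinity_diff: "C_infinity f ==> C_infinity g ==> C_infinity (%x. f x - g x)"
 using C_infinity_add[of f "%x. -1 * g x"] C_infinity_cmult[of g "-1"] by simp

lemma C_infinity_sum:
 "finite A ==> (!!a. a \<in> A ==> C_infinity (f a)) ==> C_infinity (%x. \<Sum>a\<in>A. f a x)"
 by (induction A rule: finite_induct) (auto intro: C_infinity_add C_infinity_const)

lemma C_infinity_prod:
 "finite A ==> (!!a. a \<in> A ==> C_infinity (f a)) ==> C_infinity (%x. \<Prod>a\<in>A. f a x)"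
 by (induction A rule: finite_induct) (auto intro: C_infinity_mult C_infinity_const)

lemma C_infinity_power: "C_infinity f ==> C_infinity (%x. f x ^ k)"
 by (induction k) (auto intro: C_infinity_mult C_infinity_const)

lemma partial_power:
 assumes "C_infinity f"
 shows "partial i (%x. f x ^ k) x = real k * f x ^ (k - 1) * partial i f x"
proof (induction k)
 case 0 then show ?case by (simp add: partial_const)
next
 case (Suc k)
 have "partial i (%x. f x * f x ^ k) x = f x * partial i (%x. f x ^ k) x + partial i f x * f x ^ k"
  using assms by (intro partial_mult C_infinity_differentiable C_infinity_power)
 then show ?case using Suc by (cases k) (auto simp: algebra_simps)
qed

text \<open>Translations, reflections and the dilations in one variable are all of this form.\<close>

definition dmap :: "real^'n => real^'n => real^'n => real^'n::finite" where
 "dmap p s x = (\<chi> i. p $ i + s $ i * x $ i)"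

lemma has_derivative_dmap: "(dmap p s has_derivative dmap 0 s) (at x)"
proof -
 have eq: "dmap p s = (%x. p + dmap 0 s x)" by (auto simp: dmap_def vec_eq_iff)
 have "bounded_linear (dmap 0 s)"
  by (rule linear_conv_bounded_linear[THEN iffD1], rule linearI)
   (auto simp: dmap_def vec_eq_iff algebra_simps)
 then have "(dmap 0 s has_derivative dmap 0 s) (at x)" by (rule bounded_linear_imp_has_derivative)
 from has_derivative_add[OF has_derivative_const[of p] this]
 have "((%x. p + dmap 0 s x) has_derivative dmap 0 s) (at x)" by simp
 then show ?thesis unfolding eq[symmetric] .
qed

lemma differentiable_dmap:
 "(!!x. f differentiable at x) ==> (%x. f (dmap p s x)) differentiable at x"
 using has_derivative_compose[OF has_derivative_dmap] unfolding differentiable_def by blast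

lemma partial_dmap:
 fixes f :: "'n::finite rfun"
 assumes "f differentiable at (dmap p s x)"
 shows "partial i (%x. f (dmap p s x)) x = s $ i * partial i f (dmap p s x)"
proof -
 have "partial i (%x. f (dmap p s x)) x
   = (\<Sum>j\<in>UNIV. dmap 0 s (axis i 1) $ j * partial j f (dmap p s x))"
  by (rule partial_eqI[OF has_derivative_compose[OF has_derivative_dmap
      differentiable_partial_sum[OF assms]]])
 also have "\<dots> = (\<Sum>j\<in>UNIV. if j = i then s $ i * partial i f (dmap p s x) else 0)"
  by (intro sum.cong) (auto simp: dmap_def axis_def)
 finally show ?thesis by simp
qed

lemma C_infinity_dmap:
 fixes f :: "'n::finite rfun"
 assumes "C_infinity f" shows "C_infinity (%x. f (dmap p s x))"
proof -
 have "C_infinity f ==> C_k k (%x. c * f (dmap p s x))" for k c and f :: "'n rfun"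
 proof (induction k arbitrary: f c)
  case 0
  have "continuous_on UNIV (dmap p s)"
   by (simp add: continuous_on_eq_continuous_at has_derivative_continuous[OF has_derivative_dmap])
  moreover have "continuous_on UNIV f" using 0 C_infinity_continuous by blast
  ultimately show ?case by (auto intro!: continuous_intros continuous_on_compose2[of UNIV f])
 next
  case (Suc k)
  have d: "f differentiable at x" for x using Suc.prems by (rule C_infinity_differentiable)
  have dd: "(%x. f (dmap p s x)) differentiable at x" for x using d by (rule differentiable_dmap)
  have "partial i (%x. c * f (dmap p s x)) = (%x. (c * s $ i) * partial i f (dmap p s x))" for i
   by (rule ext) (simp add: partial_cmult[OF dd] partial_dmap[OF d])
  then show ?case
   using dd Suc.IH[OF C_infinity_partial[OF Suc.prems]] by (auto intro!: differentiable_mult)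
 qed
 from this[OF assms, of _ 1] show ?thesis by (simp add: C_infinity_def)
qed

lemma partial_shift:
 fixes f :: "'n::finite rfun"
 assumes "C_infinity f" shows "partial i (%x. f (x + p)) = (%x. partial i f (x + p))"
proof
 fix x
 have *: "dmap p 1 x = x + p" for x :: "real^'n" by (simp add: dmap_def vec_eq_iff)
 show "partial i (%x. f (x + p)) x = partial i f (x + p)"
  using partial_dmap[of f p 1 x i] assms by (simp add: * C_infinity_differentiable)
qed

lemma C_infinity_shift:
 fixes f :: "'n::finite rfun"
 assumes "C_infinity f" shows "C_infinity (%x. f (x + p))"
proof -
 have *: "dmap p 1 x = x + p" for x :: "real^'n" by (simp add: dmap_def vec_eq_iff)
 show ?thesis using C_infinity_dmap[OF assms, of p 1] by (simp add: *)
qed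

lemma partial_reflect:
 fixes f :: "'n::finite rfun"
 assumes "C_infinity f" shows "partial i (%y. f (x - y)) = (%y. - partial i f (x - y))"
proof
 fix y
 have *: "dmap x (-1) y = x - y" for y :: "real^'n" by (simp add: dmap_def vec_eq_iff)
 show "partial i (%y. f (x - y)) y = - partial i f (x - y)"
  using partial_dmap[of f x "-1" y i] assms by (simp add: * C_infinity_differentiable)
qed

lemma C_infinity_reflect:
 fixes f :: "'n::finite rfun"
 assumes "C_infinity f" shows "C_infinity (%y. f (x - y))"
proof -
 have *: "dmap x (-1) y = x - y" for y :: "real^'n" by (simp add: dmap_def vec_eq_iff)
 show ?thesis using C_infinity_dmap[OF assms, of x "-1"] by (simp add: *)
qed

lemma has_real_derivative_along_axis:
 fixes f :: "'n::finite rfun"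
 assumes "!!x. f differentiable at x"
 shows "((%t. f (x + t *\<^sub>R axis i 1)) has_real_derivative partial i f (x + t *\<^sub>R axis i 1)) (at t)"
proof -
 have "((%t. x + t *\<^sub>R axis i 1) has_derivative (%h. h *\<^sub>R axis i (1::real))) (at t)"
  by (auto intro!: derivative_eq_intros)
 from has_derivative_compose[OF this differentiable_partial_sum[OF assms]]
 have "((%t. f (x + t *\<^sub>R axis i 1)) has_derivative
   (%h. \<Sum>j\<in>UNIV. (h *\<^sub>R axis i 1) $ j * partial j f (x + t *\<^sub>R axis i 1))) (at t)" .
 moreover have "(\<Sum>j\<in>UNIV. (h *\<^sub>R axis i 1) $ j * partial j f y) = partial i f y * h" for h y
 proof -
  have "(\<Sum>j\<in>UNIV. (h *\<^sub>R axis i 1) $ j * partial j f y)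
    = (\<Sum>j\<in>UNIV. if j = i then partial i f y * h else 0)"
   by (intro sum.cong) (auto simp: axis_def)
  then show ?thesis by simp
 qed
 ultimately show ?thesis by (simp add: has_field_derivative_def mult_commute_abs)
qed

text \<open>Mixed second differences do not depend on the order, and by the mean value theorem they are
  values of the mixed second derivatives at nearby points.\<close>

lemma partial_commute:
 fixes f :: "'n::finite rfun"
 assumes "C_infinity f"
 shows "partial i (partial j f) = partial j (partial i f)"
proof
 fix x
 define \<Delta> where "\<Delta> h = f (x + h *\<^sub>R axis i 1 + h *\<^sub>R axis j 1) - f (x + h *\<^sub>R axis i 1)
   - f (x + h *\<^sub>R axis j 1) + f x" for h
 have ex: "\<exists>s t. 0 < s \<and> s < h \<and> 0 < t \<and> t < h \<and>
   \<Delta> h = h * h * partial b (partial a f) (x + s *\<^sub>R axis a 1 + t *\<^sub>R axis b 1)"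
  if h: "h > 0" and ab: "(a = i \<and> b = j) \<or> (a = j \<and> b = i)" for h a b
 proof -
  define g where "g s = f (x + h *\<^sub>R axis b 1 + s *\<^sub>R axis a 1) - f (x + s *\<^sub>R axis a 1)" for s
  have "(g has_real_derivative (partial a f (x + h *\<^sub>R axis b 1 + s *\<^sub>R axis a 1)
    - partial a f (x + s *\<^sub>R axis a 1))) (at s)" for s
   unfolding g_def
   by (intro DERIV_diff has_real_derivative_along_axis C_infinity_differentiable assms)
  from MVT2[OF h this] obtain s where s: "0 < s" "s < h"
   "g h - g 0 = h * (partial a f (x + h *\<^sub>R axis b 1 + s *\<^sub>R axis a 1) - partial a f (x + s *\<^sub>R axis a 1))"
   by auto
  define k where "k t = partial a f (x + s *\<^sub>R axis a 1 + t *\<^sub>R axis b 1)" for t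
  have "(k has_real_derivative partial b (partial a f) (x + s *\<^sub>R axis a 1 + t *\<^sub>R axis b 1)) (at t)" for t
   unfolding k_def
   by (intro has_real_derivative_along_axis C_infinity_differentiable C_infinity_partial assms)
  from MVT2[OF h this] obtain t where t: "0 < t" "t < h"
   "k h - k 0 = h * partial b (partial a f) (x + s *\<^sub>R axis a 1 + t *\<^sub>R axis b 1)" by auto
  have "\<Delta> h = g h - g 0" using ab by (auto simp: \<Delta>_def g_def algebra_simps)
  also have "\<dots> = h * (k h - k 0)" using s by (simp add: k_def algebra_simps)
  finally show ?thesis using s t by auto
 qed
 have lim: "\<exists>\<delta>>0. \<forall>h. 0 < h \<and> h < \<delta> --> \<bar>\<Delta> h / (h * h) - partial b (partial a f) x\<bar> < e"
  if ab: "(a = i \<and> b = j) \<or> (a = j \<and> b = i)" and e: "e > 0" for a b e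
 proof -
  have "continuous_on UNIV (partial b (partial a f))"
   using assms by (intro C_infinity_continuous C_infinity_partial)
  then obtain d where d: "d > 0" "!!y. dist y x < d ==>
    dist (partial b (partial a f) y) (partial b (partial a f) x) < e"
   using e unfolding continuous_on_iff by (metis UNIV_I)
  have "\<bar>\<Delta> h / (h * h) - partial b (partial a f) x\<bar> < e" if h: "0 < h" "h < d / 2" for h
  proof -
   obtain s t where st: "0 < s" "s < h" "0 < t" "t < h"
    "\<Delta> h = h * h * partial b (partial a f) (x + s *\<^sub>R axis a 1 + t *\<^sub>R axis b 1)"
    using ex[OF h(1) ab] by auto
   have "norm (s *\<^sub>R axis a 1 + t *\<^sub>R axis b 1 :: real^'n) <= s + t"
    using norm_triangle_ineq[of "s *\<^sub>R axis a 1" "t *\<^sub>R axis b 1 :: real^'n"] st by simp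
   then have "dist (x + s *\<^sub>R axis a 1 + t *\<^sub>R axis b 1) x < d"
    using st h by (simp add: dist_norm add.assoc)
   from d(2)[OF this] show ?thesis using st h by (simp add: dist_real_def)
  qed
  then show ?thesis using d(1) by (intro exI[of _ "d/2"]) auto
 qed
 have "\<bar>partial i (partial j f) x - partial j (partial i f) x\<bar> < 2 * e" if e: "e > 0" for e
 proof -
  obtain d1 where d1: "d1 > 0" "!!h. 0 < h \<and> h < d1 ==> \<bar>\<Delta> h / (h * h) - partial i (partial j f) x\<bar> < e"
   using lim[OF _ e, of j i] by auto
  obtain d2 where d2: "d2 > 0" "!!h. 0 < h \<and> h < d2 ==> \<bar>\<Delta> h / (h * h) - partial j (partial i f) x\<bar> < e"
   using lim[OF _ e, of i j] by auto
  define h where "h = min d1 d2 / 2"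
  have "0 < h \<and> h < d1" "0 < h \<and> h < d2" using d1 d2 by (auto simp: h_def)
  from d1(2)[OF this(1)] d2(2)[OF this(2)] show ?thesis by linarith
 qed
 from this[of "\<bar>partial i (partial j f) x - partial j (partial i f) x\<bar> / 2"]
 show "partial i (partial j f) x = partial j (partial i f) x" by fastforce
qed

subsection \<open>Multi-indices\<close>

definition inc :: "'n multi_index => 'n => 'n multi_index" where
 "inc \<alpha> i = \<alpha>(i := Suc (\<alpha> i))"

lemma mi_length_inc[simp]: "len (inc \<alpha> i) = Suc (len \<alpha>)" for \<alpha> :: "'n::finite multi_index"
proof -
 have "len (inc \<alpha> i) = (\<Sum>j\<in>UNIV. \<alpha> j + (if j = i then 1 else 0))"
  unfolding mi_length_def inc_def by (intro sum.cong) auto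
 then show ?thesis by (simp add: sum.distrib mi_length_def)
qed

lemma inc_commute: "inc (inc \<alpha> i) j = inc (inc \<alpha> j) i"
 by (auto simp: inc_def fun_upd_def)

lemma mi_length_zero[simp]: "len (%_. 0) = 0"
 by (simp add: mi_length_def)

lemma mi_length_eq_0: "len \<alpha> = 0 \<longleftrightarrow> \<alpha> = (%_. 0)" for \<alpha> :: "'n::finite multi_index"
 by (auto simp: mi_length_def)

lemma mi_length_add: "len (%i. \<alpha> i + \<beta> i) = len \<alpha> + len \<beta>"
 by (simp add: mi_length_def sum.distrib)

lemma exists_inc:
 assumes "\<alpha> i > 0" obtains \<beta> where "\<alpha> = inc \<beta> i"
 by (rule that[of "\<alpha>(i := \<alpha> i - 1)"]) (use assms in \<open>auto simp: inc_def\<close>)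

lemma mi_Suc_obtain:
 fixes \<alpha> :: "'n::finite multi_index"
 assumes "len \<alpha> = Suc k" obtains \<beta> i where "\<alpha> = inc \<beta> i" "len \<beta> = k"
proof -
 have "\<exists>i. \<alpha> i > 0"
 proof (rule ccontr)
  assume "\<not> ?thesis" then have "\<alpha> = (%_. 0)" by auto
  then show False using assms by simp
 qed
 then obtain i where "\<alpha> i > 0" by auto
 then obtain \<beta> where "\<alpha> = inc \<beta> i" using exists_inc[of \<alpha> i] by blast
 with assms that show ?thesis by auto
qed

lemma mi_induct[case_names zero inc]:
 fixes \<alpha> :: "'n::finite multi_index"
 assumes "P (%_. 0)" and "!!\<beta> i. P \<beta> ==> P (inc \<beta> i)"
 shows "P \<alpha>"
proof (induction "len \<alpha>" arbitrary: \<alpha>)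
 case 0 then show ?case using mi_length_eq_0[of \<alpha>] assms(1) by simp
next
 case (Suc k)
 obtain \<beta> i where "\<alpha> = inc \<beta> i" "len \<beta> = k"
  using mi_Suc_obtain[OF Suc.hyps(2)[symmetric]] .
 then show ?case using Suc.hyps(1) assms(2) by simp
qed

lemma C_infinity_funpow: "C_infinity f ==> C_infinity ((partial i ^^ k) f)"
 by (induction k) (auto intro: C_infinity_partial)

lemma C_infinity_foldr:
 "C_infinity f ==> C_infinity (foldr (%i. partial i ^^ \<alpha> i) xs f)"
 by (induction xs) (auto intro: C_infinity_funpow)

lemma C_infinity_mi_partial: "C_infinity f ==> C_infinity (mi_partial \<alpha> f)"
 unfolding mi_partial_def by (rule C_infinity_foldr)

lemma partial_funpow_commute:
 "C_infinity f ==> partial i ((partial j ^^ k) f) = (partial j ^^ k) (partial i f)"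
 using partial_commute[OF C_infinity_funpow, of f i j] by (induction k) auto

lemma partial_foldr_commute:
 "C_infinity f ==> partial i (foldr (%i. partial i ^^ \<alpha> i) xs f)
  = foldr (%i. partial i ^^ \<alpha> i) xs (partial i f)"
 by (induction xs) (auto simp: partial_funpow_commute C_infinity_foldr)

text \<open>The derivatives in \<open>mi_partial\<close> are taken in a fixed order. By \<open>partial_commute\<close> a further
  one can be moved to its place.\<close>

lemma foldr_inc:
 assumes "C_infinity f" "i \<in> set xs" "distinct xs"
 shows "foldr (%j. partial j ^^ inc \<alpha> i j) xs f = partial i (foldr (%j. partial j ^^ \<alpha> j) xs f)"
 using assms(2,3)
proof (induction xs)
 case (Cons a xs)
 show ?case
 proof (cases "a = i")
  case True
  then have "foldr (%j. partial j ^^ inc \<alpha> i j) xs f = foldr (%j. partial j ^^ \<alpha> j) xs f"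
   using Cons.prems by (intro foldr_cong) (auto simp: inc_def)
  then show ?thesis using True by (simp add: inc_def)
 next
  case False
  then show ?thesis using Cons assms(1)
   by (simp add: inc_def partial_funpow_commute C_infinity_foldr)
 qed
qed simp

lemma mi_partial_inc:
 fixes f :: "'n::{finite,wellorder} rfun"
 assumes "C_infinity f" shows "mi_partial (inc \<alpha> i) f = partial i (mi_partial \<alpha> f)"
 unfolding mi_partial_def using assms by (intro foldr_inc) auto

lemma mi_partial_partial:
 fixes f :: "'n::{finite,wellorder} rfun"
 assumes "C_infinity f" shows "mi_partial \<alpha> (partial i f) = partial i (mi_partial \<alpha> f)"
 unfolding mi_partial_def using partial_foldr_commute[OF assms] by simp

lemma mi_partial_zero[simp]: "mi_partial (%_. 0) f = f"
proof -
 have "foldr (%i. partial i ^^ 0) xs f = f" for xs by (induction xs) auto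
 then show ?thesis by (simp add: mi_partial_def)
qed

lemma mi_partial_add:
 fixes f :: "'n::{finite,wellorder} rfun"
 assumes "C_infinity f" shows "mi_partial (%i. \<alpha> i + \<beta> i) f = mi_partial \<alpha> (mi_partial \<beta> f)"
proof (induction \<alpha> rule: mi_induct)
 case (inc \<alpha> i)
 have "(%j. inc \<alpha> i j + \<beta> j) = inc (%j. \<alpha> j + \<beta> j) i" by (auto simp: inc_def)
 then show ?case using inc assms by (simp add: mi_partial_inc C_infinity_mi_partial)
qed simp

subsection \<open>A smooth function that vanishes on the negative half-line\<close>

text \<open>All cutoffs and mollifiers below are multiples of
  \<open>theta (r\<^sup>2 - \<parallel>x - p\<parallel>\<^sup>2)\<close>. Being monotone, \<open>theta\<close> makes them
  radially decreasing, as the weights of the interpolation inequalities have to be.\<close>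

definition theta :: "real => real" where
 "theta t = (if t > 0 then exp (- 1 / t) else 0)"

text \<open>The derivatives of \<open>theta\<close> stay in this class of functions, which makes \<open>theta\<close> smooth at
  \<open>0\<close>.\<close>

definition theta_poly :: "real poly => real => real" where
 "theta_poly p t = (if t > 0 then poly p (1 / t) * exp (- 1 / t) else 0)"

lemma power_poly_exp_tendsto: "((%s. s ^ k * poly p s / exp s) \<longlongrightarrow> 0) at_top" for p :: "real poly"
proof (induction p arbitrary: k)
 case (pCons a p)
 have "((%s. a * (s ^ k / exp s) + s ^ Suc k * poly p s / exp s) \<longlongrightarrow> a * 0 + 0) at_top"
  by (intro tendsto_intros tendsto_power_div_exp_0 pCons.IH)
 then show ?case by (simp add: field_simps)
qed simp

lemma theta_poly_deriv:
 "(theta_poly p has_real_derivative theta_poly (monom 1 2 * (p - pderiv p)) t) (at t)"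
proof (cases t "0::real" rule: linorder_cases)
 case less
 have "((%t. 0) has_real_derivative 0) (at t)" by simp
 then have "(theta_poly p has_real_derivative 0) (at t)"
  by (rule has_field_derivative_transform_within_open[of _ _ _ "{..<0}"])
   (use less in \<open>auto simp: theta_poly_def\<close>)
 then show ?thesis using less by (simp add: theta_poly_def)
next
 case greater
 have "((%t. poly p (1 / t) * exp (- 1 / t)) has_real_derivative
   poly (monom 1 2 * (p - pderiv p)) (1 / t) * exp (- 1 / t)) (at t)"
  using greater
  by (auto intro!: derivative_eq_intros simp: poly_monom power2_eq_square field_simps)
 then have "(theta_poly p has_real_derivative
   poly (monom 1 2 * (p - pderiv p)) (1 / t) * exp (- 1 / t)) (at t)"
  by (rule has_field_derivative_transform_within_open[of _ _ _ "{0<..}"])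
   (use greater in \<open>auto simp: theta_poly_def\<close>)
 then show ?thesis using greater by (simp add: theta_poly_def)
next
 case equal
 have r: "((%h. theta_poly p h / h) \<longlongrightarrow> 0) (at_right 0)"
 proof -
  have "((%h. inverse h ^ 1 * poly p (inverse h) / exp (inverse h)) \<longlongrightarrow> 0) (at_right (0::real))"
   using power_poly_exp_tendsto[of 1 p] filterlim_inverse_at_top_right by (rule filterlim_compose)
  then show ?thesis
   by (rule Lim_transform_eventually)
    (auto simp: eventually_at_filter theta_poly_def exp_minus field_simps)
 qed
 moreover have "((%h. theta_poly p h / h) \<longlongrightarrow> 0) (at_left 0)"
  by (rule Lim_transform_eventually[OF tendsto_const])
   (auto simp: eventually_at_filter theta_poly_def)
 ultimately have "((%h. theta_poly p h / h) \<longlongrightarrow> 0) (at 0)"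
  by (simp add: filterlim_split_at)
 then show ?thesis using equal by (simp add: DERIV_def theta_poly_def)
qed

text \<open>Smoothness of a function of one variable, in the form of the sequence of its derivatives.\<close>

definition deriv_chain :: "(nat => real => real) => bool" where
 "deriv_chain F \<longleftrightarrow> (\<forall>n t. (F n has_real_derivative F (Suc n) t) (at t))"

lemma partial_compose:
 assumes "(h has_real_derivative h') (at (f x))" "f differentiable at x"
 shows "(%x. h (f x)) differentiable at x" "partial i (%x. h (f x)) x = h' * partial i f x"
proof -
 from has_derivative_compose[OF differentiable_partial_sum[OF assms(2)]
   assms(1)[unfolded has_field_derivative_def]]
 have D: "((%x. h (f x)) has_derivative (%k. h' * (\<Sum>i\<in>UNIV. k $ i * partial i f x))) (at x)" .
 then show "(%x. h (f x)) differentiable at x" by (auto simp: differentiable_def)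
 show "partial i (%x. h (f x)) x = h' * partial i f x"
  using partial_eqI[OF D] partial_eqI[OF differentiable_partial_sum[OF assms(2)], of i] by simp
qed

lemma C_infinity_compose:
 fixes f :: "'n::finite rfun"
 assumes F: "deriv_chain F" and f: "C_infinity f"
 shows "C_infinity (%x. F n (f x))"
proof -
 have d: "(F n has_real_derivative F (Suc n) t) (at t)" for n t
  using F by (simp add: deriv_chain_def)
 have "C_k k (%x. F n (f x))" for k
 proof (induction k arbitrary: n)
  case 0
  have "continuous_on UNIV (F n)"
   using d by (meson DERIV_isCont continuous_at_imp_continuous_on)
  then show ?case using C_infinity_continuous[OF f, of UNIV]
   by (auto intro: continuous_on_compose2)
 next
  case (Suc k)
  have "partial i (%x. F n (f x)) = (%x. F (Suc n) (f x) * partial i f x)" for i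
   by (rule ext, rule partial_compose(2)[OF d C_infinity_differentiable[OF f]])
  then show ?case
   using partial_compose(1)[OF d C_infinity_differentiable[OF f]]
    C_k_mult[OF Suc] f[THEN C_infinity_partial, unfolded C_infinity_def] by simp
 qed
 then show ?thesis by (simp add: C_infinity_def)
qed

lemma deriv_chain_theta: "\<exists>F. deriv_chain F \<and> F 0 = theta"
proof (intro exI conjI)
 define P where "P n = ((%p. monom 1 2 * (p - pderiv p)) ^^ n) (1 :: real poly)" for n
 show "deriv_chain (%n. theta_poly (P n))"
  by (auto simp: deriv_chain_def P_def intro: theta_poly_deriv)
 show "theta_poly (P 0) = theta" by (auto simp: P_def theta_poly_def theta_def)
qed

lemma C_infinity_theta: "C_infinity f ==> C_infinity (%x. theta (f x))"
 using deriv_chain_theta C_infinity_compose by metis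

lemma C_infinity_exp: "C_infinity f ==> C_infinity (%x. exp (f x))"
 using C_infinity_compose[of "%n. exp" f 0] by (auto simp: deriv_chain_def intro!: derivative_eq_intros)

lemma C_infinity_coord: "C_infinity (%x::real^'n::finite. x $ i)"
proof -
 have D: "((%x::real^'n. x $ i) has_derivative (%h. h $ i)) (at x)" for x
  by (rule bounded_linear_imp_has_derivative) (rule bounded_linear_vec_nth)
 have "partial j (%x::real^'n. x $ i) = (%x. axis j 1 $ i)" for j
  by (rule ext) (rule partial_eqI[OF D])
 then show ?thesis
  by (subst C_infinity_iff) (use D in \<open>auto simp: differentiable_def intro: C_infinity_const\<close>)
qed

lemma C_infinity_norm2: "C_infinity (%x::real^'n::finite. (norm (x - p))\<^sup>2)"
proof -
 have "(norm (x - p))\<^sup>2 = (\<Sum>i\<in>UNIV. (x $ i - p $ i) ^ 2)" for x :: "real^'n"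
  by (simp add: norm_vec_def L2_set_def sum_nonneg)
 then show ?thesis
  by (auto intro!: C_infinity_sum C_infinity_power C_infinity_diff C_infinity_coord C_infinity_const)
qed

lemma theta_nonneg: "theta t >= 0" and theta_pos_iff: "theta t > 0 \<longleftrightarrow> t > 0"
 and theta_eq_0_iff: "theta t = 0 \<longleftrightarrow> t <= 0" and theta_le_1: "theta t <= 1"
 by (auto simp: theta_def)

lemma theta_mono: "s <= t ==> theta s <= theta t"
 by (auto simp: theta_def field_simps)

section \<open>The Hilbert space of square-integrable functions\<close>

text \<open>Functions on the whole space, and Borel instead of Lebesgue measurable ones: they can be composed with translations
  and with dilations, and Fubini's theorem applies to their convolutions.\<close>

definition L2b :: "('n::finite rfun) => bool" where
 "L2b f \<longleftrightarrow> f \<in> borel_measurable borel \<and> integrable lborel (%x. (f x)\<^sup>2)"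

definition ip :: "('n::finite rfun) => 'n rfun => real" where
 "ip f g = (LINT x|lborel. f x * g x)"

definition nrm :: "('n::finite rfun) => real" where
 "nrm f = sqrt (LINT x|lborel. (f x)\<^sup>2)"

abbreviation nrm_on :: "(real^'n::finite) set => 'n rfun => real" where
 "nrm_on S f \<equiv> nrm (%x. ind S x * f x)"

lemma L2b_borel[measurable_dest]: "L2b f ==> f \<in> borel_measurable borel"
 by (simp add: L2b_def)

lemma L2b_integrable_sq: "L2b f ==> integrable lborel (%x. (f x)\<^sup>2)"
 by (simp add: L2b_def)

lemma L2b_integrable_mult:
 assumes "L2b f" "L2b g" shows "integrable lborel (%x. f x * g x)"
proof (rule Bochner_Integration.integrable_bound)
 show "integrable lborel (%x. (f x)\<^sup>2 + (g x)\<^sup>2)" using assms by (simp add: L2b_def)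
 show "(%x. f x * g x) \<in> borel_measurable lborel"
  using assms by (auto simp: L2b_def intro!: borel_measurable_times)
 have "\<bar>a * b\<bar> <= a\<^sup>2 + b\<^sup>2" for a b :: real
 proof -
  have "0 <= \<bar>a\<bar> * \<bar>b\<bar>" by simp
  moreover have "2 * (\<bar>a\<bar> * \<bar>b\<bar>) <= a\<^sup>2 + b\<^sup>2" using sum_squares_bound[of "\<bar>a\<bar>" "\<bar>b\<bar>"] by simp
  ultimately show ?thesis unfolding abs_mult by linarith
 qed
 then show "AE x in lborel. norm (f x * g x) <= norm ((f x)\<^sup>2 + (g x)\<^sup>2)" by simp
qed

lemma L2b_mono:
 assumes "L2b g" "f \<in> borel_measurable borel" "!!x. \<bar>f x\<bar> <= \<bar>g x\<bar>" shows "L2b f"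
 unfolding L2b_def
proof (intro conjI assms(2))
 show "integrable lborel (%x. (f x)\<^sup>2)"
 proof (rule Bochner_Integration.integrable_bound)
  show "integrable lborel (%x. (g x)\<^sup>2)" using assms by (simp add: L2b_def)
  show "(%x. (f x)\<^sup>2) \<in> borel_measurable lborel" using assms by simp
  show "AE x in lborel. norm ((f x)\<^sup>2) <= norm ((g x)\<^sup>2)"
   using assms(3) by (auto simp: abs_le_square_iff)
 qed
qed

lemma nrm_mono:
 assumes "L2b g" "f \<in> borel_measurable borel" "!!x. \<bar>f x\<bar> <= \<bar>g x\<bar>" shows "nrm f <= nrm g"
 unfolding nrm_def using assms L2b_mono[OF assms]
 by (auto intro!: integral_mono simp: L2b_def abs_le_square_iff)

lemma nrm_cong_AE:
 "f \<in> borel_measurable borel ==> g \<in> borel_measurable borel ==> AE x in lborel. f x = g x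
  ==> nrm f = nrm g"
 unfolding nrm_def by (intro arg_cong[of _ _ sqrt] integral_cong_AE) auto

lemma L2b_cmult: "L2b f ==> L2b (%x. c * f x)"
 by (auto simp: L2b_def power_mult_distrib)

lemma L2b_add:
 assumes "L2b f" "L2b g" shows "L2b (%x. f x + g x)"
 using assms L2b_integrable_mult[OF assms]
 by (auto simp: L2b_def power2_sum mult.assoc intro!: Bochner_Integration.integrable_add
   integrable_mult_right)

lemma L2b_zero: "L2b (%x. 0)" by (simp add: L2b_def)

lemma L2b_minus: "L2b f ==> L2b (%x. - f x)"
 using L2b_cmult[of f "-1"] by simp

lemma L2b_diff: "L2b f ==> L2b g ==> L2b (%x. f x - g x)"
 using L2b_add[of f "%x. -1 * g x"] L2b_cmult[of g "-1"] by simp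

lemma L2b_sum: "finite A ==> (!!a. a \<in> A ==> L2b (f a)) ==> L2b (%x. \<Sum>a\<in>A. f a x)"
 by (induction A rule: finite_induct) (auto intro: L2b_add L2b_zero)

lemma L2b_bounded_mult:
 assumes "L2b f" "h \<in> borel_measurable borel" "!!x. \<bar>h x\<bar> <= B" shows "L2b (%x. h x * f x)"
proof (rule L2b_mono[OF L2b_cmult[OF assms(1), of B]])
 show "\<bar>h x * f x\<bar> <= \<bar>B * f x\<bar>" for x
  using assms(3)[of x] by (auto simp: abs_mult intro!: mult_right_mono)
qed (use assms in \<open>auto simp: L2b_def\<close>)

lemma L2b_indicator: "L2b f ==> S \<in> sets borel ==> L2b (%x. ind S x * f x)"
 by (rule L2b_bounded_mult[where B=1]) (auto simp: indicator_def)

lemma nrm_nonneg[simp]: "nrm f >= 0"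
 unfolding nrm_def by (simp add: integral_nonneg_AE)

lemma nrm_sq: "(nrm f)\<^sup>2 = (LINT x|lborel. (f x)\<^sup>2)"
 unfolding nrm_def by (simp add: integral_nonneg_AE)

lemma nrm_zero[simp]: "nrm (%x. 0) = 0" by (simp add: nrm_def)

lemma nrm_cmult: "nrm (%x. c * f x) = \<bar>c\<bar> * nrm f"
 unfolding nrm_def by (simp add: power_mult_distrib real_sqrt_mult)

lemma nrm_minus: "nrm (%x. - f x) = nrm f" by (simp add: nrm_def)

lemma nrm_bounded_mult:
 assumes "L2b f" "h \<in> borel_measurable borel" "!!x. \<bar>h x\<bar> <= B" shows "nrm (%x. h x * f x) <= B * nrm f"
proof -
 have "B >= 0" using assms(3)[of 0] by linarith
 have "nrm (%x. h x * f x) <= nrm (%x. B * f x)"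
 proof (rule nrm_mono[OF L2b_cmult[OF assms(1)]])
  show "\<bar>h x * f x\<bar> <= \<bar>B * f x\<bar>" for x
   using assms(3)[of x] by (auto simp: abs_mult intro!: mult_right_mono)
 qed (use assms in \<open>auto simp: L2b_def\<close>)
 then show ?thesis using \<open>B >= 0\<close> by (simp add: nrm_cmult)
qed

lemma nrm_indicator_le: "L2b f ==> S \<in> sets borel ==> nrm_on S f <= nrm f"
 using nrm_bounded_mult[of f "ind S" 1] by (auto simp: indicator_def)

lemma ip_commute: "ip f g = ip g f" by (simp add: ip_def mult.commute)

lemma ip_add_left: "L2b f ==> L2b g ==> L2b h ==> ip (%x. f x + g x) h = ip f h + ip g h"
 by (simp add: ip_def distrib_right L2b_integrable_mult)

lemma ip_diff_left: "L2b f ==> L2b g ==> L2b h ==> ip (%x. f x - g x) h = ip f h - ip g h"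
 by (simp add: ip_def left_diff_distrib L2b_integrable_mult)

lemma ip_cmult_left: "ip (%x. c * f x) h = c * ip f h"
 by (simp add: ip_def mult.assoc)

lemma ip_add_right: "L2b f ==> L2b g ==> L2b h ==> ip h (%x. f x + g x) = ip h f + ip h g"
 by (simp add: ip_def distrib_left L2b_integrable_mult)

lemma ip_diff_right: "L2b f ==> L2b g ==> L2b h ==> ip h (%x. f x - g x) = ip h f - ip h g"
 by (simp add: ip_def right_diff_distrib L2b_integrable_mult)

lemma ip_cmult_right: "ip h (%x. c * f x) = c * ip h f"
 by (simp add: ip_def mult.left_commute)

lemma ip_sum_left:
 "finite A ==> (!!a. a \<in> A ==> L2b (f a)) ==> L2b h
  ==> ip (%x. \<Sum>a\<in>A. f a x) h = (\<Sum>a\<in>A. ip (f a) h)"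
 by (simp add: ip_def sum_distrib_right L2b_integrable_mult)

lemma ip_sum_right:
 "finite A ==> (!!a. a \<in> A ==> L2b (f a)) ==> L2b h
  ==> ip h (%x. \<Sum>a\<in>A. f a x) = (\<Sum>a\<in>A. ip h (f a))"
 by (simp add: ip_def sum_distrib_left L2b_integrable_mult)

lemma ip_self: "ip f f = (nrm f)\<^sup>2" unfolding nrm_sq by (simp add: ip_def power2_eq_square)

lemma nrm_sq_add:
 assumes "L2b f" "L2b g"
 shows "(nrm (%x. f x + g x))\<^sup>2 = (nrm f)\<^sup>2 + 2 * ip f g + (nrm g)\<^sup>2"
 using assms by (simp add: ip_self[symmetric] ip_add_left ip_add_right L2b_add ip_commute[of g f])

lemma ip_Cauchy_Schwarz:
 assumes "L2b f" "L2b g" shows "\<bar>ip f g\<bar> <= nrm f * nrm g"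
proof -
 have q: "0 <= t\<^sup>2 * (nrm f)\<^sup>2 + 2 * (t * ip f g) + (nrm g)\<^sup>2" for t
 proof -
  have "0 <= (nrm (%x. t * f x + g x))\<^sup>2" by simp
  then show ?thesis using assms
   by (simp add: nrm_sq_add L2b_cmult nrm_cmult ip_cmult_left power_mult_distrib)
 qed
 have "(ip f g)\<^sup>2 <= (nrm f)\<^sup>2 * (nrm g)\<^sup>2"
 proof (cases "nrm f = 0")
  case True
  have "ip f g = 0"
  proof (rule ccontr)
   assume "ip f g ~= 0"
   then have "- ((nrm g)\<^sup>2 + 1) / ip f g * ip f g = - ((nrm g)\<^sup>2 + 1)" by simp
   then have "0 <= - 2 * ((nrm g)\<^sup>2 + 1) + (nrm g)\<^sup>2"
    using q[of "- ((nrm g)\<^sup>2 + 1) / ip f g"] True by simp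
   moreover have "0 <= (nrm g)\<^sup>2" by simp
   ultimately show False by argo
  qed
  then show ?thesis by simp
 next
  case False
  have "0 <= (nrm f)\<^sup>2 * ((- ip f g / (nrm f)\<^sup>2)\<^sup>2 * (nrm f)\<^sup>2
    + 2 * (- ip f g / (nrm f)\<^sup>2 * ip f g) + (nrm g)\<^sup>2)"
   using q[of "- ip f g / (nrm f)\<^sup>2"] by (intro mult_nonneg_nonneg) auto
  also have "\<dots> = (nrm f)\<^sup>2 * (nrm g)\<^sup>2 - (ip f g)\<^sup>2"
   using False by (simp add: field_simps power2_eq_square)
  finally show ?thesis by simp
 qed
 then have "\<bar>ip f g\<bar>\<^sup>2 <= (nrm f * nrm g)\<^sup>2" by (simp add: power_mult_distrib)
 then show ?thesis by (rule power2_le_imp_le) simp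
qed

lemma nrm_triangle:
 assumes "L2b f" "L2b g" shows "nrm (%x. f x + g x) <= nrm f + nrm g"
proof -
 have "(nrm (%x. f x + g x))\<^sup>2 <= (nrm f + nrm g)\<^sup>2"
  unfolding nrm_sq_add[OF assms] power2_sum using ip_Cauchy_Schwarz[OF assms] by auto
 then show ?thesis by (rule power2_le_imp_le) simp
qed

lemma nrm_triangle_diff:
 assumes "L2b f" "L2b g" shows "nrm (%x. f x - g x) <= nrm f + nrm g"
 using nrm_triangle[OF assms(1) L2b_minus[OF assms(2)]] by (simp add: nrm_minus)

lemma nrm_triangle_diff3:
 assumes "L2b f" "L2b g" "L2b h"
 shows "nrm (%x. f x - h x) <= nrm (%x. f x - g x) + nrm (%x. g x - h x)"
 using nrm_triangle[OF L2b_diff[OF assms(1,2)] L2b_diff[OF assms(2,3)]] by simp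

lemma nrm_le_diff:
 assumes "L2b f" "L2b g" shows "nrm f <= nrm (%x. f x - g x) + nrm g"
 using nrm_triangle[OF L2b_diff[OF assms] assms(2)] by simp

lemma nrm_diff_commute: "nrm (%x. f x - g x) = nrm (%x. g x - f x)"
 unfolding nrm_def by (simp add: power2_commute)

lemma nrm_sum:
 "finite A ==> (!!a. a \<in> A ==> L2b (f a)) ==> nrm (%x. \<Sum>a\<in>A. f a x) <= (\<Sum>a\<in>A. nrm (f a))"
proof (induction A rule: finite_induct)
 case (insert a A)
 have "nrm (%x. f a x + (\<Sum>a\<in>A. f a x)) <= nrm (f a) + nrm (%x. \<Sum>a\<in>A. f a x)"
  using insert by (intro nrm_triangle L2b_sum) auto
 then show ?case using insert by (auto simp: add_left_mono intro: order_trans)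
qed simp

lemma nrm_tendsto:
 assumes "!!n. L2b (f n)" "L2b g" "(%n. nrm (%x. f n x - g x)) \<longlonglongrightarrow> 0"
 shows "(%n. nrm (f n)) \<longlonglongrightarrow> nrm g"
proof (rule LIM_zero_cancel, rule Lim_null_comparison[OF _ assms(3)])
 show "\<forall>\<^sub>F n in sequentially. norm (nrm (f n) - nrm g) <= nrm (%x. f n x - g x)"
 proof (rule always_eventually, rule allI)
  fix n
  show "norm (nrm (f n) - nrm g) <= nrm (%x. f n x - g x)"
   using nrm_le_diff[OF assms(1,2), of n] nrm_le_diff[OF assms(2,1), of n]
    nrm_diff_commute[of g "f n"] by auto
 qed
qed

lemma ip_tendsto:
 assumes "!!n. L2b (f n)" "L2b g" "(%n. nrm (%x. f n x - g x)) \<longlonglongrightarrow> 0" "L2b h"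
 shows "(%n. ip (f n) h) \<longlonglongrightarrow> ip g h"
proof (rule LIM_zero_cancel, rule Lim_null_comparison)
 show "(%n. nrm (%x. f n x - g x) * nrm h) \<longlonglongrightarrow> 0"
  using tendsto_mult_right[OF assms(3), of "nrm h"] by simp
 show "\<forall>\<^sub>F n in sequentially. norm (ip (f n) h - ip g h) <= nrm (%x. f n x - g x) * nrm h"
  using ip_Cauchy_Schwarz[OF L2b_diff[OF assms(1,2)] assms(4)]
  by (auto simp: ip_diff_left[OF assms(1,2,4)])
qed

subsection \<open>Translations\<close>

lemma lborel_shift_eq:
 fixes f :: "'n::finite rfun"
 assumes "f \<in> borel_measurable borel"
 shows "(LINT x|lborel. f (x + p)) = (LINT x|lborel. f x)"
 using integral_distr[of "(+) p" lborel borel f] assms lborel_distr_plus[of p]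
 by (simp add: add.commute)

lemma lborel_shift_integrable:
 fixes f :: "'n::finite rfun"
 assumes "f \<in> borel_measurable borel"
 shows "integrable lborel (%x. f (x + p)) = integrable lborel f"
 using integrable_distr_eq[of "(+) p" lborel borel f] assms lborel_distr_plus[of p]
 by (simp add: add.commute)

lemma L2b_shift: "L2b f ==> L2b (%x. f (x + p))"
 using lborel_shift_integrable[of "%x. (f x)\<^sup>2" p]
 by (auto simp: L2b_def intro!: measurable_compose[of "%x. x + p" borel borel f])

lemma nrm_shift: "L2b f ==> nrm (%x. f (x + p)) = nrm f"
 using lborel_shift_eq[of "%x. (f x)\<^sup>2" p] by (auto simp: nrm_def L2b_def)

lemma ip_shift: "L2b f ==> L2b g ==> ip (%x. f (x + p)) g = ip f (%x. g (x - p))"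
 using lborel_shift_eq[of "%x. f x * g (x - p)" p]
 by (auto simp: ip_def L2b_def)

lemma lborel_distr_uminus_vec: "distr lborel borel uminus = (lborel :: (real^'n::finite) measure)"
 using lborel_affine[of "-1" "0::real^'n"] density_1[of "distr lborel borel (uminus :: real^'n => _)"]
 by (simp add: one_ereal_def)

lemma lborel_reflect_eq:
 fixes f :: "'n::finite rfun"
 assumes "f \<in> borel_measurable borel"
 shows "(LINT x|lborel. f (p - x)) = (LINT x|lborel. f x)"
proof -
 have "(LINT x|lborel. f (p - x)) = (LINT x|distr lborel borel uminus. f (x + p))"
  using assms by (subst integral_distr) (auto simp: add.commute)
 also have "\<dots> = (LINT x|lborel. f x)"
  using lborel_shift_eq[OF assms] by (simp add: lborel_distr_uminus_vec)
 finally show ?thesis .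
qed

subsection \<open>Completeness and the representation of bounded functionals\<close>

text \<open>A subsequence whose increments \<open>d k\<close> have norms at most \<open>2\<^sup>-\<^sup>k\<close> converges
  almost everywhere, because \<open>\<Sum>k. 2\<^sup>k (d k)\<^sup>2\<close> has a finite integral. Fatou's lemma identifies
  the pointwise limit as the limit in norm.\<close>

lemma L2b_complete:
 fixes f :: "nat => 'n::finite rfun"
 assumes L: "!!n. L2b (f n)"
  and cauchy: "!!e. e > 0 ==> \<exists>N. \<forall>m\<ge>N. \<forall>n\<ge>N. nrm (%x. f m x - f n x) < e"
 shows "\<exists>g. L2b g \<and> (%n. nrm (%x. f n x - g x)) \<longlonglongrightarrow> 0"
proof -
 obtain N where N: "!!k m n. m >= N k ==> n >= N k ==> nrm (%x. f m x - f n x) < (1/2)^k"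
  using cauchy[of "(1/2)^k" for k] by (metis zero_less_power zero_less_divide_1_iff zero_less_numeral)
 define r where "r k = (\<Sum>j\<le>k. N j) + k" for k
 have rN: "r k >= N k" and rk: "r k >= k" for k
  using member_le_sum[of k "{..k}" N] by (auto simp: r_def)
 have rmono: "r k <= r (Suc k)" for k by (simp add: r_def)
 define d where "d k x = f (r (Suc k)) x - f (r k) x" for k x
 have Ld: "L2b (d k)" for k unfolding d_def by (intro L2b_diff L)
 have dn: "(nrm (d k))\<^sup>2 <= (1/4)^k" for k
 proof -
  have "nrm (d k) <= (1/2)^k"
   unfolding d_def using N[of k "r (Suc k)" "r k"] rN[of k] rmono[of k] by simp
  then have "(nrm (d k))\<^sup>2 <= ((1/2)^k)\<^sup>2" by (intro power_mono) auto
  also have "((1/2)^k)\<^sup>2 = (1/4::real)^k" by (simp add: power2_eq_square power_mult_distrib[symmetric])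
  finally show ?thesis .
 qed
 have [measurable]: "f n \<in> borel_measurable borel" "d k \<in> borel_measurable borel" for n k
  using L Ld by (auto simp: L2b_def)
 have ndk: "(\<integral>\<^sup>+x. ennreal (2^k * (d k x)\<^sup>2) \<partial>lborel) = ennreal (2^k * (nrm (d k))\<^sup>2)" for k
  using Ld[of k] by (subst nn_integral_eq_integral) (auto simp: L2b_def nrm_sq)
 have "(\<integral>\<^sup>+x. (\<Sum>k. ennreal (2^k * (d k x)\<^sup>2)) \<partial>lborel) = (\<Sum>k. ennreal (2^k * (nrm (d k))\<^sup>2))"
  by (subst nn_integral_suminf) (auto simp: ndk)
 also have "\<dots> <= (\<Sum>k. ennreal ((1/2)^k))"
 proof (intro suminf_le ennreal_leI)
  fix k
  have "2^k * (nrm (d k))\<^sup>2 <= 2^k * (1/4::real)^k" using dn by (intro mult_left_mono) auto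
  also have "\<dots> = (1/2)^k" by (simp add: power_mult_distrib[symmetric])
  finally show "2^k * (nrm (d k))\<^sup>2 <= (1/2)^k" .
 qed auto
 also have "\<dots> = ennreal (\<Sum>k. (1/2)^k)" by (rule suminf_ennreal2) auto
 also have "\<dots> < \<infinity>" by simp
 finally have fin: "(\<integral>\<^sup>+x. (\<Sum>k. ennreal (2^k * (d k x)\<^sup>2)) \<partial>lborel) ~= \<infinity>" by simp
 have "AE x in lborel. (\<Sum>k. ennreal (2^k * (d k x)\<^sup>2)) ~= \<infinity>"
  by (rule nn_integral_PInf_AE[OF _ fin]) measurable
 then have conv: "AE x in lborel. convergent (%k. f (r k) x)"
 proof (eventually_elim)
  fix x assume fx: "(\<Sum>k. ennreal (2^k * (d k x)\<^sup>2)) ~= \<infinity>"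
  define c where "c k = 2^k * (d k x)\<^sup>2" for k
  obtain M where M: "M >= 0" "(\<Sum>k. ennreal (c k)) = ennreal M"
  proof (cases "\<Sum>k. ennreal (c k)" rule: ennreal_cases)
   case top then show ?thesis using fx by (simp add: c_def)
  qed (use that in blast)
  have "c k <= M" for k
  proof -
   have "sum (%k. ennreal (c k)) {k} <= (\<Sum>k. ennreal (c k))"
    by (rule sum_le_suminf) (auto intro: summableI)
   then show ?thesis unfolding M(2) using M(1) by simp
  qed
  then have cM: "2^k * (d k x)\<^sup>2 <= M" for k by (simp add: c_def)
  have dk: "\<bar>d k x\<bar> <= sqrt M * (1 / sqrt 2)^k" for k
  proof -
   have "(d k x)\<^sup>2 <= M / 2^k" using cM[of k] by (simp add: field_simps)
   then have "sqrt ((d k x)\<^sup>2) <= sqrt (M / 2^k)" by (rule real_sqrt_le_mono)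
   moreover have "sqrt (M / 2^k) = sqrt M * (1 / sqrt 2)^k"
    by (simp add: real_sqrt_divide real_sqrt_power power_divide)
   ultimately show ?thesis by (simp only: real_sqrt_abs)
  qed
  have sm: "summable (%k. sqrt M * (1 / sqrt 2)^k)"
   by (intro summable_mult summable_geometric) simp
  have "summable (%k. d k x)"
   by (rule summable_comparison_test'[OF sm, where N = 0]) (use dk in simp)
  then have "convergent (%n. \<Sum>k<n. d k x)" by (simp add: summable_iff_convergent)
  moreover have "(\<Sum>k<n. d k x) = f (r n) x - f (r 0) x" for n
   unfolding d_def by (rule sum_lessThan_telescope)
  ultimately have "convergent (%n. (f (r n) x - f (r 0) x) + f (r 0) x)"
   by (intro convergent_add convergent_const) simp
  then show "convergent (%n. f (r n) x)" by simp
 qed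
 define g where "g x = lim (%k. f (r k) x)" for x
 have [measurable]: "g \<in> borel_measurable borel"
  unfolding g_def by measurable
 have glim: "AE x in lborel. (%k. f (r k) x) \<longlonglongrightarrow> g x"
  using conv by eventually_elim (simp add: g_def convergent_LIMSEQ_iff)
 have fatou: "(\<integral>\<^sup>+x. ennreal ((f n x - g x)\<^sup>2) \<partial>lborel) <= ennreal (e\<^sup>2)"
  if n: "n >= N k" and e: "e = (1/2)^k" for n k e
 proof -
  have "(\<integral>\<^sup>+x. ennreal ((f n x - g x)\<^sup>2) \<partial>lborel)
    = (\<integral>\<^sup>+x. liminf (%j. ennreal ((f n x - f (r j) x)\<^sup>2)) \<partial>lborel)"
  proof (rule nn_integral_cong_AE, use glim in eventually_elim)
   fix x assume "(%k. f (r k) x) \<longlonglongrightarrow> g x"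
   then have "(%j. ennreal ((f n x - f (r j) x)\<^sup>2)) \<longlonglongrightarrow> ennreal ((f n x - g x)\<^sup>2)"
    by (intro tendsto_ennrealI tendsto_intros)
   then show "ennreal ((f n x - g x)\<^sup>2) = liminf (%j. ennreal ((f n x - f (r j) x)\<^sup>2))"
    by (rule lim_imp_Liminf[OF sequentially_bot, symmetric])
  qed
  also have "\<dots> <= liminf (%j. \<integral>\<^sup>+x. ennreal ((f n x - f (r j) x)\<^sup>2) \<partial>lborel)"
   by (rule nn_integral_liminf) measurable
  also have "\<dots> = liminf (%j. ennreal ((nrm (%x. f n x - f (r j) x))\<^sup>2))"
   using L2b_diff[OF L L]
   by (subst nn_integral_eq_integral) (auto simp: L2b_def nrm_sq)
  also have "\<dots> <= limsup (%j. ennreal ((nrm (%x. f n x - f (r j) x))\<^sup>2))"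
   by (rule Liminf_le_Limsup) simp
  also have "\<dots> <= ennreal (e\<^sup>2)"
  proof (rule Limsup_bounded)
   show "\<forall>\<^sub>F j in sequentially. ennreal ((nrm (%x. f n x - f (r j) x))\<^sup>2) <= ennreal (e\<^sup>2)"
   proof (rule eventually_sequentiallyI)
    fix j assume "j >= N k"
    then have "nrm (%x. f n x - f (r j) x) <= e"
     using N[of k n "r j"] n rk[of j] e by (simp add: order.strict_implies_order)
    then show "ennreal ((nrm (%x. f n x - f (r j) x))\<^sup>2) <= ennreal (e\<^sup>2)"
     by (intro ennreal_leI power_mono) auto
   qed
  qed
  finally show ?thesis .
 qed
 have Lfg: "L2b (%x. f n x - g x)" and nfg: "nrm (%x. f n x - g x) <= (1/2)^k"
  if "n >= N k" for n k
 proof -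
  have le: "(\<integral>\<^sup>+x. ennreal ((f n x - g x)\<^sup>2) \<partial>lborel) <= ennreal (((1/2)^k)\<^sup>2)"
   using fatou[OF that refl] .
  also have "\<dots> < \<infinity>" by simp
  finally have int: "integrable lborel (%x. (f n x - g x)\<^sup>2)"
   by (intro integrableI_nonneg) auto
  then show "L2b (%x. f n x - g x)" by (simp add: L2b_def)
  have "ennreal ((nrm (%x. f n x - g x))\<^sup>2) <= ennreal (((1/2)^k)\<^sup>2)"
   using le int by (subst (asm) nn_integral_eq_integral) (auto simp: nrm_sq)
  then have "(nrm (%x. f n x - g x))\<^sup>2 <= ((1/2)^k)\<^sup>2" by (simp add: ennreal_le_iff)
  then show "nrm (%x. f n x - g x) <= (1/2)^k" by (rule power2_le_imp_le) simp
 qed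
 have "L2b g"
  using L2b_diff[OF L[of "N 0"] Lfg[of 0 "N 0"]] by simp
 moreover have "(%n. nrm (%x. f n x - g x)) \<longlonglongrightarrow> 0"
 proof (rule LIMSEQ_I)
  fix e :: real assume "e > 0"
  then obtain k where "(1/2::real)^k < e" using real_arch_pow_inv[of e "1/2"] by auto
  then show "\<exists>no. \<forall>n\<ge>no. norm (nrm (%x. f n x - g x) - 0) < e"
   using nfg[of k] by (intro exI[of _ "N k"]) fastforce
 qed
 ultimately show ?thesis by blast
qed

text \<open>The representing function is the limit of a minimising sequence of
  \<open>\<phi> \<mapsto> \<parallel>\<phi>\<parallel>\<^sup>2 / 2 - T \<phi>\<close>, which is a Cauchy sequence by the parallelogram identity. It is
  therefore a limit of elements of \<open>V\<close>.\<close>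

lemma Riesz_representation:
 fixes V :: "('n::finite rfun) set"
 assumes V: "!!\<phi>. \<phi> \<in> V ==> L2b \<phi>" "(%x. 0) \<in> V"
   "!!\<phi> \<psi> t. \<phi> \<in> V ==> \<psi> \<in> V ==> (%x. \<phi> x + t * \<psi> x) \<in> V"
  and T: "!!\<phi> \<psi> t. \<phi> \<in> V ==> \<psi> \<in> V ==> T (%x. \<phi> x + t * \<psi> x) = T \<phi> + t * T \<psi>"
  and C: "C >= 0" "!!\<phi>. \<phi> \<in> V ==> \<bar>T \<phi>\<bar> <= C * nrm \<phi>"
 shows "\<exists>v f. L2b v \<and> nrm v <= C \<and> (\<forall>\<phi>\<in>V. ip v \<phi> = T \<phi>) \<and>
  (\<forall>n::nat. f n \<in> V) \<and> (%n. nrm (%x. f n x - v x)) \<longlonglongrightarrow> 0"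
proof -
 define J where "J \<phi> = (nrm \<phi>)\<^sup>2 / 2 - T \<phi>" for \<phi>
 have Jlow: "J \<phi> >= - C\<^sup>2 / 2" if "\<phi> \<in> V" for \<phi>
 proof -
  have "0 <= (nrm \<phi> - C)\<^sup>2" by simp
  then have "2 * (C * nrm \<phi>) <= (nrm \<phi>)\<^sup>2 + C\<^sup>2" by (simp add: power2_diff algebra_simps)
  moreover have "T \<phi> <= C * nrm \<phi>" using C(2)[OF that] by linarith
  ultimately show ?thesis unfolding J_def by argo
 qed
 define I where "I = Inf (J ` V)"
 have bdd: "bdd_below (J ` V)" using Jlow by (auto simp: bdd_below_def)
 have I_le: "I <= J \<phi>" if "\<phi> \<in> V" for \<phi> unfolding I_def using that bdd by (intro cInf_lower) auto
 have "\<exists>\<phi>\<in>V. J \<phi> < I + e" if "e > 0" for e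
  using cInf_lessD[of "J ` V" "I + e"] V(2) that unfolding I_def by auto
 then have "\<exists>\<phi>\<in>V. J \<phi> < I + 1 / real (Suc n)" for n by (metis of_nat_0_less_iff zero_less_Suc zero_less_divide_1_iff)
 then obtain f where f: "!!n. f n \<in> V" "!!n. J (f n) < I + 1 / real (Suc n)" by metis
 have Lf: "L2b (f n)" for n using f V by auto
 have quad: "J (%x. \<phi> x + t * \<psi> x) = J \<phi> + t * (ip \<phi> \<psi> - T \<psi>) + t\<^sup>2 / 2 * (nrm \<psi>)\<^sup>2"
  if "\<phi> \<in> V" "\<psi> \<in> V" for \<phi> \<psi> t
  using that V(1) by (simp add: J_def T nrm_sq_add L2b_cmult nrm_cmult ip_cmult_right
    power_mult_distrib field_simps)
 have par: "(nrm (%x. f m x - f n x))\<^sup>2 <= 4 * (1 / real (Suc m) + 1 / real (Suc n))" for m n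
 proof -
  define \<psi> where "\<psi> = (%x. f m x - f n x)"
  have \<psi>: "\<psi> \<in> V" using V(3)[OF f(1)[of m] f(1)[of n], of "-1"] by (simp add: \<psi>_def)
  have a: "J (f m) = J (f n) + (ip (f n) \<psi> - T \<psi>) + 1 / 2 * (nrm \<psi>)\<^sup>2"
   using quad[OF f(1)[of n] \<psi>, of 1] by (simp add: \<psi>_def)
  have "I <= J (%x. f n x + 1/2 * \<psi> x)" by (intro I_le V(3) f \<psi>)
  also have "\<dots> = J (f n) + 1/2 * (ip (f n) \<psi> - T \<psi>) + 1/8 * (nrm \<psi>)\<^sup>2"
   using quad[OF f(1)[of n] \<psi>, of "1/2"] by (simp add: power_divide)
  finally have "(nrm \<psi>)\<^sup>2 <= 4 * (J (f m) - I + (J (f n) - I))" using a by argo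
  then show ?thesis using f(2)[of m] f(2)[of n] by (simp add: \<psi>_def)
 qed
 have cauchy: "\<exists>N. \<forall>m\<ge>N. \<forall>n\<ge>N. nrm (%x. f m x - f n x) < e" if e: "e > 0" for e
 proof -
  obtain N where N: "1 / real (Suc N) < e\<^sup>2 / 8" using e
   by (metis nat_approx_posE zero_less_power zero_less_divide_iff zero_less_numeral)
  have "nrm (%x. f m x - f n x) < e" if "m >= N" "n >= N" for m n
  proof -
   have "1 / real (Suc m) <= 1 / real (Suc N)" "1 / real (Suc n) <= 1 / real (Suc N)"
    using that by (auto intro!: divide_left_mono)
   then have "(nrm (%x. f m x - f n x))\<^sup>2 < e\<^sup>2" using par[of m n] N by argo
   then show ?thesis using e by (simp add: power2_less_imp_less)
  qed
  then show ?thesis by blast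
 qed
 obtain v where v: "L2b v" "(%n. nrm (%x. f n x - v x)) \<longlonglongrightarrow> 0"
  using L2b_complete[OF Lf cauchy] by auto
 have rep: "ip v \<psi> = T \<psi>" if \<psi>: "\<psi> \<in> V" for \<psi>
 proof -
  have ge: "0 <= t * (ip v \<psi> - T \<psi>) + t\<^sup>2 / 2 * (nrm \<psi>)\<^sup>2" for t
  proof (rule tendsto_lowerbound)
   show "(%n. t * (ip (f n) \<psi> - T \<psi>) + t\<^sup>2 / 2 * (nrm \<psi>)\<^sup>2 + 1 / real (Suc n))
     \<longlonglongrightarrow> t * (ip v \<psi> - T \<psi>) + t\<^sup>2 / 2 * (nrm \<psi>)\<^sup>2"
    using tendsto_add[OF tendsto_add[OF tendsto_mult_left[OF tendsto_diff[OF
      ip_tendsto[OF Lf v V(1)[OF \<psi>]] tendsto_const]] tendsto_const] LIMSEQ_inverse_real_of_nat]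
    by (simp add: inverse_eq_divide)
   show "\<forall>\<^sub>F n in sequentially. 0 <= t * (ip (f n) \<psi> - T \<psi>) + t\<^sup>2 / 2 * (nrm \<psi>)\<^sup>2 + 1 / real (Suc n)"
   proof (rule always_eventually, rule allI)
    fix n
    show "0 <= t * (ip (f n) \<psi> - T \<psi>) + t\<^sup>2 / 2 * (nrm \<psi>)\<^sup>2 + 1 / real (Suc n)"
     using I_le[OF V(3)[OF f(1)[of n] \<psi>], of t] quad[OF f(1)[of n] \<psi>, of t] f(2)[of n] by linarith
   qed
  qed simp
  define D where "D = ip v \<psi> - T \<psi>"
  define q where "q = (nrm \<psi>)\<^sup>2 + 1"
  have q: "q > 0" by (simp add: q_def add_nonneg_pos)
  have "0 <= (- D / q) * D + (- D / q)\<^sup>2 / 2 * (nrm \<psi>)\<^sup>2" using ge[of "- D / q"] by (simp add: D_def)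
  also have "\<dots> <= (- D / q) * D + (- D / q)\<^sup>2 / 2 * q"
   by (intro add_left_mono mult_left_mono) (auto simp: q_def)
  also have "\<dots> = - D\<^sup>2 / (2 * q)" using q by (simp add: field_simps power2_eq_square)
  finally have "D\<^sup>2 <= 0" using q by (simp add: divide_le_0_iff)
  then show ?thesis by (simp add: D_def)
 qed
 have "(nrm v)\<^sup>2 <= C * nrm v"
 proof (rule LIMSEQ_le)
  show "(%n. ip (f n) v) \<longlonglongrightarrow> (nrm v)\<^sup>2" using ip_tendsto[OF Lf v v(1)] by (simp add: ip_self)
  show "(%n. C * nrm (f n)) \<longlonglongrightarrow> C * nrm v" by (intro tendsto_intros nrm_tendsto Lf v)
  show "\<exists>N. \<forall>n\<ge>N. ip (f n) v <= C * nrm (f n)"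
  proof (intro exI[of _ 0] allI impI)
   fix n
   show "ip (f n) v <= C * nrm (f n)"
    using rep[OF f(1)[of n]] C(2)[OF f(1)[of n]] by (simp add: ip_commute)
  qed
 qed
 then have "nrm v <= C"
  using C(1) mult_right_le_imp_le[of "nrm v" "nrm v" C] nrm_nonneg[of v]
  by (cases "nrm v = 0") (auto simp: power2_eq_square order_less_le)
 then show ?thesis using v rep f(1) by blast
qed

section \<open>Test functions\<close>

lemma test_functionsI:
 assumes "C_infinity \<phi>" "compact K" "K \<subseteq> U" "!!x. x \<notin> K ==> \<phi> x = 0"
 shows "\<phi> \<in> test_functions U"
proof -
 have "closure {x. \<phi> x ~= 0} \<subseteq> K"
  using assms by (intro closure_minimal compact_imp_closed) auto
 moreover from this have "compact (closure {x. \<phi> x ~= 0})"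
  using assms(2) by (metis closed_closure compact_Int_closed inf.absorb_iff2)
 ultimately show ?thesis using assms by (auto simp: test_functions_def)
qed

lemma test_functionsE:
 assumes "\<phi> \<in> test_functions U"
 obtains K where "C_infinity \<phi>" "compact K" "K \<subseteq> U" "!!x. x \<notin> K ==> \<phi> x = 0"
proof (rule that[of "closure {x. \<phi> x ~= 0}"])
 show "\<phi> x = 0" if "x \<notin> closure {x. \<phi> x ~= 0}" for x
  using that subsetD[OF closure_subset, of x "{x. \<phi> x ~= 0}"] by auto
qed (use assms in \<open>simp_all add: test_functions_def\<close>)

lemma test_smooth: "\<phi> \<in> test_functions U ==> C_infinity \<phi>"
 by (simp add: test_functions_def)

lemma test_mono: "\<phi> \<in> test_functions U ==> U \<subseteq> V ==> \<phi> \<in> test_functions V"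
 by (auto simp: test_functions_def)

lemma partial_eq_0:
 assumes "open S" "x \<in> S" "!!y. y \<in> S ==> f y = 0" shows "partial i f x = 0"
proof -
 have "((%y. 0) has_derivative (%h. 0)) (at x)" by simp
 then have "(f has_derivative (%h. 0)) (at x)"
  by (rule has_derivative_transform_within_open[OF _ assms(1,2)]) (simp add: assms(3))
 then show ?thesis using partial_eqI by blast
qed

lemma test_partial:
 assumes "\<phi> \<in> test_functions U" shows "partial i \<phi> \<in> test_functions U"
proof -
 obtain K where K: "C_infinity \<phi>" "compact K" "K \<subseteq> U" "!!x. x \<notin> K ==> \<phi> x = 0"
  using test_functionsE[OF assms] by blast
 show ?thesis
 proof (rule test_functionsI[OF C_infinity_partial[OF K(1)] K(2,3)])
  fix x assume "x \<notin> K"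
  then show "partial i \<phi> x = 0"
   by (intro partial_eq_0[of "- K"]) (use K in \<open>auto intro: compact_imp_closed\<close>)
 qed
qed

lemma test_mi_partial:
 fixes \<phi> :: "'n::{finite,wellorder} rfun"
 assumes "\<phi> \<in> test_functions U" shows "mi_partial \<alpha> \<phi> \<in> test_functions U"
proof (induction \<alpha> rule: mi_induct)
 case (inc \<beta> i)
 then show ?case using assms by (simp add: mi_partial_inc[OF test_smooth] test_partial)
qed (use assms in simp)

lemma test_mult:
 assumes "C_infinity f" "\<phi> \<in> test_functions U" shows "(%x. f x * \<phi> x) \<in> test_functions U"
proof -
 obtain K where K: "C_infinity \<phi>" "compact K" "K \<subseteq> U" "!!x. x \<notin> K ==> \<phi> x = 0"
  using test_functionsE[OF assms(2)] by metis
 show ?thesis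
  by (rule test_functionsI[OF C_infinity_mult[OF assms(1) K(1)] K(2,3)]) (simp add: K(4))
qed

lemma test_mult2:
 "\<phi> \<in> test_functions U ==> C_infinity f ==> (%x. \<phi> x * f x) \<in> test_functions U"
 using test_mult[of f \<phi> U] by (simp add: mult.commute)

lemma test_cmult: "\<phi> \<in> test_functions U ==> (%x. c * \<phi> x) \<in> test_functions U"
 by (intro test_mult C_infinity_const)

lemma test_zero: "(%x. 0) \<in> test_functions U"
 by (rule test_functionsI[of _ "{}"]) (auto intro: C_infinity_const)

lemma test_add:
 assumes "\<phi> \<in> test_functions U" "\<psi> \<in> test_functions U"
 shows "(%x. \<phi> x + \<psi> x) \<in> test_functions U"
proof -
 obtain K where K: "C_infinity \<phi>" "compact K" "K \<subseteq> U" "!!x. x \<notin> K ==> \<phi> x = 0"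
  using test_functionsE[OF assms(1)] by metis
 obtain L where L: "C_infinity \<psi>" "compact L" "L \<subseteq> U" "!!x. x \<notin> L ==> \<psi> x = 0"
  using test_functionsE[OF assms(2)] by metis
 show ?thesis
 proof (rule test_functionsI[OF C_infinity_add[OF K(1) L(1)] compact_Un[OF K(2) L(2)]])
  show "\<phi> x + \<psi> x = 0" if "x \<notin> K \<union> L" for x using that K(4) L(4) by simp
 qed (use K L in auto)
qed

lemma test_sum:
 "finite A ==> (!!a. a \<in> A ==> f a \<in> test_functions U) ==> (%x. \<Sum>a\<in>A. f a x) \<in> test_functions U"
 by (induction A rule: finite_induct) (simp_all add: test_add test_zero)

lemma test_power:
 "\<phi> \<in> test_functions U ==> k > 0 ==> (%x. \<phi> x ^ k) \<in> test_functions U"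
 by (cases k) (auto intro!: test_mult2 C_infinity_power intro: test_smooth)

lemma test_shift:
 fixes \<phi> :: "'n::finite rfun"
 assumes "\<phi> \<in> test_functions U" and "!!x. x \<in> U ==> x - p \<in> V"
 shows "(%x. \<phi> (x + p)) \<in> test_functions V"
proof -
 obtain K where K: "C_infinity \<phi>" "compact K" "K \<subseteq> U" "!!x. x \<notin> K ==> \<phi> x = 0"
  using test_functionsE[OF assms(1)] by metis
 have "compact ((%x. x - p) ` K)" by (intro compact_continuous_image continuous_intros K)
 then show ?thesis
 proof (rule test_functionsI[OF C_infinity_shift[OF K(1)]])
  show "(%x. x - p) ` K \<subseteq> V" using K assms by auto
  show "\<phi> (x + p) = 0" if "x \<notin> (%x. x - p) ` K" for x
   using that by (intro K(4)) (auto simp: image_iff)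
 qed
qed

lemma test_reflect:
 fixes \<phi> :: "'n::finite rfun"
 assumes "\<phi> \<in> test_functions U" and "!!y. y \<in> U ==> x - y \<in> V"
 shows "(%y. \<phi> (x - y)) \<in> test_functions V"
proof -
 obtain K where K: "C_infinity \<phi>" "compact K" "K \<subseteq> U" "!!x. x \<notin> K ==> \<phi> x = 0"
  using test_functionsE[OF assms(1)] by metis
 have "compact ((%y. x - y) ` K)" by (intro compact_continuous_image continuous_intros K)
 then show ?thesis
 proof (rule test_functionsI[OF C_infinity_reflect[OF K(1)]])
  show "(%y. x - y) ` K \<subseteq> V" using K assms by auto
  show "\<phi> (x - y) = 0" if "y \<notin> (%y. x - y) ` K" for y
   using that by (intro K(4)) (auto simp: image_iff algebra_simps)
 qed
qed

lemma test_support: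
 assumes "\<phi> \<in> test_functions U" obtains R where "R > 0" "!!x. norm x > R ==> \<phi> x = 0"
proof -
 obtain K where K: "compact K" "!!x. x \<notin> K ==> \<phi> x = 0"
  using test_functionsE[OF assms] by metis
 obtain R where "R > 0" "!!x. x \<in> K ==> norm x <= R"
  using compact_imp_bounded[OF K(1)] by (auto simp: bounded_pos)
 then show ?thesis using that[of R] K(2) by (meson not_less)
qed

lemma test_bounded:
 assumes "\<phi> \<in> test_functions U" obtains B where "B > 0" "!!x. \<bar>\<phi> x\<bar> <= B"
proof -
 obtain K where K: "C_infinity \<phi>" "compact K" "!!x. x \<notin> K ==> \<phi> x = 0"
  using test_functionsE[OF assms] by metis
 have "bounded (\<phi> ` K)"
  by (intro compact_imp_bounded compact_continuous_image C_infinity_continuous K)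
 then obtain B where B: "B > 0" "!!x. x \<in> K ==> \<bar>\<phi> x\<bar> <= B"
  by (auto simp: bounded_pos)
 show ?thesis
 proof (rule that[OF B(1)])
  show "\<bar>\<phi> x\<bar> <= B" for x using B K(3) by (cases "x \<in> K") auto
 qed
qed

lemma test_borel: "\<phi> \<in> test_functions U ==> \<phi> \<in> borel_measurable borel"
 using C_infinity_borel test_smooth by blast

lemma L2b_indicator_cball: "L2b (ind (cball p R))"
proof -
 have "(ind (cball p R) x :: real)\<^sup>2 = ind (cball p R) x" for x
  by (simp add: indicator_def)
 then show ?thesis using emeasure_lborel_cball_finite[of p R]
  by (simp add: L2b_def borel_measurable_indicator)
qed

lemma L2b_bounded_support:
 fixes f :: "'n::finite rfun"
 assumes "f \<in> borel_measurable borel" "!!x. \<bar>f x\<bar> <= B" "!!x. x \<notin> cball p R ==> f x = 0"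
 shows "L2b f" "nrm f <= B * nrm (ind (cball p R))"
proof -
 have eq: "f = (%x. f x * ind (cball p R) x)" using assms(3) by (force simp: indicator_def)
 show "L2b f" by (subst eq) (rule L2b_bounded_mult[OF L2b_indicator_cball assms(1,2)])
 show "nrm f <= B * nrm (ind (cball p R))"
  by (subst eq) (rule nrm_bounded_mult[OF L2b_indicator_cball assms(1,2)])
qed

lemma test_L2b: assumes "\<phi> \<in> test_functions U" shows "L2b \<phi>"
proof -
 obtain B where B: "!!x. \<bar>\<phi> x\<bar> <= B" using test_bounded[OF assms] by metis
 obtain R where R: "!!x. norm x > R ==> \<phi> x = 0" using test_support[OF assms] by metis
 show ?thesis by (rule L2b_bounded_support(1)[OF test_borel[OF assms] B, of 0 R]) (simp add: R)
qed

lemma test_integrable: assumes "\<phi> \<in> test_functions U" shows "integrable lborel \<phi>"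
proof -
 obtain R where R: "!!x. norm x > R ==> \<phi> x = 0" using test_support[OF assms] by metis
 have "(%x. \<phi> x * ind (cball 0 R) x) = \<phi>" using R by (auto simp: indicator_def fun_eq_iff)
 then show ?thesis using L2b_integrable_mult[OF test_L2b[OF assms] L2b_indicator_cball, of 0 R] by simp
qed

lemma segment_mean_value:
 fixes f :: "'n::finite rfun"
 assumes "C_infinity f"
 shows "\<exists>s. 0 < s \<and> s < 1 \<and> f (x + h) - f x = (\<Sum>i\<in>UNIV. h $ i * partial i f (x + s *\<^sub>R h))"
proof -
 have "((%t. f (x + t *\<^sub>R h)) has_real_derivative (\<Sum>i\<in>UNIV. h $ i * partial i f (x + t *\<^sub>R h))) (at t)" for t
 proof -
  have "((%t. x + t *\<^sub>R h) has_derivative (%k. k *\<^sub>R h)) (at t)"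
   by (auto intro!: derivative_eq_intros)
  from has_derivative_compose[OF this C_infinity_has_derivative[OF assms]]
  have "((%t. f (x + t *\<^sub>R h)) has_derivative
    (%k. \<Sum>i\<in>UNIV. (k *\<^sub>R h) $ i * partial i f (x + t *\<^sub>R h))) (at t)" .
  moreover have "(\<Sum>i\<in>UNIV. (k *\<^sub>R h) $ i * partial i f (x + t *\<^sub>R h))
    = (\<Sum>i\<in>UNIV. h $ i * partial i f (x + t *\<^sub>R h)) * k" for k
   by (simp add: sum_distrib_left mult_ac)
  ultimately show ?thesis by (simp add: has_field_derivative_def mult_commute_abs)
 qed
 from MVT2[OF zero_less_one this] show ?thesis by auto
qed

lemma test_Lipschitz:
 fixes \<phi> :: "'n::finite rfun"
 assumes "\<phi> \<in> test_functions U"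
 obtains L where "L > 0" "!!x h. \<bar>\<phi> (x + h) - \<phi> x\<bar> <= L * norm h"
proof -
 have "\<forall>i. \<exists>B>0. \<forall>x. \<bar>partial i \<phi> x\<bar> <= B"
  using test_bounded[OF test_partial[OF assms]] by metis
 then obtain B where B: "!!i. B i > 0" "!!i x. \<bar>partial i \<phi> x\<bar> <= B i" by metis
 show ?thesis
 proof (rule that[of "\<Sum>i\<in>UNIV. B i"])
  show "(\<Sum>i\<in>UNIV. B i) > 0" by (intro sum_pos B) auto
  fix x h
  obtain s where s: "\<phi> (x + h) - \<phi> x = (\<Sum>i\<in>UNIV. h $ i * partial i \<phi> (x + s *\<^sub>R h))"
   using segment_mean_value[OF test_smooth[OF assms], of x h] by auto
  have "\<bar>\<phi> (x + h) - \<phi> x\<bar> <= (\<Sum>i\<in>UNIV. \<bar>h $ i * partial i \<phi> (x + s *\<^sub>R h)\<bar>)"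
   unfolding s by (rule sum_abs)
  also have "\<dots> <= (\<Sum>i\<in>UNIV. norm h * B i)"
   unfolding abs_mult by (intro sum_mono mult_mono B component_le_norm_cart) auto
  finally show "\<bar>\<phi> (x + h) - \<phi> x\<bar> <= (\<Sum>i\<in>UNIV. B i) * norm h"
   by (simp add: sum_distrib_left mult.commute)
 qed
qed

lemma test_Taylor2:
 fixes \<phi> :: "'n::finite rfun"
 assumes "\<phi> \<in> test_functions U"
 obtains C where "C > 0"
  "!!x h. \<bar>\<phi> (x + h) - \<phi> x - (\<Sum>i\<in>UNIV. h $ i * partial i \<phi> x)\<bar> <= C * (norm h)\<^sup>2"
proof -
 have "\<forall>i. \<exists>L>0. \<forall>x h. \<bar>partial i \<phi> (x + h) - partial i \<phi> x\<bar> <= L * norm h"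
  using test_Lipschitz[OF test_partial[OF assms]] by metis
 then obtain L where L: "!!i. L i > 0" "!!i x h. \<bar>partial i \<phi> (x + h) - partial i \<phi> x\<bar> <= L i * norm h"
  by metis
 show ?thesis
 proof (rule that[of "\<Sum>i\<in>UNIV. L i"])
  show "(\<Sum>i\<in>UNIV. L i) > 0" by (intro sum_pos L) auto
  fix x h
  obtain s where s: "0 < s" "s < 1" "\<phi> (x + h) - \<phi> x = (\<Sum>i\<in>UNIV. h $ i * partial i \<phi> (x + s *\<^sub>R h))"
   using segment_mean_value[OF test_smooth[OF assms], of x h] by auto
  have "\<bar>\<phi> (x + h) - \<phi> x - (\<Sum>i\<in>UNIV. h $ i * partial i \<phi> x)\<bar>
    = \<bar>\<Sum>i\<in>UNIV. h $ i * (partial i \<phi> (x + s *\<^sub>R h) - partial i \<phi> x)\<bar>"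
   unfolding s by (simp add: sum_subtractf right_diff_distrib)
  also have "\<dots> <= (\<Sum>i\<in>UNIV. \<bar>h $ i * (partial i \<phi> (x + s *\<^sub>R h) - partial i \<phi> x)\<bar>)"
   by (rule sum_abs)
  also have "\<dots> <= (\<Sum>i\<in>UNIV. norm h * (L i * norm h))"
   unfolding abs_mult
  proof (intro sum_mono mult_mono component_le_norm_cart)
   fix i
   have "\<bar>partial i \<phi> (x + s *\<^sub>R h) - partial i \<phi> x\<bar> <= L i * norm (s *\<^sub>R h)" by (rule L)
   also have "\<dots> <= L i * norm h"
    using s L(1)[of i] by (intro mult_left_mono) (auto simp: mult_left_le_one_le)
   finally show "\<bar>partial i \<phi> (x + s *\<^sub>R h) - partial i \<phi> x\<bar> <= L i * norm h" .
  qed auto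
  also have "\<dots> = (\<Sum>i\<in>UNIV. L i) * (norm h)\<^sup>2"
   by (simp add: sum_distrib_left power2_eq_square mult_ac)
  finally show "\<bar>\<phi> (x + h) - \<phi> x - (\<Sum>i\<in>UNIV. h $ i * partial i \<phi> x)\<bar> <= (\<Sum>i\<in>UNIV. L i) * (norm h)\<^sup>2" .
 qed
qed

subsection \<open>Integration by parts\<close>

text \<open>The difference quotients have integral zero by translation invariance.\<close>

lemma integral_directional_derivative_eq_0:
 fixes q d :: "'n::finite rfun"
 assumes q: "integrable lborel q" "q \<in> borel_measurable borel" "!!x. norm x > R ==> q x = 0"
  and lip: "!!x h. 0 < h ==> h <= 1 ==> \<bar>q (x + h *\<^sub>R e) - q x\<bar> <= L * h"
  and d: "d \<in> borel_measurable borel"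
  and lim: "AE x in lborel. (%n. (q (x + (1 / real (Suc n)) *\<^sub>R e) - q x) * real (Suc n)) \<longlonglongrightarrow> d x"
 shows "(LINT x|lborel. d x) = 0"
proof -
 define s where "s n x = (q (x + (1 / real (Suc n)) *\<^sub>R e) - q x) * real (Suc n)" for n x
 define w where "w x = L * ind (cball 0 (R + norm e)) x" for x :: "real^'n"
 have [measurable]: "q \<in> borel_measurable borel" by fact
 have L: "L >= 0" using lip[of 1 0] by auto
 have "(%n. LINT x|lborel. s n x) \<longlonglongrightarrow> (LINT x|lborel. d x)"
 proof (rule integral_dominated_convergence[where w=w])
  show "d \<in> borel_measurable lborel" using d by simp
  show "s n \<in> borel_measurable lborel" for n unfolding s_def by measurable
  have "emeasure lborel (cball (0::real^'n) (R + norm e)) < \<infinity>" by (rule emeasure_lborel_cball_finite)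
  then show "integrable lborel w" unfolding w_def by (intro integrable_mult_right) simp
  show "AE x in lborel. (%n. s n x) \<longlonglongrightarrow> d x" using lim by (simp add: s_def)
  show "AE x in lborel. norm (s n x) <= w x" for n
  proof (rule AE_I2)
   fix x :: "real^'n"
   define h where "h = 1 / real (Suc n)"
   have h: "0 < h" "h <= 1" by (auto simp: h_def)
   show "norm (s n x) <= w x"
   proof (cases "x \<in> cball 0 (R + norm e)")
    case True
    have "norm (s n x) = \<bar>q (x + h *\<^sub>R e) - q x\<bar> * real (Suc n)"
     by (simp add: s_def h_def abs_mult)
    also have "\<dots> <= L * h * real (Suc n)" by (intro mult_right_mono lip h) auto
    also have "\<dots> = L" by (simp add: h_def)
    finally show ?thesis using True by (simp add: w_def)
   next
    case False
    then have x: "norm x > R + norm e" by simp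
    have "norm (h *\<^sub>R e) <= norm e" using h by (simp add: mult_left_le_one_le)
    then have "norm (x + h *\<^sub>R e) > R" using x norm_diff_ineq[of x "h *\<^sub>R e"] by linarith
    moreover have "norm x > R" using x norm_ge_zero[of e] by linarith
    ultimately show ?thesis using q(3) L by (simp add: s_def h_def w_def)
   qed
  qed
 qed
 moreover have "(LINT x|lborel. s n x) = 0" for n
 proof -
  have "integrable lborel (%x. q (x + (1 / real (Suc n)) *\<^sub>R e))"
   using lborel_shift_integrable[OF q(2)] q(1) by simp
  then show ?thesis
   unfolding s_def using q(1) lborel_shift_eq[OF q(2)] by simp
 qed
 ultimately show ?thesis by (simp add: LIMSEQ_const_iff)
qed

lemma along_axis_tendsto:
 fixes f :: "'n::finite rfun"
 assumes "C_infinity f"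
 shows "(%n. (f (x + (1 / real (Suc n)) *\<^sub>R axis i 1) - f x) * real (Suc n)) \<longlonglongrightarrow> partial i f x"
proof -
 have "((%h. (f (x + (0 + h) *\<^sub>R axis i 1) - f (x + 0 *\<^sub>R axis i 1)) / h) \<longlongrightarrow> partial i f (x + 0 *\<^sub>R axis i 1)) (at 0)"
  using has_real_derivative_along_axis[OF C_infinity_differentiable[OF assms], of x i 0]
  unfolding DERIV_def .
 moreover have "filterlim (%n. 1 / real (Suc n)) (at 0) sequentially"
  using LIMSEQ_inverse_real_of_nat by (auto simp: filterlim_at inverse_eq_divide)
 ultimately have "(%n. (f (x + (0 + 1 / real (Suc n)) *\<^sub>R axis i 1) - f (x + 0 *\<^sub>R axis i 1)) / (1 / real (Suc n)))
   \<longlonglongrightarrow> partial i f (x + 0 *\<^sub>R axis i 1)"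
  by (rule filterlim_compose)
 then show ?thesis by simp
qed

lemma integral_partial_eq_0:
 fixes \<phi> :: "'n::finite rfun"
 assumes "\<phi> \<in> test_functions U" shows "(LINT x|lborel. partial i \<phi> x) = 0"
proof -
 obtain R where R: "!!x. norm x > R ==> \<phi> x = 0" using test_support[OF assms] by metis
 obtain L where L: "!!x h. \<bar>\<phi> (x + h) - \<phi> x\<bar> <= L * norm h" using test_Lipschitz[OF assms] by metis
 show ?thesis
 proof (rule integral_directional_derivative_eq_0[OF test_integrable[OF assms] test_borel[OF assms] R])
  show "\<bar>\<phi> (x + h *\<^sub>R axis i 1) - \<phi> x\<bar> <= L * h" if "0 < h" "h <= 1" for x h
   using L[of x "h *\<^sub>R axis i 1"] that by simp
  show "partial i \<phi> \<in> borel_measurable borel" by (rule test_borel[OF test_partial[OF assms]])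
  show "AE x in lborel. (%n. (\<phi> (x + (1 / real (Suc n)) *\<^sub>R axis i 1) - \<phi> x) * real (Suc n))
    \<longlonglongrightarrow> partial i \<phi> x"
   using along_axis_tendsto[OF test_smooth[OF assms]] by simp
 qed
qed

lemma ip_partial:
 fixes \<phi> :: "'n::finite rfun"
 assumes "C_infinity f" "\<phi> \<in> test_functions U"
 shows "ip f (partial i \<phi>) = - ip (partial i f) \<phi>"
proof -
 have "partial i (%x. f x * \<phi> x) x = f x * partial i \<phi> x + partial i f x * \<phi> x" for x
  by (intro partial_mult C_infinity_differentiable assms test_smooth[OF assms(2)])
 then have "(LINT x|lborel. f x * partial i \<phi> x + partial i f x * \<phi> x) = 0"
  using integral_partial_eq_0[OF test_mult[OF assms], of i] by simp
 moreover have "integrable lborel (%x. f x * partial i \<phi> x)"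
  by (rule test_integrable[OF test_mult[OF assms(1) test_partial[OF assms(2)]]])
 moreover have "integrable lborel (%x. partial i f x * \<phi> x)"
  by (rule test_integrable[OF test_mult[OF C_infinity_partial[OF assms(1)] assms(2)]])
 ultimately show ?thesis by (simp add: ip_def)
qed

lemma ip_mi_partial:
 fixes \<phi> :: "'n::{finite,wellorder} rfun"
 assumes "C_infinity f" "\<phi> \<in> test_functions U"
 shows "ip f (mi_partial \<alpha> \<phi>) = (-1) ^ len \<alpha> * ip (mi_partial \<alpha> f) \<phi>"
 using assms(2)
proof (induction \<alpha> arbitrary: \<phi> rule: mi_induct)
 case (inc \<beta> i)
 have "ip f (mi_partial (inc \<beta> i) \<phi>) = ip f (mi_partial \<beta> (partial i \<phi>))"
  using inc.prems by (simp add: mi_partial_inc mi_partial_partial test_smooth)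
 also have "\<dots> = (-1) ^ len \<beta> * ip (mi_partial \<beta> f) (partial i \<phi>)"
  by (intro inc.IH test_partial inc.prems)
 also have "\<dots> = (-1) ^ len (inc \<beta> i) * ip (mi_partial (inc \<beta> i) f) \<phi>"
  by (simp add: mi_partial_inc[OF assms(1)] ip_partial[OF C_infinity_mi_partial[OF assms(1)] inc.prems])
 finally show ?case .
qed simp

subsection \<open>The fundamental lemma of the calculus of variations\<close>

text \<open>For a product \<open>\<beta>\<close> of one-dimensional bumps that is positive exactly on the box, the functions
  \<open>1 - exp (- n \<beta>)\<close> increase to the indicator function.\<close>

lemma box_smooth_approx:
 fixes a b :: "real^'n::finite"
 obtains \<psi> where "!!n::nat. C_infinity (\<psi> n)" "!!n x. \<bar>\<psi> n x\<bar> <= 1" "!!n x. x \<notin> box a b ==> \<psi> n x = 0"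
  "!!x. (%n. \<psi> n x) \<longlonglongrightarrow> ind (box a b) x"
proof -
 define \<beta> where "\<beta> x = (\<Prod>i\<in>UNIV. theta (x $ i - a $ i) * theta (b $ i - x $ i))" for x :: "real^'n"
 have \<beta>: "C_infinity \<beta>" unfolding \<beta>_def
  by (intro C_infinity_prod C_infinity_mult C_infinity_theta C_infinity_diff C_infinity_coord
    C_infinity_const) auto
 have pos: "\<beta> x > 0" if "x \<in> box a b" for x
  unfolding \<beta>_def using that by (intro prod_pos) (auto simp: theta_pos_iff mem_box_cart)
 have zero: "\<beta> x = 0" if "x \<notin> box a b" for x
  using that by (force simp: \<beta>_def theta_eq_0_iff mem_box_cart not_less)
 have nonneg: "\<beta> x >= 0" for x using pos[of x] zero[of x] by (cases "x \<in> box a b") auto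
 define \<psi> where "\<psi> n x = 1 - exp (- real n * \<beta> x)" for n x
 show ?thesis
 proof (rule that)
  show "C_infinity (\<psi> n)" for n unfolding \<psi>_def
   by (intro C_infinity_diff C_infinity_const C_infinity_exp C_infinity_cmult \<beta>)
  show "\<bar>\<psi> n x\<bar> <= 1" for n x
   using mult_nonneg_nonneg[of "real n" "\<beta> x"] nonneg[of x] exp_ge_zero[of "- real n * \<beta> x"]
   by (simp add: \<psi>_def)
  show "\<psi> n x = 0" if "x \<notin> box a b" for n x using zero[OF that] by (simp add: \<psi>_def)
  show "(%n. \<psi> n x) \<longlonglongrightarrow> ind (box a b) x" for x
  proof (cases "x \<in> box a b")
   case True
   have "exp (- real n * \<beta> x) = exp (- \<beta> x) ^ n" for n
    by (simp add: exp_of_nat_mult[symmetric])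
   moreover have "(%n. exp (- \<beta> x) ^ n) \<longlonglongrightarrow> 0"
    using pos[OF True] by (intro LIMSEQ_power_zero) simp
   ultimately have "(%n. 1 - exp (- real n * \<beta> x)) \<longlonglongrightarrow> 1 - 0"
    by (intro tendsto_diff tendsto_const) simp
   then show ?thesis using True by (simp add: \<psi>_def)
  next
   case False then show ?thesis using zero[OF False] by (simp add: \<psi>_def)
  qed
 qed
qed

text \<open>Boxes are stable under intersection and generate the Borel sets, so the positive and the negative part of
  \<open>g\<close> are densities of the same measure.\<close>

lemma AE_eq_0_if_box_integrals_eq_0:
 fixes g :: "'n::finite rfun"
 assumes g: "integrable lborel g"
  and box: "!!a b. (LINT x|lborel. ind (box a b) x * g x) = 0"
 shows "AE x in lborel. g x = 0"
proof -
 define P where "P = density lborel (%x. ennreal (max 0 (g x)))"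
 define Q where "Q = density lborel (%x. ennreal (max 0 (- g x)))"
 have [measurable]: "g \<in> borel_measurable borel" using g by auto
 have int: "integrable lborel (%x. ind X x * max 0 (g x))"
  "integrable lborel (%x. ind X x * max 0 (- g x))" if "X \<in> sets borel" for X
 proof -
  have "integrable lborel (%x. max 0 (g x))" "integrable lborel (%x. max 0 (- g x))"
   using g by (auto intro!: integrable_max)
  from this[THEN integrable_mult_indicator[of X lborel, rotated]]
  show "integrable lborel (%x. ind X x * max 0 (g x))"
   "integrable lborel (%x. ind X x * max 0 (- g x))" using that by simp_all
 qed
 have P: "emeasure P X = ennreal (LINT x|lborel. ind X x * max 0 (g x))" if "X \<in> sets borel" for X
 proof -
  have "emeasure P X = (\<integral>\<^sup>+x. ennreal (ind X x * max 0 (g x)) \<partial>lborel)"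
   unfolding P_def using that by (subst emeasure_density) (auto intro!: nn_integral_cong simp: indicator_def)
  also have "\<dots> = ennreal (LINT x|lborel. ind X x * max 0 (g x))"
   using int(1)[OF that] by (intro nn_integral_eq_integral) auto
  finally show ?thesis .
 qed
 have Q: "emeasure Q X = ennreal (LINT x|lborel. ind X x * max 0 (- g x))" if "X \<in> sets borel" for X
 proof -
  have "emeasure Q X = (\<integral>\<^sup>+x. ennreal (ind X x * max 0 (- g x)) \<partial>lborel)"
   unfolding Q_def using that by (subst emeasure_density) (auto intro!: nn_integral_cong simp: indicator_def)
  also have "\<dots> = ennreal (LINT x|lborel. ind X x * max 0 (- g x))"
   using int(2)[OF that] by (intro nn_integral_eq_integral) auto
  finally show ?thesis .
 qed
 have diff: "(LINT x|lborel. ind X x * max 0 (g x)) - (LINT x|lborel. ind X x * max 0 (- g x))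
   = (LINT x|lborel. ind X x * g x)" if "X \<in> sets borel" for X
  by (subst Bochner_Integration.integral_diff[OF int[OF that], symmetric])
   (auto intro!: Bochner_Integration.integral_cong simp: max_def algebra_simps)
 have "P = Q"
 proof (rule measure_eqI_generator_eq)
  let ?E = "range (%(a, b). box a b::(real^'n) set)"
  let ?A = "%n::nat. box (- (real n *\<^sub>R One)) (real n *\<^sub>R One) :: (real^'n) set"
  show "Int_stable ?E" by (auto simp: Int_stable_def box_Int_box)
  show "?E \<subseteq> Pow UNIV" "sets P = sigma_sets UNIV ?E" "sets Q = sigma_sets UNIV ?E"
   by (simp_all add: borel_eq_box P_def Q_def)
  show "range ?A \<subseteq> ?E" "(\<Union>i. ?A i) = UNIV" unfolding UN_box_eq_UNIV by auto
  show "emeasure P (?A i) ~= \<infinity>" for i using P[of "?A i"] by simp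
  show "emeasure P X = emeasure Q X" if X: "X \<in> ?E" for X
  proof -
   obtain a b where ab: "X = box a b" using X by auto
   then have "X \<in> sets borel" by simp
   then show ?thesis using P[of X] Q[of X] diff[of X] box[of a b] by (simp add: ab)
  qed
 qed
 have "(LINT x|lborel. ind X x * g x) = 0" if X: "X \<in> sets borel" for X
 proof -
  have "ennreal (LINT x|lborel. ind X x * max 0 (g x))
    = ennreal (LINT x|lborel. ind X x * max 0 (- g x))"
   using P[OF X] Q[OF X] \<open>P = Q\<close> by simp
  then have "(LINT x|lborel. ind X x * max 0 (g x)) = (LINT x|lborel. ind X x * max 0 (- g x))"
   by (subst (asm) ennreal_inj) (auto intro!: integral_nonneg_AE)
  then show ?thesis using diff[OF X] by simp
 qed
 then show ?thesis
  using g by (intro density_unique_real[of lborel g "%x. 0"]) (auto simp: set_lebesgue_integral_def)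
qed

text \<open>Tested with the smooth approximations of the indicator functions of boxes. Since \<open>v\<close> is only locally
  integrable, this is done inside each closed box contained in \<open>U\<close>, and countably many of these cover
  \<open>U\<close>.\<close>

lemma fundamental_lemma:
 fixes v :: "'n::finite rfun"
 assumes U: "open U"
  and int: "!!K. compact K ==> K \<subseteq> U ==> integrable lebesgue (%x. ind K x * v x)"
  and zero: "!!\<phi>. \<phi> \<in> test_functions U ==> (LINT x|lebesgue. v x * \<phi> x) = 0"
 shows "AE x in lebesgue. x \<in> U --> v x = 0"
proof -
 have local: "AE x in lebesgue. x \<in> cbox a b --> v x = 0" if ab: "cbox a b \<subseteq> U" for a b :: "real^'n"
 proof -
  define w where "w x = ind (cbox a b) x * v x" for x
  have w: "integrable lebesgue w" unfolding w_def by (intro int ab compact_cbox)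
  obtain g where g: "g \<in> borel_measurable lborel" "AE x in lborel. w x = g x"
   using completion_ex_borel_measurable_real[of w lborel] w by auto
  have g': "g \<in> borel_measurable borel" using g by simp
  have wg: "AE x in lebesgue. w x = g x" using g(2) by (rule AE_completion)
  have gi: "integrable lebesgue g"
   using w wg measurable_completion[OF g(1)]
   by (subst integrable_cong_AE[of g _ w]) (auto elim: eventually_mono)
  have gl: "integrable lborel g" using gi integrable_completion[OF g(1)] by simp
  have "(LINT x|lborel. ind (box c d) x * g x) = 0" for c d
  proof -
   obtain a' b' where ab': "box a b \<inter> box c d = box a' b'" by (auto simp: box_Int_box)
   obtain \<psi> where \<psi>: "!!n::nat. C_infinity (\<psi> n)" "!!n x. \<bar>\<psi> n x\<bar> <= 1" "!!n x. x \<notin> box a' b' ==> \<psi> n x = 0"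
    "!!x. (%n. \<psi> n x) \<longlonglongrightarrow> ind (box a' b') x"
    using box_smooth_approx[of a' b'] by metis
   have sub: "box a' b' \<subseteq> cbox a b" using ab' box_subset_cbox[of a b] by blast
   have test: "\<psi> n \<in> test_functions U" for n
    by (rule test_functionsI[OF \<psi>(1) compact_cbox ab]) (use \<psi>(3) sub in auto)
   have pm: "\<psi> n \<in> borel_measurable lebesgue" for n
    using measurable_completion[of "\<psi> n" lborel borel] C_infinity_borel[OF \<psi>(1)] by simp
   have wm: "w \<in> borel_measurable lebesgue" using w by auto
   have z: "(LINT x|lebesgue. \<psi> n x * w x) = 0" for n
   proof -
    have eq: "\<psi> n x * w x = v x * \<psi> n x" for x
     using \<psi>(3)[of x n] sub by (cases "x \<in> box a' b'") (auto simp: w_def indicator_def)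
    show ?thesis unfolding eq by (rule zero[OF test])
   qed
   have "(%n. LINT x|lebesgue. \<psi> n x * w x) \<longlonglongrightarrow> (LINT x|lebesgue. ind (box a' b') x * w x)"
   proof (rule integral_dominated_convergence[where w="%x. \<bar>w x\<bar>"])
    show "(%x. ind (box a' b') x * w x) \<in> borel_measurable lebesgue"
     by (intro borel_measurable_times borel_measurable_indicator wm) simp
    show "(%x. \<psi> n x * w x) \<in> borel_measurable lebesgue" for n
     by (intro borel_measurable_times pm wm)
    show "AE x in lebesgue. (%n. \<psi> n x * w x) \<longlonglongrightarrow> ind (box a' b') x * w x"
     by (intro AE_I2 tendsto_mult_right \<psi>)
    show "AE x in lebesgue. norm (\<psi> n x * w x) <= \<bar>w x\<bar>" for n
     using \<psi>(2) by (auto simp: abs_mult intro!: mult_left_le_one_le)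
   qed (use w in simp)
   then have 0: "(LINT x|lebesgue. ind (box a' b') x * w x) = 0"
    by (simp add: z LIMSEQ_const_iff)
   have "(LINT x|lborel. ind (box c d) x * g x) = (LINT x|lebesgue. ind (box c d) x * g x)"
    using g' by (intro integral_completion[symmetric]) auto
   also have "\<dots> = (LINT x|lebesgue. ind (box a' b') x * w x)"
   proof (rule integral_cong_AE)
    have "AE x in lborel. x \<notin> cbox a b - box a b"
     using null_sets_cbox_Diff_box by (rule AE_not_in)
    then have "AE x in lebesgue. x \<notin> cbox a b - box a b" by (rule AE_completion)
    with wg show "AE x in lebesgue. ind (box c d) x * g x = ind (box a' b') x * w x"
    proof eventually_elim
     fix x assume x: "w x = g x" "x \<notin> cbox a b - box a b"
     show "ind (box c d) x * g x = ind (box a' b') x * w x"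
      using x ab' sub by (cases "x \<in> box a b") (auto simp: w_def indicator_def)
    qed
   next
    show "(%x. ind (box c d) x * g x) \<in> borel_measurable lebesgue"
     using g' by (intro borel_measurable_times borel_measurable_indicator) (auto intro: measurable_completion)
    show "(%x. ind (box a' b') x * w x) \<in> borel_measurable lebesgue"
     by (intro borel_measurable_times borel_measurable_indicator wm) simp
   qed
   finally show ?thesis using 0 by simp
  qed
  from AE_eq_0_if_box_integrals_eq_0[OF gl this] have "AE x in lebesgue. g x = 0" by (rule AE_completion)
  with wg show ?thesis by eventually_elim (auto simp: w_def indicator_def)
 qed
 obtain D where D: "countable D" "D \<subseteq> Pow U" "!!X. X \<in> D ==> \<exists>a b. X = cbox a b" "\<Union>D = U"
  using open_countable_Union_open_cbox[OF U] by blast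
 have "AE x in lebesgue. x \<in> X --> v x = 0" if X: "X \<in> D" for X
 proof -
  obtain a b where ab: "X = cbox a b" using D(3)[OF X] by blast
  have "X \<subseteq> U" using D(2) X by blast
  then show ?thesis using local[of a b] unfolding ab by simp
 qed
 then have "AE x in lebesgue. \<forall>X\<in>D. x \<in> X --> v x = 0"
  by (subst AE_ball_countable[OF D(1)]) blast
 then show ?thesis by eventually_elim (use D(4) in blast)
qed

lemma fundamental_lemma_L2b:
 fixes g :: "'n::finite rfun"
 assumes "open U" "L2b g" and zero: "!!\<phi>. \<phi> \<in> test_functions U ==> ip g \<phi> = 0"
 shows "AE x in lborel. x \<in> U --> g x = 0"
proof -
 have gm: "g \<in> borel_measurable borel" using assms by (simp add: L2b_def)
 have "AE x in lebesgue. x \<in> U --> g x = 0"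
 proof (rule fundamental_lemma[OF \<open>open U\<close>])
  fix K :: "(real^'n) set" assume "compact K"
  then obtain R where "!!x. x \<in> K ==> norm x <= R"
   using compact_imp_bounded[of K] by (auto simp: bounded_pos)
  then have R: "K \<subseteq> cball 0 R" by auto
  have K: "K \<in> sets borel" using \<open>compact K\<close> by (intro borel_closed compact_imp_closed)
  have "(%x. ind K x * (ind (cball 0 R) x * g x)) = (%x. ind K x * g x)"
   using R by (auto simp: indicator_def fun_eq_iff)
  moreover have "integrable lborel (%x. ind (cball 0 R) x * g x)"
   by (rule L2b_integrable_mult[OF L2b_indicator_cball assms(2)])
  then have "integrable lborel (%x. ind K x * (ind (cball 0 R) x * g x))"
   using K integrable_mult_indicator[of K lborel "%x. ind (cball 0 R) x * g x"] by simp
  ultimately have "integrable lborel (%x. ind K x * g x)" by simp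
  then show "integrable lebesgue (%x. ind K x * g x)"
   by (subst integrable_completion) auto
 next
  fix \<phi> :: "'n rfun" assume \<phi>: "\<phi> \<in> test_functions U"
  have "(LINT x|lebesgue. g x * \<phi> x) = (LINT x|lborel. g x * \<phi> x)"
   using gm test_borel[OF \<phi>] by (intro integral_completion) auto
  then show "(LINT x|lebesgue. g x * \<phi> x) = 0" using zero[OF \<phi>] by (simp add: ip_def)
 qed
 moreover note [measurable] = gm borel_open[OF \<open>open U\<close>]
 have "{x \<in> space borel. x \<in> U --> g x = 0} \<in> sets borel" by measurable
 ultimately show ?thesis by (subst (asm) AE_completion_iff) auto
qed

text \<open>The function that represents \<open>\<phi> \<mapsto> \<langle>g, \<phi>\<rangle>\<close> is a limit of test functions, and it is \<open>g\<close> by the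
  fundamental lemma.\<close>

lemma test_functions_dense:
 fixes g :: "'n::finite rfun"
 assumes g: "L2b g" and e: "e > 0"
 obtains \<psi> where "\<psi> \<in> test_functions UNIV" "nrm (%x. \<psi> x - g x) < e"
proof -
 have "\<exists>v f. L2b v \<and> nrm v <= nrm g \<and> (\<forall>\<phi>\<in>test_functions UNIV. ip v \<phi> = ip g \<phi>) \<and>
  (\<forall>n::nat. f n \<in> test_functions UNIV) \<and> (%n. nrm (%x. f n x - v x)) \<longlonglongrightarrow> 0"
 proof (rule Riesz_representation)
  fix \<phi> \<psi> :: "'n rfun" and t :: real
  assume \<phi>: "\<phi> \<in> test_functions UNIV"
  then show "L2b \<phi>" by (rule test_L2b)
  show "\<bar>ip g \<phi>\<bar> <= nrm g * nrm \<phi>" by (intro ip_Cauchy_Schwarz g test_L2b[OF \<phi>])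
  assume \<psi>: "\<psi> \<in> test_functions UNIV"
  show "(%x. \<phi> x + t * \<psi> x) \<in> test_functions UNIV" by (intro test_add test_cmult \<phi> \<psi>)
  show "ip g (%x. \<phi> x + t * \<psi> x) = ip g \<phi> + t * ip g \<psi>"
   by (subst ip_add_right[OF test_L2b[OF \<phi>] L2b_cmult[OF test_L2b[OF \<psi>]] g]) (simp add: ip_cmult_right)
 qed (simp_all add: test_zero)
 then obtain v f where v: "L2b v" "!!\<phi>. \<phi> \<in> test_functions UNIV ==> ip v \<phi> = ip g \<phi>"
  "!!n::nat. f n \<in> test_functions UNIV" "(%n. nrm (%x. f n x - v x)) \<longlonglongrightarrow> 0" by auto
 have "AE x in lborel. v x - g x = 0"
 proof -
  have "AE x in lborel. x \<in> UNIV --> v x - g x = 0"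
  proof (rule fundamental_lemma_L2b[OF open_UNIV L2b_diff[OF v(1) g]])
   fix \<phi> :: "'n rfun" assume "\<phi> \<in> test_functions UNIV"
   then show "ip (%x. v x - g x) \<phi> = 0" using ip_diff_left[OF v(1) g test_L2b] v(2) by simp
  qed
  then show ?thesis by simp
 qed
 then have ae: "AE x in lborel. f n x - v x = f n x - g x" for n by eventually_elim simp
 have "nrm (%x. f n x - v x) = nrm (%x. f n x - g x)" for n
 proof (rule nrm_cong_AE[OF _ _ ae])
  show "(%x. f n x - v x) \<in> borel_measurable borel" "(%x. f n x - g x) \<in> borel_measurable borel"
   using L2b_diff[OF test_L2b[OF v(3)] v(1)] L2b_diff[OF test_L2b[OF v(3)] g] by (simp_all add: L2b_def)
 qed
 then have "(%n. nrm (%x. f n x - g x)) \<longlonglongrightarrow> 0" using v(4) by simp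
 then have "\<forall>\<^sub>F n in sequentially. nrm (%x. f n x - g x) < e" using e by (rule order_tendstoD(2))
 then obtain n where "nrm (%x. f n x - g x) < e" by (auto simp: eventually_sequentially)
 then show ?thesis using that v(3) by blast
qed

section \<open>Convolution with test functions\<close>

definition conv :: "('n::finite rfun) => 'n rfun => 'n rfun" where
 "conv g \<rho> x = ip g (%y. \<rho> (x - y))"

lemma test_reflect_UNIV:
 "\<rho> \<in> test_functions UNIV ==> (%y. \<rho> (x - y)) \<in> test_functions UNIV" for x :: "real^'n::finite"
 by (rule test_reflect) auto

lemma conv_has_derivative:
 fixes g :: "'n::finite rfun"
 assumes g: "L2b g" and \<rho>: "\<rho> \<in> test_functions UNIV"
 shows "(conv g \<rho> has_derivative (%h. \<Sum>i\<in>UNIV. h $ i * conv g (partial i \<rho>) x)) (at x)"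
proof -
 obtain C where C: "C > 0"
  "!!x h. \<bar>\<rho> (x + h) - \<rho> x - (\<Sum>i\<in>UNIV. h $ i * partial i \<rho> x)\<bar> <= C * (norm h)\<^sup>2"
  using test_Taylor2[OF \<rho>] by blast
 obtain R where R: "R > 0" "!!x. norm x > R ==> \<rho> x = 0" using test_support[OF \<rho>] by blast
 have R': "partial i \<rho> z = 0" if "norm z > R" for i z
  by (rule partial_eq_0[of "{z. norm z > R}"])
   (use that R in \<open>auto intro!: open_Collect_less continuous_intros\<close>)
 define K where "K = nrm g * (C * nrm (ind (cball x (R + 1)) :: 'n rfun))"
 have Lr: "L2b (%y. \<rho> (z - y))" "L2b (%y. partial i \<rho> (z - y))" for i z
  by (auto intro!: test_L2b test_reflect_UNIV \<rho> test_partial)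
 have bound: "\<bar>conv g \<rho> (x + h) - conv g \<rho> x - (\<Sum>i\<in>UNIV. h $ i * conv g (partial i \<rho>) x)\<bar> <= K * (norm h)\<^sup>2"
  if h: "norm h < 1" for h
 proof -
  define r where "r y = \<rho> (x + h - y) - \<rho> (x - y) - (\<Sum>i\<in>UNIV. h $ i * partial i \<rho> (x - y))" for y
  have rb: "\<bar>r y\<bar> <= C * (norm h)\<^sup>2" for y
   using C(2)[of "x - y" h] by (simp add: r_def algebra_simps)
  have rz: "r y = 0" if "y \<notin> cball x (R + 1)" for y
  proof -
   have n: "norm (x - y) > R + 1" using that by (simp add: dist_norm)
   have "norm (x + h - y) >= norm (x - y) - norm h"
    using norm_diff_ineq[of "x - y" h] by (simp add: algebra_simps)
   then have "norm (x + h - y) > R" using n h by linarith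
   moreover have "norm (x - y) > R" using n by linarith
   ultimately show ?thesis by (simp add: r_def R(2) R')
  qed
  have Lr': "L2b (%y. \<Sum>i\<in>UNIV. h $ i * partial i \<rho> (x - y))"
   by (intro L2b_sum L2b_cmult Lr) auto
  have rL: "L2b r" unfolding r_def by (intro L2b_diff Lr Lr')
  then have "r \<in> borel_measurable borel" by (simp add: L2b_def)
  from L2b_bounded_support(2)[OF this rb rz]
  have rn: "nrm r <= C * (norm h)\<^sup>2 * nrm (ind (cball x (R + 1)) :: 'n rfun)" by simp
  have "ip g r = conv g \<rho> (x + h) - conv g \<rho> x - (\<Sum>i\<in>UNIV. h $ i * conv g (partial i \<rho>) x)"
   unfolding r_def conv_def
   by (simp add: ip_diff_right[OF L2b_diff[OF Lr(1) Lr(1)] Lr' g] ip_diff_right[OF Lr(1) Lr(1) g]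
     ip_sum_right[OF _ L2b_cmult[OF Lr(2)] g] ip_cmult_right)
  then have "\<bar>conv g \<rho> (x + h) - conv g \<rho> x - (\<Sum>i\<in>UNIV. h $ i * conv g (partial i \<rho>) x)\<bar> <= nrm g * nrm r"
   using ip_Cauchy_Schwarz[OF g rL] by simp
  also have "\<dots> <= nrm g * (C * (norm h)\<^sup>2 * nrm (ind (cball x (R + 1)) :: 'n rfun))"
   by (intro mult_left_mono rn) simp
  finally show ?thesis by (simp add: K_def mult_ac)
 qed
 show ?thesis
 proof (rule has_derivativeI_sandwich[where e=1 and H="%y. K * norm (y - x)"])
  show "bounded_linear (%h. \<Sum>i\<in>UNIV. h $ i * conv g (partial i \<rho>) x)"
   by (intro bounded_linear_sum bounded_linear_mult_const bounded_linear_vec_nth)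
  have "((%y. K * norm (y - x)) \<longlongrightarrow> K * norm (x - x)) (at x)" by (intro tendsto_intros)
  then show "((%y. K * norm (y - x)) \<longlongrightarrow> 0) (at x)" by simp
  fix y assume "y ~= x" "dist y x < 1"
  then show "norm (conv g \<rho> y - conv g \<rho> x - (\<Sum>i\<in>UNIV. (y - x) $ i * conv g (partial i \<rho>) x)) / norm (y - x)
    <= K * norm (y - x)"
   using bound[of "y - x"] by (simp add: dist_norm divide_le_eq power2_eq_square mult.assoc)
 qed simp
qed

lemma partial_conv:
 fixes g :: "'n::finite rfun"
 assumes "L2b g" "\<rho> \<in> test_functions UNIV"
 shows "partial i (conv g \<rho>) = conv g (partial i \<rho>)"
proof
 fix x
 have "partial i (conv g \<rho>) x = (\<Sum>j\<in>UNIV. axis i 1 $ j * conv g (partial j \<rho>) x)"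
  by (rule partial_eqI[OF conv_has_derivative[OF assms]])
 also have "\<dots> = (\<Sum>j\<in>UNIV. if j = i then conv g (partial j \<rho>) x else 0)"
  by (intro sum.cong) (auto simp: axis_def)
 finally show "partial i (conv g \<rho>) x = conv g (partial i \<rho>) x" by simp
qed

lemma C_infinity_conv:
 fixes g :: "'n::finite rfun"
 assumes "L2b g" "\<rho> \<in> test_functions UNIV"
 shows "C_infinity (conv g \<rho>)"
proof -
 have d: "conv g \<rho> differentiable at x" if "\<rho> \<in> test_functions UNIV" for \<rho> x
  using conv_has_derivative[OF assms(1) that] by (auto simp: differentiable_def)
 have "\<rho> \<in> test_functions UNIV ==> C_k k (conv g \<rho>)" for k \<rho>
 proof (induction k arbitrary: \<rho>)
  case 0
  then show ?case
   using d by (auto simp: continuous_on_eq_continuous_at intro: differentiable_imp_continuous_within)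
 next
  case (Suc k)
  then show ?case using d by (simp add: partial_conv[OF assms(1)] test_partial)
 qed
 with assms(2) show ?thesis by (simp add: C_infinity_def)
qed

lemma mi_partial_conv:
 fixes g :: "'n::{finite,wellorder} rfun"
 assumes "L2b g" "\<rho> \<in> test_functions UNIV"
 shows "mi_partial \<alpha> (conv g \<rho>) = conv g (mi_partial \<alpha> \<rho>)"
proof (induction \<alpha> rule: mi_induct)
 case (inc \<beta> i)
 then show ?case
  by (simp add: mi_partial_inc C_infinity_conv[OF assms] test_smooth[OF assms(2)]
    partial_conv[OF assms(1) test_mi_partial[OF assms(2)]])
qed simp

lemma conv_eq_0: "(!!y. \<rho> (x - y) ~= 0 ==> g y = 0) ==> conv g \<rho> x = 0"
proof -
 assume "!!y. \<rho> (x - y) ~= 0 ==> g y = 0"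
 then have eq: "g y * \<rho> (x - y) = 0" for y by (cases "\<rho> (x - y) = 0") auto
 show ?thesis unfolding conv_def ip_def eq by simp
qed

text \<open>Jensen's inequality: the variance of \<open>g\<close> under the probability density
  \<open>y \<mapsto> \<rho> (x - y)\<close> is nonnegative, and \<open>conv g \<rho> x\<close> is its mean.\<close>

lemma conv_sq_le:
 fixes g :: "'n::finite rfun"
 assumes g: "L2b g" and \<rho>: "\<rho> \<in> test_functions UNIV" "!!z. \<rho> z >= 0" "(LINT z|lborel. \<rho> z) = 1"
 shows "integrable lborel (%y. (g y)\<^sup>2 * \<rho> (x - y))"
  "(conv g \<rho> x)\<^sup>2 <= (LINT y|lborel. (g y)\<^sup>2 * \<rho> (x - y))"
proof -
 obtain B where B: "!!z. \<bar>\<rho> z\<bar> <= B" using test_bounded[OF \<rho>(1)] by metis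
 have \<rho>x: "(%y. \<rho> (x - y)) \<in> test_functions UNIV" by (rule test_reflect_UNIV[OF \<rho>(1)])
 have [measurable]: "g \<in> borel_measurable borel" "(%y. \<rho> (x - y)) \<in> borel_measurable borel"
  using g test_borel[OF \<rho>x] by (auto simp: L2b_def)
 show int: "integrable lborel (%y. (g y)\<^sup>2 * \<rho> (x - y))"
 proof (rule Bochner_Integration.integrable_bound)
  show "integrable lborel (%y. B * (g y)\<^sup>2)" using g by (simp add: L2b_def)
  show "(%y. (g y)\<^sup>2 * \<rho> (x - y)) \<in> borel_measurable lborel" by measurable
  show "AE y in lborel. norm ((g y)\<^sup>2 * \<rho> (x - y)) <= norm (B * (g y)\<^sup>2)"
  proof (rule AE_I2)
   fix y
   have "\<bar>\<rho> (x - y)\<bar> * (g y)\<^sup>2 <= \<bar>B\<bar> * (g y)\<^sup>2"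
    using B[of "x - y"] by (intro mult_right_mono) auto
   then show "norm ((g y)\<^sup>2 * \<rho> (x - y)) <= norm (B * (g y)\<^sup>2)" by (simp add: abs_mult mult.commute)
  qed
 qed
 have i1: "integrable lborel (%y. g y * \<rho> (x - y))" by (rule L2b_integrable_mult[OF g test_L2b[OF \<rho>x]])
 have i2: "integrable lborel (%y. \<rho> (x - y))" by (rule test_integrable[OF \<rho>x])
 have one: "(LINT y|lborel. \<rho> (x - y)) = 1"
  using lborel_reflect_eq[OF test_borel[OF \<rho>(1)]] \<rho>(3) by simp
 define c where "c = conv g \<rho> x"
 have c: "c = (LINT y|lborel. g y * \<rho> (x - y))" by (simp add: c_def conv_def ip_def)
 have "0 <= (LINT y|lborel. (g y - c)\<^sup>2 * \<rho> (x - y))"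
  by (intro integral_nonneg_AE AE_I2 mult_nonneg_nonneg \<rho>) auto
 also have "\<dots> = (LINT y|lborel. (g y)\<^sup>2 * \<rho> (x - y) - (2 * c) * (g y * \<rho> (x - y)) + c\<^sup>2 * \<rho> (x - y))"
  by (intro Bochner_Integration.integral_cong) (auto simp: power2_eq_square algebra_simps)
 also have "\<dots> = (LINT y|lborel. (g y)\<^sup>2 * \<rho> (x - y)) - 2 * c * c + c\<^sup>2"
  using int i1 i2 by (simp add: one c[symmetric])
 finally show "(conv g \<rho> x)\<^sup>2 <= (LINT y|lborel. (g y)\<^sup>2 * \<rho> (x - y))"
  by (simp add: c_def power2_eq_square)
qed

text \<open>\<open>conv_sq_le\<close> integrated over \<open>x\<close>, with the order of integration exchanged.\<close>

lemma conv_contraction: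
 fixes g :: "'n::finite rfun"
 assumes g: "L2b g" and \<rho>: "\<rho> \<in> test_functions UNIV" "!!z. \<rho> z >= 0" "(LINT z|lborel. \<rho> z) = 1"
 shows "L2b (conv g \<rho>)" "nrm (conv g \<rho>) <= nrm g"
proof -
 have [measurable]: "g \<in> borel_measurable borel" "\<rho> \<in> borel_measurable borel" "conv g \<rho> \<in> borel_measurable borel"
  using g test_borel[OF \<rho>(1)] C_infinity_borel[OF C_infinity_conv[OF g \<rho>(1)]] by (auto simp: L2b_def)
 have g2: "(\<integral>\<^sup>+y. ennreal ((g y)\<^sup>2) \<partial>lborel) = ennreal ((nrm g)\<^sup>2)"
  using g unfolding nrm_sq by (intro nn_integral_eq_integral) (auto simp: L2b_def)
 have \<rho>1: "(\<integral>\<^sup>+x. ennreal (\<rho> (x - y)) \<partial>lborel) = 1" for y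
 proof -
  have "(%x. \<rho> (x + - y)) \<in> test_functions UNIV" by (rule test_shift[OF \<rho>(1)]) auto
  then have "integrable lborel (%x. \<rho> (x + - y))" by (rule test_integrable)
  then have "(\<integral>\<^sup>+x. ennreal (\<rho> (x + - y)) \<partial>lborel) = ennreal (LINT x|lborel. \<rho> (x + - y))"
   using \<rho>(2) by (intro nn_integral_eq_integral) auto
  also have "(LINT x|lborel. \<rho> (x + - y)) = 1"
   using lborel_shift_eq[of \<rho> "- y"] \<rho>(3) by simp
  finally show ?thesis by simp
 qed
 have "(\<integral>\<^sup>+x. ennreal ((conv g \<rho> x)\<^sup>2) \<partial>lborel)
   <= (\<integral>\<^sup>+x. (\<integral>\<^sup>+y. ennreal ((g y)\<^sup>2 * \<rho> (x - y)) \<partial>lborel) \<partial>lborel)"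
 proof (rule nn_integral_mono)
  fix x
  have "(\<integral>\<^sup>+y. ennreal ((g y)\<^sup>2 * \<rho> (x - y)) \<partial>lborel) = ennreal (LINT y|lborel. (g y)\<^sup>2 * \<rho> (x - y))"
   by (rule nn_integral_eq_integral[OF conv_sq_le(1)[OF assms]]) (simp add: \<rho>(2))
  then show "ennreal ((conv g \<rho> x)\<^sup>2) <= (\<integral>\<^sup>+y. ennreal ((g y)\<^sup>2 * \<rho> (x - y)) \<partial>lborel)"
   using conv_sq_le(2)[OF assms, of x] by (simp add: ennreal_leI)
 qed
 also have "\<dots> = (\<integral>\<^sup>+y. (\<integral>\<^sup>+x. ennreal ((g y)\<^sup>2 * \<rho> (x - y)) \<partial>lborel) \<partial>lborel)"
  by (rule lborel_pair.Fubini'[symmetric]) measurable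
 also have "\<dots> = (\<integral>\<^sup>+y. ennreal ((g y)\<^sup>2) \<partial>lborel)"
 proof (rule nn_integral_cong)
  fix y
  have "(\<integral>\<^sup>+x. ennreal ((g y)\<^sup>2 * \<rho> (x - y)) \<partial>lborel) = (\<integral>\<^sup>+x. ennreal ((g y)\<^sup>2) * ennreal (\<rho> (x - y)) \<partial>lborel)"
   by (intro nn_integral_cong ennreal_mult) (auto simp: \<rho>)
  also have "\<dots> = ennreal ((g y)\<^sup>2)" by (subst nn_integral_cmult) (auto simp: \<rho>1)
  finally show "(\<integral>\<^sup>+x. ennreal ((g y)\<^sup>2 * \<rho> (x - y)) \<partial>lborel) = ennreal ((g y)\<^sup>2)" .
 qed
 finally have le: "(\<integral>\<^sup>+x. ennreal ((conv g \<rho> x)\<^sup>2) \<partial>lborel) <= ennreal ((nrm g)\<^sup>2)" by (simp only: g2)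
 have "integrable lborel (%x. (conv g \<rho> x)\<^sup>2)"
 proof (rule integrableI_nonneg)
  show "(\<integral>\<^sup>+x. ennreal ((conv g \<rho> x)\<^sup>2) \<partial>lborel) < \<infinity>" using le by (rule order.strict_trans1) simp
 qed auto
 then show L: "L2b (conv g \<rho>)" by (simp add: L2b_def)
 have "ennreal ((nrm (conv g \<rho>))\<^sup>2) = (\<integral>\<^sup>+x. ennreal ((conv g \<rho> x)\<^sup>2) \<partial>lborel)"
  using L unfolding nrm_sq by (intro nn_integral_eq_integral[symmetric]) (auto simp: L2b_def)
 with le have "ennreal ((nrm (conv g \<rho>))\<^sup>2) <= ennreal ((nrm g)\<^sup>2)" by (simp only:)
 then have "(nrm (conv g \<rho>))\<^sup>2 <= (nrm g)\<^sup>2" by (subst (asm) ennreal_le_iff) auto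
 then show "nrm (conv g \<rho>) <= nrm g" by (rule power2_le_imp_le) simp
qed

definition mollifier :: "('n::finite rfun) => bool" where
 "mollifier \<rho> \<longleftrightarrow> \<rho> \<in> test_functions UNIV \<and> (\<forall>z. \<rho> z >= 0) \<and> (LINT z|lborel. \<rho> z) = 1"

lemma mollifier_exists:
 fixes p :: "real^'n::finite"
 assumes r: "r > 0"
 obtains \<rho> where "mollifier \<rho>" "!!z. \<rho> z ~= 0 ==> norm (z - p) < r"
proof -
 define \<beta> where "\<beta> z = theta (r\<^sup>2 - (norm (z - p))\<^sup>2)" for z
 have C: "C_infinity \<beta>" unfolding \<beta>_def
  by (intro C_infinity_theta C_infinity_diff C_infinity_const C_infinity_norm2)
 have nz: "norm (z - p) < r \<longleftrightarrow> \<beta> z ~= 0" for z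
  using r power2_less_imp_less[of "norm (z - p)" r] power_strict_mono[of "norm (z - p)" r 2] by (auto simp add: \<beta>_def theta_eq_0_iff not_le)
 have test: "\<beta> \<in> test_functions UNIV"
 proof (rule test_functionsI[OF C compact_cball])
  show "\<beta> x = 0" if "x \<notin> cball p r" for x
   using that nz[of x] by (auto simp: dist_norm norm_minus_commute)
 qed simp
 have nonneg: "\<beta> z >= 0" for z by (simp add: \<beta>_def theta_nonneg)
 have pos: "(LINT z|lborel. \<beta> z) > 0"
 proof (rule ccontr)
  assume "\<not> ?thesis"
  moreover have "(LINT z|lborel. \<beta> z) >= 0" by (intro integral_nonneg_AE AE_I2 nonneg)
  ultimately have "(LINT z|lborel. \<beta> z) = 0" by simp
  then have "AE z in lborel. \<beta> z = 0"
   using integral_nonneg_eq_0_iff_AE[OF test_integrable[OF test]] nonneg by simp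
  then have "AE z in lborel. z \<notin> ball p r"
   by eventually_elim (use nz in \<open>auto simp: dist_norm norm_minus_commute\<close>)
  then have "ball p r \<in> null_sets lborel" by (subst AE_iff_null_sets) auto
  then have "emeasure lborel (ball p r) = 0" by (simp add: null_sets_def)
  moreover have "measure lborel (ball p r) > 0" using r by (rule content_ball_pos)
  ultimately show False by (simp add: measure_def)
 qed
 show ?thesis
 proof (rule that[of "%z. (1 / (LINT z|lborel. \<beta> z)) * \<beta> z"])
  show "mollifier (%z. (1 / (LINT z|lborel. \<beta> z)) * \<beta> z)"
   unfolding mollifier_def
  proof (intro conjI allI)
   show "(%z. (1 / (LINT z|lborel. \<beta> z)) * \<beta> z) \<in> test_functions UNIV" by (rule test_cmult[OF test])
   show "(1 / (LINT z|lborel. \<beta> z)) * \<beta> z >= 0" for z using pos nonneg by simp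
   show "(LINT z|lborel. (1 / (LINT z|lborel. \<beta> z)) * \<beta> z) = 1" using pos by simp
  qed
  show "norm (z - p) < r" if "(1 / (LINT z|lborel. \<beta> z)) * \<beta> z ~= 0" for z
   using that nz[of z] by simp
 qed
qed

lemma mollifier_test: "mollifier \<rho> ==> \<rho> \<in> test_functions UNIV"
 by (simp add: mollifier_def)

lemma L2b_conv: "L2b g ==> mollifier \<rho> ==> L2b (conv g \<rho>)"
 and nrm_conv: "L2b g ==> mollifier \<rho> ==> nrm (conv g \<rho>) <= nrm g"
 using conv_contraction[of g \<rho>] by (auto simp: mollifier_def)

lemma conv_diff:
 assumes "L2b g" "L2b g'" "\<rho> \<in> test_functions UNIV"
 shows "conv g \<rho> x - conv g' \<rho> x = conv (%y. g y - g' y) \<rho> x"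
 unfolding conv_def
 by (rule ip_diff_left[OF assms(1,2) test_L2b[OF test_reflect_UNIV[OF assms(3)]], symmetric])

text \<open>A test function is Lipschitz continuous and has bounded support, so the convolutions converge uniformly on a fixed
  ball and vanish outside of it.\<close>

lemma conv_tendsto_test:
 fixes \<psi> :: "'n::finite rfun"
 assumes \<psi>: "\<psi> \<in> test_functions UNIV"
  and \<rho>: "!!n. mollifier (\<rho> n)" "!!n z. \<rho> n z ~= 0 ==> norm z < \<delta> n" and \<delta>: "\<delta> \<longlonglongrightarrow> 0"
 shows "(%n. nrm (%x. conv \<psi> (\<rho> n) x - \<psi> x)) \<longlonglongrightarrow> 0"
proof -
 obtain L where L: "L > 0" "!!x h. \<bar>\<psi> (x + h) - \<psi> x\<bar> <= L * norm h" using test_Lipschitz[OF \<psi>] by blast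
 obtain R where R: "R > 0" "!!x. norm x > R ==> \<psi> x = 0" using test_support[OF \<psi>] by blast
 define K where "K = nrm (ind (cball 0 (R + 1)) :: 'n rfun)"
 have ev: "\<forall>\<^sub>F n in sequentially. \<delta> n < 1" using order_tendstoD(2)[OF \<delta>, of 1] by simp
 show ?thesis
 proof (rule Lim_null_comparison)
  show "(%n. L * \<bar>\<delta> n\<bar> * K) \<longlonglongrightarrow> 0"
   using tendsto_mult_right[OF tendsto_mult_left[OF tendsto_rabs[OF \<delta>], of L], of K] by simp
  show "\<forall>\<^sub>F n in sequentially. norm (nrm (%x. conv \<psi> (\<rho> n) x - \<psi> x)) <= L * \<bar>\<delta> n\<bar> * K"
   using ev
  proof eventually_elim
   fix n assume d: "\<delta> n < 1"
   have t: "\<rho> n \<in> test_functions UNIV" "!!z. \<rho> n z >= 0" "(LINT z|lborel. \<rho> n z) = 1"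
    using \<rho>(1)[of n] by (auto simp: mollifier_def)
   have b: "\<bar>conv \<psi> (\<rho> n) x - \<psi> x\<bar> <= L * \<bar>\<delta> n\<bar>" for x
   proof -
    have t': "(%y. \<rho> n (x - y)) \<in> test_functions UNIV" by (rule test_reflect_UNIV[OF t(1)])
    have one: "(LINT y|lborel. \<rho> n (x - y)) = 1"
     using lborel_reflect_eq[OF test_borel[OF t(1)]] t(3) by simp
    have i1: "integrable lborel (%y. \<psi> y * \<rho> n (x - y))"
     by (rule L2b_integrable_mult[OF test_L2b[OF \<psi>] test_L2b[OF t']])
    have i2: "integrable lborel (%y. \<rho> n (x - y))" by (rule test_integrable[OF t'])
    have "conv \<psi> (\<rho> n) x - \<psi> x = (LINT y|lborel. (\<psi> y - \<psi> x) * \<rho> n (x - y))"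
     using i1 i2 by (simp add: conv_def ip_def left_diff_distrib one)
    also have "\<bar>\<dots>\<bar> <= (LINT y|lborel. L * \<bar>\<delta> n\<bar> * \<rho> n (x - y))"
    proof (rule order_trans[OF integral_abs_bound], rule integral_mono)
     show "integrable lborel (%y. \<bar>(\<psi> y - \<psi> x) * \<rho> n (x - y)\<bar>)"
      using i1 i2 by (auto simp: left_diff_distrib intro!: integrable_abs)
     show "integrable lborel (%y. L * \<bar>\<delta> n\<bar> * \<rho> n (x - y))" using i2 by simp
     fix y
     show "\<bar>(\<psi> y - \<psi> x) * \<rho> n (x - y)\<bar> <= L * \<bar>\<delta> n\<bar> * \<rho> n (x - y)"
     proof (cases "\<rho> n (x - y) = 0")
      case False
      have "\<bar>\<psi> y - \<psi> x\<bar> <= L * norm (y - x)" using L(2)[of x "y - x"] by simp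
      also have "\<dots> <= L * \<bar>\<delta> n\<bar>"
       using \<rho>(2)[OF False] L(1) by (intro mult_left_mono) (auto simp: norm_minus_commute)
      finally show ?thesis using t(2) by (auto simp: abs_mult intro!: mult_right_mono)
     qed simp
    qed
    also have "\<dots> = L * \<bar>\<delta> n\<bar>" using one by simp
    finally show ?thesis .
   qed
   have z: "conv \<psi> (\<rho> n) x - \<psi> x = 0" if "x \<notin> cball 0 (R + 1)" for x
   proof -
    have x: "norm x > R + 1" using that by simp
    have "conv \<psi> (\<rho> n) x = 0"
    proof (rule conv_eq_0)
     fix y assume "\<rho> n (x - y) ~= 0"
     then have "norm (x - y) < 1" using \<rho>(2)[of n "x - y"] d by linarith
     then have "norm y > R" using x norm_triangle_ineq2[of x y] by linarith
     then show "\<psi> y = 0" by (rule R(2))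
    qed
    then show ?thesis using R(2)[of x] x by simp
   qed
   have "L2b (%x. conv \<psi> (\<rho> n) x - \<psi> x)"
    by (rule L2b_diff[OF L2b_conv[OF test_L2b[OF \<psi>] \<rho>(1)] test_L2b[OF \<psi>]])
   then have "(%x. conv \<psi> (\<rho> n) x - \<psi> x) \<in> borel_measurable borel" by (simp add: L2b_def)
   from L2b_bounded_support(2)[where p = 0 and R = "R + 1", OF this b z]
   show "norm (nrm (%x. conv \<psi> (\<rho> n) x - \<psi> x)) <= L * \<bar>\<delta> n\<bar> * K" by (simp add: K_def)
  qed
 qed
qed

text \<open>By density it suffices to consider test functions, since convolution is a contraction.\<close>

lemma conv_tendsto:
 fixes g :: "'n::finite rfun"
 assumes g: "L2b g"
  and \<rho>: "!!n. mollifier (\<rho> n)" "!!n z. \<rho> n z ~= 0 ==> norm z < \<delta> n" and \<delta>: "\<delta> \<longlonglongrightarrow> 0"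
 shows "(%n. nrm (%x. conv g (\<rho> n) x - g x)) \<longlonglongrightarrow> 0"
proof (rule LIMSEQ_I)
 fix e :: real assume e: "e > 0"
 obtain \<psi> where \<psi>: "\<psi> \<in> test_functions UNIV" "nrm (%x. \<psi> x - g x) < e / 3"
  using test_functions_dense[OF g, of "e/3"] e by auto
 have L\<psi>: "L2b \<psi>" by (rule test_L2b[OF \<psi>(1)])
 have "\<forall>\<^sub>F n in sequentially. nrm (%x. conv \<psi> (\<rho> n) x - \<psi> x) < e / 3"
  using order_tendstoD(2)[OF conv_tendsto_test[of \<psi> \<rho> \<delta>, OF \<psi>(1) \<rho> \<delta>], of "e / 3"] e by simp
 then obtain N where N: "!!n. n >= N ==> nrm (%x. conv \<psi> (\<rho> n) x - \<psi> x) < e / 3"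
  by (auto simp: eventually_sequentially)
 have "nrm (%x. conv g (\<rho> n) x - g x) < e" if "n >= N" for n
 proof -
  have t: "\<rho> n \<in> test_functions UNIV" using \<rho>(1) by (rule mollifier_test)
  have "nrm (%x. conv g (\<rho> n) x - conv \<psi> (\<rho> n) x) = nrm (conv (%y. g y - \<psi> y) (\<rho> n))"
   by (simp add: conv_diff[OF g L\<psi> t])
  also have "\<dots> <= nrm (%y. g y - \<psi> y)" by (rule nrm_conv[OF L2b_diff[OF g L\<psi>] \<rho>(1)])
  finally have 1: "nrm (%x. conv g (\<rho> n) x - conv \<psi> (\<rho> n) x) < e / 3"
   using \<psi>(2) nrm_diff_commute[of g \<psi>] by linarith
  have 2: "nrm (%x. conv \<psi> (\<rho> n) x - g x) < 2 * e / 3"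
   using nrm_triangle_diff3[OF L2b_conv[OF L\<psi> \<rho>(1)] L\<psi> g, of n] N[OF that] \<psi>(2) by linarith
  show ?thesis
   using nrm_triangle_diff3[OF L2b_conv[OF g \<rho>(1)] L2b_conv[OF L\<psi> \<rho>(1)] g, of n n] 1 2 by linarith
 qed
 then show "\<exists>no. \<forall>n\<ge>no. norm (nrm (%x. conv g (\<rho> n) x - g x) - 0) < e" by auto
qed

section \<open>Weak derivatives\<close>

text \<open>Only the values on \<open>U\<close> matter: the pairing can be taken over the whole space because test functions are
  extended by zero.\<close>

definition wd :: "(real^'n::{finite,wellorder}) set => 'n multi_index =>
  'n rfun => 'n rfun => bool" where
 "wd U \<alpha> g g' \<longleftrightarrow> (\<forall>\<phi>\<in>test_functions U. ip g (mi_partial \<alpha> \<phi>) = (-1) ^ len \<alpha> * ip g' \<phi>)"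

definition wd1 :: "(real^'n::{finite,wellorder}) set => 'n =>
  'n rfun => 'n rfun => bool" where
 "wd1 U i g g' \<longleftrightarrow> (\<forall>\<phi>\<in>test_functions U. ip g (partial i \<phi>) = - ip g' \<phi>)"

lemma wdD: "wd U \<alpha> g g' ==> \<phi> \<in> test_functions U ==> ip g (mi_partial \<alpha> \<phi>) = (-1) ^ len \<alpha> * ip g' \<phi>"
 by (simp add: wd_def)

lemma wd1D: "wd1 U i g g' ==> \<phi> \<in> test_functions U ==> ip g (partial i \<phi>) = - ip g' \<phi>"
 by (simp add: wd1_def)

lemma wd_zero: "wd U (%_. 0) g g" by (simp add: wd_def)

lemma wd_mono: "wd V \<alpha> g g' ==> U \<subseteq> V ==> wd U \<alpha> g g'"
 by (auto simp: wd_def intro: test_mono)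

lemma wd_inc:
 assumes "wd U \<alpha> g a" "wd1 U i a b" shows "wd U (inc \<alpha> i) g b"
 unfolding wd_def
proof
 fix \<phi> assume \<phi>: "\<phi> \<in> test_functions U"
 have "ip g (mi_partial (inc \<alpha> i) \<phi>) = ip g (mi_partial \<alpha> (partial i \<phi>))"
  by (simp add: mi_partial_inc mi_partial_partial test_smooth[OF \<phi>])
 also have "\<dots> = (-1) ^ len \<alpha> * ip a (partial i \<phi>)" by (rule wdD[OF assms(1) test_partial[OF \<phi>]])
 also have "\<dots> = (-1) ^ len (inc \<alpha> i) * ip b \<phi>" by (simp add: wd1D[OF assms(2) \<phi>])
 finally show "ip g (mi_partial (inc \<alpha> i) \<phi>) = (-1) ^ len (inc \<alpha> i) * ip b \<phi>" .
qed

lemma wd_cancel: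
 assumes "wd U \<alpha> g a" "wd U (%i. \<alpha> i + \<beta> i) g b" shows "wd U \<beta> a b"
 unfolding wd_def
proof
 fix \<phi> assume \<phi>: "\<phi> \<in> test_functions U"
 have "(-1) ^ len \<alpha> * ip a (mi_partial \<beta> \<phi>) = ip g (mi_partial \<alpha> (mi_partial \<beta> \<phi>))"
  by (rule wdD[OF assms(1) test_mi_partial[OF \<phi>], symmetric])
 also have "\<dots> = ip g (mi_partial (%i. \<alpha> i + \<beta> i) \<phi>)" by (simp add: mi_partial_add test_smooth[OF \<phi>])
 also have "\<dots> = (-1) ^ len \<alpha> * ((-1) ^ len \<beta> * ip b \<phi>)"
  by (simp add: wdD[OF assms(2) \<phi>] mi_length_add power_add)
 finally show "ip a (mi_partial \<beta> \<phi>) = (-1) ^ len \<beta> * ip b \<phi>" by simp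
qed

lemma wd1_iff_wd: "wd1 U i g g' \<longleftrightarrow> wd U (inc (%_. 0) i) g g'"
 unfolding wd1_def wd_def by (auto simp: mi_partial_inc test_smooth)

lemma inc_eq_add: "inc \<alpha> i = (%j. \<alpha> j + inc (%_. 0) i j)"
 by (auto simp: inc_def)

lemma wd_inc_cancel: "wd U \<alpha> g a ==> wd U (inc \<alpha> i) g b ==> wd1 U i a b"
 unfolding wd1_iff_wd by (rule wd_cancel) (simp_all add: inc_eq_add[symmetric])

lemma wd_diff:
 assumes "wd U \<alpha> f f'" "wd U \<alpha> g g'" "L2b f" "L2b g" "L2b f'" "L2b g'"
 shows "wd U \<alpha> (%x. f x - g x) (%x. f' x - g' x)"
 unfolding wd_def
proof
 fix \<phi> assume \<phi>: "\<phi> \<in> test_functions U"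
 show "ip (%x. f x - g x) (mi_partial \<alpha> \<phi>) = (-1) ^ len \<alpha> * ip (%x. f' x - g' x) \<phi>"
  by (simp add: ip_diff_left[OF assms(3,4) test_L2b[OF test_mi_partial[OF \<phi>]]]
    ip_diff_left[OF assms(5,6) test_L2b[OF \<phi>]] wdD[OF assms(1) \<phi>] wdD[OF assms(2) \<phi>] right_diff_distrib)
qed

lemma wd_cmult: "wd U \<alpha> f f' ==> wd U \<alpha> (%x. c * f x) (%x. c * f' x)"
 by (simp add: wd_def ip_cmult_left)

lemma mi_partial_shift:
 fixes f :: "'n::{finite,wellorder} rfun"
 assumes "C_infinity f" shows "mi_partial \<alpha> (%x. f (x + p)) = (%x. mi_partial \<alpha> f (x + p))"
proof (induction \<alpha> rule: mi_induct)
 case (inc \<beta> i)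
 then show ?case
  by (simp add: mi_partial_inc assms C_infinity_shift partial_shift C_infinity_mi_partial)
qed simp

lemma wd_shift:
 assumes w: "wd V \<alpha> g g'" and L: "L2b g" "L2b g'" and UV: "!!x. x \<in> U ==> x + p \<in> V"
 shows "wd U \<alpha> (%x. g (x + p)) (%x. g' (x + p))"
 unfolding wd_def
proof
 fix \<phi> assume \<phi>: "\<phi> \<in> test_functions U"
 have \<phi>': "(%x. \<phi> (x + - p)) \<in> test_functions V" by (rule test_shift[OF \<phi>]) (simp add: UV)
 have "ip (%x. g (x + p)) (mi_partial \<alpha> \<phi>) = ip g (%x. mi_partial \<alpha> \<phi> (x - p))"
  by (rule ip_shift[OF L(1) test_L2b[OF test_mi_partial[OF \<phi>]]])
 also have "\<dots> = ip g (mi_partial \<alpha> (%x. \<phi> (x + - p)))"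
  by (subst mi_partial_shift[OF test_smooth[OF \<phi>]]) simp
 also have "\<dots> = (-1) ^ len \<alpha> * ip g' (%x. \<phi> (x + - p))" by (rule wdD[OF w \<phi>'])
 also have "ip g' (%x. \<phi> (x + - p)) = ip (%x. g' (x + p)) \<phi>"
  using ip_shift[OF L(2) test_L2b[OF \<phi>]] by simp
 finally show "ip (%x. g (x + p)) (mi_partial \<alpha> \<phi>) = (-1) ^ len \<alpha> * ip (%x. g' (x + p)) \<phi>" .
qed

lemma mi_partial_reflect:
 fixes f :: "'n::{finite,wellorder} rfun"
 assumes "C_infinity f"
 shows "mi_partial \<alpha> (%y. f (x - y)) = (%y. (-1) ^ len \<alpha> * mi_partial \<alpha> f (x - y))"
proof (induction \<alpha> rule: mi_induct)
 case (inc \<beta> i)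
 have C: "C_infinity (%y. mi_partial \<beta> f (x - y))"
  by (rule C_infinity_reflect[OF C_infinity_mi_partial[OF assms]])
 have "partial i (%y. (-1) ^ len \<beta> * mi_partial \<beta> f (x - y)) y
   = (-1) ^ len \<beta> * (- partial i (mi_partial \<beta> f) (x - y))" for y
  by (simp add: partial_cmult[OF C_infinity_differentiable[OF C]]
    partial_reflect[OF C_infinity_mi_partial[OF assms]])
 then have "partial i (%y. (-1) ^ len \<beta> * mi_partial \<beta> f (x - y))
   = (%y. (-1) ^ len (inc \<beta> i) * mi_partial (inc \<beta> i) f (x - y))"
  by (simp add: mi_partial_inc[OF assms] fun_eq_iff)
 then show ?case by (simp only: mi_partial_inc[OF C_infinity_reflect[OF assms]] inc)
qed simp

lemma conv_wd:
 fixes g :: "'n::{finite,wellorder} rfun"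
 assumes "wd U \<alpha> g g'" "C_infinity \<rho>" "(%y. \<rho> (x - y)) \<in> test_functions U"
 shows "conv g (mi_partial \<alpha> \<rho>) x = conv g' \<rho> x"
 using wdD[OF assms(1,3)] by (simp add: mi_partial_reflect[OF assms(2)] conv_def ip_cmult_right)

text \<open>A convolution differentiates like \<open>g\<close> at every point for which the translated and reflected kernel is an
  admissible test function. Only the part of \<open>g\<close> seen by the kernel has to be weakly differentiable.\<close>

lemma mi_partial_conv_wd:
 fixes g :: "'n::{finite,wellorder} rfun"
 assumes "L2b g" "\<rho> \<in> test_functions UNIV" "wd U \<alpha> g g'" "(%y. \<rho> (x - y)) \<in> test_functions U"
 shows "mi_partial \<alpha> (conv g \<rho>) x = conv g' \<rho> x"
 using conv_wd[OF assms(3) test_smooth[OF assms(2)] assms(4)] by (simp add: mi_partial_conv[OF assms(1,2)])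

lemma test_reflect_support:
 fixes \<rho> :: "'n::finite rfun"
 assumes "\<rho> \<in> test_functions UNIV" "!!z. \<rho> z ~= 0 ==> z \<in> S" "compact S" "!!z. z \<in> S ==> x - z \<in> U"
 shows "(%y. \<rho> (x - y)) \<in> test_functions U"
proof (rule test_functionsI[OF C_infinity_reflect[OF test_smooth[OF assms(1)]]])
 show "compact ((%z. x - z) ` S)" by (intro compact_continuous_image continuous_intros assms)
 show "(%z. x - z) ` S \<subseteq> U" using assms by auto
 show "\<rho> (x - y) = 0" if "y \<notin> (%z. x - z) ` S" for y
 proof (rule ccontr)
  assume "\<rho> (x - y) ~= 0"
  then have "x - y \<in> S" by (rule assms(2))
  then have "x - (x - y) \<in> (%z. x - z) ` S" by (rule imageI)
  then show False using that by simp
 qed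
qed

text \<open>If \<open>\<phi>\<close> is a test function on the whole space, then \<open>\<zeta> \<phi>\<close> is one on \<open>U\<close>.\<close>

lemma wd1_cutoff:
 fixes g :: "'n::{finite,wellorder} rfun"
 assumes w: "wd1 U i g g'" and L: "L2b g" "L2b g'" and \<zeta>: "\<zeta> \<in> test_functions U"
 shows "wd1 UNIV i (%x. \<zeta> x * g x) (%x. \<zeta> x * g' x + partial i \<zeta> x * g x)"
 unfolding wd1_def
proof
 fix \<phi> :: "'n rfun" assume \<phi>: "\<phi> \<in> test_functions UNIV"
 have t1: "(%x. \<zeta> x * \<phi> x) \<in> test_functions U" by (rule test_mult2[OF \<zeta> test_smooth[OF \<phi>]])
 have t2: "(%x. \<zeta> x * partial i \<phi> x) \<in> test_functions U"
  by (rule test_mult2[OF \<zeta> C_infinity_partial[OF test_smooth[OF \<phi>]]])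
 have t3: "(%x. partial i \<zeta> x * \<phi> x) \<in> test_functions U"
  by (rule test_mult2[OF test_partial[OF \<zeta>] test_smooth[OF \<phi>]])
 have p: "partial i (%x. \<zeta> x * \<phi> x) = (%x. \<zeta> x * partial i \<phi> x + partial i \<zeta> x * \<phi> x)"
  by (rule ext, rule partial_mult) (rule C_infinity_differentiable[OF test_smooth], fact)+
 have "ip g (%x. \<zeta> x * partial i \<phi> x) + ip g (%x. partial i \<zeta> x * \<phi> x) = - ip g' (%x. \<zeta> x * \<phi> x)"
  using wd1D[OF w t1] unfolding p ip_add_right[OF test_L2b[OF t2] test_L2b[OF t3] L(1)] .
 moreover have "ip (%x. \<zeta> x * g x) (partial i \<phi>) = ip g (%x. \<zeta> x * partial i \<phi> x)"
  by (simp add: ip_def mult_ac)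
 moreover have "ip (%x. \<zeta> x * g' x + partial i \<zeta> x * g x) \<phi>
   = ip g' (%x. \<zeta> x * \<phi> x) + ip g (%x. partial i \<zeta> x * \<phi> x)"
 proof -
  have "integrable lborel (%x. g' x * (\<zeta> x * \<phi> x))" "integrable lborel (%x. g x * (partial i \<zeta> x * \<phi> x))"
   by (intro L2b_integrable_mult L test_L2b[OF t1] test_L2b[OF t3])+
  then show ?thesis
   unfolding ip_def by (subst Bochner_Integration.integral_add[symmetric])
    (auto intro!: Bochner_Integration.integral_cong simp: algebra_simps)
 qed
 ultimately show "ip (%x. \<zeta> x * g x) (partial i \<phi>) = - ip (%x. \<zeta> x * g' x + partial i \<zeta> x * g x) \<phi>" by simp
qed

lemma wd1_add:
 assumes "wd1 U i f f'" "wd1 U i g g'" "L2b f" "L2b g" "L2b f'" "L2b g'"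
 shows "wd1 U i (%x. f x + g x) (%x. f' x + g' x)"
 unfolding wd1_def
proof
 fix \<phi> assume \<phi>: "\<phi> \<in> test_functions U"
 show "ip (%x. f x + g x) (partial i \<phi>) = - ip (%x. f' x + g' x) \<phi>"
  by (simp add: ip_add_left[OF assms(3,4) test_L2b[OF test_partial[OF \<phi>]]]
    ip_add_left[OF assms(5,6) test_L2b[OF \<phi>]] wd1D[OF assms(1) \<phi>] wd1D[OF assms(2) \<phi>])
qed

lemma wd1_sum:
 assumes "finite A" "!!a. a \<in> A ==> wd1 U i (f a) (f' a)" "!!a. a \<in> A ==> L2b (f a)" "!!a. a \<in> A ==> L2b (f' a)"
 shows "wd1 U i (%x. \<Sum>a\<in>A. f a x) (%x. \<Sum>a\<in>A. f' a x)"
 using assms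
proof (induction A rule: finite_induct)
 case empty
 then show ?case by (simp add: wd1_def ip_def)
next
 case (insert a A)
 have "wd1 U i (%x. f a x + (\<Sum>a\<in>A. f a x)) (%x. f' a x + (\<Sum>a\<in>A. f' a x))"
  by (rule wd1_add) (use insert in \<open>auto intro!: L2b_sum\<close>)
 then show ?case using insert.hyps by simp
qed

text \<open>A family of functions, indexed by multi-indices, that are the weak derivatives of its member
  of index \<open>0\<close>.\<close>

definition jet :: "nat => (real^'n::{finite,wellorder}) set =>
  ('n multi_index => 'n rfun) => bool" where
 "jet k U D \<longleftrightarrow> (\<forall>\<alpha>. len \<alpha> <= k --> L2b (D \<alpha>) \<and> wd U \<alpha> (D (%_. 0)) (D \<alpha>))"

lemma jet_L2b: "jet k U D ==> len \<alpha> <= k ==> L2b (D \<alpha>)"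
 and jet_wd: "jet k U D ==> len \<alpha> <= k ==> wd U \<alpha> (D (%_. 0)) (D \<alpha>)"
 by (auto simp: jet_def)

lemma jet_wd1: "jet k U D ==> len \<alpha> < k ==> wd1 U i (D \<alpha>) (D (inc \<alpha> i))"
 by (rule wd_inc_cancel[of U \<alpha> "D (%_. 0)"]) (auto intro: jet_wd)

text \<open>Each derivative that falls on a power of \<open>\<zeta>\<close> lowers its exponent by one only. The
  coefficients depend on \<open>\<zeta>\<close>, \<open>K\<close> and \<open>\<alpha>\<close>, and not on the function that is differentiated.\<close>

lemma Leibniz_power:
 fixes \<zeta> :: "'n::{finite,wellorder} rfun"
 assumes \<zeta>: "\<zeta> \<in> test_functions U"
 shows "len \<alpha> <= K ==> \<exists>c. (\<forall>\<gamma>. c \<gamma> \<in> test_functions U) \<and> (\<forall>k D. jet k U D \<and> len \<alpha> <= k -->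
  wd UNIV \<alpha> (%x. \<zeta> x ^ K * D (%_. 0) x)
   (%x. \<zeta> x ^ K * D \<alpha> x + \<zeta> x ^ (K - len \<alpha>) * (\<Sum>\<gamma> | len \<gamma> < len \<alpha>. c \<gamma> x * D \<gamma> x)))"
proof (induction \<alpha> rule: mi_induct)
 case zero
 show ?case by (intro exI[of _ "%_ _. 0"]) (simp add: test_zero wd_zero)
next
 case (inc \<beta> i)
 define b where "b = len \<beta>"
 have bK: "b < K" using inc.prems by (simp add: b_def)
 obtain c where c: "!!\<gamma>. c \<gamma> \<in> test_functions U"
  "!!k D. jet k U D ==> b <= k ==> wd UNIV \<beta> (%x. \<zeta> x ^ K * D (%_. 0) x)
   (%x. \<zeta> x ^ K * D \<beta> x + \<zeta> x ^ (K - b) * (\<Sum>\<gamma> | len \<gamma> < b. c \<gamma> x * D \<gamma> x))"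
  using inc.IH bK by (auto simp: b_def)
 define dec where "dec \<gamma> = \<gamma>(i := \<gamma> i - 1)" for \<gamma> :: "'n multi_index"
 have dec_inc: "dec (inc \<gamma> i) = \<gamma>" for \<gamma> by (simp add: dec_def inc_def)
 define c1 where "c1 \<gamma> x = (if \<gamma> = \<beta> then real K * (\<zeta> x ^ b * partial i \<zeta> x) else 0)" for \<gamma> x
 define c2 where "c2 \<gamma> x = (if len \<gamma> < b then real (K - b) * (partial i \<zeta> x * c \<gamma> x) + \<zeta> x * partial i (c \<gamma>) x else 0)" for \<gamma> x
 define c3 where "c3 \<gamma> x = (if \<gamma> i > 0 then \<zeta> x * c (dec \<gamma>) x else 0)" for \<gamma> x
 define c' where "c' \<gamma> x = c1 \<gamma> x + c2 \<gamma> x + c3 \<gamma> x" for \<gamma> x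
 have s\<zeta>: "C_infinity \<zeta>" by (rule test_smooth[OF \<zeta>])
 have t1: "c1 \<gamma> \<in> test_functions U" for \<gamma>
  unfolding c1_def by (cases "\<gamma> = \<beta>") (auto intro!: test_zero test_cmult test_mult C_infinity_power s\<zeta> test_partial \<zeta>)
 have t2: "c2 \<gamma> \<in> test_functions U" for \<gamma>
  unfolding c2_def by (cases "len \<gamma> < b")
   (auto intro!: test_zero test_add test_cmult test_mult C_infinity_partial s\<zeta> test_partial c)
 have t3: "c3 \<gamma> \<in> test_functions U" for \<gamma>
  unfolding c3_def by (cases "\<gamma> i > 0") (auto intro!: test_zero test_mult s\<zeta> c)
 have t': "c' \<gamma> \<in> test_functions U" for \<gamma>
  unfolding c'_def by (intro test_add t1 t2 t3)
 have fin: "finite {\<gamma>::'n multi_index. len \<gamma> < n}" for n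
  by (rule finite_subset[OF _ finite_mi_length_le[of n]]) auto
 show ?case
 proof (intro exI[of _ c'] conjI allI impI t')
  fix k D assume "jet k U D \<and> len (inc \<beta> i) <= k"
  then have D: "jet k U D" and k: "b < k" by (auto simp: b_def)
  have LD: "L2b (D \<gamma>)" if "len \<gamma> <= Suc b" for \<gamma> using D k that by (auto intro: jet_L2b)
  have wD: "wd1 U i (D \<gamma>) (D (inc \<gamma> i))" if "len \<gamma> <= b" for \<gamma> using D k that by (auto intro: jet_wd1)
  have Lmult: "L2b (%x. h x * f x)" if h: "h \<in> test_functions U" and "L2b f" for h f
  proof -
   obtain B where "!!x. \<bar>h x\<bar> <= B" using test_bounded[OF h] by metis
   then show ?thesis using L2b_bounded_mult[OF \<open>L2b f\<close> test_borel[OF h]] by blast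
  qed
  define w where "w \<gamma> x = \<zeta> x ^ (K - b) * c \<gamma> x" for \<gamma> x
  have tw: "w \<gamma> \<in> test_functions U" for \<gamma> unfolding w_def by (intro test_mult C_infinity_power s\<zeta> c)
  have tK: "(%x. \<zeta> x ^ K) \<in> test_functions U" using bK by (intro test_power \<zeta>) simp
  have pK: "partial i (%x. \<zeta> x ^ K) x = \<zeta> x ^ (K - Suc b) * (real K * (\<zeta> x ^ b * partial i \<zeta> x))" for x
  proof -
   have "\<zeta> x ^ (K - 1) = \<zeta> x ^ (K - Suc b) * \<zeta> x ^ b" using bK by (simp add: power_add[symmetric])
   then show ?thesis by (simp add: partial_power[OF s\<zeta>])
  qed
  have pw: "partial i (w \<gamma>) x = \<zeta> x ^ (K - Suc b) * (real (K - b) * (partial i \<zeta> x * c \<gamma> x) + \<zeta> x * partial i (c \<gamma>) x)" for \<gamma> x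
  proof -
   have "partial i (w \<gamma>) x = \<zeta> x ^ (K - b) * partial i (c \<gamma>) x + partial i (%x. \<zeta> x ^ (K - b)) x * c \<gamma> x"
    unfolding w_def
    by (intro partial_mult C_infinity_differentiable C_infinity_power s\<zeta> test_smooth[OF c(1)])
   moreover have "\<zeta> x ^ (K - b) = \<zeta> x ^ (K - Suc b) * \<zeta> x" using bK by (simp add: Suc_diff_Suc[symmetric])
   moreover have "partial i (%x. \<zeta> x ^ (K - b)) x = real (K - b) * \<zeta> x ^ (K - Suc b) * partial i \<zeta> x"
    by (simp add: partial_power[OF s\<zeta>])
   ultimately show ?thesis by (simp add: algebra_simps)
  qed
  have A: "wd1 UNIV i (%x. \<zeta> x ^ K * D \<beta> x) (%x. \<zeta> x ^ K * D (inc \<beta> i) x + partial i (%x. \<zeta> x ^ K) x * D \<beta> x)"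
   by (rule wd1_cutoff[OF wD LD LD tK]) (simp_all add: b_def)
  have B: "wd1 UNIV i (%x. \<Sum>\<gamma> | len \<gamma> < b. w \<gamma> x * D \<gamma> x)
    (%x. \<Sum>\<gamma> | len \<gamma> < b. w \<gamma> x * D (inc \<gamma> i) x + partial i (w \<gamma>) x * D \<gamma> x)"
  proof (rule wd1_sum[OF fin])
   fix \<gamma> :: "'n multi_index" assume "\<gamma> \<in> {\<gamma>. len \<gamma> < b}"
   then have g: "len \<gamma> < b" by simp
   show "wd1 UNIV i (%x. w \<gamma> x * D \<gamma> x) (%x. w \<gamma> x * D (inc \<gamma> i) x + partial i (w \<gamma>) x * D \<gamma> x)"
    by (rule wd1_cutoff[OF wD LD LD tw]) (use g in simp_all)
   show "L2b (%x. w \<gamma> x * D \<gamma> x)" by (intro Lmult tw LD) (use g in simp)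
   show "L2b (%x. w \<gamma> x * D (inc \<gamma> i) x + partial i (w \<gamma>) x * D \<gamma> x)"
    by (intro L2b_add Lmult tw test_partial LD) (use g in simp_all)
  qed
  have E: "(%x. \<zeta> x ^ K * D \<beta> x + \<zeta> x ^ (K - b) * (\<Sum>\<gamma> | len \<gamma> < b. c \<gamma> x * D \<gamma> x))
    = (%x. \<zeta> x ^ K * D \<beta> x + (\<Sum>\<gamma> | len \<gamma> < b. w \<gamma> x * D \<gamma> x))"
   by (simp add: w_def sum_distrib_left mult.assoc)
  have AB: "wd1 UNIV i (%x. \<zeta> x ^ K * D \<beta> x + (\<Sum>\<gamma> | len \<gamma> < b. w \<gamma> x * D \<gamma> x))
    (%x. (\<zeta> x ^ K * D (inc \<beta> i) x + partial i (%x. \<zeta> x ^ K) x * D \<beta> x)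
     + (\<Sum>\<gamma> | len \<gamma> < b. w \<gamma> x * D (inc \<gamma> i) x + partial i (w \<gamma>) x * D \<gamma> x))"
   by (rule wd1_add[OF A B]; intro L2b_add L2b_sum Lmult tK tw test_partial LD fin) (auto simp: b_def)
  have sum1: "(\<Sum>\<gamma> | len \<gamma> < Suc b. c1 \<gamma> x * D \<gamma> x) = real K * (\<zeta> x ^ b * partial i \<zeta> x) * D \<beta> x" for x
  proof -
   have "(\<Sum>\<gamma> | len \<gamma> < Suc b. c1 \<gamma> x * D \<gamma> x) = (\<Sum>\<gamma>\<in>{\<beta>}. c1 \<gamma> x * D \<gamma> x)"
    by (rule sum.mono_neutral_right[OF fin]) (auto simp: c1_def b_def)
   then show ?thesis by (simp add: c1_def)
  qed
  have sum2: "(\<Sum>\<gamma> | len \<gamma> < Suc b. c2 \<gamma> x * D \<gamma> x)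
    = (\<Sum>\<gamma> | len \<gamma> < b. (real (K - b) * (partial i \<zeta> x * c \<gamma> x) + \<zeta> x * partial i (c \<gamma>) x) * D \<gamma> x)" for x
  proof -
   have "(\<Sum>\<gamma> | len \<gamma> < Suc b. c2 \<gamma> x * D \<gamma> x) = (\<Sum>\<gamma> | len \<gamma> < b. c2 \<gamma> x * D \<gamma> x)"
    by (rule sum.mono_neutral_right[OF fin]) (auto simp: c2_def)
   then show ?thesis by (simp add: c2_def)
  qed
  have sum3: "(\<Sum>\<gamma> | len \<gamma> < Suc b. c3 \<gamma> x * D \<gamma> x)
    = (\<Sum>\<gamma> | len \<gamma> < b. \<zeta> x * c \<gamma> x * D (inc \<gamma> i) x)" for x
  proof -
   have "(\<Sum>\<gamma> | len \<gamma> < Suc b. c3 \<gamma> x * D \<gamma> x) = (\<Sum>\<gamma>\<in>(%\<gamma>. inc \<gamma> i) ` {\<gamma>. len \<gamma> < b}. c3 \<gamma> x * D \<gamma> x)"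
   proof (rule sum.mono_neutral_right[OF fin])
    show "\<forall>\<gamma>\<in>{\<gamma>. len \<gamma> < Suc b} - (%\<gamma>. inc \<gamma> i) ` {\<gamma>. len \<gamma> < b}. c3 \<gamma> x * D \<gamma> x = 0"
    proof
     fix \<gamma> assume \<gamma>: "\<gamma> \<in> {\<gamma>. len \<gamma> < Suc b} - (%\<gamma>. inc \<gamma> i) ` {\<gamma>. len \<gamma> < b}"
     have "\<not> \<gamma> i > 0"
     proof
      assume "\<gamma> i > 0"
      then obtain \<delta> where "\<gamma> = inc \<delta> i" using exists_inc[of \<gamma> i] by blast
      then show False using \<gamma> by auto
     qed
     then show "c3 \<gamma> x * D \<gamma> x = 0" by (simp add: c3_def)
    qed
   qed auto
   also have "\<dots> = (\<Sum>\<gamma> | len \<gamma> < b. c3 (inc \<gamma> i) x * D (inc \<gamma> i) x)"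
    by (subst sum.reindex) (auto intro: inj_on_inverseI[of _ dec] simp: dec_inc)
   also have "\<dots> = (\<Sum>\<gamma> | len \<gamma> < b. \<zeta> x * c \<gamma> x * D (inc \<gamma> i) x)"
    by (intro sum.cong) (auto simp: c3_def dec_inc, simp add: inc_def)
   finally show ?thesis .
  qed
  have eq: "(\<zeta> x ^ K * D (inc \<beta> i) x + partial i (%x. \<zeta> x ^ K) x * D \<beta> x)
     + (\<Sum>\<gamma> | len \<gamma> < b. w \<gamma> x * D (inc \<gamma> i) x + partial i (w \<gamma>) x * D \<gamma> x)
    = \<zeta> x ^ K * D (inc \<beta> i) x + \<zeta> x ^ (K - Suc b) * (\<Sum>\<gamma> | len \<gamma> < Suc b. c' \<gamma> x * D \<gamma> x)" for x
  proof -
   have w: "w \<gamma> x = \<zeta> x ^ (K - Suc b) * (\<zeta> x * c \<gamma> x)" for \<gamma>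
    using bK by (simp add: w_def Suc_diff_Suc[symmetric])
   have "(\<Sum>\<gamma> | len \<gamma> < Suc b. c' \<gamma> x * D \<gamma> x)
     = real K * (\<zeta> x ^ b * partial i \<zeta> x) * D \<beta> x
      + (\<Sum>\<gamma> | len \<gamma> < b. (real (K - b) * (partial i \<zeta> x * c \<gamma> x) + \<zeta> x * partial i (c \<gamma>) x) * D \<gamma> x)
      + (\<Sum>\<gamma> | len \<gamma> < b. \<zeta> x * c \<gamma> x * D (inc \<gamma> i) x)"
    by (simp only: c'_def distrib_right sum.distrib sum1 sum2 sum3)
   then show ?thesis unfolding pK
    by (simp add: w pw sum.distrib sum_distrib_left algebra_simps)
  qed
  show "wd UNIV (inc \<beta> i) (%x. \<zeta> x ^ K * D (%_. 0) x)
   (%x. \<zeta> x ^ K * D (inc \<beta> i) x + \<zeta> x ^ (K - len (inc \<beta> i))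
    * (\<Sum>\<gamma> | len \<gamma> < len (inc \<beta> i). c' \<gamma> x * D \<gamma> x))"
   using wd_inc[OF c(2)[OF D less_imp_le[OF k]], unfolded E, OF AB] unfolding eq
   by (simp add: b_def)
 qed
qed

section \<open>Difference quotients and the half-space\<close>

abbreviation lastix :: "'n::{finite,wellorder}" where "lastix \<equiv> Max UNIV"

text \<open>For \<open>\<sigma> = 1\<close> convolution moves supports strictly upwards, which turns functions that vanish below
  the boundary into test functions on the half-ball. For \<open>\<sigma> = -1\<close> the convolution at \<open>x\<close> sees
  only points above \<open>x\<close>.\<close>

definition one_sided :: "real => (nat => 'n::{finite,wellorder} rfun) => bool" where
 "one_sided \<sigma> \<rho> \<longleftrightarrow> (\<forall>n. mollifier (\<rho> n) \<and> (\<forall>z. \<rho> n z ~= 0 -->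
   norm z < 3 / real (Suc n) \<and> \<sigma> * z $ lastix > 1 / real (Suc n)))"

lemma one_sided_exists:
 fixes \<sigma> :: real
 assumes "\<sigma> = 1 \<or> \<sigma> = -1"
 shows "\<exists>\<rho> :: nat => 'n::{finite,wellorder} rfun. one_sided \<sigma> \<rho>"
proof -
 define p where "p n = (\<sigma> * 2 / real (Suc n)) *\<^sub>R (axis lastix 1 :: real^'n::_)" for n :: nat
 have "\<exists>\<rho>. mollifier \<rho> \<and> (\<forall>z. \<rho> z ~= 0 --> norm (z - p n :: real^'n::_) < 1 / real (Suc n))" for n
  using mollifier_exists[of "1 / real (Suc n)" "p n"] by (metis of_nat_0_less_iff zero_less_Suc zero_less_divide_1_iff)
 then obtain \<rho> where \<rho>: "!!n. mollifier (\<rho> n)" "!!n z. \<rho> n z ~= 0 ==> norm (z - p n :: real^'n::_) < 1 / real (Suc n)"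
  by metis
 show ?thesis
  unfolding one_sided_def
 proof (intro exI[of _ \<rho>] allI conjI impI \<rho>(1))
  fix n z assume z: "\<rho> n z ~= 0"
  have np: "norm (p n) = 2 / real (Suc n)" using assms by (auto simp: p_def)
  have "norm z <= norm (z - p n) + norm (p n)" using norm_triangle_ineq[of "z - p n" "p n"] by simp
  also have "\<dots> < 1 / real (Suc n) + 2 / real (Suc n)" using \<rho>(2)[OF z] np by simp
  finally show "norm z < 3 / real (Suc n)" by (simp add: add_divide_distrib[symmetric])
  have "\<bar>(z - p n) $ lastix\<bar> < 1 / real (Suc n)"
   using component_le_norm_cart[of "z - p n" lastix] \<rho>(2)[OF z] by linarith
  then have "\<bar>z $ lastix - \<sigma> * (2 / real (Suc n))\<bar> < 1 / real (Suc n)" by (simp add: p_def)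
  moreover have "2 / real (Suc n) = 1 / real (Suc n) + 1 / real (Suc n)" by simp
  ultimately show "\<sigma> * z $ lastix > 1 / real (Suc n)"
   using assms by (auto simp: abs_less_iff)
 qed
qed

lemma one_sidedD:
 assumes "one_sided \<sigma> \<rho>"
 shows "mollifier (\<rho> n)" "\<rho> n z ~= 0 ==> norm z < 3 / real (Suc n)"
  "\<rho> n z ~= 0 ==> \<sigma> * z $ lastix > 1 / real (Suc n)"
 using assms by (auto simp: one_sided_def)

lemma three_over_Suc_tendsto: "(%n. 3 / real (Suc n)) \<longlonglongrightarrow> 0"
 using tendsto_mult_right[OF LIMSEQ_inverse_real_of_nat, of 3] by (simp add: inverse_eq_divide)

lemma test_difference_quotient:
 fixes \<phi> :: "'n::finite rfun"
 assumes \<phi>: "\<phi> \<in> test_functions U"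
 obtains C where "C >= 0" "!!h. \<bar>h\<bar> <= 1 ==>
  nrm (%x. \<phi> (x + h *\<^sub>R axis i 1) - \<phi> x - h * partial i \<phi> x) <= C * h\<^sup>2"
proof -
 obtain C where C: "C > 0"
  "!!x h. \<bar>\<phi> (x + h) - \<phi> x - (\<Sum>i\<in>UNIV. h $ i * partial i \<phi> x)\<bar> <= C * (norm h)\<^sup>2"
  using test_Taylor2[OF \<phi>] by blast
 obtain R where R: "R > 0" "!!x. norm x > R ==> \<phi> x = 0" using test_support[OF \<phi>] by blast
 have R': "partial i \<phi> z = 0" if "norm z > R" for z
  by (rule partial_eq_0[of "{z. norm z > R}"])
   (use that R in \<open>auto intro!: open_Collect_less continuous_intros\<close>)
 show ?thesis
 proof (rule that[of "C * nrm (ind (cball 0 (R + 1)) :: 'n rfun)"])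
  fix h :: real assume h: "\<bar>h\<bar> <= 1"
  define r where "r x = \<phi> (x + h *\<^sub>R axis i 1) - \<phi> x - h * partial i \<phi> x" for x
  have b: "\<bar>r x\<bar> <= C * h\<^sup>2" for x
  proof -
   have "(\<Sum>j\<in>UNIV. (h *\<^sub>R axis i 1) $ j * partial j \<phi> x) = (\<Sum>j\<in>UNIV. if j = i then h * partial j \<phi> x else 0)"
    by (intro sum.cong) (auto simp: axis_def)
   then show ?thesis using C(2)[of x "h *\<^sub>R axis i 1"] by (simp add: r_def)
  qed
  have z: "r x = 0" if "x \<notin> cball 0 (R + 1)" for x
  proof -
   have x: "norm x > R + 1" using that by simp
   have "norm (x + h *\<^sub>R axis i 1) >= norm x - norm (h *\<^sub>R axis i 1 :: real^'n::_)" by (rule norm_diff_ineq)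
   then have "norm (x + h *\<^sub>R axis i 1) > R" using x h by simp
   moreover have "norm x > R" using x by simp
   ultimately show ?thesis by (simp add: r_def R(2) R')
  qed
  have "(%x. \<phi> (x + h *\<^sub>R axis i 1)) \<in> test_functions UNIV"
   by (rule test_shift[OF test_mono[OF \<phi>]]) auto
  then have "L2b r" unfolding r_def
   by (intro L2b_diff L2b_cmult test_L2b[OF \<phi>] test_L2b[OF test_partial[OF \<phi>]]) (rule test_L2b)
  then have "r \<in> borel_measurable borel" by (simp add: L2b_def)
  from L2b_bounded_support(2)[where p=0 and R="R + 1", OF this b z]
  show "nrm (%x. \<phi> (x + h *\<^sub>R axis i 1) - \<phi> x - h * partial i \<phi> x)
    <= C * nrm (ind (cball 0 (R + 1)) :: 'n rfun) * h\<^sup>2"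
   by (simp add: r_def mult_ac)
 qed (use C in simp)
qed

text \<open>The increment over \<open>h\<close> is the sum of \<open>n\<close> translates of the increment over \<open>h / n\<close>, and each
  of them is close to \<open>h / n\<close> times the derivative.\<close>

lemma increment_le_test:
 fixes v :: "'n::finite rfun"
 assumes v: "v \<in> test_functions UNIV" and S: "S \<in> sets borel" "S' \<in> sets borel"
  and SS': "!!x t. x \<in> S ==> 0 <= t ==> t <= 1 ==> x + (t * h) *\<^sub>R axis i 1 \<in> S'"
 shows "nrm (%x. ind S x * (v (x + h *\<^sub>R axis i 1) - v x))
  <= \<bar>h\<bar> * nrm (%x. ind S' x * partial i v x)"
proof -
 obtain C where C: "C >= 0" "!!h. \<bar>h\<bar> <= 1 ==>
  nrm (%x. v (x + h *\<^sub>R axis i 1) - v x - h * partial i v x) <= C * h\<^sup>2"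
  using test_difference_quotient[OF v] by blast
 define P where "P = nrm (%x. ind S' x * partial i v x)"
 have vsh: "(%x. v (x + p)) \<in> test_functions UNIV" for p by (rule test_shift[OF v]) auto
 have LP: "L2b (%x. ind S' x * partial i v x)"
  by (intro L2b_indicator S test_L2b[OF test_partial[OF v]])
 have main: "nrm (%x. ind S x * (v (x + h *\<^sub>R axis i 1) - v x)) <= \<bar>h\<bar> * P + C * h\<^sup>2 / real n"
  if n: "n > 0" "\<bar>h\<bar> <= real n" for n
 proof -
  define k where "k = h / real n"
  have k: "\<bar>k\<bar> <= 1" using n by (simp add: k_def)
  define w where "w x = v (x + k *\<^sub>R axis i 1) - v x" for x
  have Lw: "L2b w" unfolding w_def by (intro L2b_diff test_L2b[OF v] test_L2b[OF vsh])
  have LSw: "L2b (%x. ind S' x * w x)" by (rule L2b_indicator[OF Lw S(2)])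
  have tel: "v (x + h *\<^sub>R axis i 1) - v x = (\<Sum>j<n. w (x + (real j * k) *\<^sub>R axis i 1))" for x
  proof -
   have "(\<Sum>j<n. w (x + (real j * k) *\<^sub>R axis i 1))
     = (\<Sum>j<n. v (x + (real (Suc j) * k) *\<^sub>R axis i 1) - v (x + (real j * k) *\<^sub>R axis i 1))"
    by (intro sum.cong) (auto simp: w_def algebra_simps)
   also have "\<dots> = v (x + (real n * k) *\<^sub>R axis i 1) - v (x + (real 0 * k) *\<^sub>R axis i 1)"
    by (rule sum_lessThan_telescope)
   finally show ?thesis using n by (simp add: k_def)
  qed
  have each: "nrm (%x. ind S x * w (x + (real j * k) *\<^sub>R axis i 1)) <= nrm (%x. ind S' x * w x)"
   if j: "j < n" for j
  proof -
   let ?p = "(real j * k) *\<^sub>R axis i 1 :: real^'n::_"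
   have "nrm (%x. ind S x * w (x + ?p)) <= nrm (%x. ind S' (x + ?p) * w (x + ?p))"
   proof (rule nrm_mono)
    show "L2b (%x. ind S' (x + ?p) * w (x + ?p))" by (rule L2b_shift[OF LSw])
    show "(%x. ind S x * w (x + ?p)) \<in> borel_measurable borel"
     using L2b_indicator[OF L2b_shift[OF Lw, of ?p] S(1)] by (simp add: L2b_def)
    show "\<bar>ind S x * w (x + ?p)\<bar> <= \<bar>ind S' (x + ?p) * w (x + ?p)\<bar>" for x
    proof (cases "x \<in> S")
     case True
     have "x + ((real j / real n) * h) *\<^sub>R axis i 1 \<in> S'" using True j by (intro SS') auto
     then show ?thesis using True by (simp add: k_def)
    qed simp
   qed
   also have "\<dots> = nrm (%x. ind S' x * w x)" by (rule nrm_shift[OF LSw])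
   finally show ?thesis .
  qed
  have small: "nrm (%x. ind S' x * w x) <= \<bar>k\<bar> * P + C * k\<^sup>2"
  proof -
   define r where "r x = w x - k * partial i v x" for x
   have Lr: "L2b r" unfolding r_def by (intro L2b_diff Lw L2b_cmult test_L2b[OF test_partial[OF v]])
   have "(%x. ind S' x * w x) = (%x. k * (ind S' x * partial i v x) + ind S' x * r x)"
    by (simp add: r_def algebra_simps)
   then have "nrm (%x. ind S' x * w x) <= nrm (%x. k * (ind S' x * partial i v x)) + nrm (%x. ind S' x * r x)"
    using nrm_triangle[OF L2b_cmult[OF LP] L2b_indicator[OF Lr S(2)]] by simp
   moreover have "nrm r <= C * k\<^sup>2" using C(2)[OF k] by (simp add: r_def[abs_def] w_def)
   then have "nrm (%x. ind S' x * r x) <= C * k\<^sup>2"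
    by (rule order_trans[OF nrm_indicator_le[OF Lr S(2)]])
   ultimately show ?thesis by (simp add: nrm_cmult P_def)
  qed
  have "nrm (%x. ind S x * (v (x + h *\<^sub>R axis i 1) - v x))
    = nrm (%x. \<Sum>j<n. ind S x * w (x + (real j * k) *\<^sub>R axis i 1))"
   by (simp add: tel sum_distrib_left)
  also have "\<dots> <= (\<Sum>j<n. nrm (%x. ind S x * w (x + (real j * k) *\<^sub>R axis i 1)))"
   by (intro nrm_sum L2b_indicator L2b_shift Lw S) auto
  also have "\<dots> <= (\<Sum>j<n. \<bar>k\<bar> * P + C * k\<^sup>2)"
   by (intro sum_mono order_trans[OF each small]) auto
  also have "\<dots> = \<bar>h\<bar> * P + C * h\<^sup>2 / real n"
   using n by (simp add: k_def field_simps power2_eq_square)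
  finally show ?thesis .
 qed
 have "(%n. \<bar>h\<bar> * P + C * h\<^sup>2 * (1 / real n)) \<longlonglongrightarrow> \<bar>h\<bar> * P + C * h\<^sup>2 * 0"
  by (intro tendsto_intros lim_1_over_n)
 moreover obtain N where N: "\<bar>h\<bar> <= real N" using real_arch_simple by blast
 have "\<exists>N. \<forall>n\<ge>N. nrm (%x. ind S x * (v (x + h *\<^sub>R axis i 1) - v x)) <= \<bar>h\<bar> * P + C * h\<^sup>2 * (1 / real n)"
  using main N by (intro exI[of _ "Suc N"]) auto
 ultimately show ?thesis using LIMSEQ_le_const unfolding P_def by fastforce
qed

text \<open>Mollified functions inherit the inequality for test functions. The hypothesis \<open>loc\<close> allows points of
  \<open>S'\<close> at which nothing is known about weak derivatives, provided that \<open>g\<close> and \<open>g'\<close> vanish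
  nearby.\<close>

lemma increment_le:
 fixes g :: "'n::{finite,wellorder} rfun"
 assumes w: "wd1 U i g g'" and L: "L2b g" "L2b g'" and supp: "!!x. norm x > R ==> g x = 0"
  and S: "S \<in> sets borel" "S' \<in> sets borel"
  and SS': "!!x t. x \<in> S ==> 0 <= t ==> t <= 1 ==> x + (t * h) *\<^sub>R axis i 1 \<in> S'"
  and e: "e > 0"
  and loc: "!!x. x \<in> S' ==> ball x e \<subseteq> U \<or> (\<forall>y\<in>ball x e. g y = 0 \<and> g' y = 0)"
 shows "nrm (%x. ind S x * (g (x + h *\<^sub>R axis i 1) - g x))
  <= \<bar>h\<bar> * nrm (%x. ind S' x * g' x)"
proof -
 obtain \<rho> where os: "one_sided 1 (\<rho> :: nat => 'n rfun)"
  using one_sided_exists[of 1] by blast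
 note \<rho> = one_sidedD[OF os]
 let ?e = "axis i 1 :: real^'n::_"
 define v where "v n = conv g (\<rho> n)" for n
 have \<rho>t: "\<rho> n \<in> test_functions UNIV" for n by (rule mollifier_test[OF \<rho>(1)])
 have Lv: "L2b (v n)" for n unfolding v_def by (rule L2b_conv[OF L(1) \<rho>(1)])
 have vlim: "(%n. nrm (%x. v n x - g x)) \<longlonglongrightarrow> 0"
  unfolding v_def by (rule conv_tendsto[OF L(1) \<rho>(1,2) three_over_Suc_tendsto])
 have vt: "v n \<in> test_functions UNIV" for n
 proof (rule test_functionsI)
  show "C_infinity (v n)" unfolding v_def by (rule C_infinity_conv[OF L(1) \<rho>t])
  show "compact (cball 0 (R + 3) :: (real^'n::_) set)" by (rule compact_cball)
  show "v n x = 0" if "x \<notin> cball 0 (R + 3)" for x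
   unfolding v_def
  proof (rule conv_eq_0)
   fix y assume "\<rho> n (x - y) ~= 0"
   then have "norm (x - y) < 3 / real (Suc n)" by (rule \<rho>(2))
   also have "\<dots> <= 3" by (simp add: divide_le_eq)
   finally have "norm y > R" using that norm_triangle_ineq2[of x y] by simp
   then show "g y = 0" by (rule supp)
  qed
 qed simp
 have Lsh: "L2b (%x. f (x + h *\<^sub>R ?e) - f x)" if "L2b f" for f
  by (intro L2b_diff L2b_shift that)
 have ev: "\<forall>\<^sub>F n in sequentially. 3 / real (Suc n) < e"
  using order_tendstoD(2)[OF three_over_Suc_tendsto e] .
 have le: "\<forall>\<^sub>F n in sequentially. nrm (%x. ind S x * (v n (x + h *\<^sub>R ?e) - v n x))
   <= \<bar>h\<bar> * nrm (%x. ind S' x * conv g' (\<rho> n) x)"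
  using ev
 proof eventually_elim
  fix n assume n: "3 / real (Suc n) < e"
  have eq: "ind S' x * partial i (v n) x = ind S' x * conv g' (\<rho> n) x" for x
  proof (cases "x \<in> S'")
   case True
   have near: "x - z \<in> ball x e" if "\<rho> n z ~= 0" for z
    using \<rho>(2)[OF that] n by (simp add: dist_norm)
   have "partial i (v n) x = conv g' (\<rho> n) x"
    using loc[OF True]
   proof
    assume U: "ball x e \<subseteq> U"
    have "(%y. \<rho> n (x - y)) \<in> test_functions U"
    proof (rule test_reflect_support[OF \<rho>t, of _ "cball 0 (3 / real (Suc n))"])
     show "z \<in> cball 0 (3 / real (Suc n))" if "\<rho> n z ~= 0" for z
      using \<rho>(2)[OF that] by simp
     show "x - z \<in> U" if "z \<in> cball 0 (3 / real (Suc n))" for z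
      using that n U by (auto simp: dist_norm)
    qed simp
    from mi_partial_conv_wd[OF L(1) \<rho>t w[unfolded wd1_iff_wd] this]
    have "mi_partial (inc (%_. 0) i) (conv g (\<rho> n)) x = conv g' (\<rho> n) x" .
    then show ?thesis by (simp add: mi_partial_inc C_infinity_conv[OF L(1) \<rho>t] v_def)
   next
    assume z: "\<forall>y\<in>ball x e. g y = 0 \<and> g' y = 0"
    have "partial i (v n) x = conv g (partial i (\<rho> n)) x"
     unfolding v_def by (simp add: partial_conv[OF L(1) \<rho>t])
    also have "\<dots> = 0"
    proof (rule conv_eq_0)
     fix y assume y: "partial i (\<rho> n) (x - y) ~= 0"
     have "norm (x - y) <= 3 / real (Suc n)"
     proof (rule ccontr)
      assume "\<not> ?thesis"
      then have "partial i (\<rho> n) (x - y) = 0"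
       using \<rho>(2)[of n] by (intro partial_eq_0[of "{z. norm z > 3 / real (Suc n)}"])
        (auto intro!: open_Collect_less continuous_intros simp: not_less[symmetric] dest: less_asym)
      then show False using y by simp
     qed
     then show "g y = 0" using z n by (auto simp: dist_norm)
    qed
    also have "0 = conv g' (\<rho> n) x"
     by (rule conv_eq_0[symmetric]) (use z near[of "x - y" for y] in auto)
    finally show ?thesis .
   qed
   then show ?thesis by simp
  qed simp
  show "nrm (%x. ind S x * (v n (x + h *\<^sub>R ?e) - v n x))
   <= \<bar>h\<bar> * nrm (%x. ind S' x * conv g' (\<rho> n) x)"
   using increment_le_test[OF vt[of n] S SS'] unfolding eq .
 qed
 have lim1: "(%n. nrm (%x. ind S x * (v n (x + h *\<^sub>R ?e) - v n x)))
   \<longlonglongrightarrow> nrm (%x. ind S x * (g (x + h *\<^sub>R ?e) - g x))"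
 proof (rule nrm_tendsto)
  show "L2b (%x. ind S x * (v n (x + h *\<^sub>R ?e) - v n x))" for n
   by (intro L2b_indicator Lsh Lv S)
  show "L2b (%x. ind S x * (g (x + h *\<^sub>R ?e) - g x))" by (intro L2b_indicator Lsh L S)
  show "(%n. nrm (%x. ind S x * (v n (x + h *\<^sub>R ?e) - v n x) - ind S x * (g (x + h *\<^sub>R ?e) - g x)))
    \<longlonglongrightarrow> 0"
  proof (rule Lim_null_comparison)
   show "(%n. 2 * nrm (%x. v n x - g x)) \<longlonglongrightarrow> 0" using tendsto_mult_left[OF vlim, of 2] by simp
   show "\<forall>\<^sub>F n in sequentially. norm (nrm (%x. ind S x * (v n (x + h *\<^sub>R ?e) - v n x)
     - ind S x * (g (x + h *\<^sub>R ?e) - g x))) <= 2 * nrm (%x. v n x - g x)"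
   proof (rule always_eventually, rule allI)
    fix n
    define d where "d x = v n x - g x" for x
    have Ld: "L2b d" unfolding d_def by (rule L2b_diff[OF Lv L(1)])
    have "nrm (%x. ind S x * (d (x + h *\<^sub>R ?e) - d x)) <= nrm (%x. d (x + h *\<^sub>R ?e) - d x)"
     by (rule nrm_indicator_le[OF Lsh[OF Ld] S(1)])
    also have "\<dots> <= nrm (%x. d (x + h *\<^sub>R ?e)) + nrm d"
     by (rule nrm_triangle_diff[OF L2b_shift[OF Ld] Ld])
    also have "\<dots> = 2 * nrm d" by (simp add: nrm_shift[OF Ld])
    finally show "norm (nrm (%x. ind S x * (v n (x + h *\<^sub>R ?e) - v n x)
     - ind S x * (g (x + h *\<^sub>R ?e) - g x))) <= 2 * nrm (%x. v n x - g x)"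
     by (simp add: d_def[abs_def] algebra_simps)
   qed
  qed
 qed
 have lim2: "(%n. nrm (%x. ind S' x * conv g' (\<rho> n) x)) \<longlonglongrightarrow> nrm (%x. ind S' x * g' x)"
 proof (rule nrm_tendsto)
  show "L2b (%x. ind S' x * conv g' (\<rho> n) x)" for n by (intro L2b_indicator L2b_conv L \<rho>(1) S)
  show "L2b (%x. ind S' x * g' x)" by (intro L2b_indicator L S)
  show "(%n. nrm (%x. ind S' x * conv g' (\<rho> n) x - ind S' x * g' x)) \<longlonglongrightarrow> 0"
  proof (rule Lim_null_comparison[OF always_eventually conv_tendsto[OF L(2) \<rho>(1,2) three_over_Suc_tendsto]], rule allI)
   fix n
   have "nrm (%x. ind S' x * (conv g' (\<rho> n) x - g' x)) <= nrm (%x. conv g' (\<rho> n) x - g' x)"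
    by (rule nrm_indicator_le[OF L2b_diff[OF L2b_conv[OF L(2) \<rho>(1)] L(2)] S(2)])
   then show "norm (nrm (%x. ind S' x * conv g' (\<rho> n) x - ind S' x * g' x))
     <= nrm (%x. conv g' (\<rho> n) x - g' x)" by (simp add: right_diff_distrib)
  qed
 qed
 show ?thesis
  by (rule tendsto_le[OF sequentially_bot tendsto_mult_left[OF lim2] lim1 le])
qed

text \<open>All weak derivatives are constructed in this way: a bound on the distributional derivative, as a functional on test
  functions, yields a function by Riesz' theorem.\<close>

lemma wd_from_bound:
 fixes g :: "'n::{finite,wellorder} rfun"
 assumes g: "L2b g" and C: "C >= 0"
  and bound: "!!\<phi>. \<phi> \<in> test_functions U ==> \<bar>ip g (mi_partial \<alpha> \<phi>)\<bar> <= C * nrm \<phi>"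
 obtains E where "L2b E" "wd U \<alpha> g E" "nrm E <= C"
proof -
 define s :: real where "s = (-1) ^ len \<alpha>"
 have s: "s * s = 1" "\<bar>s\<bar> = 1" by (auto simp: s_def power_mult_distrib[symmetric] power_abs)
 define T where "T \<phi> = s * ip g (mi_partial \<alpha> \<phi>)" for \<phi>
 have "\<exists>v f. L2b v \<and> nrm v <= C \<and> (\<forall>\<phi>\<in>test_functions U. ip v \<phi> = T \<phi>) \<and>
  (\<forall>n::nat. f n \<in> test_functions U) \<and> (%n. nrm (%x. f n x - v x)) \<longlonglongrightarrow> 0"
 proof (rule Riesz_representation)
  fix \<phi> \<psi> :: "'n rfun" and t :: real
  assume \<phi>: "\<phi> \<in> test_functions U"
  then show "L2b \<phi>" by (rule test_L2b)
  show "\<bar>T \<phi>\<bar> <= C * nrm \<phi>" using bound[OF \<phi>] s by (simp add: T_def abs_mult)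
  assume \<psi>: "\<psi> \<in> test_functions U"
  show "(%x. \<phi> x + t * \<psi> x) \<in> test_functions U" by (intro test_add test_cmult \<phi> \<psi>)
  have "mi_partial \<alpha> (%x. \<phi> x + t * \<psi> x) = (%x. mi_partial \<alpha> \<phi> x + t * mi_partial \<alpha> \<psi> x)"
  proof (induction \<alpha> rule: mi_induct)
   case (inc \<beta> i)
   have C: "C_infinity (mi_partial \<beta> \<phi>)" "C_infinity (mi_partial \<beta> \<psi>)"
    using \<phi> \<psi> by (auto intro: C_infinity_mi_partial test_smooth)
   have "partial i (%x. mi_partial \<beta> \<phi> x + t * mi_partial \<beta> \<psi> x) x
     = partial i (mi_partial \<beta> \<phi>) x + t * partial i (mi_partial \<beta> \<psi>) x" for x
    by (subst partial_add) (simp_all add: partial_cmult C C_infinity_differentiable C_infinity_cmult)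
   then show ?case using inc \<phi> \<psi>
    by (simp add: mi_partial_inc C_infinity_add C_infinity_cmult test_smooth)
  qed simp
  then show "T (%x. \<phi> x + t * \<psi> x) = T \<phi> + t * T \<psi>"
   unfolding T_def
   by (simp add: ip_add_right[OF test_L2b[OF test_mi_partial[OF \<phi>]] L2b_cmult[OF test_L2b[OF test_mi_partial[OF \<psi>]]] g]
     ip_cmult_right algebra_simps)
 qed (simp_all add: test_zero C)
 then obtain v where v: "L2b v" "nrm v <= C" "!!\<phi>. \<phi> \<in> test_functions U ==> ip v \<phi> = T \<phi>" by blast
 have "wd U \<alpha> g v"
  unfolding wd_def
 proof
  fix \<phi> assume "\<phi> \<in> test_functions U"
  then have "ip v \<phi> = s * ip g (mi_partial \<alpha> \<phi>)" using v(3) by (simp add: T_def)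
  then have "s * ip v \<phi> = (s * s) * ip g (mi_partial \<alpha> \<phi>)" by simp
  then show "ip g (mi_partial \<alpha> \<phi>) = (-1) ^ len \<alpha> * ip v \<phi>" using s by (simp add: s_def)
 qed
 then show ?thesis using that v by blast
qed

text \<open>A weak derivative vanishes where the function vanishes.\<close>

lemma wd_restrict:
 fixes g :: "'n::{finite,wellorder} rfun"
 assumes w: "wd U \<alpha> g E" and L: "L2b E" and U: "open U" and Z: "open Z" "!!x. x \<in> U ==> x \<in> Z ==> g x = 0"
 shows "wd U \<alpha> g (%x. ind (U - Z) x * E x)"
 unfolding wd_def
proof
 have "AE x in lborel. x \<in> U \<inter> Z --> E x = 0"
 proof (rule fundamental_lemma_L2b[OF _ L])
  show "open (U \<inter> Z)" by (rule open_Int[OF U Z(1)])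
  fix \<phi> :: "'n rfun" assume \<phi>: "\<phi> \<in> test_functions (U \<inter> Z)"
  then have \<phi>': "\<phi> \<in> test_functions U" by (rule test_mono) simp
  obtain K where K: "K \<subseteq> U \<inter> Z" "!!x. x \<notin> K ==> mi_partial \<alpha> \<phi> x = 0"
   using test_functionsE[OF test_mi_partial[OF \<phi>]] by metis
  have eq: "g x * mi_partial \<alpha> \<phi> x = 0" for x using K Z(2) by (cases "x \<in> K") auto
  have "ip g (mi_partial \<alpha> \<phi>) = 0" unfolding ip_def eq by simp
  then show "ip E \<phi> = 0" using wdD[OF w \<phi>'] by simp
 qed
 then have ae: "AE x in lborel. x \<in> U --> ind (U - Z) x * E x = E x"
  by eventually_elim (auto simp: indicator_def)
 fix \<phi> :: "'n rfun" assume \<phi>: "\<phi> \<in> test_functions U"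
 obtain K where K: "K \<subseteq> U" "!!x. x \<notin> K ==> \<phi> x = 0" using test_functionsE[OF \<phi>] by metis
 have "UZ \<in> sets borel" if "UZ = U - Z" for UZ using that U Z by auto
 then have m: "(%x. ind (U - Z) x * E x) \<in> borel_measurable borel"
  using L2b_indicator[OF L] by (simp add: L2b_def)
 have "ip (%x. ind (U - Z) x * E x) \<phi> = ip E \<phi>"
  unfolding ip_def
 proof (rule integral_cong_AE)
  show "(%x. ind (U - Z) x * E x * \<phi> x) \<in> borel_measurable lborel"
   "(%x. E x * \<phi> x) \<in> borel_measurable lborel"
   using m L test_borel[OF \<phi>] by (auto simp: L2b_def)
  show "AE x in lborel. ind (U - Z) x * E x * \<phi> x = E x * \<phi> x"
   using ae
  proof eventually_elim
   fix x assume "x \<in> U --> ind (U - Z) x * E x = E x"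
   then show "ind (U - Z) x * E x * \<phi> x = E x * \<phi> x" using K by (cases "x \<in> U") auto
  qed
 qed
 then show "ip g (mi_partial \<alpha> \<phi>) = (-1) ^ len \<alpha> * ip (%x. ind (U - Z) x * E x) \<phi>"
  using wdD[OF w \<phi>] by simp
qed

text \<open>An equation in divergence form on the half-ball extends from test functions to functions
  that vanish below the flat boundary: translate upwards and mollify.\<close>

lemma weak_equation_extend:
 fixes G :: "'n::{finite,wellorder} multi_index => 'n rfun"
 assumes eq: "!!\<phi>. \<phi> \<in> test_functions (half_ball R) ==> (\<Sum>\<beta> | len \<beta> <= m. ip (G \<beta>) (mi_partial \<beta> \<phi>)) = 0"
  and G: "!!\<beta>. len \<beta> <= m ==> L2b (G \<beta>)"
  and \<Psi>: "jet m UNIV \<Psi>" and R: "R' < R"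
  and supp: "!!x. norm x > R' ==> \<Psi> (%_. 0) x = 0" "!!x. x $ lastix < 0 ==> \<Psi> (%_. 0) x = 0"
 shows "(\<Sum>\<beta> | len \<beta> <= m. ip (G \<beta>) (\<Psi> \<beta>)) = 0"
proof -
 obtain \<rho> where os: "one_sided 1 (\<rho> :: nat => 'n rfun)"
  using one_sided_exists[of 1] by blast
 note \<rho> = one_sidedD[OF os]
 have \<rho>t: "\<rho> n \<in> test_functions UNIV" for n by (rule mollifier_test[OF \<rho>(1)])
 have L\<Psi>: "L2b (\<Psi> \<beta>)" if "len \<beta> <= m" for \<beta> by (rule jet_L2b[OF \<Psi> that])
 have L0: "L2b (\<Psi> (%_. 0))" by (rule L\<Psi>) simp
 define \<phi> where "\<phi> n = conv (\<Psi> (%_. 0)) (\<rho> n)" for n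
 have mp: "mi_partial \<beta> (\<phi> n) = conv (\<Psi> \<beta>) (\<rho> n)" if "len \<beta> <= m" for n \<beta>
 proof
  fix x
  show "mi_partial \<beta> (\<phi> n) x = conv (\<Psi> \<beta>) (\<rho> n) x"
   unfolding \<phi>_def
   by (rule mi_partial_conv_wd[OF L0 \<rho>t jet_wd[OF \<Psi> that] test_reflect_UNIV[OF \<rho>t]])
 qed
 have ev: "\<forall>\<^sub>F n in sequentially. 3 / real (Suc n) < R - R'"
  using order_tendstoD(2)[OF three_over_Suc_tendsto] R by simp
 have zero: "\<forall>\<^sub>F n in sequentially. (\<Sum>\<beta> | len \<beta> <= m. ip (G \<beta>) (conv (\<Psi> \<beta>) (\<rho> n))) = 0"
  using ev
 proof eventually_elim
  fix n assume n: "3 / real (Suc n) < R - R'"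
  define K where "K = cball 0 (R' + 3 / real (Suc n)) \<inter> {x::(real^'n::_). x $ lastix >= 1 / real (Suc n)}"
  have "closed {x::(real^'n::_). x $ lastix >= 1 / real (Suc n)}"
   by (intro closed_Collect_le continuous_intros)
  then have "compact K" unfolding K_def by (intro compact_Int_closed compact_cball)
  then have "\<phi> n \<in> test_functions (half_ball R)"
  proof (rule test_functionsI[rotated])
   show "C_infinity (\<phi> n)" unfolding \<phi>_def by (rule C_infinity_conv[OF L0 \<rho>t])
   show "K \<subseteq> half_ball R"
   proof
    fix x assume x: "x \<in> K"
    have "0 < 1 / real (Suc n)" by simp
    also have "\<dots> <= x $ lastix" using x by (simp add: K_def)
    finally have "x $ lastix > 0" .
    moreover have "norm x <= R' + 3 / real (Suc n)" using x by (simp add: K_def)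
    ultimately show "x \<in> half_ball R" using n by (simp add: half_ball_def)
   qed
   show "\<phi> n x = 0" if x: "x \<notin> K" for x
    unfolding \<phi>_def
   proof (rule conv_eq_0)
    fix y assume y: "\<rho> n (x - y) ~= 0"
    show "\<Psi> (%_. 0) y = 0"
    proof (rule ccontr)
     assume "\<Psi> (%_. 0) y ~= 0"
     then have "norm y <= R'" "y $ lastix >= 0" using supp[of y] by (auto simp: not_less[symmetric])
     then have "norm x <= R' + 3 / real (Suc n)" "x $ lastix >= 1 / real (Suc n)"
      using \<rho>(2)[OF y] \<rho>(3)[OF y] norm_triangle_ineq2[of x y] by auto
     then show False using x by (simp add: K_def)
    qed
   qed
  qed
  from eq[OF this] show "(\<Sum>\<beta> | len \<beta> <= m. ip (G \<beta>) (conv (\<Psi> \<beta>) (\<rho> n))) = 0"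
   by (simp add: mp)
 qed
 have "(%n. \<Sum>\<beta> | len \<beta> <= m. ip (G \<beta>) (conv (\<Psi> \<beta>) (\<rho> n))) \<longlonglongrightarrow> (\<Sum>\<beta> | len \<beta> <= m. ip (G \<beta>) (\<Psi> \<beta>))"
 proof (rule tendsto_sum)
  fix \<beta> :: "'n multi_index" assume "\<beta> \<in> {\<beta>. len \<beta> <= m}"
  then have b: "len \<beta> <= m" by simp
  show "(%n. ip (G \<beta>) (conv (\<Psi> \<beta>) (\<rho> n))) \<longlonglongrightarrow> ip (G \<beta>) (\<Psi> \<beta>)"
   unfolding ip_commute[of "G \<beta>"]
   by (rule ip_tendsto[OF L2b_conv[OF L\<Psi>[OF b] \<rho>(1)] L\<Psi>[OF b]
      conv_tendsto[OF L\<Psi>[OF b] \<rho>(1,2) three_over_Suc_tendsto] G[OF b]])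
 qed
 then show ?thesis
  using tendsto_eventually[OF zero] LIMSEQ_unique by blast
qed

section \<open>Tangential regularity\<close>

lemma quadratic_absorb:
 fixes c X Z A B :: real
 assumes "c > 0" "A >= 0" "B >= 0" "Z >= 0" "X >= 0" "c * X\<^sup>2 <= A * Z * X + B * Z\<^sup>2"
 shows "X <= ((A + B) / c + 1) * Z"
proof (cases "X <= Z")
 case True
 have "0 <= (A + B) / c * Z" using assms by simp
 then show ?thesis using True by (simp add: distrib_right)
next
 case False
 then have "X > 0" using assms by linarith
 have "B * Z\<^sup>2 <= B * (Z * X)"
  unfolding power2_eq_square using False assms by (intro mult_left_mono) auto
 then have "(c * X) * X <= ((A + B) * Z) * X"
  using assms(6) by (simp add: power2_eq_square algebra_simps)
 then have "c * X <= (A + B) * Z" using \<open>X > 0\<close> by (rule mult_right_le_imp_le)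
 then have "X <= (A + B) / c * Z" using assms(1) by (simp add: field_simps)
 then show ?thesis using assms(4) by (simp add: distrib_right)
qed

text \<open>The ellipticity condition applied at every point to \<open>\<xi> \<alpha> = F \<alpha> x\<close> and
  integrated.\<close>

lemma elliptic_ip:
 assumes a: "elliptic_with m c a" and F: "!!\<alpha>. len \<alpha> = m ==> L2b (F \<alpha>)"
 shows "c * (\<Sum>\<alpha> | len \<alpha> = m. (nrm (F \<alpha>))\<^sup>2)
  <= (\<Sum>\<alpha> | len \<alpha> = m. \<Sum>\<beta> | len \<beta> = m. a \<alpha> \<beta> * ip (F \<alpha>) (F \<beta>))"
proof -
 have i: "integrable lborel (%x. F \<alpha> x * F \<beta> x)" if "len \<alpha> = m" "len \<beta> = m" for \<alpha> \<beta>
  by (intro L2b_integrable_mult F that)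
 have "c * (\<Sum>\<alpha> | len \<alpha> = m. (nrm (F \<alpha>))\<^sup>2) = (LINT x|lborel. c * (\<Sum>\<alpha> | len \<alpha> = m. (F \<alpha> x)\<^sup>2))"
  using L2b_integrable_sq[OF F] by (simp add: nrm_sq)
 also have "\<dots> <= (LINT x|lborel. (\<Sum>\<alpha> | len \<alpha> = m. \<Sum>\<beta> | len \<beta> = m. a \<alpha> \<beta> * (F \<alpha> x * F \<beta> x)))"
 proof (rule integral_mono)
  show "integrable lborel (%x. c * (\<Sum>\<alpha> | len \<alpha> = m. (F \<alpha> x)\<^sup>2))"
   using L2b_integrable_sq[OF F] by (intro integrable_mult_right Bochner_Integration.integrable_sum) simp
  show "integrable lborel (%x. \<Sum>\<alpha> | len \<alpha> = m. \<Sum>\<beta> | len \<beta> = m. a \<alpha> \<beta> * (F \<alpha> x * F \<beta> x))"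
   by (intro Bochner_Integration.integrable_sum integrable_mult_right i) auto
  fix x
  show "c * (\<Sum>\<alpha> | len \<alpha> = m. (F \<alpha> x)\<^sup>2)
    <= (\<Sum>\<alpha> | len \<alpha> = m. \<Sum>\<beta> | len \<beta> = m. a \<alpha> \<beta> * (F \<alpha> x * F \<beta> x))"
   using a[unfolded elliptic_with_def, rule_format, of "%\<alpha>. F \<alpha> x"] by (simp add: mult.assoc)
 qed
 also have "\<dots> = (\<Sum>\<alpha> | len \<alpha> = m. \<Sum>\<beta> | len \<beta> = m. a \<alpha> \<beta> * ip (F \<alpha>) (F \<beta>))"
 proof -
  have 1: "(LINT x|lborel. (\<Sum>\<beta> | len \<beta> = m. a \<alpha> \<beta> * (F \<alpha> x * F \<beta> x)))
    = (\<Sum>\<beta> | len \<beta> = m. a \<alpha> \<beta> * ip (F \<alpha>) (F \<beta>))" if "len \<alpha> = m" for \<alpha>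
   unfolding ip_def
   by (subst Bochner_Integration.integral_sum) (auto intro!: integrable_mult_right i that)
  show ?thesis
   by (subst Bochner_Integration.integral_sum)
    (auto intro!: Bochner_Integration.integrable_sum integrable_mult_right i simp: 1)
 qed
 finally show ?thesis .
qed

definition dq :: "real => 'n => ('n::finite rfun) => 'n rfun" where
 "dq h i g x = (1 / h) * (g (x + h *\<^sub>R axis i 1) - g x)"

lemma L2b_dq: "L2b g ==> L2b (dq h i g)"
 unfolding dq_def by (intro L2b_cmult L2b_diff L2b_shift)

lemma ip_dq:
 assumes "L2b f" "L2b g" shows "ip f (dq (- h) i g) = - ip (dq h i f) g"
proof -
 let ?p = "h *\<^sub>R axis i 1"
 have eq: "dq (- h) i g = (%x. - (1 / h) * (g (x - ?p) - g x))" by (simp add: dq_def fun_eq_iff)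
 have "L2b (%x. g (x - ?p))" using L2b_shift[OF assms(2), of "- ?p"] by simp
 then have "ip f (dq (- h) i g) = - (1 / h) * (ip f (%x. g (x - ?p)) - ip f g)"
  unfolding eq ip_cmult_right by (simp add: ip_diff_right[OF _ assms(2,1)])
 also have "ip f (%x. g (x - ?p)) = ip (%x. f (x + ?p)) g" by (rule ip_shift[OF assms, symmetric])
 also have "- (1 / h) * (ip (%x. f (x + ?p)) g - ip f g) = - ip (dq h i f) g"
  unfolding dq_def[abs_def] ip_cmult_left by (simp add: ip_diff_left[OF L2b_shift[OF assms(1)] assms])
 finally show ?thesis .
qed

lemma jet_dq:
 assumes D: "jet k V D" and UV: "U \<subseteq> V" "!!x. x \<in> U ==> x + h *\<^sub>R axis i 1 \<in> V"
 shows "jet k U (%\<alpha>. dq h i (D \<alpha>))"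
 unfolding jet_def
proof (intro allI impI conjI)
 fix \<alpha> :: "'a multi_index" assume \<alpha>: "len \<alpha> <= k"
 have L: "L2b (D \<alpha>)" "L2b (D (%_. 0))" using jet_L2b[OF D] \<alpha> by auto
 show "L2b (dq h i (D \<alpha>))" by (rule L2b_dq[OF L(1)])
 show "wd U \<alpha> (dq h i (D (%_. 0))) (dq h i (D \<alpha>))"
  unfolding dq_def[abs_def]
  by (intro wd_cmult wd_diff L2b_shift L wd_shift[OF jet_wd[OF D \<alpha>]] UV(2) wd_mono[OF jet_wd[OF D \<alpha>] UV(1)])
qed

lemma nrm_dq_le:
 fixes g :: "'n::{finite,wellorder} rfun"
 assumes "wd1 U i g g'" "L2b g" "L2b g'" "!!x. norm x > R ==> g x = 0"
  "S \<in> sets borel" "S' \<in> sets borel" "h ~= 0"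
  "!!x t. x \<in> S ==> 0 <= t ==> t <= 1 ==> x + (t * h) *\<^sub>R axis i 1 \<in> S'" "e > 0"
  "!!x. x \<in> S' ==> ball x e \<subseteq> U"
 shows "nrm_on S (dq h i g) <= nrm (%x. ind S' x * g' x)"
proof -
 have "(%x. ind S x * dq h i g x) = (%x. (1 / h) * (ind S x * (g (x + h *\<^sub>R axis i 1) - g x)))"
  by (simp add: dq_def fun_eq_iff)
 then have "nrm_on S (dq h i g)
   = \<bar>1 / h\<bar> * nrm (%x. ind S x * (g (x + h *\<^sub>R axis i 1) - g x))" by (simp only: nrm_cmult)
 also have "\<dots> <= \<bar>1 / h\<bar> * (\<bar>h\<bar> * nrm (%x. ind S' x * g' x))"
  by (intro mult_left_mono increment_le[of U i g g' R S S' h e] assms) (use assms(10) in auto)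
 also have "\<dots> = nrm (%x. ind S' x * g' x)" using assms(7) by (simp add: abs_divide)
 finally show ?thesis .
qed

lemma cutoff_exists:
 fixes r s R :: real
 assumes "0 < r" "r < s" "s < R"
 obtains \<eta> :: "'n::finite rfun" and c0 where "\<eta> \<in> test_functions (ball 0 R)" "!!x. 0 <= \<eta> x" "!!x. \<eta> x <= 1"
  "!!x. norm x > s ==> \<eta> x = 0" "c0 > 0" "!!x. norm x < r ==> c0 <= \<eta> x"
  "!!x y. norm x <= norm y ==> \<eta> y <= \<eta> x"
proof -
 define \<eta> where "\<eta> x = theta (s\<^sup>2 - (norm (x - 0))\<^sup>2)" for x :: "real^'n::_"
 have C: "C_infinity \<eta>" unfolding \<eta>_def
  by (intro C_infinity_theta C_infinity_diff C_infinity_const C_infinity_norm2)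
 have z: "\<eta> x = 0" if "norm x > s" for x
  using that power_strict_mono[of s "norm x" 2] assms by (simp add: \<eta>_def theta_eq_0_iff)
 show ?thesis
 proof (rule that)
  show "\<eta> \<in> test_functions (ball 0 R)"
   by (rule test_functionsI[OF C, of "cball 0 s"]) (use assms z in auto)
  show "0 <= \<eta> x" "\<eta> x <= 1" for x by (simp_all add: \<eta>_def theta_nonneg theta_le_1)
  show "!!x. norm x > s ==> \<eta> x = 0" by (rule z)
  show "theta (s\<^sup>2 - r\<^sup>2) > 0"
   using power_strict_mono[of r s 2] assms by (simp add: theta_pos_iff)
  show "theta (s\<^sup>2 - r\<^sup>2) <= \<eta> x" if "norm x < r" for x
   using that power_mono[of "norm x" r 2] by (auto simp: \<eta>_def intro!: theta_mono)
  show "\<eta> y <= \<eta> x" if "norm x <= norm y" for x y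
   using power_mono[OF that, of 2] by (auto simp: \<eta>_def intro!: theta_mono)
 qed
qed

lemma finite_mi_length_less: "finite {\<gamma>::'n::finite multi_index. len \<gamma> < n}"
 by (rule finite_subset[OF _ finite_mi_length_le[of n]]) auto

text \<open>The equation is tested with \<open>D\<^sub>-\<^sub>h (\<eta>\<^sup>2\<^sup>m D\<^sub>h u)\<close>. By the Leibniz formula every derivative of
  \<open>\<eta>\<^sup>2\<^sup>m D\<^sub>h u\<close> of order at most \<open>m\<close> retains a factor \<open>\<eta>\<^sup>m\<close>, which is the weight that the ellipticity
  condition controls. The derivatives of \<open>D\<^sub>h u\<close> of order less than \<open>m\<close> are bounded by those of \<open>u\<close>
  of order at most \<open>m\<close>.\<close>

lemma difference_quotient_estimate:
 fixes c M r R :: real and m :: nat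
 assumes m: "m >= 1" and c: "c > 0" and r: "0 < r" "r < R"
 shows "\<exists>C h0. C >= 0 \<and> h0 > 0 \<and> (\<forall>(a :: 'n::{finite,wellorder} coeffs) D f1 \<sigma> i Z h \<alpha>.
  elliptic_with m c a --> (\<forall>\<alpha> \<beta>. len \<alpha> = m --> len \<beta> = m --> \<bar>a \<alpha> \<beta>\<bar> <= M) -->
  jet m (ball 0 R) D -->
  (\<forall>\<alpha>. len \<alpha> <= m --> nrm (D \<alpha>) <= Z \<and> (\<forall>x. norm x > R \<or> x $ lastix < 0 --> D \<alpha> x = 0)) -->
  L2b f1 --> nrm f1 <= Z --> len \<sigma> < m -->
  (\<forall>\<phi>\<in>test_functions (half_ball R). (\<Sum>\<alpha> | len \<alpha> = m. \<Sum>\<beta> | len \<beta> = m.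
    a \<alpha> \<beta> * ip (D \<alpha>) (mi_partial \<beta> \<phi>)) = ip f1 (mi_partial \<sigma> \<phi>)) -->
  i ~= lastix --> h ~= 0 --> \<bar>h\<bar> < h0 --> len \<alpha> <= m -->
  nrm_on (ball 0 r) (dq h i (D \<alpha>)) <= C * Z)"
proof -
 define s where "s = (2 * r + R) / 3"
 define R2 where "R2 = (r + 2 * R) / 3"
 define h0 where "h0 = (R - R2) / 2"
 have radii: "r < s" "s < R2" "R2 < R" "h0 > 0" "s + h0 < R" "R2 + h0 < R" "R - (R2 + h0) = h0"
  using r by (auto simp: s_def R2_def h0_def field_simps)
 obtain \<eta> :: "'n rfun" and c0 where \<eta>: "\<eta> \<in> test_functions (ball 0 R2)" "!!x. 0 <= \<eta> x" "!!x. \<eta> x <= 1"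
  "!!x. norm x > s ==> \<eta> x = 0" and c0: "c0 > 0" "!!x. norm x < r ==> c0 <= \<eta> x"
  using cutoff_exists[OF r(1) radii(1,2)] by metis
 have "\<forall>\<alpha>. \<exists>c. len \<alpha> <= m --> (\<forall>\<gamma>. c \<gamma> \<in> test_functions (ball 0 R2)) \<and> (\<forall>k D. jet k (ball 0 R2) D \<and> len \<alpha> <= k -->
  wd UNIV \<alpha> (%x. \<eta> x ^ (2*m) * D (%_. 0) x)
   (%x. \<eta> x ^ (2*m) * D \<alpha> x + \<eta> x ^ (2*m - len \<alpha>) * (\<Sum>\<gamma> | len \<gamma> < len \<alpha>. c \<gamma> x * D \<gamma> x)))"
 proof
  fix \<alpha> :: "'n multi_index"
  show "\<exists>c. len \<alpha> <= m --> (\<forall>\<gamma>. c \<gamma> \<in> test_functions (ball 0 R2)) \<and> (\<forall>k D. jet k (ball 0 R2) D \<and> len \<alpha> <= k -->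
  wd UNIV \<alpha> (%x. \<eta> x ^ (2*m) * D (%_. 0) x)
   (%x. \<eta> x ^ (2*m) * D \<alpha> x + \<eta> x ^ (2*m - len \<alpha>) * (\<Sum>\<gamma> | len \<gamma> < len \<alpha>. c \<gamma> x * D \<gamma> x)))"
  proof (cases "len \<alpha> <= m")
   case True
   then have "len \<alpha> <= 2 * m" by simp
   from Leibniz_power[OF \<eta>(1) this] show ?thesis by blast
  qed simp
 qed
 from choice[OF this] obtain cc where cc0: "\<forall>\<alpha>. len \<alpha> <= m --> (\<forall>\<gamma>. cc \<alpha> \<gamma> \<in> test_functions (ball 0 R2)) \<and> (\<forall>k D. jet k (ball 0 R2) D \<and> len \<alpha> <= k -->
  wd UNIV \<alpha> (%x. \<eta> x ^ (2*m) * D (%_. 0) x)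
   (%x. \<eta> x ^ (2*m) * D \<alpha> x + \<eta> x ^ (2*m - len \<alpha>) * (\<Sum>\<gamma> | len \<gamma> < len \<alpha>. cc \<alpha> \<gamma> x * D \<gamma> x)))" ..
 have cct: "cc \<alpha> \<gamma> \<in> test_functions (ball 0 R2)" if "len \<alpha> <= m" for \<alpha> \<gamma> using cc0 that by simp
 have ccw: "wd UNIV \<alpha> (%x. \<eta> x ^ (2*m) * D (%_. 0) x)
   (%x. \<eta> x ^ (2*m) * D \<alpha> x + \<eta> x ^ (2*m - len \<alpha>) * (\<Sum>\<gamma> | len \<gamma> < len \<alpha>. cc \<alpha> \<gamma> x * D \<gamma> x))"
  if "len \<alpha> <= m" "jet m (ball 0 R2) D" for \<alpha> D using cc0 that by simp
 have "\<forall>\<alpha> \<gamma>. \<exists>b. b >= 0 \<and> (len \<alpha> <= m --> (\<forall>x. \<bar>cc \<alpha> \<gamma> x\<bar> <= b))"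
 proof (intro allI)
  fix \<alpha> \<gamma> :: "'n multi_index"
  show "\<exists>b. b >= 0 \<and> (len \<alpha> <= m --> (\<forall>x. \<bar>cc \<alpha> \<gamma> x\<bar> <= b))"
  proof (cases "len \<alpha> <= m")
   case True
   obtain B where "B > 0" "!!x. \<bar>cc \<alpha> \<gamma> x\<bar> <= B" using test_bounded[OF cct[OF True]] by metis
   then show ?thesis by (intro exI[of _ B]) auto
  qed auto
 qed
 then obtain b where b: "!!\<alpha> \<gamma>. b \<alpha> \<gamma> >= 0" "!!\<alpha> \<gamma> x. len \<alpha> <= m ==> \<bar>cc \<alpha> \<gamma> x\<bar> <= b \<alpha> \<gamma>" by metis
 define I where "I = {\<alpha>::'n multi_index. len \<alpha> = m}"
 have finI: "finite I" unfolding I_def by (rule finite_mi_length_eq)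
 \<comment> \<open>bounds all commutator terms \<open>W\<close> of the Leibniz formula at once\<close>
 define \<kappa> where "\<kappa> = (\<Sum>\<alpha>\<in>{\<alpha>::'n multi_index. len \<alpha> <= m}. \<Sum>\<gamma>\<in>{\<gamma>. len \<gamma> < m}. b \<alpha> \<gamma>)"
 have \<kappa>0: "\<kappa> >= 0" unfolding \<kappa>_def by (intro sum_nonneg b)
 define A where "A = real (card I) * real (card I) * \<bar>M\<bar> * \<kappa> + 1"
 define CX where "CX = (A + (1 + \<kappa>)) / c + 1"
 have A0: "A >= 0" using \<kappa>0 by (simp add: A_def)
 have CX0: "CX >= 0" using A0 \<kappa>0 c by (simp add: CX_def)
 define C where "C = CX / c0 ^ m + 1"
 have C0: "C >= 0" using CX0 c0 by (simp add: C_def)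
 have main: "nrm_on (ball 0 r) (dq h i (D \<alpha>)) <= C * Z"
  if ell: "elliptic_with m c a" and aM: "!!\<alpha> \<beta>. len \<alpha> = m ==> len \<beta> = m ==> \<bar>a \<alpha> \<beta>\<bar> <= M"
   and D: "jet m (ball 0 R) D" and DZ: "!!\<alpha>. len \<alpha> <= m ==> nrm (D \<alpha>) <= Z"
   and Dz: "!!\<alpha> x. len \<alpha> <= m ==> norm x > R \<or> x $ lastix < 0 ==> D \<alpha> x = 0"
   and f1: "L2b f1" "nrm f1 <= Z" and \<sigma>: "len \<sigma> < m"
   and eq: "!!\<phi>. \<phi> \<in> test_functions (half_ball R) ==> (\<Sum>\<alpha> | len \<alpha> = m. \<Sum>\<beta> | len \<beta> = m.
    a \<alpha> \<beta> * ip (D \<alpha>) (mi_partial \<beta> \<phi>)) = ip f1 (mi_partial \<sigma> \<phi>)"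
   and i: "i ~= lastix" and h: "h ~= 0" "\<bar>h\<bar> < h0" and \<alpha>: "len \<alpha> <= m"
  for a :: "'n coeffs" and D :: "'n multi_index => 'n rfun" and f1 \<sigma> and i :: 'n and Z h and \<alpha> :: "'n multi_index"
 proof -
  let ?e = "axis i 1 :: real^'n::_"
  have Z0: "Z >= 0" using f1(2) nrm_nonneg[of f1] by linarith
  have M0: "\<bar>a \<alpha> \<beta>\<bar> <= \<bar>M\<bar>" if "len \<alpha> = m" "len \<beta> = m" for \<alpha> \<beta> using aM[OF that] by linarith
  have nh: "norm (t *\<^sub>R ?e) = \<bar>t\<bar>" for t by simp
  define V where "V \<gamma> = dq h i (D \<gamma>)" for \<gamma>
  have LD: "L2b (D \<gamma>)" if "len \<gamma> <= m" for \<gamma> by (rule jet_L2b[OF D that])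
  have JV: "jet m (ball 0 R2) V"
   unfolding V_def
  proof (rule jet_dq[OF D])
   show "ball 0 R2 \<subseteq> ball (0::real^'n::_) R" using radii by auto
   show "x + h *\<^sub>R ?e \<in> ball 0 R" if "x \<in> ball 0 R2" for x
    using that norm_triangle_ineq[of x "h *\<^sub>R ?e"] nh[of h] h radii by simp
  qed
  have LV: "L2b (V \<gamma>)" if "len \<gamma> <= m" for \<gamma> by (rule jet_L2b[OF JV that])
  have Vz: "V \<gamma> x = 0" if "len \<gamma> <= m" "x $ lastix < 0" for \<gamma> x
  proof -
   have "(x + h *\<^sub>R ?e) $ lastix = x $ lastix" using i by (simp add: axis_def)
   then have "(x + h *\<^sub>R ?e) $ lastix < 0" using that(2) by (simp only:)
   from Dz[OF that(1) disjI2[OF this]] Dz[OF that(1) disjI2[OF that(2)]]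
   show ?thesis by (simp add: V_def dq_def)
  qed
  have YV: "nrm_on (ball 0 R2) (V \<gamma>) <= Z" if \<gamma>: "len \<gamma> < m" for \<gamma>
  proof -
   have l: "len \<gamma> <= m" "len (inc \<gamma> i) <= m" using \<gamma> by auto
   have "nrm_on (ball 0 R2) (V \<gamma>) <= nrm_on (ball 0 (R2 + h0)) (D (inc \<gamma> i))"
    unfolding V_def
   proof (rule nrm_dq_le[OF jet_wd1[OF D \<gamma>] LD[OF l(1)] LD[OF l(2)]])
    show "D \<gamma> x = 0" if "norm x > R" for x using Dz[OF l(1)] that by blast
    show "x + (t * h) *\<^sub>R ?e \<in> ball 0 (R2 + h0)" if "x \<in> ball 0 R2" "0 <= t" "t <= 1" for x t
    proof -
     have "\<bar>t * h\<bar> <= \<bar>h\<bar>" using that by (simp add: abs_mult mult_left_le_one_le)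
     then show ?thesis using that norm_triangle_ineq[of x "(t * h) *\<^sub>R ?e"] nh[of "t * h"] h by simp
    qed
    show "ball x h0 \<subseteq> ball 0 R" if "x \<in> ball 0 (R2 + h0)" for x :: "real^'n::_"
    proof
     fix y assume "y \<in> ball x h0"
     then show "y \<in> ball 0 R"
      using that radii norm_triangle_ineq2[of y x] by (simp add: dist_norm norm_minus_commute)
    qed
   qed (use h radii in auto)
   also have "\<dots> <= nrm (D (inc \<gamma> i))" by (rule nrm_indicator_le[OF LD[OF l(2)]]) simp
   also have "\<dots> <= Z" by (rule DZ[OF l(2)])
   finally show ?thesis .
  qed
  define W where "W \<beta> x = (\<Sum>\<gamma> | len \<gamma> < len \<beta>. cc \<beta> \<gamma> x * V \<gamma> x)" for \<beta> x
  have LcV: "L2b (%x. cc \<beta> \<gamma> x * V \<gamma> x)" and ncV: "nrm (%x. cc \<beta> \<gamma> x * V \<gamma> x) <= b \<beta> \<gamma> * Z"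
   if \<beta>: "len \<beta> <= m" and \<gamma>: "len \<gamma> < len \<beta>" for \<beta> \<gamma>
  proof -
   have l: "len \<gamma> < m" using \<beta> \<gamma> by simp
   show "L2b (%x. cc \<beta> \<gamma> x * V \<gamma> x)"
    by (rule L2b_bounded_mult[OF LV test_borel[OF cct[OF \<beta>]] b(2)[OF \<beta>]]) (use l in simp)
   have "cc \<beta> \<gamma> x = 0" if "x \<notin> ball 0 R2" for x
    using test_functionsE[OF cct[OF \<beta>]] that by (metis subsetD)
   then have "(%x. cc \<beta> \<gamma> x * V \<gamma> x) = (%x. cc \<beta> \<gamma> x * (ind (ball 0 R2) x * V \<gamma> x))"
    by (auto simp: indicator_def fun_eq_iff)
   then have "nrm (%x. cc \<beta> \<gamma> x * V \<gamma> x) <= b \<beta> \<gamma> * nrm_on (ball 0 R2) (V \<gamma>)"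
    using nrm_bounded_mult[OF L2b_indicator[OF LV] test_borel[OF cct[OF \<beta>]] b(2)[OF \<beta>]] l by simp
   also have "\<dots> <= b \<beta> \<gamma> * Z" by (intro mult_left_mono YV l b)
   finally show "nrm (%x. cc \<beta> \<gamma> x * V \<gamma> x) <= b \<beta> \<gamma> * Z" .
  qed
  have LW: "L2b (W \<beta>)" if "len \<beta> <= m" for \<beta>
   unfolding W_def by (rule L2b_sum[OF finite_mi_length_less]) (use LcV[OF that] in simp)
  have nW: "nrm (W \<beta>) <= \<kappa> * Z" if \<beta>: "len \<beta> <= m" for \<beta>
  proof -
   have "nrm (W \<beta>) <= (\<Sum>\<gamma> | len \<gamma> < len \<beta>. nrm (%x. cc \<beta> \<gamma> x * V \<gamma> x))"
    unfolding W_def by (rule nrm_sum[OF finite_mi_length_less]) (use LcV[OF \<beta>] in simp)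
   also have "\<dots> <= (\<Sum>\<gamma> | len \<gamma> < len \<beta>. b \<beta> \<gamma> * Z)"
    by (rule sum_mono) (use ncV[OF \<beta>] in simp)
   also have "\<dots> <= (\<Sum>\<gamma> | len \<gamma> < m. b \<beta> \<gamma> * Z)"
    by (rule sum_mono2[OF finite_mi_length_less]) (use \<beta> b Z0 in auto)
   also have "\<dots> = (\<Sum>\<gamma> | len \<gamma> < m. b \<beta> \<gamma>) * Z" by (simp add: sum_distrib_right)
   also have "\<dots> <= \<kappa> * Z"
    unfolding \<kappa>_def
    by (intro mult_right_mono Z0 member_le_sum[where f="%\<alpha>. \<Sum>\<gamma> | len \<gamma> < m. b \<alpha> \<gamma>"])
     (use \<beta> finite_mi_length_le in \<open>auto intro: sum_nonneg b\<close>)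
   finally show ?thesis .
  qed
  have pw: "(%x. \<eta> x ^ k) \<in> borel_measurable borel" "\<bar>\<eta> x ^ k\<bar> <= 1" for k x
   using C_infinity_borel[OF C_infinity_power[OF test_smooth[OF \<eta>(1)]]] \<eta>(2,3)
   by (auto simp: power_le_one)
  have Lp: "L2b (%x. \<eta> x ^ k * g x)" and np: "nrm (%x. \<eta> x ^ k * g x) <= nrm g" if "L2b g" for k g
   using L2b_bounded_mult[OF that pw] nrm_bounded_mult[OF that pw] by simp_all
  define \<Phi> where "\<Phi> \<beta> x = \<eta> x ^ (2*m) * V \<beta> x + \<eta> x ^ (2*m - len \<beta>) * W \<beta> x" for \<beta> x
  have \<Phi>0: "\<Phi> (%_. 0) = (%x. \<eta> x ^ (2*m) * V (%_. 0) x)" by (simp add: \<Phi>_def W_def fun_eq_iff)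
  have L\<Phi>: "L2b (\<Phi> \<beta>)" if "len \<beta> <= m" for \<beta>
   unfolding \<Phi>_def by (intro L2b_add Lp LV LW that)
  have J\<Phi>: "jet m UNIV \<Phi>"
   unfolding jet_def
  proof (intro allI impI conjI L\<Phi>)
   fix \<beta> :: "'n multi_index" assume \<beta>: "len \<beta> <= m"
   from ccw[OF \<beta> JV] show "wd UNIV \<beta> (\<Phi> (%_. 0)) (\<Phi> \<beta>)"
    unfolding \<Phi>0 by (simp add: \<Phi>_def[abs_def] W_def)
  qed
  have \<Phi>z: "\<Phi> \<beta> x = 0" if "len \<beta> <= m" "norm x > s \<or> x $ lastix < 0" for \<beta> x
  proof -
   have e: "2 * m - len \<beta> ~= 0" "2 * m ~= 0" using that m by simp_all
   show ?thesis
    using that(2)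
   proof
    assume "norm x > s"
    then show ?thesis using \<eta>(4)[of x] e by (simp add: \<Phi>_def zero_power)
   next
    assume x: "x $ lastix < 0"
    have "W \<beta> x = 0" unfolding W_def by (rule sum.neutral) (use Vz[OF _ x] that(1) in simp)
    then show ?thesis using Vz[OF that(1) x] by (simp add: \<Phi>_def)
   qed
  qed
  define \<Psi> where "\<Psi> \<beta> = dq (- h) i (\<Phi> \<beta>)" for \<beta>
  have J\<Psi>: "jet m UNIV \<Psi>" unfolding \<Psi>_def by (rule jet_dq[OF J\<Phi>]) auto
  have \<Psi>z: "\<Psi> (%_. 0) x = 0" if "norm x > s + h0 \<or> x $ lastix < 0" for x
  proof -
   have 1: "(x + (- h) *\<^sub>R ?e) $ lastix = x $ lastix" using i by (simp add: axis_def)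
   have "norm (x + (- h) *\<^sub>R ?e) >= norm x - \<bar>h\<bar>"
    using norm_diff_ineq[of x "(- h) *\<^sub>R ?e"] nh[of "- h"] by simp
   then have "norm (x + (- h) *\<^sub>R ?e) > s \<or> x $ lastix < 0" "norm x > s \<or> x $ lastix < 0"
    using that h radii by auto
   then have "\<Phi> (%_. 0) x = 0" "\<Phi> (%_. 0) (x + (- h) *\<^sub>R ?e) = 0"
    using \<Phi>z[of "%_. 0" x] \<Phi>z[of "%_. 0" "x + (- h) *\<^sub>R ?e"] 1 by auto
   then show ?thesis by (simp add: \<Psi>_def dq_def)
  qed
  define G where "G \<beta> x = (if len \<beta> = m then (\<Sum>\<alpha>\<in>I. a \<alpha> \<beta> * D \<alpha> x) else 0)
    - (if \<beta> = \<sigma> then f1 x else 0)" for \<beta> x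
  have LG1: "L2b (%x. if len \<beta> = m then (\<Sum>\<alpha>\<in>I. a \<alpha> \<beta> * D \<alpha> x) else 0)" for \<beta>
  proof (cases "len \<beta> = m")
   case True
   have "L2b (%x. \<Sum>\<alpha>\<in>I. a \<alpha> \<beta> * D \<alpha> x)"
    by (intro L2b_sum finI L2b_cmult LD) (simp add: I_def)
   then show ?thesis using True by simp
  qed (simp add: L2b_zero)
  have LG2: "L2b (%x. if \<beta> = \<sigma> then f1 x else 0)" for \<beta>
   by (cases "\<beta> = \<sigma>") (simp_all add: f1 L2b_zero)
  have LG: "L2b (G \<beta>)" for \<beta> unfolding G_def by (intro L2b_diff LG1 LG2)
  have Gsum: "(\<Sum>\<beta> | len \<beta> <= m. ip (G \<beta>) (X \<beta>))
    = (\<Sum>\<alpha>\<in>I. \<Sum>\<beta>\<in>I. a \<alpha> \<beta> * ip (D \<alpha>) (X \<beta>)) - ip f1 (X \<sigma>)"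
   if X: "!!\<beta>. len \<beta> <= m ==> L2b (X \<beta>)" for X
  proof -
   have e: "ip (G \<beta>) (X \<beta>) = (if \<beta> \<in> I then (\<Sum>\<alpha>\<in>I. a \<alpha> \<beta> * ip (D \<alpha>) (X \<beta>)) else 0)
     - (if \<beta> = \<sigma> then ip f1 (X \<beta>) else 0)" if "len \<beta> <= m" for \<beta>
   proof -
    have "ip (G \<beta>) (X \<beta>) = ip (%x. if len \<beta> = m then (\<Sum>\<alpha>\<in>I. a \<alpha> \<beta> * D \<alpha> x) else 0) (X \<beta>)
      - ip (%x. if \<beta> = \<sigma> then f1 x else 0) (X \<beta>)"
     unfolding G_def by (rule ip_diff_left[OF LG1 LG2 X[OF that]])
    moreover have "ip (%x. if len \<beta> = m then (\<Sum>\<alpha>\<in>I. a \<alpha> \<beta> * D \<alpha> x) else 0) (X \<beta>)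
      = (if \<beta> \<in> I then (\<Sum>\<alpha>\<in>I. a \<alpha> \<beta> * ip (D \<alpha>) (X \<beta>)) else 0)"
    proof (cases "len \<beta> = m")
     case True
     have "ip (%x. \<Sum>\<alpha>\<in>I. a \<alpha> \<beta> * D \<alpha> x) (X \<beta>) = (\<Sum>\<alpha>\<in>I. ip (%x. a \<alpha> \<beta> * D \<alpha> x) (X \<beta>))"
      by (rule ip_sum_left[OF finI L2b_cmult[OF LD] X[OF that]]) (simp add: I_def)
     then show ?thesis using True by (simp add: I_def ip_cmult_left)
    qed (simp add: I_def ip_def)
    moreover have "ip (%x. if \<beta> = \<sigma> then f1 x else 0) (X \<beta>) = (if \<beta> = \<sigma> then ip f1 (X \<beta>) else 0)"
     by (cases "\<beta> = \<sigma>") (simp_all add: ip_def)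
    ultimately show ?thesis by simp
   qed
   have "(\<Sum>\<beta> | len \<beta> <= m. ip (G \<beta>) (X \<beta>))
     = (\<Sum>\<beta> | len \<beta> <= m. if \<beta> \<in> I then (\<Sum>\<alpha>\<in>I. a \<alpha> \<beta> * ip (D \<alpha>) (X \<beta>)) else 0)
      - (\<Sum>\<beta> | len \<beta> <= m. if \<beta> = \<sigma> then ip f1 (X \<beta>) else 0)"
    using e by (simp add: sum_subtractf[symmetric])
   also have "(\<Sum>\<beta> | len \<beta> <= m. if \<beta> \<in> I then (\<Sum>\<alpha>\<in>I. a \<alpha> \<beta> * ip (D \<alpha>) (X \<beta>)) else 0)
     = (\<Sum>\<beta>\<in>{\<beta>. len \<beta> <= m} \<inter> I. \<Sum>\<alpha>\<in>I. a \<alpha> \<beta> * ip (D \<alpha>) (X \<beta>))"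
    by (rule sum.inter_restrict[OF finite_mi_length_le, symmetric])
   also have "{\<beta>. len \<beta> <= m} \<inter> I = I" by (auto simp: I_def)
   also have "(\<Sum>\<beta>\<in>I. \<Sum>\<alpha>\<in>I. a \<alpha> \<beta> * ip (D \<alpha>) (X \<beta>)) = (\<Sum>\<alpha>\<in>I. \<Sum>\<beta>\<in>I. a \<alpha> \<beta> * ip (D \<alpha>) (X \<beta>))"
    by (rule sum.swap)
   also have "(\<Sum>\<beta> | len \<beta> <= m. if \<beta> = \<sigma> then ip f1 (X \<beta>) else 0) = ip f1 (X \<sigma>)"
    using \<sigma> by (simp add: finite_mi_length_le sum.delta)
   finally show ?thesis .
  qed
  have "(\<Sum>\<beta> | len \<beta> <= m. ip (G \<beta>) (\<Psi> \<beta>)) = 0"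
  proof (rule weak_equation_extend[where R=R and R'="s + h0"])
   fix \<phi> :: "'n rfun" assume \<phi>: "\<phi> \<in> test_functions (half_ball R)"
   show "(\<Sum>\<beta> | len \<beta> <= m. ip (G \<beta>) (mi_partial \<beta> \<phi>)) = 0"
    using Gsum[of "%\<beta>. mi_partial \<beta> \<phi>"] eq[OF \<phi>] test_L2b[OF test_mi_partial[OF \<phi>]]
    by (simp add: I_def)
  qed (use LG J\<Psi> radii \<Psi>z in auto)
  then have eq1: "(\<Sum>\<alpha>\<in>I. \<Sum>\<beta>\<in>I. a \<alpha> \<beta> * ip (D \<alpha>) (\<Psi> \<beta>)) = ip f1 (\<Psi> \<sigma>)"
   using Gsum[OF jet_L2b[OF J\<Psi>]] by simp
  define F where "F \<alpha> x = \<eta> x ^ m * V \<alpha> x" for \<alpha> x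
  have LF: "L2b (F \<alpha>)" if "len \<alpha> <= m" for \<alpha> unfolding F_def by (intro Lp LV that)
  have ip1: "ip (D \<alpha>) (\<Psi> \<beta>) = - (ip (F \<alpha>) (F \<beta>) + ip (F \<alpha>) (W \<beta>))" if "\<alpha> \<in> I" "\<beta> \<in> I" for \<alpha> \<beta>
  proof -
   have l: "len \<alpha> <= m" "len \<beta> <= m" "len \<beta> = m" using that by (auto simp: I_def)
   have "ip (D \<alpha>) (\<Psi> \<beta>) = - ip (V \<alpha>) (\<Phi> \<beta>)"
    unfolding \<Psi>_def V_def by (rule ip_dq[OF LD L\<Phi>]) (use l in auto)
   also have "ip (V \<alpha>) (\<Phi> \<beta>) = ip (F \<alpha>) (%x. F \<beta> x + W \<beta> x)"
   proof -
    have "\<eta> x ^ (2*m) = \<eta> x ^ m * \<eta> x ^ m" for x by (simp only: mult_2 power_add)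
    then have "V \<alpha> x * \<Phi> \<beta> x = F \<alpha> x * (F \<beta> x + W \<beta> x)" for x
     unfolding \<Phi>_def F_def l(3) by (simp add: algebra_simps)
    then show ?thesis by (simp add: ip_def)
   qed
   also have "\<dots> = ip (F \<alpha>) (F \<beta>) + ip (F \<alpha>) (W \<beta>)"
    by (rule ip_add_right[OF LF LW LF]) (use l in auto)
   finally show ?thesis .
  qed
  define Q where "Q = (\<Sum>\<alpha>\<in>I. (nrm (F \<alpha>))\<^sup>2)"
  define X where "X = sqrt Q"
  have Q0: "Q >= 0" unfolding Q_def by (intro sum_nonneg) simp
  have X0: "X >= 0" and X2: "X\<^sup>2 = Q" using Q0 by (simp_all add: X_def)
  have FX: "nrm (F \<alpha>) <= X" if "\<alpha> \<in> I" for \<alpha>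
  proof -
   have "(nrm (F \<alpha>))\<^sup>2 <= Q" unfolding Q_def using that finI by (intro member_le_sum) auto
   then show ?thesis unfolding X_def by (rule real_le_rsqrt)
  qed
  have e1: "c * X\<^sup>2 <= (\<Sum>\<alpha>\<in>I. \<Sum>\<beta>\<in>I. a \<alpha> \<beta> * ip (F \<alpha>) (F \<beta>))"
   using elliptic_ip[OF ell, of F] LF unfolding X2 Q_def I_def by simp
  have e2: "(\<Sum>\<alpha>\<in>I. \<Sum>\<beta>\<in>I. a \<alpha> \<beta> * ip (F \<alpha>) (F \<beta>))
    = - ip f1 (\<Psi> \<sigma>) - (\<Sum>\<alpha>\<in>I. \<Sum>\<beta>\<in>I. a \<alpha> \<beta> * ip (F \<alpha>) (W \<beta>))"
  proof -
   have "(\<Sum>\<alpha>\<in>I. \<Sum>\<beta>\<in>I. a \<alpha> \<beta> * ip (D \<alpha>) (\<Psi> \<beta>))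
     = (\<Sum>\<alpha>\<in>I. \<Sum>\<beta>\<in>I. - (a \<alpha> \<beta> * ip (F \<alpha>) (F \<beta>)) - a \<alpha> \<beta> * ip (F \<alpha>) (W \<beta>))"
    by (intro sum.cong refl) (simp add: ip1 algebra_simps)
   also have "\<dots> = - (\<Sum>\<alpha>\<in>I. \<Sum>\<beta>\<in>I. a \<alpha> \<beta> * ip (F \<alpha>) (F \<beta>)) - (\<Sum>\<alpha>\<in>I. \<Sum>\<beta>\<in>I. a \<alpha> \<beta> * ip (F \<alpha>) (W \<beta>))"
    by (simp add: sum_subtractf sum_negf)
   finally show ?thesis using eq1 by linarith
  qed
  have e3: "\<bar>\<Sum>\<alpha>\<in>I. \<Sum>\<beta>\<in>I. a \<alpha> \<beta> * ip (F \<alpha>) (W \<beta>)\<bar> <= (real (card I) * real (card I) * \<bar>M\<bar> * \<kappa>) * Z * X"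
  proof -
   have "\<bar>\<Sum>\<alpha>\<in>I. \<Sum>\<beta>\<in>I. a \<alpha> \<beta> * ip (F \<alpha>) (W \<beta>)\<bar> <= (\<Sum>\<alpha>\<in>I. \<Sum>\<beta>\<in>I. \<bar>a \<alpha> \<beta> * ip (F \<alpha>) (W \<beta>)\<bar>)"
    by (rule order_trans[OF sum_abs]) (intro sum_mono sum_abs)
   also have "\<dots> <= (\<Sum>\<alpha>\<in>I. \<Sum>\<beta>\<in>I. \<bar>M\<bar> * (X * (\<kappa> * Z)))"
   proof (intro sum_mono)
    fix \<alpha> \<beta> assume ab: "\<alpha> \<in> I" "\<beta> \<in> I"
    then have l: "len \<alpha> = m" "len \<beta> = m" by (auto simp: I_def)
    have "\<bar>ip (F \<alpha>) (W \<beta>)\<bar> <= nrm (F \<alpha>) * nrm (W \<beta>)"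
     by (rule ip_Cauchy_Schwarz[OF LF LW]) (use l in auto)
    also have "\<dots> <= X * (\<kappa> * Z)" by (intro mult_mono FX ab nW X0) (use l in auto)
    finally show "\<bar>a \<alpha> \<beta> * ip (F \<alpha>) (W \<beta>)\<bar> <= \<bar>M\<bar> * (X * (\<kappa> * Z))"
     unfolding abs_mult by (intro mult_mono M0 l) auto
   qed
   also have "\<dots> = (real (card I) * real (card I) * \<bar>M\<bar> * \<kappa>) * Z * X" by simp
   finally show ?thesis .
  qed
  have n\<Psi>: "nrm (\<Psi> \<sigma>) <= X + (1 + \<kappa>) * Z"
  proof -
   have l: "len \<sigma> <= m" "len (inc \<sigma> i) <= m" using \<sigma> by auto
   have "nrm_on UNIV (\<Psi> \<sigma>) <= nrm_on UNIV (\<Phi> (inc \<sigma> i))"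
    unfolding \<Psi>_def
    by (rule nrm_dq_le[OF jet_wd1[OF J\<Phi> \<sigma>] L\<Phi>[OF l(1)] L\<Phi>[OF l(2)], of s _ _ _ 1])
     (use \<Phi>z[OF l(1)] h in auto)
   then have "nrm (\<Psi> \<sigma>) <= nrm (\<Phi> (inc \<sigma> i))" by simp
   also have "\<dots> <= nrm (%x. \<eta> x ^ (2*m) * V (inc \<sigma> i) x) + nrm (%x. \<eta> x ^ (2*m - len (inc \<sigma> i)) * W (inc \<sigma> i) x)"
    unfolding \<Phi>_def by (rule nrm_triangle[OF Lp[OF LV[OF l(2)]] Lp[OF LW[OF l(2)]]])
   also have "\<dots> <= (X + Z) + \<kappa> * Z"
   proof (rule add_mono)
    show "nrm (%x. \<eta> x ^ (2*m - len (inc \<sigma> i)) * W (inc \<sigma> i) x) <= \<kappa> * Z"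
     by (rule order_trans[OF np[OF LW[OF l(2)]] nW[OF l(2)]])
    show "nrm (%x. \<eta> x ^ (2*m) * V (inc \<sigma> i) x) <= X + Z"
    proof (cases "len (inc \<sigma> i) = m")
     case True
     have "(%x. \<eta> x ^ (2*m) * V (inc \<sigma> i) x) = (%x. \<eta> x ^ m * F (inc \<sigma> i) x)"
      by (simp add: F_def mult_2 power_add mult.assoc)
     then have "nrm (%x. \<eta> x ^ (2*m) * V (inc \<sigma> i) x) <= nrm (F (inc \<sigma> i))"
      using np[OF LF[OF l(2)], of m] by simp
     also have "\<dots> <= X" by (rule FX) (use True in \<open>simp add: I_def\<close>)
     finally show ?thesis using Z0 by simp
    next
     case False
     then have l': "len (inc \<sigma> i) < m" using l by simp
     have z: "\<eta> x = 0" if "x \<notin> ball 0 R2" for x using \<eta>(4)[of x] that radii by simp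
     have "(%x. \<eta> x ^ (2*m) * V (inc \<sigma> i) x) = (%x. \<eta> x ^ (2*m) * (ind (ball 0 R2) x * V (inc \<sigma> i) x))"
      using z m by (auto simp: indicator_def fun_eq_iff)
     then have "nrm (%x. \<eta> x ^ (2*m) * V (inc \<sigma> i) x) <= nrm_on (ball 0 R2) (V (inc \<sigma> i))"
      using np[OF L2b_indicator[OF LV[OF l(2)]], of "ball 0 R2" "2*m"] by simp
     also have "\<dots> <= Z" by (rule YV[OF l'])
     finally show ?thesis using X0 by simp
    qed
   qed
   finally show ?thesis by (simp add: algebra_simps)
  qed
  have "\<bar>ip f1 (\<Psi> \<sigma>)\<bar> <= nrm f1 * nrm (\<Psi> \<sigma>)"
   by (rule ip_Cauchy_Schwarz[OF f1(1) jet_L2b[OF J\<Psi>]]) (use \<sigma> in simp)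
  also have "\<dots> <= Z * (X + (1 + \<kappa>) * Z)" by (intro mult_mono f1 n\<Psi> Z0) simp
  finally have e4: "\<bar>ip f1 (\<Psi> \<sigma>)\<bar> <= Z * X + (1 + \<kappa>) * Z\<^sup>2" by (simp add: power2_eq_square algebra_simps)
  have "c * X\<^sup>2 <= A * Z * X + (1 + \<kappa>) * Z\<^sup>2"
   using e1 e2 e3 e4 unfolding A_def by (simp add: distrib_right)
  then have XC: "X <= CX * Z"
   unfolding CX_def by (rule quadratic_absorb[OF c A0 _ Z0 X0, rotated]) (use \<kappa>0 in simp)
  show ?thesis
  proof (cases "len \<alpha> = m")
   case True
   have "nrm_on (ball 0 r) (V \<alpha>) <= nrm (%x. (1 / c0 ^ m) * F \<alpha> x)"
   proof (rule nrm_mono)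
    show "L2b (%x. (1 / c0 ^ m) * F \<alpha> x)" by (intro L2b_cmult LF \<alpha>)
    show "(%x. ind (ball 0 r) x * V \<alpha> x) \<in> borel_measurable borel"
     using L2b_indicator[OF LV[OF \<alpha>], of "ball 0 r"] by (simp add: L2b_def)
    fix x
    show "\<bar>ind (ball 0 r) x * V \<alpha> x\<bar> <= \<bar>(1 / c0 ^ m) * F \<alpha> x\<bar>"
    proof (cases "x \<in> ball 0 r")
     case True
     then have "c0 ^ m <= \<eta> x ^ m" using c0 by (intro power_mono) auto
     then have "1 <= (1 / c0 ^ m) * \<eta> x ^ m" using c0 by (simp add: field_simps)
     then have "1 * \<bar>V \<alpha> x\<bar> <= ((1 / c0 ^ m) * \<eta> x ^ m) * \<bar>V \<alpha> x\<bar>" by (intro mult_right_mono) auto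
     then show ?thesis using True c0 \<eta>(2)[of x] by (simp add: F_def abs_mult)
    qed simp
   qed
   also have "\<dots> = (1 / c0 ^ m) * nrm (F \<alpha>)" unfolding nrm_cmult using c0 by simp
   also have "\<dots> <= (1 / c0 ^ m) * (CX * Z)"
    using FX[of \<alpha>] XC True c0 by (intro mult_left_mono) (auto simp: I_def)
   also have "\<dots> <= C * Z" using Z0 by (simp add: C_def distrib_right)
   finally show ?thesis by (simp add: V_def)
  next
   case False
   then have l: "len \<alpha> < m" using \<alpha> by simp
   have "nrm_on (ball 0 r) (V \<alpha>) = nrm (%x. ind (ball 0 r) x * (ind (ball 0 R2) x * V \<alpha> x))"
    using radii by (intro arg_cong[of _ _ nrm]) (auto simp: indicator_def fun_eq_iff)
   also have "\<dots> <= nrm_on (ball 0 R2) (V \<alpha>)"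
    by (rule nrm_indicator_le[OF L2b_indicator[OF LV[OF \<alpha>]]]) simp_all
   also have "\<dots> <= Z" by (rule YV[OF l])
   also have "\<dots> <= C * Z"
    using Z0 CX0 c0 by (simp add: C_def distrib_right)
   finally show ?thesis by (simp add: V_def)
  qed
 qed
 show ?thesis
  by (rule exI[of _ C], rule exI[of _ h0], intro conjI C0 radii(4) allI impI, rule main) auto
qed

text \<open>The uniformly bounded difference quotients converge to the derivative as functionals on test functions.\<close>

lemma tangential_step:
 fixes c M r R :: real and m :: nat
 assumes m: "m >= 1" and c: "c > 0" and r: "0 < r" "r < R"
 shows "\<exists>C. C >= 0 \<and> (\<forall>(a :: 'n::{finite,wellorder} coeffs) D f1 \<sigma> i Z \<alpha>.
  elliptic_with m c a --> (\<forall>\<alpha> \<beta>. len \<alpha> = m --> len \<beta> = m --> \<bar>a \<alpha> \<beta>\<bar> <= M) -->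
  jet m (ball 0 R) D -->
  (\<forall>\<alpha>. len \<alpha> <= m --> nrm (D \<alpha>) <= Z \<and> (\<forall>x. norm x > R \<or> x $ lastix < 0 --> D \<alpha> x = 0)) -->
  L2b f1 --> nrm f1 <= Z --> len \<sigma> < m -->
  (\<forall>\<phi>\<in>test_functions (half_ball R). (\<Sum>\<alpha> | len \<alpha> = m. \<Sum>\<beta> | len \<beta> = m.
    a \<alpha> \<beta> * ip (D \<alpha>) (mi_partial \<beta> \<phi>)) = ip f1 (mi_partial \<sigma> \<phi>)) -->
  i ~= lastix --> len \<alpha> <= m -->
  (\<exists>E. L2b E \<and> wd1 (ball 0 r) i (D \<alpha>) E \<and> nrm E <= C * Z))"
proof -
 obtain C h0 where C: "C >= 0" "h0 > 0" and est: "\<forall>(a :: 'n::{finite,wellorder} coeffs) D f1 \<sigma> i Z h \<alpha>.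
  elliptic_with m c a --> (\<forall>\<alpha> \<beta>. len \<alpha> = m --> len \<beta> = m --> \<bar>a \<alpha> \<beta>\<bar> <= M) -->
  jet m (ball 0 R) D -->
  (\<forall>\<alpha>. len \<alpha> <= m --> nrm (D \<alpha>) <= Z \<and> (\<forall>x. norm x > R \<or> x $ lastix < 0 --> D \<alpha> x = 0)) -->
  L2b f1 --> nrm f1 <= Z --> len \<sigma> < m -->
  (\<forall>\<phi>\<in>test_functions (half_ball R). (\<Sum>\<alpha> | len \<alpha> = m. \<Sum>\<beta> | len \<beta> = m.
    a \<alpha> \<beta> * ip (D \<alpha>) (mi_partial \<beta> \<phi>)) = ip f1 (mi_partial \<sigma> \<phi>)) -->
  i ~= lastix --> h ~= 0 --> \<bar>h\<bar> < h0 --> len \<alpha> <= m -->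
  nrm_on (ball 0 r) (dq h i (D \<alpha>)) <= C * Z"
  using difference_quotient_estimate[OF assms, of M] by blast
 show ?thesis
 proof (intro exI[of _ C] conjI allI impI C(1))
  fix a :: "'n coeffs" and D :: "'n multi_index => 'n rfun" and f1 \<sigma> and i :: 'n and Z and \<alpha> :: "'n multi_index"
  assume h: "elliptic_with m c a" "\<forall>\<alpha> \<beta>. len \<alpha> = m --> len \<beta> = m --> \<bar>a \<alpha> \<beta>\<bar> <= M"
   "jet m (ball 0 R) D"
   "\<forall>\<alpha>. len \<alpha> <= m --> nrm (D \<alpha>) <= Z \<and> (\<forall>x. norm x > R \<or> x $ lastix < 0 --> D \<alpha> x = 0)"
   "L2b f1" "nrm f1 <= Z" "len \<sigma> < m"
   "\<forall>\<phi>\<in>test_functions (half_ball R). (\<Sum>\<alpha> | len \<alpha> = m. \<Sum>\<beta> | len \<beta> = m.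
    a \<alpha> \<beta> * ip (D \<alpha>) (mi_partial \<beta> \<phi>)) = ip f1 (mi_partial \<sigma> \<phi>)"
   "i ~= lastix" and \<alpha>: "len \<alpha> <= m"
  have Z0: "Z >= 0" using h(6) nrm_nonneg[of f1] by linarith
  have dqb: "nrm_on (ball 0 r) (dq k i (D \<alpha>)) <= C * Z" if "k ~= 0" "\<bar>k\<bar> < h0" for k
   by (rule est[rule_format, OF h(1) h(2)[rule_format] h(3) h(4)[rule_format] h(5,6,7) h(8)[rule_format] h(9) that \<alpha>])
    auto
  have L: "L2b (D \<alpha>)" by (rule jet_L2b[OF h(3) \<alpha>])
  have "\<bar>ip (D \<alpha>) (mi_partial (inc (%_. 0) i) \<phi>)\<bar> <= (C * Z) * nrm \<phi>" if \<phi>: "\<phi> \<in> test_functions (ball 0 r)" for \<phi>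
  proof -
   obtain B where B: "B >= 0" "!!h. \<bar>h\<bar> <= 1 ==>
    nrm (%x. \<phi> (x + h *\<^sub>R axis i 1) - \<phi> x - h * partial i \<phi> x) <= B * h\<^sup>2"
    using test_difference_quotient[OF \<phi>] by blast
   have L\<phi>: "L2b \<phi>" by (rule test_L2b[OF \<phi>])
   have zero: "\<phi> x = 0" if "x \<notin> ball 0 r" for x using test_functionsE[OF \<phi>] that by (metis subsetD)
   have b: "\<bar>ip (D \<alpha>) (dq k i \<phi>)\<bar> <= (C * Z) * nrm \<phi>" if k: "k ~= 0" "\<bar>k\<bar> < h0" for k
   proof -
    have "ip (D \<alpha>) (dq k i \<phi>) = - ip (dq (- k) i (D \<alpha>)) \<phi>" using ip_dq[OF L L\<phi>, of "- k" i] by simp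
    also have "ip (dq (- k) i (D \<alpha>)) \<phi> = ip (%x. ind (ball 0 r) x * dq (- k) i (D \<alpha>) x) \<phi>"
     unfolding ip_def by (rule Bochner_Integration.integral_cong) (auto simp: indicator_def zero)
    also have "\<bar>- \<dots>\<bar> <= nrm_on (ball 0 r) (dq (- k) i (D \<alpha>)) * nrm \<phi>"
     using ip_Cauchy_Schwarz[OF L2b_indicator[OF L2b_dq[OF L]] L\<phi>] by simp
    also have "\<dots> <= (C * Z) * nrm \<phi>" by (intro mult_right_mono dqb) (use k in auto)
    finally show ?thesis .
   qed
   define k where "k n = 1 / real (Suc n)" for n
   have kl: "k \<longlonglongrightarrow> 0" unfolding k_def using LIMSEQ_inverse_real_of_nat by (simp add: inverse_eq_divide)
   have k01: "k n > 0" "k n <= 1" for n by (auto simp: k_def)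
   have conv: "(%n. nrm (%x. dq (k n) i \<phi> x - partial i \<phi> x)) \<longlonglongrightarrow> 0"
   proof (rule Lim_null_comparison)
    show "(%n. B * k n) \<longlonglongrightarrow> 0" using tendsto_mult_left[OF kl, of B] by simp
    show "\<forall>\<^sub>F n in sequentially. norm (nrm (%x. dq (k n) i \<phi> x - partial i \<phi> x)) <= B * k n"
    proof (rule always_eventually, rule allI)
     fix n
     have "(%x. dq (k n) i \<phi> x - partial i \<phi> x)
       = (%x. (1 / k n) * (\<phi> (x + k n *\<^sub>R axis i 1) - \<phi> x - k n * partial i \<phi> x))"
      using k01[of n] by (simp add: dq_def fun_eq_iff field_simps)
     then have "nrm (%x. dq (k n) i \<phi> x - partial i \<phi> x)
       = (1 / k n) * nrm (%x. \<phi> (x + k n *\<^sub>R axis i 1) - \<phi> x - k n * partial i \<phi> x)"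
      using k01[of n] nrm_cmult[of "1 / k n"] by (simp only:) simp
     also have "\<dots> <= (1 / k n) * (B * (k n)\<^sup>2)"
      using k01[of n] by (intro mult_left_mono B) auto
     also have "\<dots> = B * k n" using k01[of n] by (simp add: power2_eq_square)
     finally show "norm (nrm (%x. dq (k n) i \<phi> x - partial i \<phi> x)) <= B * k n" by simp
    qed
   qed
   have "(%n. ip (dq (k n) i \<phi>) (D \<alpha>)) \<longlonglongrightarrow> ip (partial i \<phi>) (D \<alpha>)"
    by (rule ip_tendsto[OF L2b_dq[OF L\<phi>] test_L2b[OF test_partial[OF \<phi>]] conv L])
   then have lim: "(%n. \<bar>ip (D \<alpha>) (dq (k n) i \<phi>)\<bar>) \<longlonglongrightarrow> \<bar>ip (D \<alpha>) (partial i \<phi>)\<bar>"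
    by (intro tendsto_rabs) (simp add: ip_commute)
   have "\<forall>\<^sub>F n in sequentially. \<bar>ip (D \<alpha>) (dq (k n) i \<phi>)\<bar> <= (C * Z) * nrm \<phi>"
    using order_tendstoD(2)[OF kl C(2)]
   proof eventually_elim
    fix n assume "k n < h0"
    then show "\<bar>ip (D \<alpha>) (dq (k n) i \<phi>)\<bar> <= (C * Z) * nrm \<phi>" using k01[of n] by (intro b) auto
   qed
   then have "\<bar>ip (D \<alpha>) (partial i \<phi>)\<bar> <= (C * Z) * nrm \<phi>"
    by (rule tendsto_upperbound[OF lim _ sequentially_bot])
   then show ?thesis by (simp add: mi_partial_inc test_smooth[OF \<phi>])
  qed
  then obtain E where "L2b E" "wd (ball 0 r) (inc (%_. 0) i) (D \<alpha>) E" "nrm E <= C * Z"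
   using wd_from_bound[OF L, of "C * Z" "ball 0 r" "inc (%_. 0) i"] C(1) Z0 by (metis mult_nonneg_nonneg)
  then show "\<exists>E. L2b E \<and> wd1 (ball 0 r) i (D \<alpha>) E \<and> nrm E <= C * Z" by (auto simp: wd1_iff_wd)
 qed
qed

lemma half_ball_subset: "half_ball r \<subseteq> ball 0 r" by (auto simp: half_ball_def)

lemma half_ball_mono: "r <= R ==> half_ball r \<subseteq> half_ball R" by (auto simp: half_ball_def)

lemma open_lower: "open {x::real^'n::{finite,wellorder}. x $ lastix < 0}"
 by (intro open_Collect_less continuous_intros)

lemma open_half_ball: "open (half_ball r)"
 unfolding half_ball_def by (intro open_Int open_ball open_Collect_less continuous_intros)

lemma norm_split:
 fixes y :: "real^'n::finite"
 shows "(norm y)\<^sup>2 = (norm (y - (y $ i) *\<^sub>R axis i 1))\<^sup>2 + (y $ i)\<^sup>2"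
proof -
 have "y \<bullet> axis i 1 = y $ i" "axis i 1 \<bullet> y = y $ i" "axis i 1 \<bullet> (axis i 1 :: real^'n) = 1"
  by (simp_all add: inner_axis inner_commute[of "axis i 1" y])
 then show ?thesis
  by (simp add: power2_norm_eq_inner inner_diff_left inner_diff_right) (simp add: power2_eq_square)
qed

text \<open>Every point of the ball is moved into the lower half-space by the translation by \<open>-1\<close> along
  the last axis, and the segment meets the half-space \<open>x\<^sub>N > 0\<close> within the same ball.\<close>

lemma Poincare_step:
 fixes D :: "'n::{finite,wellorder} multi_index => 'n rfun"
 assumes D: "jet m (ball 0 1) D" and r: "0 < r" "r < 1" and \<alpha>: "len \<alpha> < m"
  and z: "!!\<alpha> x. len \<alpha> <= m ==> norm x > 1 \<or> x $ lastix < 0 ==> D \<alpha> x = 0"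
 shows "nrm_on (ball 0 r) (D \<alpha>) <= nrm_on (ball 0 r) (D (inc \<alpha> lastix))"
proof -
 let ?e = "axis lastix 1 :: real^'n::_"
 have l: "len \<alpha> <= m" "len (inc \<alpha> lastix) <= m" using \<alpha> by auto
 have L: "L2b (D \<alpha>)" "L2b (D (inc \<alpha> lastix))" using jet_L2b[OF D] l by auto
 define \<epsilon> where "\<epsilon> = (1 - r\<^sup>2) / 2"
 have \<epsilon>: "\<epsilon> > 0" "\<epsilon> <= 1 - r" "\<epsilon> < 1"
 proof -
  have "r\<^sup>2 < 1" using r by (simp add: power_less_one_iff abs_square_less_1)
  then show "\<epsilon> > 0" by (simp add: \<epsilon>_def)
  have "1 - r\<^sup>2 = (1 - r) * (1 + r)" by (simp add: power2_eq_square algebra_simps)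
  also have "\<dots> <= (1 - r) * 2" using r by (intro mult_left_mono) auto
  finally show "\<epsilon> <= 1 - r" by (simp add: \<epsilon>_def)
  then show "\<epsilon> < 1" using r by simp
 qed
 define S' where "S' = ball 0 r \<union> {y::real^'n::_. y $ lastix < 0 \<and> norm (y - (y $ lastix) *\<^sub>R ?e) < r}"
 have "open {y::real^'n::_. y $ lastix < 0 \<and> norm (y - (y $ lastix) *\<^sub>R ?e) < r}"
  by (intro open_Collect_conj open_Collect_less continuous_intros)
 then have S': "S' \<in> sets borel" unfolding S'_def by (intro sets.Un borel_open) auto
 have "nrm (%x. ind (ball 0 r) x * (D \<alpha> (x + (-1) *\<^sub>R ?e) - D \<alpha> x))
   <= \<bar>-1\<bar> * nrm (%x. ind S' x * D (inc \<alpha> lastix) x)"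
 proof (rule increment_le[OF jet_wd1[OF D \<alpha>] L _ _ S' _ \<epsilon>(1)])
  show "D \<alpha> x = 0" if "norm x > 1" for x using z[OF l(1)] that by blast
  show "x + (t * (-1)) *\<^sub>R ?e \<in> S'" if x: "x \<in> ball 0 r" and t: "0 <= t" "t <= 1" for x t
  proof -
   let ?y = "x + (t * (-1)) *\<^sub>R ?e"
   have yN: "?y $ lastix = x $ lastix - t" by simp
   have yx: "?y - (?y $ lastix) *\<^sub>R ?e = x - (x $ lastix) *\<^sub>R ?e"
    unfolding yN by (simp add: algebra_simps)
   show ?thesis
   proof (cases "?y $ lastix < 0")
    case True
    have "(norm (x - (x $ lastix) *\<^sub>R ?e))\<^sup>2 <= (norm x)\<^sup>2" using norm_split[of x lastix] by simp
    then have "norm (x - (x $ lastix) *\<^sub>R ?e) <= norm x" by (rule power2_le_imp_le) simp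
    then show ?thesis using True x unfolding S'_def yx[symmetric] by simp
   next
    case False
    then have "(x $ lastix - t)\<^sup>2 <= (x $ lastix)\<^sup>2" using t yN by (intro power_mono) auto
    then have "(norm ?y)\<^sup>2 <= (norm x)\<^sup>2"
     using norm_split[of x lastix] norm_split[of ?y lastix, unfolded yx, unfolded yN] by linarith
    then have "norm ?y <= norm x" by (rule power2_le_imp_le) simp
    then show ?thesis using x by (simp add: S'_def)
   qed
  qed
  show "ball y \<epsilon> \<subseteq> ball 0 1 \<or> (\<forall>x\<in>ball y \<epsilon>. D \<alpha> x = 0 \<and> D (inc \<alpha> lastix) x = 0)" if y: "y \<in> S'" for y
  proof (cases "norm y < 1 - \<epsilon>")
   case True
   have "x \<in> ball 0 1" if "x \<in> ball y \<epsilon>" for x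
    using that True norm_triangle_ineq2[of x y] by (simp add: dist_norm norm_minus_commute)
   then show ?thesis by blast
  next
   case False
   then have "y \<notin> ball 0 r" using \<epsilon> by simp
   then have yN: "y $ lastix < 0" "norm (y - (y $ lastix) *\<^sub>R ?e) < r" using y by (auto simp: S'_def)
   have "(norm (y - (y $ lastix) *\<^sub>R ?e))\<^sup>2 < r\<^sup>2" using yN(2) by (intro power_strict_mono) auto
   moreover have "(1 - \<epsilon>)\<^sup>2 <= (norm y)\<^sup>2" using False \<epsilon> by (intro power_mono) auto
   ultimately have "(1 - \<epsilon>)\<^sup>2 - r\<^sup>2 < (- (y $ lastix))\<^sup>2" using norm_split[of y lastix] by simp
   moreover have "(1 - \<epsilon>)\<^sup>2 - r\<^sup>2 = \<epsilon>\<^sup>2" by (simp add: \<epsilon>_def power2_eq_square field_simps)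
   ultimately have "\<epsilon> < - (y $ lastix)" using yN(1) by (intro power2_less_imp_less[of \<epsilon>]) auto
   have "x $ lastix < 0" if "x \<in> ball y \<epsilon>" for x
   proof -
    have "\<bar>(x - y) $ lastix\<bar> <= norm (x - y)" by (rule component_le_norm_cart)
    then show ?thesis using that \<open>\<epsilon> < - (y $ lastix)\<close> by (simp add: dist_norm norm_minus_commute)
   qed
   then show ?thesis using z l by blast
  qed
 qed simp
 moreover have "nrm (%x. ind (ball 0 r) x * (D \<alpha> (x + (-1) *\<^sub>R ?e) - D \<alpha> x))
   = nrm_on (ball 0 r) (D \<alpha>)"
 proof -
  have "ind (ball 0 r) x * (D \<alpha> (x + (-1) *\<^sub>R ?e) - D \<alpha> x) = - (ind (ball 0 r) x * D \<alpha> x)" for x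
  proof (cases "x \<in> ball 0 r")
   case True
   then have "x $ lastix < 1" using component_le_norm_cart[of x lastix] r by simp
   then have "(x + (-1) *\<^sub>R ?e) $ lastix < 0" by simp
   from z[OF l(1) disjI2[OF this]] show ?thesis using True by simp
  qed simp
  then show ?thesis by (simp add: nrm_minus)
 qed
 moreover have "nrm (%x. ind S' x * D (inc \<alpha> lastix) x) <= nrm_on (ball 0 r) (D (inc \<alpha> lastix))"
 proof (rule nrm_mono)
  show "L2b (%x. ind (ball 0 r) x * D (inc \<alpha> lastix) x)" by (intro L2b_indicator L) simp
  show "(%x. ind S' x * D (inc \<alpha> lastix) x) \<in> borel_measurable borel"
   using L2b_indicator[OF L(2) S'] by (simp add: L2b_def)
  show "\<bar>ind S' x * D (inc \<alpha> lastix) x\<bar> <= \<bar>ind (ball 0 r) x * D (inc \<alpha> lastix) x\<bar>" for x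
  proof (cases "x \<in> ball 0 r")
   case False
   show ?thesis
   proof (cases "x \<in> S'")
    case True
    then have "x $ lastix < 0" using False by (auto simp: S'_def)
    from z[OF l(2) disjI2[OF this]] show ?thesis by simp
   qed simp
  qed (simp add: S'_def)
 qed
 ultimately show ?thesis by simp
qed

lemma Poincare:
 fixes D :: "'n::{finite,wellorder} multi_index => 'n rfun"
 assumes D: "jet m (ball 0 1) D" and r: "0 < r" "r < 1"
  and z: "!!\<alpha> x. len \<alpha> <= m ==> norm x > 1 \<or> x $ lastix < 0 ==> D \<alpha> x = 0"
  and top: "!!\<alpha>. len \<alpha> = m ==> nrm (D \<alpha>) <= B"
 shows "len \<alpha> <= m ==> nrm_on (ball 0 r) (D \<alpha>) <= B"
proof (induction "m - len \<alpha>" arbitrary: \<alpha>)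
 case 0
 then have e: "len \<alpha> = m" by simp
 have "nrm_on (ball 0 r) (D \<alpha>) <= nrm (D \<alpha>)"
  by (rule nrm_indicator_le[OF jet_L2b[OF D]]) (use e in auto)
 then show ?case using top[OF e] by simp
next
 case (Suc k)
 have "nrm_on (ball 0 r) (D \<alpha>) <= nrm_on (ball 0 r) (D (inc \<alpha> lastix))"
  by (rule Poincare_step[OF D r _ z]) (use Suc.hyps in auto)
 also have "\<dots> <= B" by (rule Suc.hyps(1)) (use Suc.hyps in auto)
 finally show ?case .
qed

text \<open>The situation of the theorem, with the derivatives of \<open>u\<close> and of \<open>f\<close> given as families of
  Borel functions on the whole space.\<close>

definition half_ball_solution :: "nat => nat => real => real => 'n::{finite,wellorder} coeffs =>
  ('n multi_index => 'n rfun) => ('n multi_index => 'n rfun) => real => bool" where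
 "half_ball_solution m l c M a D F Z \<longleftrightarrow> elliptic_with m c a \<and>
  (\<forall>\<alpha> \<beta>. len \<alpha> = m --> len \<beta> = m --> \<bar>a \<alpha> \<beta>\<bar> <= M) \<and>
  jet m (ball 0 1) D \<and>
  (\<forall>\<alpha> x. len \<alpha> <= m --> norm x > 1 \<or> x $ lastix < 0 --> D \<alpha> x = 0) \<and>
  (\<forall>\<alpha>. len \<alpha> = m --> nrm (D \<alpha>) <= Z) \<and>
  jet l (half_ball 1) F \<and> (\<forall>\<gamma>. len \<gamma> <= l --> nrm (F \<gamma>) <= Z) \<and>
  (\<forall>\<phi>\<in>test_functions (half_ball 1). (\<Sum>\<alpha> | len \<alpha> = m. \<Sum>\<beta> | len \<beta> = m.
    a \<alpha> \<beta> * ip (D \<alpha>) (mi_partial \<beta> \<phi>)) = ip (F (%_. 0)) \<phi>)"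

lemma mi_below:
 fixes \<mu> :: "'n::finite multi_index"
 shows "k <= len \<mu> ==> \<exists>\<delta>. (\<forall>j. \<delta> j <= \<mu> j) \<and> len \<delta> = k"
proof (induction "len \<mu> - k" arbitrary: \<mu>)
 case 0 then show ?case by (intro exI[of _ \<mu>]) auto
next
 case (Suc n)
 then have "len \<mu> = Suc (len \<mu> - 1)" by linarith
 from mi_Suc_obtain[OF this] obtain \<beta> i where \<beta>: "\<mu> = inc \<beta> i" "len \<beta> = len \<mu> - 1" by blast
 have "n = len \<beta> - k" "k <= len \<beta>"
  using Suc.hyps(2) \<beta>(2) Suc.prems by linarith+
 from Suc.hyps(1)[OF this] obtain \<delta> where \<delta>: "!!j. \<delta> j <= \<beta> j" "len \<delta> = k" by blast
 have "\<delta> j <= \<mu> j" for j using \<delta>(1)[of j] le_Suc_eq by (auto simp: \<beta>(1) inc_def)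
 then show ?case using \<delta>(2) by blast
qed

lemma mi_split:
 fixes \<mu> :: "'n::finite multi_index"
 assumes "k <= len \<mu>"
 obtains \<delta> \<nu> where "\<mu> = (%j. \<delta> j + \<nu> j)" "len \<delta> = k" "len \<nu> = len \<mu> - k"
proof -
 obtain \<delta> where \<delta>: "!!j. \<delta> j <= \<mu> j" "len \<delta> = k" using mi_below[OF assms] by blast
 have e: "\<mu> = (%j. \<delta> j + (\<mu> j - \<delta> j))" using \<delta>(1) by auto
 have "len \<mu> = len \<delta> + len (%j. \<mu> j - \<delta> j)"
  by (subst e) (rule mi_length_add)
 then show ?thesis using that[OF e \<delta>(2)] \<delta>(2) by simp
qed

lemma mi_length_remove:
 fixes \<gamma> :: "'n::finite multi_index"
 shows "len (\<gamma>(i := 0)) + \<gamma> i = len \<gamma>"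
proof -
 have "len \<gamma> = \<gamma> i + (\<Sum>j\<in>UNIV - {i}. \<gamma> j)"
  unfolding mi_length_def by (rule sum.remove) auto
 moreover have "len (\<gamma>(i := 0)) = (\<gamma>(i := 0)) i + (\<Sum>j\<in>UNIV - {i}. (\<gamma>(i := 0)) j)"
  unfolding mi_length_def by (rule sum.remove) auto
 ultimately show ?thesis by simp
qed

lemma mi_split_tangential:
 fixes \<gamma> :: "'n::{finite,wellorder} multi_index"
 assumes "\<gamma> lastix <= m" "len \<gamma> = Suc (m + k)"
 obtains \<delta> \<alpha> i where "i ~= lastix" "\<delta> lastix = 0" "len \<delta> = k" "len \<alpha> = m"
  "\<gamma> = inc (%j. \<delta> j + \<alpha> j) i"
proof -
 define \<mu> where "\<mu> = \<gamma>(lastix := 0)"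
 have "len \<mu> >= Suc k" using mi_length_remove[of \<gamma> lastix] assms by (simp add: \<mu>_def)
 from mi_below[OF this] obtain \<delta>' where \<delta>': "!!j. \<delta>' j <= \<mu> j" "len \<delta>' = Suc k" by blast
 obtain \<delta> i where \<delta>: "\<delta>' = inc \<delta> i" "len \<delta> = k" using mi_Suc_obtain[OF \<delta>'(2)] by metis
 have dN: "\<delta>' lastix = 0" using \<delta>'(1)[of lastix] by (simp add: \<mu>_def)
 have i: "i ~= lastix"
 proof
  assume "i = lastix" then show False using dN by (simp add: \<delta>(1) inc_def)
 qed
 have \<delta>N: "\<delta> lastix = 0" using dN i by (simp add: \<delta>(1) inc_def)
 have le: "\<delta>' j <= \<gamma> j" for j
 proof (cases "j = lastix")
  case False
  then have "\<mu> j = \<gamma> j" by (simp add: \<mu>_def)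
  then show ?thesis using \<delta>'(1)[of j] by simp
 qed (simp add: dN)
 define \<alpha> where "\<alpha> j = \<gamma> j - \<delta>' j" for j
 have "\<gamma> = (%j. \<delta>' j + \<alpha> j)" using le by (auto simp: \<alpha>_def)
 then have "len \<gamma> = len \<delta>' + len \<alpha>" using mi_length_add by metis
 then have "len \<alpha> = m" using \<delta>'(2) assms(2) by simp
 moreover have "\<gamma> = inc (%j. \<delta> j + \<alpha> j) i"
 proof
  fix j
  have "\<gamma> j = \<delta>' j + \<alpha> j" using le[of j] by (simp add: \<alpha>_def)
  then show "\<gamma> j = inc (%j. \<delta> j + \<alpha> j) i j" by (simp add: \<delta>(1) inc_def)
 qed
 ultimately show ?thesis using that i \<delta>N \<delta>(2) by blast
qed

text \<open>Tangential derivatives of \<open>u\<close> solve the differentiated equation. As long as \<open>f\<close> has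
  derivatives left they are put on \<open>f\<close>, and afterwards up to \<open>m\<close> tangential derivatives can be left
  on the test function.\<close>

lemma tangential_regularity:
 fixes c M :: real and m l :: nat
 assumes m: "m >= 1" and c: "c > 0"
 shows "k <= m + l ==> 0 < r ==> r < 1 ==> \<exists>C\<ge>0. \<forall>(a :: 'n::{finite,wellorder} coeffs) D F Z \<gamma>.
  half_ball_solution m l c M a D F Z --> \<gamma> lastix <= m --> len \<gamma> <= m + k -->
  (\<exists>E. L2b E \<and> wd (ball 0 r) \<gamma> (D (%_. 0)) E \<and> nrm E <= C * Z \<and>
   (\<forall>x. norm x > r \<or> x $ lastix < 0 --> E x = 0))"
proof (induction k arbitrary: r)
 case 0
 show ?case
 proof (intro exI[of _ 1] conjI allI impI)
  fix a :: "'n coeffs" and D :: "'n multi_index => 'n rfun" and F Z and \<gamma> :: "'n multi_index"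
  assume h: "half_ball_solution m l c M a D F Z" and \<gamma>: "\<gamma> lastix <= m" "len \<gamma> <= m + 0"
  let ?Z = "{x::real^'n::_. x $ lastix < 0}"
  have D: "jet m (ball 0 1) D" and z: "!!\<alpha> x. len \<alpha> <= m ==> norm x > 1 \<or> x $ lastix < 0 ==> D \<alpha> x = 0"
   and top: "!!\<alpha>. len \<alpha> = m ==> nrm (D \<alpha>) <= Z"
   using h by (auto simp: half_ball_solution_def)
  have g: "len \<gamma> <= m" using \<gamma> by simp
  have L: "L2b (D \<gamma>)" by (rule jet_L2b[OF D g])
  have w: "wd (ball 0 r) \<gamma> (D (%_. 0)) (D \<gamma>)" by (rule wd_mono[OF jet_wd[OF D g]]) (use 0 in auto)
  have "wd (ball 0 r) \<gamma> (D (%_. 0)) (%x. ind (ball 0 r - ?Z) x * D \<gamma> x)"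
   by (rule wd_restrict[OF w L open_ball open_lower]) (use z[of "%_. 0"] in auto)
  moreover have "(%x. ind (ball 0 r - ?Z) x * D \<gamma> x) = (%x. ind (ball 0 r) x * D \<gamma> x)"
   using z[OF g] by (auto simp: indicator_def fun_eq_iff)
  ultimately show "\<exists>E. L2b E \<and> wd (ball 0 r) \<gamma> (D (%_. 0)) E \<and> nrm E <= 1 * Z \<and>
   (\<forall>x. norm x > r \<or> x $ lastix < 0 --> E x = 0)"
   using Poincare[OF D 0(2,3) z top g] L2b_indicator[OF L, of "ball 0 r"] z[OF g]
   by (intro exI[of _ "%x. ind (ball 0 r) x * D \<gamma> x"]) auto
 qed simp
next
 case (Suc k)
 define R where "R = (r + 1) / 2"
 have R: "0 < R" "R < 1" "r < R" using Suc.prems by (auto simp: R_def)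
 obtain C1 where C1: "C1 >= 0" and IH: "!!(a :: 'n coeffs) D F Z \<gamma>.
  half_ball_solution m l c M a D F Z ==> \<gamma> lastix <= m ==> len \<gamma> <= m + k ==>
  (\<exists>E. L2b E \<and> wd (ball 0 R) \<gamma> (D (%_. 0)) E \<and> nrm E <= C1 * Z \<and>
   (\<forall>x. norm x > R \<or> x $ lastix < 0 --> E x = 0))"
  using Suc.IH[OF _ R(1,2)] Suc.prems(1) by auto
 obtain C2 where C2: "C2 >= 0" and step: "\<forall>(a :: 'n::{finite,wellorder} coeffs) D f1 \<sigma> i Z \<alpha>.
  elliptic_with m c a --> (\<forall>\<alpha> \<beta>. len \<alpha> = m --> len \<beta> = m --> \<bar>a \<alpha> \<beta>\<bar> <= M) -->
  jet m (ball 0 R) D -->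
  (\<forall>\<alpha>. len \<alpha> <= m --> nrm (D \<alpha>) <= Z \<and> (\<forall>x. norm x > R \<or> x $ lastix < 0 --> D \<alpha> x = 0)) -->
  L2b f1 --> nrm f1 <= Z --> len \<sigma> < m -->
  (\<forall>\<phi>\<in>test_functions (half_ball R). (\<Sum>\<alpha> | len \<alpha> = m. \<Sum>\<beta> | len \<beta> = m.
    a \<alpha> \<beta> * ip (D \<alpha>) (mi_partial \<beta> \<phi>)) = ip f1 (mi_partial \<sigma> \<phi>)) -->
  i ~= lastix --> len \<alpha> <= m -->
  (\<exists>E. L2b E \<and> wd1 (ball 0 r) i (D \<alpha>) E \<and> nrm E <= C2 * Z)"
  using tangential_step[OF m c Suc.prems(2) R(3), of M] by blast
 define C where "C = C1 + C2 * (C1 + 1)"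
 have C: "C >= 0" "C1 <= C" "C2 * (C1 + 1) <= C" using C1 C2 by (auto simp: C_def)
 show ?case
 proof (intro exI[of _ C] conjI allI impI C(1))
  fix a :: "'n coeffs" and D :: "'n multi_index => 'n rfun"
   and F :: "'n multi_index => 'n rfun" and Z and \<gamma> :: "'n multi_index"
  assume h: "half_ball_solution m l c M a D F Z" and \<gamma>: "\<gamma> lastix <= m" "len \<gamma> <= m + Suc k"
  let ?Z = "{x::real^'n::_. x $ lastix < 0}"
  have ell: "elliptic_with m c a" and aM: "\<forall>\<alpha> \<beta>. len \<alpha> = m --> len \<beta> = m --> \<bar>a \<alpha> \<beta>\<bar> <= M"
   and D: "jet m (ball 0 1) D" and z: "!!\<alpha> x. len \<alpha> <= m ==> norm x > 1 \<or> x $ lastix < 0 ==> D \<alpha> x = 0"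
   and F: "jet l (half_ball 1) F" "!!\<gamma>. len \<gamma> <= l ==> nrm (F \<gamma>) <= Z"
   and eq: "!!\<phi>. \<phi> \<in> test_functions (half_ball 1) ==> (\<Sum>\<alpha> | len \<alpha> = m. \<Sum>\<beta> | len \<beta> = m.
    a \<alpha> \<beta> * ip (D \<alpha>) (mi_partial \<beta> \<phi>)) = ip (F (%_. 0)) \<phi>"
   using h unfolding half_ball_solution_def by blast+
  have Z0: "Z >= 0" using F(2)[of "%_. 0"] order_trans[OF nrm_nonneg[of "F (%_. 0)"]] by simp
  have finish: "\<exists>E. L2b E \<and> wd (ball 0 r) \<gamma> (D (%_. 0)) E \<and> nrm E <= C * Z \<and>
    (\<forall>x. norm x > r \<or> x $ lastix < 0 --> E x = 0)"
   if E: "L2b E" "wd (ball 0 r) \<gamma> (D (%_. 0)) E" "nrm E <= B * Z" "B <= C" for E B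
  proof (intro exI[of _ "%x. ind (ball 0 r - ?Z) x * E x"] conjI allI impI)
   have S: "ball 0 r - ?Z \<in> sets borel" using open_lower by (intro sets.Diff borel_open) auto
   show "L2b (%x. ind (ball 0 r - ?Z) x * E x)" by (rule L2b_indicator[OF E(1) S])
   show "wd (ball 0 r) \<gamma> (D (%_. 0)) (%x. ind (ball 0 r - ?Z) x * E x)"
    by (rule wd_restrict[OF E(2,1) open_ball open_lower]) (use z[of "%_. 0"] in auto)
   have "nrm_on (ball 0 r - ?Z) E <= nrm E" by (rule nrm_indicator_le[OF E(1) S])
   also have "\<dots> <= B * Z" by (rule E)
   also have "\<dots> <= C * Z" by (intro mult_right_mono E Z0)
   finally show "nrm_on (ball 0 r - ?Z) E <= C * Z" .
   show "ind (ball 0 r - ?Z) x * E x = 0" if "norm x > r \<or> x $ lastix < 0" for x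
    using that by (auto simp: indicator_def)
  qed
  show "\<exists>E. L2b E \<and> wd (ball 0 r) \<gamma> (D (%_. 0)) E \<and> nrm E <= C * Z \<and>
   (\<forall>x. norm x > r \<or> x $ lastix < 0 --> E x = 0)"
  proof (cases "len \<gamma> <= m + k")
   case True
   from IH[OF h \<gamma>(1) True] obtain E where E: "L2b E" "wd (ball 0 R) \<gamma> (D (%_. 0)) E" "nrm E <= C1 * Z" by blast
   have "wd (ball 0 r) \<gamma> (D (%_. 0)) E" by (rule wd_mono[OF E(2)]) (use R in auto)
   then show ?thesis by (rule finish[OF E(1) _ E(3) C(2)])
  next
   case False
   then have len: "len \<gamma> = Suc (m + k)" using \<gamma> by simp
   obtain \<delta> \<alpha> i where d: "i ~= lastix" "\<delta> lastix = 0" "len \<delta> = k" "len \<alpha> = m"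
    "\<gamma> = inc (%j. \<delta> j + \<alpha> j) i" by (rule mi_split_tangential[of \<gamma> m k, OF \<gamma>(1) len])
   have dl: "(%j. \<delta> j + \<beta> j) lastix <= m" "len (%j. \<delta> j + \<beta> j) <= m + k" if "len \<beta> <= m" for \<beta>
   proof -
    have "\<beta> lastix <= len \<beta>" using mi_length_remove[of \<beta> lastix] by simp
    then show "(%j. \<delta> j + \<beta> j) lastix <= m" "len (%j. \<delta> j + \<beta> j) <= m + k"
     using that d by (simp_all add: mi_length_add)
   qed
   have "\<forall>\<beta>. \<exists>E. len \<beta> <= m --> L2b E \<and> wd (ball 0 R) (%j. \<delta> j + \<beta> j) (D (%_. 0)) E \<and>
     nrm E <= C1 * Z \<and> (\<forall>x. norm x > R \<or> x $ lastix < 0 --> E x = 0)"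
   proof
    fix \<beta> :: "'n multi_index"
    show "\<exists>E. len \<beta> <= m --> L2b E \<and> wd (ball 0 R) (%j. \<delta> j + \<beta> j) (D (%_. 0)) E \<and>
     nrm E <= C1 * Z \<and> (\<forall>x. norm x > R \<or> x $ lastix < 0 --> E x = 0)"
    proof (cases "len \<beta> <= m")
     case True
     from IH[where \<gamma> = "%j. \<delta> j + \<beta> j", OF h dl(1)[OF True] dl(2)[OF True]] show ?thesis by blast
    qed simp
   qed
   from choice[OF this] obtain G where G: "!!\<beta>. len \<beta> <= m ==> L2b (G \<beta>)"
    "!!\<beta>. len \<beta> <= m ==> wd (ball 0 R) (%j. \<delta> j + \<beta> j) (D (%_. 0)) (G \<beta>)"
    "!!\<beta>. len \<beta> <= m ==> nrm (G \<beta>) <= C1 * Z"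
    "!!\<beta> x. len \<beta> <= m ==> norm x > R \<or> x $ lastix < 0 ==> G \<beta> x = 0" by blast
   have G0: "wd (ball 0 R) \<delta> (D (%_. 0)) (G (%_. 0))" using G(2)[of "%_. 0"] by simp
   have JG: "jet m (ball 0 R) G"
    unfolding jet_def using G(1) wd_cancel[OF G0 G(2)] by blast
   define l1 where "l1 = min k l"
   obtain \<delta>1 \<sigma> where s: "\<delta> = (%j. \<delta>1 j + \<sigma> j)" "len \<delta>1 = l1" "len \<sigma> = k - l1"
   proof (rule mi_split[of l1 \<delta>])
    show "l1 <= len \<delta>" using d(3) by (simp add: l1_def)
   qed (use d(3) that in auto)
   have s': "len \<sigma> < m" "len \<delta>1 <= l" using Suc.prems(1) m s by (auto simp: l1_def)
   define f1 where "f1 x = ((-1) ^ k * (-1) ^ l1) * F \<delta>1 x" for x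
   have Lf1: "L2b f1" unfolding f1_def by (intro L2b_cmult jet_L2b[OF F(1)] s')
   have nf1: "nrm f1 <= Z"
    unfolding f1_def nrm_cmult using F(2)[OF s'(2)] by (simp add: abs_mult power_abs)
   have eqG: "(\<Sum>\<alpha> | len \<alpha> = m. \<Sum>\<beta> | len \<beta> = m. a \<alpha> \<beta> * ip (G \<alpha>) (mi_partial \<beta> \<phi>))
     = ip f1 (mi_partial \<sigma> \<phi>)" if \<phi>: "\<phi> \<in> test_functions (half_ball R)" for \<phi>
   proof -
    have C\<phi>: "C_infinity \<phi>" by (rule test_smooth[OF \<phi>])
    have \<phi>R: "\<phi> \<in> test_functions (ball 0 R)" by (rule test_mono[OF \<phi> half_ball_subset])
    have \<phi>1: "\<phi> \<in> test_functions (half_ball 1)" by (rule test_mono[OF \<phi> half_ball_mono]) (use R in simp)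
    have "ip (G \<alpha>) (mi_partial \<beta> \<phi>) = (-1) ^ k * ip (D \<alpha>) (mi_partial \<beta> (mi_partial \<delta> \<phi>))"
     if ab: "len \<alpha> = m" "len \<beta> = m" for \<alpha> \<beta>
    proof -
     have 1: "wd (ball 0 R) \<alpha> (D (%_. 0)) (D \<alpha>)"
      by (rule wd_mono[OF jet_wd[OF D]]) (use ab R in auto)
     have 2: "wd (ball 0 R) (%j. \<alpha> j + \<delta> j) (D (%_. 0)) (G \<alpha>)"
      using G(2)[of \<alpha>] ab by (simp add: add.commute)
     have "ip (D \<alpha>) (mi_partial \<delta> (mi_partial \<beta> \<phi>)) = (-1) ^ k * ip (G \<alpha>) (mi_partial \<beta> \<phi>)"
      using wdD[OF wd_cancel[OF 1 2] test_mi_partial[OF \<phi>R]] d(3) by simp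
     moreover have "mi_partial \<delta> (mi_partial \<beta> \<phi>) = mi_partial \<beta> (mi_partial \<delta> \<phi>)"
      using mi_partial_add[OF C\<phi>, of \<delta> \<beta>] mi_partial_add[OF C\<phi>, of \<beta> \<delta>] by (simp add: add.commute)
     ultimately show ?thesis by (simp add: power_add[symmetric] mult.assoc[symmetric])
    qed
    then have "(\<Sum>\<alpha> | len \<alpha> = m. \<Sum>\<beta> | len \<beta> = m. a \<alpha> \<beta> * ip (G \<alpha>) (mi_partial \<beta> \<phi>))
      = (-1) ^ k * (\<Sum>\<alpha> | len \<alpha> = m. \<Sum>\<beta> | len \<beta> = m. a \<alpha> \<beta> * ip (D \<alpha>) (mi_partial \<beta> (mi_partial \<delta> \<phi>)))"
     by (simp add: sum_distrib_left mult.left_commute)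
    also have "\<dots> = (-1) ^ k * ip (F (%_. 0)) (mi_partial \<delta> \<phi>)"
     by (subst eq[OF test_mi_partial[OF \<phi>1]]) simp
    also have "mi_partial \<delta> \<phi> = mi_partial \<delta>1 (mi_partial \<sigma> \<phi>)" unfolding s(1) by (rule mi_partial_add[OF C\<phi>])
    also have "ip (F (%_. 0)) (mi_partial \<delta>1 (mi_partial \<sigma> \<phi>)) = (-1) ^ l1 * ip (F \<delta>1) (mi_partial \<sigma> \<phi>)"
     using wdD[OF jet_wd[OF F(1) s'(2)] test_mi_partial[OF \<phi>1]] s(2) by simp
    finally show ?thesis by (simp add: f1_def[abs_def] ip_cmult_left mult.assoc)
   qed
   have Zle: "C1 * Z <= (C1 + 1) * Z" "Z <= (C1 + 1) * Z" using Z0 C1 by (auto simp: distrib_right)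
   have "\<exists>E. L2b E \<and> wd1 (ball 0 r) i (G \<alpha>) E \<and> nrm E <= C2 * ((C1 + 1) * Z)"
   proof (rule step[rule_format, OF ell aM[rule_format] JG _ Lf1 _ s'(1) _ d(1)])
    show "nrm (G \<beta>) <= (C1 + 1) * Z \<and> (\<forall>x. norm x > R \<or> x $ lastix < 0 --> G \<beta> x = 0)" if "len \<beta> <= m" for \<beta>
     using G(3)[OF that] G(4)[OF that] Zle(1) by auto
   qed (use nf1 Zle(2) eqG d(4) in auto)
   then obtain E where E: "L2b E" "wd1 (ball 0 r) i (G \<alpha>) E" "nrm E <= C2 * (C1 + 1) * Z"
    by (auto simp: mult.assoc)
   have "wd (ball 0 r) (%j. \<delta> j + \<alpha> j) (D (%_. 0)) (G \<alpha>)"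
    by (rule wd_mono[OF G(2)]) (use d R in auto)
   from wd_inc[OF this E(2)] have "wd (ball 0 r) \<gamma> (D (%_. 0)) E" unfolding d(5) .
   then show ?thesis by (rule finish[OF E(1) _ E(3) C(3)])
  qed
 qed
qed

section \<open>Interpolation of normal derivatives in the half-space\<close>

definition upper :: "(real^'n::{finite,wellorder}) set" where "upper = {x. x $ lastix > 0}"

definition hn :: "('n::{finite,wellorder} rfun) => real" where
 "hn g = nrm_on upper g"

definition hi :: "('n::{finite,wellorder} rfun) => real" where
 "hi g = (LINT x|lborel. ind upper x * g x)"

lemmas test_L2b_UNIV = test_L2b[where U = UNIV]

text \<open>This dilation normal to the boundary fixes the boundary and decreases no norm.\<close>

definition st :: "real^'n::{finite,wellorder} => real^'n::_" where
 "st = dmap 0 (\<chi> j. if j = lastix then 2 else 1)"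

lemma open_upper: "open upper"
 unfolding upper_def by (intro open_Collect_less continuous_intros)

lemma upper_borel[measurable]: "upper \<in> sets borel"
 using open_upper by (rule borel_open)

lemma st_component: "st x $ j = (if j = lastix then 2 * x $ j else x $ j)"
 by (simp add: st_def dmap_def)

lemma st_upper: "st x \<in> upper \<longleftrightarrow> x \<in> upper"
 by (simp add: upper_def st_component)

lemma st_boundary: "x $ lastix = 0 ==> st x = x"
 by (simp add: vec_eq_iff st_component)

lemma norm_st: "norm x <= norm (st x)"
 by (rule norm_le_componentwise_cart) (auto simp: st_component abs_mult)

lemma partial_st:
 assumes "C_infinity f"
 shows "partial i (%x. f (st x)) x = (if i = lastix then 2 else 1) * partial i f (st x)"
 unfolding st_def by (subst partial_dmap[OF C_infinity_differentiable[OF assms]]) simp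

lemma C_infinity_st: "C_infinity f ==> C_infinity (%x. f (st x))"
 unfolding st_def by (rule C_infinity_dmap)

lemma test_st:
 assumes "\<phi> \<in> test_functions UNIV" shows "(%x. \<phi> (st x)) \<in> test_functions UNIV"
proof -
 obtain R where R: "!!x. norm x > R ==> \<phi> x = 0" using test_support[OF assms] by metis
 show ?thesis
 proof (rule test_functionsI[OF C_infinity_st[OF test_smooth[OF assms]] compact_cball])
  show "\<phi> (st x) = 0" if "x \<notin> cball 0 R" for x
   using that norm_st[of x] by (intro R) simp
 qed simp
qed

lemma st_integral:
 fixes f :: "'n::{finite,wellorder} rfun"
 assumes "f \<in> borel_measurable borel"
 shows "(LINT x|lborel. f x) = 2 * (LINT x|lborel. f (st x))"
  and "integrable lborel f ==> integrable lborel (%x. f (st x))"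
proof -
 define c where "c j = (if j = axis lastix 1 then 2 else 1 :: real)" for j :: "real^'n::_"
 have "st \<in> borel_measurable borel"
  by (intro borel_measurable_continuous_onI)
   (simp add: st_def continuous_on_eq_continuous_at has_derivative_continuous[OF has_derivative_dmap])
 then have [measurable]: "st \<in> borel \<rightarrow>\<^sub>M borel" .
 have st: "st x = 0 + (\<Sum>j\<in>Basis. (c j * (x \<bullet> j)) *\<^sub>R j)" for x :: "real^'n::_"
 proof (rule vec_eq_iff[THEN iffD2], rule allI)
  fix k
  have "(\<Sum>j\<in>Basis. (c j * (x \<bullet> j)) *\<^sub>R j) $ k = (0 + (\<Sum>j\<in>Basis. (c j * (x \<bullet> j)) *\<^sub>R j)) \<bullet> axis k 1"
   by (simp add: inner_axis)
  also have "\<dots> = c (axis k 1) * (x \<bullet> axis k 1)"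
   by (simp add: inner_sum_left inner_Basis axis_in_Basis_iff if_distrib sum.delta cong: if_cong)
  finally show "st x $ k = (0 + (\<Sum>j\<in>Basis. (c j * (x \<bullet> j)) *\<^sub>R j)) $ k"
   by (simp add: st_component c_def inner_axis axis_eq_axis)
 qed
 have prod: "(\<Prod>j\<in>Basis. \<bar>c j\<bar>) = 2"
 proof -
  have "(\<Prod>j\<in>Basis. \<bar>c j\<bar>) = \<bar>c (axis lastix 1)\<bar> * (\<Prod>j\<in>Basis - {axis lastix 1}. \<bar>c j\<bar>)"
   by (rule prod.remove) (auto simp: axis_in_Basis_iff)
  also have "(\<Prod>j\<in>Basis - {axis lastix 1}. \<bar>c j\<bar>) = 1" by (rule prod.neutral) (simp add: c_def)
  finally show ?thesis by (simp add: c_def)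
 qed
 have "lborel = density (distr lborel borel (%x. 0 + (\<Sum>j\<in>Basis. (c j * (x \<bullet> j)) *\<^sub>R j))) (%_. (\<Prod>j\<in>Basis. \<bar>c j\<bar>))"
  by (rule lborel_affine_euclidean) (simp add: c_def)
 then have eq: "(lborel :: (real^'n::_) measure) = density (distr lborel borel st) (%_. ennreal 2)"
  by (simp only: st[symmetric] prod)
 have "(LINT x|lborel. f x) = (LINT x|density (distr lborel borel st) (%_. ennreal 2). f x)"
  by (subst eq) simp
 also have "\<dots> = (LINT x|distr lborel borel st. 2 *\<^sub>R f x)"
  using assms by (intro integral_density) auto
 also have "\<dots> = 2 * (LINT x|lborel. f (st x))"
  using assms by (subst integral_distr) auto
 finally show "(LINT x|lborel. f x) = 2 * (LINT x|lborel. f (st x))" .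
 assume "integrable lborel f"
 then have "integrable (density (distr lborel borel st) (%_. ennreal 2)) f" using eq by simp
 then have "integrable (distr lborel borel st) (%x. 2 *\<^sub>R f x)"
  using assms by (subst (asm) integrable_density) auto
 then show "integrable lborel (%x. f (st x))"
  using assms by (subst (asm) integrable_distr_eq) auto
qed

lemma L2b_upper: "L2b g ==> L2b (%x. ind upper x * g x)"
 by (rule L2b_indicator) auto

lemma hn_nonneg[simp]: "hn g >= 0" by (simp add: hn_def)

lemma hn_st:
 fixes g :: "'n::{finite,wellorder} rfun"
 assumes "L2b g" shows "hn (%x. g (st x)) <= hn g"
proof -
 have m: "(%x. (ind upper x * g x)\<^sup>2) \<in> borel_measurable borel"
  using L2b_upper[OF assms] by (auto simp: L2b_def)
 have "ind upper (st x) = (ind upper x :: real)" for x :: "real^'n::_"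
  by (simp add: indicator_def st_upper)
 then have "(LINT x|lborel. (ind upper x * g x)\<^sup>2) = 2 * (LINT x|lborel. (ind upper x * g (st x))\<^sup>2)"
  using st_integral(1)[OF m] by simp
 moreover have "(LINT x|lborel. (ind upper x * g (st x))\<^sup>2) >= 0" by (intro integral_nonneg_AE) simp
 ultimately show ?thesis unfolding hn_def nrm_def by (intro real_sqrt_le_mono) linarith
qed

lemma hn_mono:
 assumes "L2b g" "f \<in> borel_measurable borel" "!!x. x \<in> upper ==> \<bar>f x\<bar> <= \<bar>g x\<bar>" shows "hn f <= hn g"
 unfolding hn_def
proof (rule nrm_mono[OF L2b_upper[OF assms(1)]])
 show "(%x. ind upper x * f x) \<in> borel_measurable borel" using assms(2) by measurable
 show "\<bar>ind upper x * f x\<bar> <= \<bar>ind upper x * g x\<bar>" for x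
  using assms(3)[of x] by (auto simp: indicator_def)
qed

lemma hn_add: "L2b f ==> L2b g ==> hn (%x. f x + g x) <= hn f + hn g"
 unfolding hn_def using nrm_triangle[OF L2b_upper L2b_upper, of f g] by (simp add: distrib_left)

lemma hn_cmult: "hn (%x. c * f x) = \<bar>c\<bar> * hn f"
 unfolding hn_def by (simp add: mult.left_commute nrm_cmult)

lemma hi_CS: assumes "L2b f" "L2b g" shows "\<bar>hi (%x. f x * g x)\<bar> <= hn f * hn g"
proof -
 have "hi (%x. f x * g x) = ip (%x. ind upper x * f x) (%x. ind upper x * g x)"
  unfolding hi_def ip_def by (rule Bochner_Integration.integral_cong) (auto simp: indicator_def)
 then show ?thesis unfolding hn_def using ip_Cauchy_Schwarz[OF L2b_upper L2b_upper, OF assms] by simp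
qed

lemma hi_integrable:
 assumes "\<phi> \<in> test_functions UNIV" shows "integrable lborel (%x. ind upper x * \<phi> x)"
 using integrable_mult_indicator[OF _ test_integrable[OF assms], of upper] by simp

lemma hi_add:
 "\<phi> \<in> test_functions UNIV ==> \<psi> \<in> test_functions UNIV ==> hi (%x. \<phi> x + \<psi> x) = hi \<phi> + hi \<psi>"
 unfolding hi_def by (simp add: distrib_left hi_integrable)

lemma hi_sq: assumes "L2b f" shows "hi (%x. (f x)\<^sup>2) = (hn f)\<^sup>2"
 unfolding hi_def hn_def nrm_sq
 by (rule Bochner_Integration.integral_cong) (auto simp: indicator_def)

lemma AE_last_neq_0: "AE x in lborel. (x::real^'n::{finite,wellorder}) $ lastix ~= 0"
proof -
 have "negligible {x::real^'n::_. x $ lastix = 0}" by (rule negligible_standard_hyperplane_cart)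
 then have "{x::real^'n::_. x $ lastix = 0} \<in> null_sets lebesgue" by (simp add: negligible_iff_null_sets)
 then have "AE x in lebesgue. (x::real^'n::_) $ lastix ~= 0"
  using AE_not_in by fastforce
 moreover have "{x::real^'n::_. x $ lastix ~= 0} \<in> sets borel"
  by (intro borel_open open_Collect_neq continuous_intros)
 ultimately show ?thesis by (subst (asm) AE_completion_iff) auto
qed

text \<open>The integral of \<open>\<partial>\<^sub>i p\<close> is the limit of integrals of difference quotients of
  \<open>p\<close>. Tangential translations preserve the half-space. For the normal derivative, the extension by zero of
  \<open>p\<close> to the lower half-space is Lipschitz continuous along the axis because \<open>p\<close> vanishes on the
  boundary, so the limit is again a dominated one.\<close>

lemma half_space_divergence:
 fixes p :: "'n::{finite,wellorder} rfun"
 assumes p: "p \<in> test_functions UNIV" and bd: "i ~= lastix \<or> (\<forall>x. x $ lastix = 0 --> p x = 0)"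
 shows "hi (partial i p) = 0"
proof -
 let ?e = "axis i 1 :: real^'n::_"
 obtain R where R: "!!x. norm x > R ==> p x = 0" using test_support[OF p] by metis
 obtain L where L: "L > 0" "!!x h. \<bar>p (x + h) - p x\<bar> <= L * norm h" using test_Lipschitz[OF p] by blast
 define q where "q x = ind upper x * p x" for x
 have shift_in: "x + h *\<^sub>R ?e \<in> upper \<longleftrightarrow> x \<in> upper" if "i ~= lastix" for x h
  using that by (simp add: upper_def axis_def)
 have comp: "(x + h *\<^sub>R ?e) $ lastix = x $ lastix + h" if "i = lastix" for x h using that by simp
 show ?thesis
  unfolding hi_def
 proof (rule integral_directional_derivative_eq_0[where q=q and R=R and e="?e" and L=L])
  show "integrable lborel q" unfolding q_def by (rule hi_integrable[OF p])
  show "q \<in> borel_measurable borel" unfolding q_def using test_borel[OF p] by measurable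
  show "q x = 0" if "norm x > R" for x using R[OF that] by (simp add: q_def)
  show "(%x. ind upper x * partial i p x) \<in> borel_measurable borel"
   using test_borel[OF test_partial[OF p]] by measurable
  show "\<bar>q (x + h *\<^sub>R ?e) - q x\<bar> <= L * h" if h: "0 < h" "h <= 1" for x h
  proof -
   have b: "\<bar>p (x + h *\<^sub>R ?e) - p x\<bar> <= L * h" using L(2)[of x "h *\<^sub>R ?e"] h by simp
   consider "i ~= lastix" | "i = lastix" "x \<in> upper" | "i = lastix" "x \<notin> upper" "x + h *\<^sub>R ?e \<in> upper"
    | "i = lastix" "x \<notin> upper" "x + h *\<^sub>R ?e \<notin> upper" by blast
   then show ?thesis
   proof cases
    case 1
    then show ?thesis using b h L by (cases "x \<in> upper") (auto simp: q_def shift_in)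
   next
    case 2
    then have "x + h *\<^sub>R ?e \<in> upper" using h by (simp add: upper_def)
    then show ?thesis using 2 b by (simp add: q_def)
   next
    case 3
    define y where "y = x + (- (x $ lastix)) *\<^sub>R ?e"
    have "y $ lastix = 0" using 3 by (simp add: y_def)
    then have py: "p y = 0" using bd 3 by blast
    have "x + h *\<^sub>R ?e = y + (x $ lastix + h) *\<^sub>R ?e" by (simp add: y_def algebra_simps)
    then have "\<bar>p (x + h *\<^sub>R ?e)\<bar> <= L * \<bar>x $ lastix + h\<bar>"
     using L(2)[of y "(x $ lastix + h) *\<^sub>R ?e"] py by simp
    also have "\<dots> <= L * h"
     using 3 L(1) by (intro mult_left_mono) (auto simp: upper_def)
    finally show ?thesis using 3 by (simp add: q_def)
   next
    case 4
    then show ?thesis using h L by (simp add: q_def)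
   qed
  qed
  show "AE x in lborel. (%n. (q (x + (1 / real (Suc n)) *\<^sub>R ?e) - q x) * real (Suc n))
    \<longlonglongrightarrow> ind upper x * partial i p x"
   using AE_last_neq_0
  proof eventually_elim
   fix x :: "real^'n::_" assume x: "x $ lastix ~= 0"
   have conv: "(%n. (p (x + (1 / real (Suc n)) *\<^sub>R ?e) - p x) * real (Suc n)) \<longlonglongrightarrow> partial i p x"
    by (rule along_axis_tendsto[OF test_smooth[OF p]])
   show "(%n. (q (x + (1 / real (Suc n)) *\<^sub>R ?e) - q x) * real (Suc n))
    \<longlonglongrightarrow> ind upper x * partial i p x"
   proof (cases "x \<in> upper")
    case True
    have "x + (1 / real (Suc n)) *\<^sub>R ?e \<in> upper" for n
    proof (cases "i = lastix")
     case True
     then show ?thesis using \<open>x \<in> upper\<close> by (simp add: upper_def add_pos_pos)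
    qed (use True shift_in in simp)
    then show ?thesis using conv True by (simp add: q_def)
   next
    case False
    then have neg: "x $ lastix < 0" using x by (simp add: upper_def)
    have "\<forall>\<^sub>F n in sequentially. x + (1 / real (Suc n)) *\<^sub>R ?e \<notin> upper"
    proof (cases "i = lastix")
     case True
     have "(%n. 1 / real (Suc n)) \<longlonglongrightarrow> 0" using LIMSEQ_inverse_real_of_nat by (simp add: inverse_eq_divide)
     from order_tendstoD(2)[OF this, of "- (x $ lastix)"] neg
     have "\<forall>\<^sub>F n in sequentially. 1 / real (Suc n) < - (x $ lastix)" by simp
     then show ?thesis by eventually_elim (use True in \<open>simp add: upper_def\<close>)
    qed (use False shift_in in simp)
    then have "\<forall>\<^sub>F n in sequentially. (q (x + (1 / real (Suc n)) *\<^sub>R ?e) - q x) * real (Suc n) = 0"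
     by eventually_elim (use False in \<open>simp add: q_def\<close>)
    then show ?thesis using False by (simp add: tendsto_eventually)
   qed
  qed
 qed
qed

text \<open>A \<open>C\<^sup>1\<close> reflection: \<open>reflx f\<close> has the boundary values of \<open>f\<close> and the opposite normal
  derivative there, and its norms over the half-space are controlled by those of \<open>f\<close>.\<close>

definition reflx :: "('n::{finite,wellorder} rfun) => 'n rfun" where
 "reflx f x = 3 * f x - 2 * f (st x)"

lemma test_reflx: assumes "f \<in> test_functions UNIV" shows "reflx f \<in> test_functions UNIV"
 using test_add[OF test_cmult[OF assms, of 3] test_cmult[OF test_st[OF assms], of "-2"]]
 by (simp add: reflx_def[abs_def])

lemma partial_comb_st:
 assumes "f \<in> test_functions UNIV"
 shows "partial i (%x. a * f x + b * f (st x)) x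
  = a * partial i f x + (if i = lastix then 2 else 1) * b * partial i f (st x)"
proof -
 have d: "f differentiable at x" "(%x. f (st x)) differentiable at x" for x
  by (intro C_infinity_differentiable C_infinity_st test_smooth[OF assms])+
 have "partial i (%x. a * f x + b * f (st x)) x = partial i (%x. a * f x) x + partial i (%x. b * f (st x)) x"
  by (rule partial_add) (auto intro!: differentiable_mult d)
 then show ?thesis
  by (simp add: partial_cmult d partial_st[OF test_smooth[OF assms]])
qed

text \<open>The dilation decreases weighted norms, as the dilated weight is at most \<open>\<zeta>\<close> and the dilation
  expands the volume.\<close>

lemma hn_comb_st:
 assumes f: "f \<in> test_functions UNIV" and \<zeta>: "\<zeta> \<in> test_functions UNIV" "!!x. 0 <= \<zeta> x" "!!x. \<zeta> (st x) <= \<zeta> x"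
 shows "hn (%x. \<zeta> (st x) ^ k * (a * f x + b * f (st x))) <= (\<bar>a\<bar> + \<bar>b\<bar>) * hn (%x. \<zeta> x ^ k * f x)"
proof -
 define g where "g x = \<zeta> x ^ k * f x" for x
 have g: "g \<in> test_functions UNIV" unfolding g_def by (intro test_mult C_infinity_power test_smooth[OF \<zeta>(1)] f)
 have \<zeta>s: "C_infinity (%x. \<zeta> (st x) ^ k)" by (intro C_infinity_power C_infinity_st test_smooth[OF \<zeta>(1)])
 have t1: "(%x. \<zeta> (st x) ^ k * f x) \<in> test_functions UNIV" by (rule test_mult[OF \<zeta>s f])
 have Lg: "L2b g" "L2b (%x. g (st x))" by (auto intro: test_L2b_UNIV test_st g)
 have "hn (%x. a * (\<zeta> (st x) ^ k * f x) + b * g (st x)) <= hn (%x. a * (\<zeta> (st x) ^ k * f x)) + hn (%x. b * g (st x))"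
  by (intro hn_add L2b_cmult Lg test_L2b[OF t1])
 also have "\<dots> = \<bar>a\<bar> * hn (%x. \<zeta> (st x) ^ k * f x) + \<bar>b\<bar> * hn (%x. g (st x))" by (simp add: hn_cmult)
 also have "\<dots> <= \<bar>a\<bar> * hn g + \<bar>b\<bar> * hn g"
 proof (intro add_mono mult_left_mono hn_st Lg)
  show "hn (%x. \<zeta> (st x) ^ k * f x) <= hn g"
  proof (rule hn_mono[OF Lg(1) test_borel[OF t1]])
   fix x
   have "\<zeta> (st x) ^ k <= \<zeta> x ^ k" by (intro power_mono \<zeta>)
   then show "\<bar>\<zeta> (st x) ^ k * f x\<bar> <= \<bar>g x\<bar>"
    using \<zeta>(2) by (auto simp: g_def abs_mult intro!: mult_right_mono)
  qed
 qed auto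
 finally show ?thesis by (simp add: g_def[abs_def] algebra_simps)
qed

text \<open>The weight decreases under the dilation \<open>st\<close>, so that \<open>\<zeta> \<circ> st\<close> can serve as the weight of the
  reflected functions.\<close>

context
 fixes \<zeta> :: "'n::{finite,wellorder} rfun" and L :: real
 assumes \<zeta>: "\<zeta> \<in> test_functions UNIV" "!!x. 0 <= \<zeta> x" "!!x. \<zeta> (st x) <= \<zeta> x"
  and L: "L >= 0" "!!i x. \<bar>partial i \<zeta> x\<bar> <= L"
begin

lemma smooth_\<zeta>: "C_infinity \<zeta>" by (rule test_smooth[OF \<zeta>(1)])

lemma test_weight: "f \<in> test_functions UNIV ==> (%x. \<zeta> x ^ k * f x) \<in> test_functions UNIV"
 by (intro test_mult C_infinity_power smooth_\<zeta>)

lemma test_weight_st: "f \<in> test_functions UNIV ==> (%x. \<zeta> (st x) ^ k * f x) \<in> test_functions UNIV"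
 by (intro test_mult C_infinity_power C_infinity_st smooth_\<zeta>)

lemma weighted_CS:
 assumes "f \<in> test_functions UNIV" "g \<in> test_functions UNIV" "a + b = n"
 shows "\<bar>hi (%x. \<zeta> x ^ n * f x * g x)\<bar> <= hn (%x. \<zeta> x ^ a * f x) * hn (%x. \<zeta> x ^ b * g x)"
  and "\<bar>hi (%x. \<zeta> (st x) ^ n * f x * g x)\<bar> <= hn (%x. \<zeta> (st x) ^ a * f x) * hn (%x. \<zeta> (st x) ^ b * g x)"
proof -
 have "(%x. \<zeta> x ^ n * f x * g x) = (%x. (\<zeta> x ^ a * f x) * (\<zeta> x ^ b * g x))"
  "(%x. \<zeta> (st x) ^ n * f x * g x) = (%x. (\<zeta> (st x) ^ a * f x) * (\<zeta> (st x) ^ b * g x))"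
  by (auto simp: assms(3)[symmetric] power_add)
 then show "\<bar>hi (%x. \<zeta> x ^ n * f x * g x)\<bar> <= hn (%x. \<zeta> x ^ a * f x) * hn (%x. \<zeta> x ^ b * g x)"
  "\<bar>hi (%x. \<zeta> (st x) ^ n * f x * g x)\<bar> <= hn (%x. \<zeta> (st x) ^ a * f x) * hn (%x. \<zeta> (st x) ^ b * g x)"
  by (simp_all only:) (intro hi_CS test_L2b_UNIV test_weight test_weight_st assms)+
qed

text \<open>The terms in which the derivative falls on the weight.\<close>

lemma weight_derivative_bound:
 assumes f: "f \<in> test_functions UNIV" and g: "g \<in> test_functions UNIV" and ab: "a + b + 1 = n"
 shows "\<bar>hi (%x. partial i (%x. \<zeta> x ^ n) x * f x * g x)\<bar>
   <= real n * L * (hn (%x. \<zeta> x ^ a * f x) * hn (%x. \<zeta> x ^ b * g x))"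
  and "\<bar>hi (%x. partial i (%x. \<zeta> (st x) ^ n) x * f x * g x)\<bar>
   <= 2 * real n * L * (hn (%x. \<zeta> (st x) ^ a * f x) * hn (%x. \<zeta> (st x) ^ b * g x))"
proof -
 have n1: "n - 1 = a + b" "n - Suc 0 = a + b" using ab by simp_all
 have t: "(%x. partial i \<zeta> x * f x) \<in> test_functions UNIV"
  by (intro test_mult C_infinity_partial smooth_\<zeta> f)
 have "(%x. partial i (%x. \<zeta> x ^ n) x * f x * g x)
   = (%x. (real n * (\<zeta> x ^ a * (partial i \<zeta> x * f x))) * (\<zeta> x ^ b * g x))"
  by (simp add: partial_power[OF smooth_\<zeta>] n1 power_add mult_ac)
 then have "\<bar>hi (%x. partial i (%x. \<zeta> x ^ n) x * f x * g x)\<bar>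
   <= hn (%x. real n * (\<zeta> x ^ a * (partial i \<zeta> x * f x))) * hn (%x. \<zeta> x ^ b * g x)"
  by (simp only:) (intro hi_CS test_L2b_UNIV test_cmult test_weight t g)
 also have "hn (%x. real n * (\<zeta> x ^ a * (partial i \<zeta> x * f x))) <= hn (%x. (real n * L) * (\<zeta> x ^ a * f x))"
 proof (rule hn_mono)
  show "L2b (%x. (real n * L) * (\<zeta> x ^ a * f x))" by (intro test_L2b_UNIV test_cmult test_weight f)
  show "(%x. real n * (\<zeta> x ^ a * (partial i \<zeta> x * f x))) \<in> borel_measurable borel"
   by (rule test_borel[where U=UNIV]) (intro test_cmult test_weight t)
  fix x
  have "\<bar>partial i \<zeta> x\<bar> * (real n * \<bar>\<zeta> x ^ a * f x\<bar>) <= L * (real n * \<bar>\<zeta> x ^ a * f x\<bar>)"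
   by (intro mult_right_mono L) auto
  then show "\<bar>real n * (\<zeta> x ^ a * (partial i \<zeta> x * f x))\<bar> <= \<bar>real n * L * (\<zeta> x ^ a * f x)\<bar>"
   using L(1) by (simp add: abs_mult mult_ac)
 qed
 finally show "\<bar>hi (%x. partial i (%x. \<zeta> x ^ n) x * f x * g x)\<bar>
   <= real n * L * (hn (%x. \<zeta> x ^ a * f x) * hn (%x. \<zeta> x ^ b * g x))"
  unfolding hn_cmult using L(1) by (simp add: abs_mult mult.assoc mult_right_mono)
 define \<tau> where "\<tau> = (if i = lastix then 2 else 1 :: real)"
 have t': "(%x. partial i \<zeta> (st x) * f x) \<in> test_functions UNIV"
  by (intro test_mult C_infinity_st C_infinity_partial smooth_\<zeta> f)
 have "partial i (%x. \<zeta> (st x) ^ n) x = \<tau> * (real n * \<zeta> (st x) ^ (n - 1) * partial i \<zeta> (st x))" for x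
  unfolding partial_power[OF C_infinity_st[OF smooth_\<zeta>]] partial_st[OF smooth_\<zeta>] by (simp add: \<tau>_def)
 then have "(%x. partial i (%x. \<zeta> (st x) ^ n) x * f x * g x)
   = (%x. (\<tau> * real n * (\<zeta> (st x) ^ a * (partial i \<zeta> (st x) * f x))) * (\<zeta> (st x) ^ b * g x))"
  by (simp add: n1 power_add mult_ac)
 then have "\<bar>hi (%x. partial i (%x. \<zeta> (st x) ^ n) x * f x * g x)\<bar>
   <= hn (%x. \<tau> * real n * (\<zeta> (st x) ^ a * (partial i \<zeta> (st x) * f x))) * hn (%x. \<zeta> (st x) ^ b * g x)"
  by (simp only:) (intro hi_CS test_L2b_UNIV test_cmult test_weight_st t' g)
 also have "hn (%x. \<tau> * real n * (\<zeta> (st x) ^ a * (partial i \<zeta> (st x) * f x))) <= hn (%x. (2 * real n * L) * (\<zeta> (st x) ^ a * f x))"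
 proof (rule hn_mono)
  show "L2b (%x. (2 * real n * L) * (\<zeta> (st x) ^ a * f x))" by (intro test_L2b_UNIV test_cmult test_weight_st f)
  show "(%x. \<tau> * real n * (\<zeta> (st x) ^ a * (partial i \<zeta> (st x) * f x))) \<in> borel_measurable borel"
   by (rule test_borel[where U=UNIV]) (intro test_cmult test_weight_st t')
  fix x
  have "(\<tau> * \<bar>partial i \<zeta> (st x)\<bar>) * (real n * \<bar>\<zeta> (st x) ^ a * f x\<bar>) <= (2 * L) * (real n * \<bar>\<zeta> (st x) ^ a * f x\<bar>)"
   by (intro mult_right_mono mult_mono L) (auto simp: \<tau>_def)
  then show "\<bar>\<tau> * real n * (\<zeta> (st x) ^ a * (partial i \<zeta> (st x) * f x))\<bar> <= \<bar>2 * real n * L * (\<zeta> (st x) ^ a * f x)\<bar>"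
   using L(1) by (simp add: abs_mult mult_ac \<tau>_def split: if_splits)
 qed
 finally show "\<bar>hi (%x. partial i (%x. \<zeta> (st x) ^ n) x * f x * g x)\<bar>
   <= 2 * real n * L * (hn (%x. \<zeta> (st x) ^ a * f x) * hn (%x. \<zeta> (st x) ^ b * g x))"
  unfolding hn_cmult using L(1) by (simp add: abs_mult mult.assoc mult_right_mono)
qed

lemma refl_boundary:
 assumes "x $ lastix = 0" "f \<in> test_functions UNIV"
 shows "reflx f x = f x" "partial lastix (reflx f) x = - partial lastix f x"
proof -
 show "reflx f x = f x" by (simp add: reflx_def st_boundary[OF assms(1)])
 have "reflx f = (%x. 3 * f x + (-2) * f (st x))" by (simp add: reflx_def fun_eq_iff)
 then show "partial lastix (reflx f) x = - partial lastix f x"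
  by (simp only: partial_comb_st[OF assms(2)]) (simp add: st_boundary[OF assms(1)])
qed

lemma partial_refl_eq:
 assumes "f \<in> test_functions UNIV"
 shows "i ~= lastix ==> partial i (reflx f) = reflx (partial i f)"
  "partial lastix (reflx f) = (%x. 3 * partial lastix f x + (-4) * partial lastix f (st x))"
  "partial lastix (partial lastix (reflx f)) = (%x. 3 * partial lastix (partial lastix f) x + (-8) * partial lastix (partial lastix f) (st x))"
proof -
 have e: "reflx f = (%x. 3 * f x + (-2) * f (st x))" by (simp add: reflx_def fun_eq_iff)
 show "i ~= lastix ==> partial i (reflx f) = reflx (partial i f)"
  unfolding e by (rule ext) (simp only: partial_comb_st[OF assms], simp add: reflx_def)
 show 1: "partial lastix (reflx f) = (%x. 3 * partial lastix f x + (-4) * partial lastix f (st x))"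
  unfolding e by (rule ext) (simp only: partial_comb_st[OF assms], simp)
 show "partial lastix (partial lastix (reflx f)) = (%x. 3 * partial lastix (partial lastix f) x + (-8) * partial lastix (partial lastix f) (st x))"
  unfolding 1 by (rule ext) (simp only: partial_comb_st[OF test_partial[OF assms]], simp)
qed

text \<open>The constants are \<open>3 + 2 \<cdot> 2\<^sup>j\<close>, where \<open>j\<close> is the number of normal
  derivatives.\<close>

lemma refl_bounds:
 assumes f: "f \<in> test_functions UNIV"
 shows "hn (%x. \<zeta> (st x) ^ k * reflx f x) <= 5 * hn (%x. \<zeta> x ^ k * f x)"
  "hn (%x. \<zeta> (st x) ^ k * partial lastix (reflx f) x) <= 7 * hn (%x. \<zeta> x ^ k * partial lastix f x)"
  "hn (%x. \<zeta> (st x) ^ k * partial lastix (partial lastix (reflx f)) x)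
   <= 11 * hn (%x. \<zeta> x ^ k * partial lastix (partial lastix f) x)"
proof -
 have e: "reflx f = (%x. 3 * f x + (-2) * f (st x))" by (simp add: reflx_def fun_eq_iff)
 show "hn (%x. \<zeta> (st x) ^ k * reflx f x) <= 5 * hn (%x. \<zeta> x ^ k * f x)"
  using hn_comb_st[OF f \<zeta>, of k 3 "-2"] unfolding e by simp
 show "hn (%x. \<zeta> (st x) ^ k * partial lastix (reflx f) x) <= 7 * hn (%x. \<zeta> x ^ k * partial lastix f x)"
  using hn_comb_st[OF test_partial[OF f] \<zeta>, where k=k and a=3 and b="-4"] unfolding partial_refl_eq(2)[OF f] by simp
 show "hn (%x. \<zeta> (st x) ^ k * partial lastix (partial lastix (reflx f)) x)
   <= 11 * hn (%x. \<zeta> x ^ k * partial lastix (partial lastix f) x)"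
  using hn_comb_st[OF test_partial[OF test_partial[OF f]] \<zeta>, where k=k and a=3 and b="-8"]
  unfolding partial_refl_eq(3)[OF f] by simp
qed

lemma partial_mult3:
 assumes "C_infinity f" "C_infinity g" "C_infinity h"
 shows "partial i (%x. f x * g x * h x) x
  = partial i f x * g x * h x + f x * partial i g x * h x + f x * g x * partial i h x"
proof -
 have "partial i (%x. (f x * g x) * h x) x = (f x * g x) * partial i h x + partial i (%x. f x * g x) x * h x"
  by (intro partial_mult C_infinity_differentiable C_infinity_mult assms)
 also have "partial i (%x. f x * g x) x = f x * partial i g x + partial i f x * g x"
  by (intro partial_mult C_infinity_differentiable assms)
 finally show ?thesis by (simp add: algebra_simps)
qed

text \<open>Integration by parts in the normal direction. The boundary terms of a function and of its
  reflection cancel.\<close>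

lemma normal_parts:
 assumes K: "K \<in> test_functions UNIV" and Z: "Z \<in> test_functions UNIV"
  and ab: "a + b = 2 * s" and ae: "a + e + 1 = 2 * s"
 shows "\<bar>hi (%x. \<zeta> x ^ (2 * s) * partial lastix Z x * partial lastix K x)
   + hi (%x. \<zeta> (st x) ^ (2 * s) * partial lastix (reflx Z) x * partial lastix (reflx K) x)\<bar>
  <= (56 + 142 * real (2 * s) * L) * (hn (%x. \<zeta> x ^ a * Z x) *
    (hn (%x. \<zeta> x ^ b * partial lastix (partial lastix K) x) + hn (%x. \<zeta> x ^ e * partial lastix K x)))"
proof -
 let ?N = "lastix :: 'n"
 define A where "A = hn (%x. \<zeta> x ^ a * Z x)"
 define B where "B = hn (%x. \<zeta> x ^ b * partial ?N (partial ?N K) x)"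
 define E where "E = hn (%x. \<zeta> x ^ e * partial ?N K x)"
 have nonneg: "A >= 0" "B >= 0" "E >= 0" by (simp_all add: A_def B_def E_def)
 have rK: "reflx K \<in> test_functions UNIV" and rZ: "reflx Z \<in> test_functions UNIV" by (intro test_reflx K Z)+
 define p where "p x = \<zeta> x ^ (2 * s) * Z x * partial ?N K x + \<zeta> (st x) ^ (2 * s) * reflx Z x * partial ?N (reflx K) x" for x
 have sm: "C_infinity (%x. \<zeta> x ^ (2 * s))" "C_infinity (%x. \<zeta> (st x) ^ (2 * s))"
  by (intro C_infinity_power C_infinity_st smooth_\<zeta>)+
 have t: "(%x. f x * g x * h x) \<in> test_functions UNIV" if "C_infinity f" "g \<in> test_functions UNIV" "h \<in> test_functions UNIV" for f g h :: "'n rfun"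
  by (intro test_mult C_infinity_mult that test_smooth[OF that(2)])
 have pt: "p \<in> test_functions UNIV" unfolding p_def
  by (intro test_add t sm Z rZ test_partial K rK)
 have pz: "p x = 0" if "x $ ?N = 0" for x
  by (simp add: p_def refl_boundary[OF that K] refl_boundary[OF that Z] st_boundary[OF that])
 have "hi (partial ?N p) = 0" by (rule half_space_divergence[OF pt]) (simp add: pz)
 define q1 where "q1 x = partial ?N (%x. \<zeta> x ^ (2 * s)) x * Z x * partial ?N K x" for x
 define q2 where "q2 x = \<zeta> x ^ (2 * s) * partial ?N Z x * partial ?N K x" for x
 define q3 where "q3 x = \<zeta> x ^ (2 * s) * Z x * partial ?N (partial ?N K) x" for x
 define q4 where "q4 x = partial ?N (%x. \<zeta> (st x) ^ (2 * s)) x * reflx Z x * partial ?N (reflx K) x" for x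
 define q5 where "q5 x = \<zeta> (st x) ^ (2 * s) * partial ?N (reflx Z) x * partial ?N (reflx K) x" for x
 define q6 where "q6 x = \<zeta> (st x) ^ (2 * s) * reflx Z x * partial ?N (partial ?N (reflx K)) x" for x
 have qt: "q1 \<in> test_functions UNIV" "q2 \<in> test_functions UNIV" "q3 \<in> test_functions UNIV"
  "q4 \<in> test_functions UNIV" "q5 \<in> test_functions UNIV" "q6 \<in> test_functions UNIV"
  unfolding q1_def q2_def q3_def q4_def q5_def q6_def
  by (intro t sm C_infinity_partial Z rZ K rK test_partial)+
 have "partial ?N p x = (q1 x + q2 x + q3 x) + (q4 x + q5 x + q6 x)" for x
 proof -
  have "partial ?N p x = partial ?N (%x. \<zeta> x ^ (2 * s) * Z x * partial ?N K x) x
    + partial ?N (%x. \<zeta> (st x) ^ (2 * s) * reflx Z x * partial ?N (reflx K) x) x"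
   unfolding p_def
   by (intro partial_add C_infinity_differentiable test_smooth[where U=UNIV] t sm Z rZ test_partial K rK)
  then show ?thesis
   unfolding q1_def q2_def q3_def q4_def q5_def q6_def
   by (simp add: partial_mult3 sm test_smooth[OF Z] test_smooth[OF rZ] test_smooth[OF test_partial[OF K]]
     test_smooth[OF test_partial[OF rK]])
 qed
 then have "partial ?N p = (%x. (q1 x + q2 x + q3 x) + (q4 x + q5 x + q6 x))" ..
 then have sum0: "hi q2 + hi q5 = - (hi q1 + hi q3 + hi q4 + hi q6)"
  using \<open>hi (partial ?N p) = 0\<close> by (simp add: hi_add qt test_add)
 have b1: "\<bar>hi q1\<bar> <= real (2 * s) * L * (A * E)"
  unfolding q1_def A_def E_def by (rule weight_derivative_bound(1)[OF Z test_partial[OF K] ae])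
 have b3: "\<bar>hi q3\<bar> <= A * B"
  unfolding q3_def A_def B_def by (rule weighted_CS(1)[OF Z test_partial[OF test_partial[OF K]] ab])
 have b4: "\<bar>hi q4\<bar> <= 2 * real (2 * s) * L * ((5 * A) * (7 * E))"
 proof -
  have "\<bar>hi q4\<bar> <= 2 * real (2 * s) * L * (hn (%x. \<zeta> (st x) ^ a * reflx Z x) * hn (%x. \<zeta> (st x) ^ e * partial ?N (reflx K) x))"
   unfolding q4_def by (rule weight_derivative_bound(2)[OF rZ test_partial[OF rK] ae])
  also have "\<dots> <= 2 * real (2 * s) * L * ((5 * A) * (7 * E))"
   unfolding A_def E_def using L(1) by (intro mult_left_mono mult_mono refl_bounds Z K) auto
  finally show ?thesis .
 qed
 have b6: "\<bar>hi q6\<bar> <= (5 * A) * (11 * B)"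
 proof -
  have "\<bar>hi q6\<bar> <= hn (%x. \<zeta> (st x) ^ a * reflx Z x) * hn (%x. \<zeta> (st x) ^ b * partial ?N (partial ?N (reflx K)) x)"
   unfolding q6_def by (rule weighted_CS(2)[OF rZ test_partial[OF test_partial[OF rK]] ab])
  also have "\<dots> <= (5 * A) * (11 * B)"
   unfolding A_def B_def by (intro mult_mono refl_bounds Z K) auto
  finally show ?thesis .
 qed
 define w where "w = real (2 * s) * L"
 have w: "w >= 0" using L(1) by (simp add: w_def)
 have "\<bar>hi q2 + hi q5\<bar> <= \<bar>hi q1\<bar> + \<bar>hi q3\<bar> + \<bar>hi q4\<bar> + \<bar>hi q6\<bar>" using sum0 by linarith
 also have "\<dots> <= w * (A * E) + A * B + 70 * (w * (A * E)) + 55 * (A * B)"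
  using b1 b3 b4 b6 unfolding w_def by linarith
 also have "\<dots> <= (56 + 142 * w) * (A * (B + E))"
 proof -
  have "0 <= w * (A * B)" "0 <= w * (A * E)" "0 <= A * E" using nonneg w by auto
  moreover have "(56 + 142 * w) * (A * (B + E)) = 56 * (A * B) + 56 * (A * E) + 142 * (w * (A * B)) + 142 * (w * (A * E))"
   by (simp add: algebra_simps)
  ultimately show ?thesis by linarith
 qed
 finally show ?thesis unfolding A_def B_def E_def q2_def q5_def w_def by (simp add: mult.assoc)
qed

lemma power_double_split: "z ^ (2 * n) = z ^ n * z ^ n" for z :: real
 by (simp only: mult_2 power_add)

text \<open>\<open>normal_parts\<close> with \<open>Z = K\<close>: the term with the reflected copies is nonnegative and can be
  dropped.\<close>

lemma interpolate_normal:
 assumes K: "K \<in> test_functions UNIV"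
 shows "(hn (%x. \<zeta> x ^ (t + 1) * partial lastix K x))\<^sup>2
  <= (56 + 142 * real (2 * (t + 1)) * L) * (hn (%x. \<zeta> x ^ t * K x) *
    (hn (%x. \<zeta> x ^ (t + 2) * partial lastix (partial lastix K) x) + hn (%x. \<zeta> x ^ (t + 1) * partial lastix K x)))"
proof -
 have "(hn (%x. \<zeta> x ^ (t + 1) * partial lastix K x))\<^sup>2 = hi (%x. (\<zeta> x ^ (t + 1) * partial lastix K x)\<^sup>2)"
  by (rule hi_sq[symmetric]) (intro test_L2b_UNIV test_weight test_partial K)
 also have "(%x. (\<zeta> x ^ (t + 1) * partial lastix K x)\<^sup>2) = (%x. \<zeta> x ^ (2 * (t + 1)) * partial lastix K x * partial lastix K x)"
  by (rule ext) (simp only: power_double_split power2_eq_square, simp only: mult_ac)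
 also have "hi \<dots> <= \<bar>hi \<dots> + hi (%x. \<zeta> (st x) ^ (2 * (t + 1)) * partial lastix (reflx K) x * partial lastix (reflx K) x)\<bar>"
 proof -
  have "0 <= hi (%x. \<zeta> (st x) ^ (2 * (t + 1)) * partial lastix (reflx K) x * partial lastix (reflx K) x)"
   unfolding hi_def by (intro integral_nonneg_AE AE_I2 mult_nonneg_nonneg[OF indicator_pos_le])
    (simp add: \<zeta>(2) mult.assoc)
  then show ?thesis by linarith
 qed
 also have "\<dots> <= (56 + 142 * real (2 * (t + 1)) * L) * (hn (%x. \<zeta> x ^ t * K x) *
    (hn (%x. \<zeta> x ^ (t + 2) * partial lastix (partial lastix K) x) + hn (%x. \<zeta> x ^ (t + 1) * partial lastix K x)))"
  by (rule normal_parts[OF K K]) auto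
 finally show ?thesis .
qed

lemma tangential_parts:
 assumes J: "J \<in> test_functions UNIV" and G: "G \<in> test_functions UNIV" and i: "i ~= lastix"
 shows "hi (%x. \<zeta> x ^ n * partial i J x * G x)
   = - hi (%x. partial i (%x. \<zeta> x ^ n) x * J x * G x) - hi (%x. \<zeta> x ^ n * J x * partial i G x)"
  "hi (%x. \<zeta> (st x) ^ n * partial i J x * G x)
   = - hi (%x. partial i (%x. \<zeta> (st x) ^ n) x * J x * G x) - hi (%x. \<zeta> (st x) ^ n * J x * partial i G x)"
proof -
 have gen: "hi (%x. w x * partial i J x * G x) = - hi (%x. partial i w x * J x * G x) - hi (%x. w x * J x * partial i G x)"
  if w: "C_infinity w" for w :: "'n rfun"
 proof -
  have t: "(%x. f x * g x * h x) \<in> test_functions UNIV" if "C_infinity f" "g \<in> test_functions UNIV" "h \<in> test_functions UNIV" for f g h :: "'n rfun"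
   by (intro test_mult C_infinity_mult that test_smooth[OF that(2)])
  have "hi (partial i (%x. w x * J x * G x)) = 0"
   by (rule half_space_divergence) (use i t[OF w J G] in auto)
  moreover have "partial i (%x. w x * J x * G x) = (%x. partial i w x * J x * G x + w x * partial i J x * G x + w x * J x * partial i G x)"
   by (rule ext, rule partial_mult3) (intro w test_smooth[OF J] test_smooth[OF G])+
  ultimately show ?thesis
   by (simp add: hi_add test_add t w J G test_partial C_infinity_partial)
 qed
 show "hi (%x. \<zeta> x ^ n * partial i J x * G x)
   = - hi (%x. partial i (%x. \<zeta> x ^ n) x * J x * G x) - hi (%x. \<zeta> x ^ n * J x * partial i G x)"
  by (rule gen) (intro C_infinity_power smooth_\<zeta>)
 show "hi (%x. \<zeta> (st x) ^ n * partial i J x * G x)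
   = - hi (%x. partial i (%x. \<zeta> (st x) ^ n) x * J x * G x) - hi (%x. \<zeta> (st x) ^ n * J x * partial i G x)"
  by (rule gen) (intro C_infinity_power C_infinity_st smooth_\<zeta>)
qed

text \<open>Two integrations by parts turn \<open>(\<partial>\<^sub>i \<partial>\<^sub>N K)\<^sup>2\<close> into
  \<open>\<partial>\<^sub>i \<partial>\<^sub>i K \<cdot> \<partial>\<^sub>N \<partial>\<^sub>N K\<close>. The tangential
  one, along \<open>i\<close>, has no boundary term, and the normal one is \<open>normal_parts\<close>.\<close>

lemma interpolate_mixed:
 assumes K: "K \<in> test_functions UNIV" and i: "i ~= lastix"
 shows "(hn (%x. \<zeta> x ^ (t + 1) * partial i (partial lastix K) x))\<^sup>2
  <= (56 + 142 * real (2 * (t + 1)) * L) *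
   (hn (%x. \<zeta> x ^ (t + 1) * partial i (partial i K) x) *
    (hn (%x. \<zeta> x ^ (t + 1) * partial lastix (partial lastix K) x) + hn (%x. \<zeta> x ^ t * partial lastix K x))
    + hn (%x. \<zeta> x ^ (t + 1) * partial i (partial lastix K) x) * hn (%x. \<zeta> x ^ t * partial lastix K x))"
proof -
 let ?N = "lastix :: 'n"
 let ?s = "2 * (t + 1)"
 define A where "A = hn (%x. \<zeta> x ^ (t + 1) * partial i (partial i K) x)"
 define B where "B = hn (%x. \<zeta> x ^ (t + 1) * partial ?N (partial ?N K) x)"
 define E where "E = hn (%x. \<zeta> x ^ t * partial ?N K x)"
 define H where "H = hn (%x. \<zeta> x ^ (t + 1) * partial i (partial ?N K) x)"
 have nonneg: "A >= 0" "B >= 0" "E >= 0" "H >= 0" by (simp_all add: A_def B_def E_def H_def)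
 have rK: "reflx K \<in> test_functions UNIV" by (intro test_reflx K)
 have sK: "C_infinity K" and srK: "C_infinity (reflx K)" using K rK by (auto intro: test_smooth)
 have Z: "partial i (partial i K) \<in> test_functions UNIV" by (intro test_partial K)
 have rZ: "reflx (partial i (partial i K)) = partial i (partial i (reflx K))"
  by (simp add: partial_refl_eq(1)[OF K i] partial_refl_eq(1)[OF test_partial[OF K] i])
 have main: "\<bar>hi (%x. \<zeta> x ^ ?s * partial ?N (partial i (partial i K)) x * partial ?N K x)
   + hi (%x. \<zeta> (st x) ^ ?s * partial ?N (partial i (partial i (reflx K))) x * partial ?N (reflx K) x)\<bar>
  <= (56 + 142 * real ?s * L) * (A * (B + E))"
  unfolding A_def B_def E_def rZ[symmetric] by (rule normal_parts[OF K Z]) auto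
 have c1: "partial ?N (partial i (partial i f)) = partial i (partial i (partial ?N f))" if "C_infinity f" for f :: "'n rfun"
  using partial_commute[OF C_infinity_partial[OF that], of ?N i i] partial_commute[OF that, of ?N i] by simp
 define J where "J = partial i (partial ?N K)"
 define J' where "J' = partial i (partial ?N (reflx K))"
 have JT: "J \<in> test_functions UNIV" "J' \<in> test_functions UNIV" unfolding J_def J'_def by (intro test_partial K rK)+
 have e1: "hi (%x. \<zeta> x ^ ?s * partial ?N (partial i (partial i K)) x * partial ?N K x)
   = - hi (%x. partial i (%x. \<zeta> x ^ ?s) x * J x * partial ?N K x) - hi (%x. \<zeta> x ^ ?s * J x * J x)"
  unfolding c1[OF sK] J_def by (rule tangential_parts(1)) (intro test_partial K i)+
 have e2: "hi (%x. \<zeta> (st x) ^ ?s * partial ?N (partial i (partial i (reflx K))) x * partial ?N (reflx K) x)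
   = - hi (%x. partial i (%x. \<zeta> (st x) ^ ?s) x * J' x * partial ?N (reflx K) x) - hi (%x. \<zeta> (st x) ^ ?s * J' x * J' x)"
  unfolding c1[OF srK] J'_def by (rule tangential_parts(2)) (intro test_partial rK i)+
 have H2: "hi (%x. \<zeta> x ^ ?s * J x * J x) = H\<^sup>2"
 proof -
  have "(%x. \<zeta> x ^ ?s * J x * J x) = (%x. (\<zeta> x ^ (t + 1) * J x)\<^sup>2)"
   by (rule ext) (simp only: power_double_split power2_eq_square, simp only: mult_ac)
  then show ?thesis unfolding H_def J_def[symmetric] by (simp only: hi_sq[OF test_L2b[OF test_weight[OF JT(1)]]])
 qed
 have H2': "hi (%x. \<zeta> (st x) ^ ?s * J' x * J' x) >= 0"
  unfolding hi_def by (intro integral_nonneg_AE AE_I2 mult_nonneg_nonneg[OF indicator_pos_le])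
   (simp add: \<zeta>(2) mult.assoc)
 have w1: "\<bar>hi (%x. partial i (%x. \<zeta> x ^ ?s) x * J x * partial ?N K x)\<bar> <= real ?s * L * (H * E)"
  unfolding H_def E_def J_def by (rule weight_derivative_bound(1)) (intro test_partial K | simp)+
 have w2: "\<bar>hi (%x. partial i (%x. \<zeta> (st x) ^ ?s) x * J' x * partial ?N (reflx K) x)\<bar> <= 2 * real ?s * L * ((7 * H) * (7 * E))"
 proof -
  have "\<bar>hi (%x. partial i (%x. \<zeta> (st x) ^ ?s) x * J' x * partial ?N (reflx K) x)\<bar>
    <= 2 * real ?s * L * (hn (%x. \<zeta> (st x) ^ (t + 1) * J' x) * hn (%x. \<zeta> (st x) ^ t * partial ?N (reflx K) x))"
   by (rule weight_derivative_bound(2)) (intro test_partial rK JT | simp)+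
  also have "hn (%x. \<zeta> (st x) ^ (t + 1) * J' x) <= 7 * H"
  proof -
   have "J' = partial ?N (reflx (partial i K))"
    unfolding J'_def using partial_commute[OF srK, of i ?N] by (simp add: partial_refl_eq(1)[OF K i])
   then show ?thesis
    using refl_bounds(2)[OF test_partial[OF K], of "t + 1" i] partial_commute[OF sK, of i ?N] by (simp add: H_def)
  qed
  also have "hn (%x. \<zeta> (st x) ^ t * partial ?N (reflx K) x) <= 7 * E"
   unfolding E_def by (rule refl_bounds(2)[OF K])
  finally show ?thesis using L(1) nonneg by (simp add: mult_left_mono mult_right_mono mult_mono)
 qed
 define w where "w = real ?s * L"
 have w: "w >= 0" using L(1) by (simp add: w_def)
 have "(56 + 142 * real ?s * L) * (A * (B + E)) = (56 + 142 * w) * (A * (B + E))"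
  "real ?s * L * (H * E) = w * (H * E)" "2 * real ?s * L * ((7 * H) * (7 * E)) = 98 * (w * (H * E))"
  by (simp_all add: w_def)
 then have "H\<^sup>2 <= (56 + 142 * w) * (A * (B + E)) + w * (H * E) + 98 * (w * (H * E))"
  using main e1 e2 H2 H2' w1 w2 by linarith
 also have "\<dots> <= (56 + 142 * w) * (A * (B + E) + H * E)"
 proof -
  have "0 <= w * (H * E)" "0 <= H * E" using nonneg w by auto
  moreover have "(56 + 142 * w) * (A * (B + E) + H * E) = (56 + 142 * w) * (A * (B + E)) + 56 * (H * E) + 142 * (w * (H * E))"
   by (simp add: algebra_simps)
  ultimately show ?thesis by linarith
 qed
 finally show ?thesis unfolding A_def B_def E_def H_def w_def by (simp only: mult.assoc)
qed

end

section \<open>Normal regularity: the a priori estimate\<close>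

text \<open>The form in which the interpolation inequalities are used: \<open>H\<close> is a middle derivative, \<open>P\<close>
  collects those with fewer and \<open>B\<close> those with more normal derivatives, and \<open>B\<close> enters with an
  arbitrarily small factor \<open>e\<close>.\<close>

lemma quadratic_interp:
 fixes C H P B e :: real
 assumes "C >= 1" "H >= 0" "P >= 0" "B >= 0" "e > 0" "H\<^sup>2 <= C * (P * B + P\<^sup>2 + H * P)"
 shows "H <= e * B + (4 * C + C / e) * P"
proof (cases "H <= 4 * C * P")
 case True
 have "0 <= e * B" "0 <= C / e * P" using assms by auto
 then show ?thesis using True by (simp add: distrib_right)
next
 case False
 then have H4: "C * P <= H / 4" by simp
 have "P <= C * P" using assms by (simp add: mult_left_le_one_le mult_le_cancel_right1)
 then have P4: "P <= H / 4" using H4 by linarith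
 have 1: "C * (H * P) <= H\<^sup>2 / 4"
  using mult_right_mono[OF H4 assms(2)] by (simp add: power2_eq_square mult_ac)
 have 2: "C * P\<^sup>2 <= H\<^sup>2 / 16"
  using mult_mono[OF H4 P4] assms by (simp add: power2_eq_square mult_ac)
 have 0: "0 <= C * (P * B)" using assms by simp
 have "C * (P * B + P\<^sup>2 + H * P) = C * (P * B) + C * P\<^sup>2 + C * (H * P)" by (simp add: distrib_left)
 then have "H\<^sup>2 <= 2 * (C * (P * B))" using assms(6) 0 1 2 by linarith
 also have "\<dots> = 2 * ((e * B) * (C / e * P))" using assms(5) by simp
 also have "\<dots> <= (e * B + C / e * P)\<^sup>2"
  using zero_le_power2[of "e * B"] zero_le_power2[of "C / e * P"] by (simp add: power2_sum)
 finally have "H <= e * B + C / e * P" by (rule power2_le_imp_le) (use assms in auto)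
 moreover have "0 <= 4 * C * P" using assms by simp
 ultimately show ?thesis by (simp add: distrib_right)
qed

text \<open>Interpolation between neighbours in a finite chain gives interpolation between its ends, again with an arbitrarily
  small factor at the upper end: \<open>C\<close> depends on \<open>e\<close>, \<open>c\<close> and the length only.\<close>

lemma interp_chain:
 fixes c :: "real => real" and n :: nat
 assumes c: "!!e. e > 0 ==> c e >= 0" and e: "e > 0"
 shows "\<exists>C\<ge>0. \<forall>(T::nat => real) Z. (\<forall>j. T j >= 0) --> Z >= 0 -->
  (\<forall>e>0. \<forall>j. 1 <= j \<and> j < n --> T j <= e * T (j + 1) + c e * (T (j - 1) + Z)) -->
  (\<forall>j<n. T j <= e * T n + C * (T 0 + Z))"
proof -
 define H where "H T Z \<longleftrightarrow> (\<forall>j. T j >= 0) \<and> Z >= 0 \<and>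
  (\<forall>e>0. \<forall>j. 1 <= j \<and> j < n --> T j <= e * T (j + 1) + c e * (T (j - 1) + Z))" for T :: "nat => real" and Z
 have step: "j < n ==> e > 0 ==> \<exists>C\<ge>0. \<forall>T Z. H T Z --> T j <= e * T (j + 1) + C * (T 0 + Z)" for j e
 proof (induction j arbitrary: e)
  case 0
  show ?case
  proof (intro exI[of _ 1] conjI allI impI)
   fix T Z assume "H T Z"
   then have "0 <= e * T (0 + 1)" "Z >= 0" using 0 by (auto simp: H_def)
   then show "T 0 <= e * T (0 + 1) + 1 * (T 0 + Z)" by simp
  qed simp
 next
  case (Suc j)
  define k where "k = c (e / 2)"
  have k: "k >= 0" unfolding k_def using Suc.prems by (intro c) simp
  define d where "d = 1 / (2 * k + 2)"
  have d: "d > 0" "k * d <= 1 / 2" using k by (auto simp: d_def field_simps)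
  obtain C where C: "C >= 0" "!!T Z. H T Z ==> T j <= d * T (j + 1) + C * (T 0 + Z)"
   using Suc.IH[of d] Suc.prems d by auto
  show ?case
  proof (intro exI[of _ "2 * k * (C + 1)"] conjI allI impI)
   show "0 <= 2 * k * (C + 1)" using k C by simp
   fix T Z assume h: "H T Z"
   have nn: "T 0 >= 0" "Z >= 0" "T (Suc j) >= 0" using h by (auto simp: H_def)
   have "T (Suc j) <= e / 2 * T (Suc j + 1) + k * (T j + Z)"
    using h Suc.prems unfolding H_def k_def by (metis add_diff_cancel_left' half_gt_zero le_add1 plus_1_eq_Suc)
   also have "k * (T j + Z) <= k * (d * T (Suc j) + C * (T 0 + Z) + Z)"
    using C(2)[OF h] k by (intro mult_left_mono) auto
   also have "\<dots> = (k * d) * T (Suc j) + k * (C * (T 0 + Z) + Z)" by (simp add: algebra_simps)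
   also have "\<dots> <= 1 / 2 * T (Suc j) + k * (C * (T 0 + Z) + (T 0 + Z))"
    using d nn k by (intro add_mono mult_right_mono mult_left_mono) auto
   finally have "T (Suc j) <= e * T (Suc j + 1) + 2 * (k * (C * (T 0 + Z) + (T 0 + Z)))" by simp
   then show "T (Suc j) <= e * T (Suc j + 1) + 2 * k * (C + 1) * (T 0 + Z)" by (simp add: algebra_simps)
  qed
 qed
 have all: "j < n ==> e > 0 ==> \<exists>C\<ge>0. \<forall>T Z. H T Z --> T j <= e * T n + C * (T 0 + Z)" for j e
 proof (induction "n - j" arbitrary: j)
  case 0 then show ?case by simp
 next
  case (Suc k)
  show ?case
  proof (cases "j + 1 = n")
   case True
   then show ?thesis using step[OF Suc.prems] by simp
  next
   case False
   then have "k = n - (j + 1)" "j + 1 < n" using Suc.hyps(2) Suc.prems by auto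
   from Suc.hyps(1)[OF this Suc.prems(2)] obtain C1 where C1: "C1 >= 0" "!!T Z. H T Z ==> T (j + 1) <= e * T n + C1 * (T 0 + Z)"
    by blast
   obtain C2 where C2: "C2 >= 0" "!!T Z. H T Z ==> T j <= 1 * T (j + 1) + C2 * (T 0 + Z)"
    using step[OF Suc.prems(1), of 1] by auto
   show ?thesis
   proof (intro exI[of _ "C1 + C2"] conjI allI impI)
    fix T Z assume h: "H T Z"
    show "T j <= e * T n + (C1 + C2) * (T 0 + Z)"
     using C1(2)[OF h] C2(2)[OF h] by (simp add: algebra_simps)
   qed (use C1 C2 in simp)
  qed
 qed
 have "\<forall>j. \<exists>C. C >= 0 \<and> (j < n --> (\<forall>T Z. H T Z --> T j <= e * T n + C * (T 0 + Z)))"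
  using all e by (metis order_refl)
 from choice[OF this] obtain C where C: "!!j. C j >= 0" "!!j T Z. j < n ==> H T Z ==> T j <= e * T n + C j * (T 0 + Z)"
  by blast
 show ?thesis
 proof (intro exI[of _ "\<Sum>j<n. C j"] conjI allI impI)
  show "0 <= (\<Sum>j<n. C j)" by (intro sum_nonneg C)
  fix T :: "nat => real" and Z j
  assume h: "\<forall>j. T j >= 0" "Z >= 0"
   "\<forall>e>0. \<forall>j. 1 <= j \<and> j < n --> T j <= e * T (j + 1) + c e * (T (j - 1) + Z)" and j: "j < n"
  have "T j <= e * T n + C j * (T 0 + Z)" using C(2)[OF j] h by (simp add: H_def)
  also have "C j * (T 0 + Z) <= (\<Sum>j<n. C j) * (T 0 + Z)"
   using j h C(1) by (intro mult_right_mono member_le_sum) auto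
  finally show "T j <= e * T n + (\<Sum>j<n. C j) * (T 0 + Z)" by simp
 qed
qed

text \<open>\<open>T s j\<close> stands for the norms of the derivatives of order \<open>s\<close> of which \<open>j\<close> are normal. The rows
  are interpolated between tangential and pure normal derivatives of order \<open>q\<close>, and the diagonals
  between order \<open>q\<close> and the tangential derivatives. The bound for \<open>T q q\<close> comes from the
  differential equation.\<close>

lemma interp_absorb:
 fixes c :: "real => real" and q :: nat and K0 :: real
 assumes c: "!!e. e > 0 ==> c e >= 0" and K0: "K0 >= 0"
 shows "\<exists>C\<ge>0. \<forall>(T::nat => nat => real) D. D >= 0 --> (\<forall>s j. T s j >= 0) --> (\<forall>s\<le>q. T s 0 <= D) -->
  (\<forall>e>0. \<forall>j. 1 <= j \<and> j < q --> T q j <= e * T q (j + 1) + c e * (T q (j - 1) + T (q - 1) j)) -->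
  (\<forall>e>0. \<forall>s j. 1 <= j \<and> j <= s \<and> s < q --> T s j <= e * T (s + 1) (j + 1) + c e * T (s - 1) (j - 1)) -->
  T q q <= D + K0 * (\<Sum>j\<in>{1..<q}. T q j) --> (\<forall>s\<le>q. \<forall>j\<le>s. T s j <= C * D)"
proof -
 \<comment> \<open>small enough for \<open>top\<close> to absorb the multiple of \<open>T q q\<close> coming from the row\<close>
 define e1 where "e1 = 1 / (2 * (K0 * real q + 1))"
 have small: "1 / (2 * (k + 1)) > 0" "1 / (2 * (k + 1)) <= 1" "k * (1 / (2 * (k + 1))) <= 1 / 2"
  if "k >= 0" for k :: real
  using that by (simp_all add: divide_simps)
 have "K0 * real q >= 0" using K0 by simp
 from small[OF this] have e1: "e1 > 0" "e1 <= 1" "K0 * real q * e1 <= 1 / 2"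
  by (simp_all add: e1_def)
 obtain CA where CA: "CA >= 0" "!!(T::nat => real) Z. (\<forall>j. T j >= 0) ==> Z >= 0 ==>
  (\<forall>e>0. \<forall>j. 1 <= j \<and> j < q --> T j <= e * T (j + 1) + c e * (T (j - 1) + Z)) ==>
  (\<forall>j<q. T j <= e1 * T q + CA * (T 0 + Z))"
  using interp_chain[of c e1 q, OF c e1(1)] by blast
 define B1 where "B1 = 2 * (1 + K0 * real q * CA)"
 define B2 where "B2 = B1 + CA"
 have B: "B1 >= 0" "B2 >= 0" "B1 <= B2" using K0 CA by (auto simp: B1_def B2_def)
 define n0 where "n0 = real (card (SIGMA s:{..<q}. {..s}))"
 \<comment> \<open>small enough to absorb the part of \<open>Y\<close> that returns through the diagonals\<close>
 define e2 where "e2 = 1 / (2 * (n0 * B2 + 1))"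
 have n0: "n0 >= 0" unfolding n0_def by (rule of_nat_0_le_iff)
 have "n0 * B2 >= 0" using n0 B by simp
 from small[OF this] have e2: "e2 > 0" "n0 * (e2 * B2) <= 1 / 2"
  by (simp_all add: e2_def mult_ac)
 define G where "G d C \<longleftrightarrow> (\<forall>(T::nat => real) Z. (\<forall>j. T j >= 0) --> Z >= 0 -->
  (\<forall>e>0. \<forall>j. 1 <= j \<and> j < q - d --> T j <= e * T (j + 1) + c e * (T (j - 1) + Z)) -->
  (\<forall>j<q - d. T j <= e2 * T (q - d) + C * (T 0 + Z)))" for d C
 have "\<forall>d. \<exists>C\<ge>0. G d C"
  unfolding G_def by (rule allI) (rule interp_chain[of c e2, OF c e2(1)])
 from choice[OF this] obtain CB where CBG: "\<forall>d. CB d >= 0 \<and> G d (CB d)" ..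
 have CB: "CB d >= 0" and CB2: "!!(T::nat => real) Z. (\<forall>j. T j >= 0) ==> Z >= 0 ==>
  (\<forall>e>0. \<forall>j. 1 <= j \<and> j < q - d --> T j <= e * T (j + 1) + c e * (T (j - 1) + Z)) ==>
  (\<forall>j<q - d. T j <= e2 * T (q - d) + CB d * (T 0 + Z))" for d
  using spec[OF CBG, of d] unfolding G_def by simp_all
 define CC where "CC = (\<Sum>d\<le>q. CB d)"
 have CC0: "CC >= 0" unfolding CC_def by (intro sum_nonneg CB)
 define BY where "BY = 1 + 2 * n0 * CC"
 have BY: "BY >= 0" using n0 CC0 by (simp add: BY_def)
 define C where "C = BY + B2 * (1 + BY)"
 show ?thesis
 proof (intro exI[of _ C] conjI allI impI)
  show "C >= 0" using BY B by (simp add: C_def)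
  fix T :: "nat => nat => real" and D and s j :: nat
  assume D: "D >= 0" and T0: "\<forall>s j. T s j >= 0" and TD: "\<forall>s\<le>q. T s 0 <= D"
   and row: "\<forall>e>0. \<forall>j. 1 <= j \<and> j < q --> T q j <= e * T q (j + 1) + c e * (T q (j - 1) + T (q - 1) j)"
   and diag: "\<forall>e>0. \<forall>s j. 1 <= j \<and> j <= s \<and> s < q --> T s j <= e * T (s + 1) (j + 1) + c e * T (s - 1) (j - 1)"
   and top: "T q q <= D + K0 * (\<Sum>j\<in>{1..<q}. T q j)" and sj: "s <= q" "j <= s"
  \<comment> \<open>all derivatives of order less than \<open>q\<close> together\<close>
  define Y where "Y = (\<Sum>(s, j)\<in>(SIGMA s:{..<q}. {..s}). T s j)"
  have Y0: "Y >= 0" unfolding Y_def using T0 by (intro sum_nonneg) auto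
  have TY: "T s j <= Y" if "s < q" "j <= s" for s j
  proof -
   have "(case (s, j) of (s, j) => T s j) <= Y"
    unfolding Y_def by (rule member_le_sum) (use that T0 in auto)
   then show ?thesis by simp
  qed
  have rowY: "\<forall>e>0. \<forall>j. 1 <= j \<and> j < q --> T q j <= e * T q (j + 1) + c e * (T q (j - 1) + Y)"
  proof (intro allI impI)
   fix e :: real and j assume e: "e > 0" and j: "1 <= j \<and> j < q"
   have "T q j <= e * T q (j + 1) + c e * (T q (j - 1) + T (q - 1) j)" using row e j by blast
   also have "c e * (T q (j - 1) + T (q - 1) j) <= c e * (T q (j - 1) + Y)"
    using TY[of "q - 1" j] j c[OF e] by (intro mult_left_mono) auto
   finally show "T q j <= e * T q (j + 1) + c e * (T q (j - 1) + Y)" by simp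
  qed
  have r1: "T q j <= e1 * T q q + CA * (D + Y)" if "j < q" for j
  proof -
   have "T q j <= e1 * T q q + CA * (T q 0 + Y)" using CA(2)[of "T q" Y] T0 Y0 rowY that by blast
   also have "CA * (T q 0 + Y) <= CA * (D + Y)" using TD CA(1) by (intro mult_left_mono) auto
   finally show ?thesis by simp
  qed
  have r2: "T q q <= B1 * (D + Y)"
  proof -
   have "(\<Sum>j\<in>{1..<q}. T q j) <= (\<Sum>j\<in>{1..<q}. e1 * T q q + CA * (D + Y))"
    by (intro sum_mono r1) auto
   also have "\<dots> = real (q - 1) * (e1 * T q q + CA * (D + Y))" by simp
   also have "\<dots> <= real q * (e1 * T q q + CA * (D + Y))"
    using T0 e1 CA(1) D Y0 by (intro mult_right_mono) auto
   finally have "T q q <= D + K0 * (real q * (e1 * T q q + CA * (D + Y)))"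
    using top K0 by (smt (verit) mult_left_mono)
   also have "\<dots> = D + (K0 * real q * e1) * T q q + K0 * real q * CA * (D + Y)" by (simp add: algebra_simps)
   also have "\<dots> <= (D + Y) + 1 / 2 * T q q + K0 * real q * CA * (D + Y)"
    using mult_right_mono[OF e1(3), of "T q q"] T0 Y0 by simp
   finally have "T q q <= 2 * (D + Y) + 2 * (K0 * real q * CA * (D + Y))" by simp
   then show ?thesis by (simp add: B1_def algebra_simps)
  qed
  have r3: "T q j <= B2 * (D + Y)" if "j <= q" for j
  proof (cases "j = q")
   case True
   have "B1 * (D + Y) <= B2 * (D + Y)" using B D Y0 by (intro mult_right_mono) auto
   then show ?thesis using r2 True by simp
  next
   case False
   then have "T q j <= e1 * T q q + CA * (D + Y)" using r1 that by simp
   also have "e1 * T q q <= 1 * (B1 * (D + Y))" using e1 r2 T0 by (intro mult_mono) auto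
   finally show ?thesis by (simp add: B2_def algebra_simps)
  qed
  have low: "T s j <= e2 * (B2 * (D + Y)) + CC * D" if "s < q" "j <= s" for s j
  proof -
   define d where "d = s - j"
   have d: "j < q - d" "d + j = s" "d + (q - d) = q" "d <= q" using that by (auto simp: d_def)
   have "\<forall>j'<q - d. T (d + j') j' <= e2 * T (d + (q - d)) (q - d) + CB d * (T (d + 0) 0 + 0)"
   proof (rule CB2[of "%j. T (d + j) j" 0 d])
    show "\<forall>e>0. \<forall>j. 1 <= j \<and> j < q - d --> T (d + j) j <= e * T (d + (j + 1)) (j + 1) + c e * (T (d + (j - 1)) (j - 1) + 0)"
    proof (intro allI impI)
     fix e :: real and j assume e: "e > 0" and j: "1 <= j \<and> j < q - d"
     have "T (d + j) j <= e * T (d + j + 1) (j + 1) + c e * T (d + j - 1) (j - 1)"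
      using diag e j by auto
     moreover have "d + j - 1 = d + (j - 1)" using j by simp
     ultimately show "T (d + j) j <= e * T (d + (j + 1)) (j + 1) + c e * (T (d + (j - 1)) (j - 1) + 0)"
      by (simp add: add.assoc)
    qed
   qed (use T0 in auto)
   then have "T s j <= e2 * T q (q - d) + CB d * T d 0" using d by fastforce
   also have "e2 * T q (q - d) <= e2 * (B2 * (D + Y))" using e2 by (intro mult_left_mono r3) auto
   also have "CB d * T d 0 <= CC * D"
   proof (rule mult_mono)
    show "CB d <= CC" unfolding CC_def by (rule member_le_sum) (use d CB in auto)
   qed (use TD d CC0 T0 in auto)
   finally show ?thesis by simp
  qed
  have "Y <= (\<Sum>(s, j)\<in>(SIGMA s:{..<q}. {..s}). e2 * (B2 * (D + Y)) + CC * D)"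
   unfolding Y_def by (rule sum_mono) (use low Y_def in auto)
  also have "\<dots> = n0 * (e2 * (B2 * (D + Y)) + CC * D)" by (simp add: n0_def split_def)
  also have "\<dots> = (n0 * (e2 * B2)) * (D + Y) + n0 * CC * D" by (simp add: algebra_simps)
  also have "\<dots> <= 1 / 2 * (D + Y) + n0 * CC * D" using mult_right_mono[OF e2(2), of "D + Y"] D Y0 by simp
  finally have "Y <= D + 2 * (n0 * CC * D)" by (simp add: field_simps)
  then have YD: "Y <= BY * D" by (simp add: BY_def algebra_simps)
  show "T s j <= C * D"
  proof (cases "s = q")
   case True
   have "T s j <= B2 * (D + Y)" using r3 True sj by simp
   also have "\<dots> <= B2 * (D + BY * D)" using B YD by (intro mult_left_mono) auto
   also have "\<dots> = (B2 * (1 + BY)) * D" by (simp add: algebra_simps)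
   also have "\<dots> <= C * D" using BY D by (intro mult_right_mono) (auto simp: C_def)
   finally show ?thesis .
  next
   case False
   then have "T s j <= Y" using TY sj by simp
   also have "\<dots> <= BY * D" by (rule YD)
   also have "\<dots> <= C * D" using B BY D by (intro mult_right_mono) (auto simp: C_def)
   finally show ?thesis .
  qed
 qed
qed

text \<open>The operator up to the sign \<open>(-1)\<^sup>m\<close>, which the \<open>m\<close> integrations by parts of the weak
  formulation produce.\<close>

definition Aop :: "nat => 'n::{finite,wellorder} coeffs => 'n rfun => 'n rfun" where
 "Aop m a v x = (\<Sum>\<alpha> | len \<alpha> = m. \<Sum>\<beta> | len \<beta> = m. a \<alpha> \<beta> * mi_partial (%i. \<alpha> i + \<beta> i) v x)"

definition normal_ix :: "nat => 'n::{finite,wellorder} multi_index" where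
 "normal_ix k = (%_. 0)(lastix := k)"

lemma mi_length_normal_ix[simp]: "len (normal_ix k :: 'n::{finite,wellorder} multi_index) = k"
proof -
 have "(normal_ix k :: 'n multi_index)(lastix := 0) = (%_. 0)" by (auto simp: normal_ix_def)
 then show ?thesis
  using mi_length_remove[of "normal_ix k :: 'n multi_index" lastix]
  by (simp add: normal_ix_def mi_length_def)
qed

lemma normal_ix_eqI:
 fixes \<gamma> :: "'n::{finite,wellorder} multi_index"
 assumes "len \<gamma> <= \<gamma> lastix" shows "\<gamma> = normal_ix (\<gamma> lastix)"
proof -
 have "len (\<gamma>(lastix := 0)) = 0" using mi_length_remove[of \<gamma> lastix] assms by simp
 then have z: "\<gamma>(lastix := 0) = (%_. 0)" by (simp add: mi_length_eq_0)
 show ?thesis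
 proof
  fix j
  show "\<gamma> j = normal_ix (\<gamma> lastix) j" using fun_cong[OF z, of j] by (auto simp: normal_ix_def split: if_splits)
 qed
qed

lemma mi_minus_normal:
 fixes \<gamma> :: "'n::{finite,wellorder} multi_index"
 assumes "k <= \<gamma> lastix"
 obtains \<gamma>' where "\<gamma> = (%i. \<gamma>' i + normal_ix k i)" "len \<gamma>' + k = len \<gamma>" "\<gamma>' lastix + k = \<gamma> lastix"
proof -
 define \<gamma>' where "\<gamma>' i = \<gamma> i - normal_ix k i" for i
 have e: "\<gamma> = (%i. \<gamma>' i + normal_ix k i)"
 proof
  fix i show "\<gamma> i = \<gamma>' i + normal_ix k i" using assms by (simp add: \<gamma>'_def normal_ix_def)
 qed
 have "len (%i. \<gamma>' i + normal_ix k i) = len \<gamma>' + k" by (simp add: mi_length_add)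
 then have "len \<gamma>' + k = len \<gamma>" using e by simp
 moreover have "\<gamma>' lastix + k = \<gamma> lastix" using assms by (simp add: \<gamma>'_def normal_ix_def)
 ultimately show ?thesis using that e by blast
qed

text \<open>Ellipticity tested with the vector \<open>\<xi>\<close> that is \<open>1\<close> at \<open>m e\<^sub>N\<close> and
  \<open>0\<close> elsewhere.\<close>

lemma elliptic_normal_coeff:
 fixes a :: "'n::{finite,wellorder} coeffs"
 assumes "elliptic_with m c a"
 shows "c <= a (normal_ix m) (normal_ix m)"
proof -
 let ?n = "normal_ix m :: 'n multi_index"
 define \<xi> where "\<xi> \<alpha> = (if \<alpha> = ?n then 1 else 0 :: real)" for \<alpha>
 have "(\<Sum>\<alpha> | len \<alpha> = m. \<bar>\<xi> \<alpha>\<bar>\<^sup>2) = (\<Sum>\<alpha> | len \<alpha> = m. if \<alpha> = ?n then 1 else 0)"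
  by (intro sum.cong) (auto simp: \<xi>_def)
 also have "\<dots> = 1" by (simp add: sum.delta finite_mi_length_eq)
 finally have 1: "(\<Sum>\<alpha> | len \<alpha> = m. \<bar>\<xi> \<alpha>\<bar>\<^sup>2) = 1" .
 have "(\<Sum>\<beta> | len \<beta> = m. a \<alpha> \<beta> * \<xi> \<alpha> * \<xi> \<beta>) = (if \<alpha> = ?n then a ?n ?n else 0)" for \<alpha>
 proof -
  have "(\<Sum>\<beta> | len \<beta> = m. a \<alpha> \<beta> * \<xi> \<alpha> * \<xi> \<beta>) = (\<Sum>\<beta> | len \<beta> = m. if \<beta> = ?n then a \<alpha> ?n * \<xi> \<alpha> else 0)"
   by (intro sum.cong) (auto simp: \<xi>_def)
  also have "\<dots> = a \<alpha> ?n * \<xi> \<alpha>" by (simp add: sum.delta finite_mi_length_eq)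
  finally show ?thesis by (simp add: \<xi>_def)
 qed
 then have "(\<Sum>\<alpha> | len \<alpha> = m. \<Sum>\<beta> | len \<beta> = m. a \<alpha> \<beta> * \<xi> \<alpha> * \<xi> \<beta>) = a ?n ?n"
  by (simp add: sum.delta finite_mi_length_eq)
 with assms[unfolded elliptic_with_def, rule_format, of \<xi>] 1 show ?thesis by simp
qed

lemma half_ball_borel: "half_ball r \<in> sets borel"
 by (intro borel_open open_half_ball)

text \<open>By \<open>elliptic_normal_coeff\<close> the equation can be divided by the coefficient of the pure normal
  derivative. The family \<open>f\<close> stands for the derivatives of one function, possibly multiplied by a weight.\<close>

lemma solve_for_normal:
 fixes a :: "'n::{finite,wellorder} coeffs" and f :: "'n multi_index => 'n rfun"
 assumes ell: "elliptic_with m c a" and c: "c > 0"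
  and aM: "!!\<alpha> \<beta>. len \<alpha> = m ==> len \<beta> = m ==> \<bar>a \<alpha> \<beta>\<bar> <= M"
  and f: "!!\<gamma>. L2b (f \<gamma>)"
  and g: "!!x. g x = (\<Sum>\<alpha> | len \<alpha> = m. \<Sum>\<beta> | len \<beta> = m. a \<alpha> \<beta> * f (%i. \<alpha> i + \<beta> i) x)"
  and S: "S \<in> sets borel"
  and gB: "nrm_on S g <= B"
  and fB: "!!\<gamma>. len \<gamma> = 2 * m ==> \<gamma> lastix < 2 * m ==> nrm_on S (f \<gamma>) <= B'"
  and B': "B' >= 0"
 shows "nrm_on S (f (normal_ix (2 * m)))
  <= (1 / c) * (B + (real (card {\<alpha>::'n multi_index. len \<alpha> = m}))\<^sup>2 * \<bar>M\<bar> * B')"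
proof -
 let ?n = "normal_ix m :: 'n multi_index"
 let ?I = "{\<alpha>::'n multi_index. len \<alpha> = m}"
 define P where "P = ?I \<times> ?I - {(?n, ?n)}"
 have fin: "finite ?I" by (rule finite_mi_length_eq)
 have finP: "finite P" unfolding P_def using fin by auto
 have nn: "(%i. ?n i + ?n i) = normal_ix (2 * m)" by (auto simp: normal_ix_def)
 have a0: "c <= a ?n ?n" by (rule elliptic_normal_coeff[OF ell])
 define h where "h p = (case p of (\<alpha>, \<beta>) => (%x. ind S x * (a \<alpha> \<beta> * f (%i. \<alpha> i + \<beta> i) x)))" for p
 have Lh: "L2b (h p)" for p unfolding h_def by (cases p) (auto intro!: L2b_indicator L2b_cmult f S)
 have sum: "g x = a ?n ?n * f (normal_ix (2 * m)) x + (\<Sum>(\<alpha>, \<beta>)\<in>P. a \<alpha> \<beta> * f (%i. \<alpha> i + \<beta> i) x)" for x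
 proof -
  have "g x = (\<Sum>(\<alpha>, \<beta>)\<in>?I \<times> ?I. a \<alpha> \<beta> * f (%i. \<alpha> i + \<beta> i) x)"
   unfolding g by (rule sum.cartesian_product)
  also have "\<dots> = (case (?n, ?n) of (\<alpha>, \<beta>) => a \<alpha> \<beta> * f (%i. \<alpha> i + \<beta> i) x)
    + (\<Sum>(\<alpha>, \<beta>)\<in>P. a \<alpha> \<beta> * f (%i. \<alpha> i + \<beta> i) x)"
   unfolding P_def by (rule sum.remove) (use fin in auto)
  finally show ?thesis by (simp add: nn)
 qed
 have Lg: "L2b (%x. ind S x * g x)"
  unfolding g by (intro L2b_indicator L2b_sum fin L2b_cmult f S)
 have hB: "nrm (h p) <= \<bar>M\<bar> * B'" if p: "p \<in> P" for p
 proof -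
  obtain \<alpha> \<beta> where ab: "p = (\<alpha>, \<beta>)" "len \<alpha> = m" "len \<beta> = m" "(\<alpha>, \<beta>) ~= (?n, ?n)"
   using p by (auto simp: P_def)
  have l: "len (%i. \<alpha> i + \<beta> i) = 2 * m" using ab by (simp add: mi_length_add)
  have "\<alpha> lastix + \<beta> lastix < 2 * m"
  proof (rule ccontr)
   assume "\<not> ?thesis"
   moreover have "\<alpha> lastix <= m" "\<beta> lastix <= m"
    using mi_length_remove[of \<alpha> lastix] mi_length_remove[of \<beta> lastix] ab by auto
   ultimately have "\<alpha> lastix = m" "\<beta> lastix = m" by auto
   then have "\<alpha> = ?n" "\<beta> = ?n" using normal_ix_eqI[of \<alpha>] normal_ix_eqI[of \<beta>] ab by auto
   then show False using ab by simp
  qed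
  then have fb: "nrm_on S (f (%i. \<alpha> i + \<beta> i)) <= B'" using fB[OF l] by simp
  have "h p = (%x. a \<alpha> \<beta> * (ind S x * f (%i. \<alpha> i + \<beta> i) x))"
   by (simp add: h_def ab mult.left_commute)
  then have "nrm (h p) = \<bar>a \<alpha> \<beta>\<bar> * nrm_on S (f (%i. \<alpha> i + \<beta> i))" by (simp only: nrm_cmult)
  also have "\<dots> <= \<bar>M\<bar> * B'" using aM[OF ab(2,3)] fb by (intro mult_mono) auto
  finally show ?thesis .
 qed
 have "(%x. a ?n ?n * (ind S x * f (normal_ix (2 * m)) x)) = (%x. ind S x * g x - (\<Sum>p\<in>P. h p x))"
 proof
  fix x
  have "(\<Sum>p\<in>P. h p x) = ind S x * (\<Sum>(\<alpha>, \<beta>)\<in>P. a \<alpha> \<beta> * f (%i. \<alpha> i + \<beta> i) x)"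
   unfolding sum_distrib_left by (intro sum.cong refl) (auto simp: h_def)
  then show "a ?n ?n * (ind S x * f (normal_ix (2 * m)) x) = ind S x * g x - (\<Sum>p\<in>P. h p x)"
   by (simp add: sum algebra_simps)
 qed
 then have "\<bar>a ?n ?n\<bar> * nrm_on S (f (normal_ix (2 * m))) = nrm (%x. ind S x * g x - (\<Sum>p\<in>P. h p x))"
  by (simp only: nrm_cmult[symmetric])
 also have "\<dots> <= nrm_on S g + nrm (%x. \<Sum>p\<in>P. h p x)"
  by (rule nrm_triangle_diff[OF Lg L2b_sum[OF finP Lh]])
 also have "nrm (%x. \<Sum>p\<in>P. h p x) <= (\<Sum>p\<in>P. nrm (h p))" by (rule nrm_sum[OF finP Lh])
 also have "\<dots> <= (\<Sum>p\<in>P. \<bar>M\<bar> * B')" by (rule sum_mono[OF hB])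
 also have "\<dots> = real (card P) * (\<bar>M\<bar> * B')" by simp
 also have "\<dots> <= (real (card ?I))\<^sup>2 * (\<bar>M\<bar> * B')"
 proof (rule mult_right_mono)
  have "card P <= card (?I \<times> ?I)" unfolding P_def using fin by (intro card_mono) auto
  then show "real (card P) <= (real (card ?I))\<^sup>2"
   by (simp add: card_cartesian_product power2_eq_square flip: of_nat_mult)
 qed (use B' in simp)
 finally have 1: "\<bar>a ?n ?n\<bar> * nrm_on S (f (normal_ix (2 * m))) <= B + (real (card ?I))\<^sup>2 * \<bar>M\<bar> * B'"
  using gB by (simp add: mult.assoc)
 have "c * nrm_on S (f (normal_ix (2 * m))) <= \<bar>a ?n ?n\<bar> * nrm_on S (f (normal_ix (2 * m)))"
  using a0 c by (intro mult_right_mono) auto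
 then have "c * nrm_on S (f (normal_ix (2 * m))) <= B + (real (card ?I))\<^sup>2 * \<bar>M\<bar> * B'" using 1 by linarith
 then show ?thesis using c by (simp add: field_simps)
qed

lemma normal_ix_last[simp]: "normal_ix k lastix = k" by (simp add: normal_ix_def)

lemma inc_apply: "inc \<alpha> i j = (if j = i then Suc (\<alpha> j) else \<alpha> j)" by (simp add: inc_def)

lemma mi_partial_lincomb:
 fixes f :: "'b => 'n::{finite,wellorder} rfun"
 assumes A: "finite A" and f: "!!j. j \<in> A ==> C_infinity (f j)"
 shows "mi_partial \<delta> (%x. \<Sum>j\<in>A. b j * f j x) = (%x. \<Sum>j\<in>A. b j * mi_partial \<delta> (f j) x)"
proof (induction \<delta> rule: mi_induct)
 case (inc \<delta> i)
 have C: "C_infinity (%x. \<Sum>j\<in>A. b j * f j x)"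
  by (intro C_infinity_sum A C_infinity_cmult f)
 have p: "partial i (%x. \<Sum>j\<in>B. b j * mi_partial \<delta> (f j) x) x = (\<Sum>j\<in>B. b j * partial i (mi_partial \<delta> (f j)) x)"
  if "B \<subseteq> A" for B x
  using finite_subset[OF that A] that
 proof (induction B rule: finite_induct)
  case (insert k B)
  have k: "C_infinity (mi_partial \<delta> (f k))" using insert by (intro C_infinity_mi_partial f) auto
  have s: "C_infinity (%x. \<Sum>j\<in>B. b j * mi_partial \<delta> (f j) x)"
   using insert by (intro C_infinity_sum C_infinity_cmult C_infinity_mi_partial f) auto
  have "partial i (%x. b k * mi_partial \<delta> (f k) x + (\<Sum>j\<in>B. b j * mi_partial \<delta> (f j) x)) x
   = partial i (%x. b k * mi_partial \<delta> (f k) x) x + partial i (%x. \<Sum>j\<in>B. b j * mi_partial \<delta> (f j) x) x"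
   by (rule partial_add) (intro C_infinity_differentiable C_infinity_cmult k s)+
  then show ?case using insert by (simp add: partial_cmult C_infinity_differentiable[OF k])
 qed (simp add: partial_const)
 show ?case
  unfolding mi_partial_inc[OF C] inc.IH
  using p[OF order_refl] by (simp add: fun_eq_iff mi_partial_inc f)
qed simp

lemma Aop_pairs:
 "Aop m a v x = (\<Sum>p\<in>{\<alpha>. len \<alpha> = m} \<times> {\<beta>. len \<beta> = m}.
  a (fst p) (snd p) * mi_partial (%i. fst p i + snd p i) v x)"
 unfolding Aop_def by (simp add: sum.cartesian_product split_def)

text \<open>Constant coefficients: the operator commutes with derivatives, so the derivatives of \<open>v\<close> satisfy the same
  hypotheses as \<open>v\<close>.\<close>

lemma mi_partial_Aop:
 fixes v :: "'n::{finite,wellorder} rfun"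
 assumes "C_infinity v" shows "mi_partial \<delta> (Aop m a v) = Aop m a (mi_partial \<delta> v)"
proof -
 have c: "mi_partial \<delta> (mi_partial \<alpha> v) = mi_partial \<alpha> (mi_partial \<delta> v)" for \<alpha>
  using mi_partial_add[OF assms, of \<delta> \<alpha>] mi_partial_add[OF assms, of \<alpha> \<delta>] by (simp add: add.commute)
 have e: "Aop m a v = (%x. \<Sum>p\<in>{\<alpha>. len \<alpha> = m} \<times> {\<beta>. len \<beta> = m}.
  a (fst p) (snd p) * mi_partial (%i. fst p i + snd p i) v x)" by (simp add: Aop_pairs fun_eq_iff)
 have "mi_partial \<delta> (Aop m a v) = (%x. \<Sum>p\<in>{\<alpha>. len \<alpha> = m} \<times> {\<beta>. len \<beta> = m}.
  a (fst p) (snd p) * mi_partial \<delta> (mi_partial (%i. fst p i + snd p i) v) x)"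
  unfolding e by (rule mi_partial_lincomb) (auto intro: C_infinity_mi_partial assms simp: finite_mi_length_eq)
 then show ?thesis by (simp add: c Aop_pairs fun_eq_iff)
qed

lemma test_Aop: "v \<in> test_functions U ==> Aop m a v \<in> test_functions U"
 unfolding Aop_pairs[abs_def] by (intro test_sum test_cmult test_mi_partial) (simp add: finite_mi_length_eq)

lemma sum_index_le:
 fixes X :: "'n::{finite,wellorder} multi_index => real"
 assumes "!!\<gamma>. len \<gamma> = s ==> \<gamma> lastix = j ==> X \<gamma> <= b" "b >= 0" "s <= q"
 shows "(\<Sum>\<gamma> | len \<gamma> = s \<and> \<gamma> lastix = j. X \<gamma>) <= real (card {\<gamma>::'n multi_index. len \<gamma> <= q}) * b"
proof -
 have "(\<Sum>\<gamma> | len \<gamma> = s \<and> \<gamma> lastix = j. X \<gamma>) <= real (card {\<gamma>::'n multi_index. len \<gamma> = s \<and> \<gamma> lastix = j}) * b"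
  by (rule sum_bounded_above) (use assms in auto)
 also have "\<dots> <= real (card {\<gamma>::'n multi_index. len \<gamma> <= q}) * b"
  using assms(2,3) by (intro mult_right_mono of_nat_mono card_mono finite_mi_length_le) auto
 finally show ?thesis .
qed

text \<open>What \<open>tangential_regularity\<close> and the equation provide for the mollifications of \<open>u\<close>.\<close>

definition a_priori_data :: "nat => nat => real => real => real => 'n::{finite,wellorder} coeffs =>
  'n rfun => real => bool" where
 "a_priori_data m l c M R a v D \<longleftrightarrow> elliptic_with m c a \<and>
  (\<forall>\<alpha> \<beta>. len \<alpha> = m --> len \<beta> = m --> \<bar>a \<alpha> \<beta>\<bar> <= M) \<and> v \<in> test_functions UNIV \<and>
  (\<forall>\<gamma>. len \<gamma> <= 2 * m + l --> \<gamma> lastix <= m --> nrm_on (half_ball R) (mi_partial \<gamma> v) <= D) \<and>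
  (\<forall>\<delta>. len \<delta> <= l --> nrm_on (half_ball R) (mi_partial \<delta> (Aop m a v)) <= D)"

lemma a_priori_data_nonneg: assumes "a_priori_data m l c M R a v D" shows "D >= 0"
proof -
 have "\<forall>\<delta>. len \<delta> <= l --> nrm_on (half_ball R) (mi_partial \<delta> (Aop m a v)) <= D"
  using assms unfolding a_priori_data_def by blast
 from spec[OF this, of "%_. 0"] have "nrm_on (half_ball R) (Aop m a v) <= D" by simp
 then show ?thesis by (rule order_trans[OF nrm_nonneg])
qed

text \<open>The weight of a derivative of order \<open>k\<close> of \<open>g = \<partial>\<^sub>N\<^sup>m v\<close> is
  \<open>\<zeta>\<^sup>k\<^sup>+\<^sup>1\<close>, so that a derivative that falls on the weight costs one power, which matches the
  order that \<open>g\<close> has lost. The sums \<open>T s j\<close> of the weighted norms over all derivatives of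
  \<open>g\<close> of order \<open>s\<close> with \<open>j\<close> normal ones satisfy the hypotheses of
  \<open>interp_absorb\<close> with \<open>q = m\<close>.\<close>

lemma normal_estimate_base:
 fixes c M r R :: real and m :: nat
 assumes c: "c > 0" and r: "0 < r" "r < R"
 shows "\<exists>C\<ge>0. \<forall>(a :: 'n::{finite,wellorder} coeffs) v D \<gamma>. a_priori_data m 0 c M R a v D -->
  len \<gamma> <= 2 * m --> nrm_on (half_ball r) (mi_partial \<gamma> v) <= C * D"
proof -
 define s where "s = (r + R) / 2"
 have s: "r < s" "s < R" using r by (auto simp: s_def)
 obtain \<zeta> :: "'n rfun" and c0 where \<zeta>R: "\<zeta> \<in> test_functions (ball 0 R)" and \<zeta>0: "!!x. 0 <= \<zeta> x"
  and \<zeta>1: "!!x. \<zeta> x <= 1" and \<zeta>s: "!!x. norm x > s ==> \<zeta> x = 0" and c0: "c0 > 0" "!!x. norm x < r ==> c0 <= \<zeta> x"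
  and \<zeta>m: "!!x y. norm x <= norm y ==> \<zeta> y <= \<zeta> x"
  using cutoff_exists[OF r(1) s] by blast
 have \<zeta>: "\<zeta> \<in> test_functions UNIV" by (rule test_mono[OF \<zeta>R]) simp
 have \<zeta>st: "\<zeta> (st x) <= \<zeta> x" for x by (rule \<zeta>m[OF norm_st])
 have "\<exists>L. \<forall>x. \<bar>partial i \<zeta> x\<bar> <= L" for i using test_bounded[OF test_partial[OF \<zeta>]] by metis
 then obtain Li where Li: "!!i x. \<bar>partial i \<zeta> x\<bar> <= Li i" by metis
 define L where "L = (\<Sum>i\<in>UNIV. Li i)"
 have Li0: "0 <= Li i" for i using Li[of i 0] by linarith
 have L0: "L >= 0" unfolding L_def by (intro sum_nonneg Li0)
 have L: "\<bar>partial i \<zeta> x\<bar> <= L" for i x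
 proof -
  have "Li i <= L" unfolding L_def by (rule member_le_sum) (use Li0 in auto)
  then show ?thesis using Li[of i x] by linarith
 qed
 define C1 where "C1 = 56 + 142 * real (2 * (m + 1)) * L"
 have C1: "C1 >= 1" using L0 by (simp add: C1_def)
 have C1m: "56 + 142 * real (2 * (t + 1)) * L <= C1" if "t <= m" for t
  unfolding C1_def using that L0 by (intro add_left_mono mult_right_mono mult_left_mono) auto
 define K where "K = real (card {\<gamma>::'n multi_index. len \<gamma> <= 2 * m})"
 have "card {\<gamma>::'n multi_index. len \<gamma> <= 2 * m} ~= 0"
  using finite_mi_length_le[of "2 * m", where 'n='n] by (auto simp: mi_length_def intro: exI[of _ "%_. 0"])
 then have K: "K >= 1" unfolding K_def by linarith
 define cc where "cc e = K * (4 * C1 + C1 / (e / K))" for e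
 have cc: "cc e >= 0" if "e > 0" for e using that K C1 by (simp add: cc_def)
 define K1 where "K1 = (real (card {\<alpha>::'n multi_index. len \<alpha> = m}))\<^sup>2 * \<bar>M\<bar>"
 have K1: "K1 >= 0" by (simp add: K1_def)
 have K1c: "K1 / c >= 0" using K1 c by simp
 obtain C where C: "C >= 0" and absorb: "!!(T::nat => nat => real) D. D >= 0 ==> (\<forall>s j. T s j >= 0) ==> (\<forall>s\<le>m. T s 0 <= D) ==>
  (\<forall>e>0. \<forall>j. 1 <= j \<and> j < m --> T m j <= e * T m (j + 1) + cc e * (T m (j - 1) + T (m - 1) j)) ==>
  (\<forall>e>0. \<forall>s j. 1 <= j \<and> j <= s \<and> s < m --> T s j <= e * T (s + 1) (j + 1) + cc e * T (s - 1) (j - 1)) ==>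
  T m m <= D + K1 / c * (\<Sum>j\<in>{1..<m}. T m j) ==> (\<forall>s\<le>m. \<forall>j\<le>s. T s j <= C * D)"
  using interp_absorb[of cc "K1 / c" m, OF cc K1c] by blast
 define K3 where "K3 = K + (1 + K1) / c"
 have K3: "K3 >= 0" using K K1 c by (simp add: K3_def)
 define d0 where "d0 = min c0 1"
 have d0: "d0 > 0" "d0 <= 1" "!!x. norm x < r ==> d0 <= \<zeta> x" using c0 by (auto simp: d0_def min.coboundedI1)
 have low: "hn (%x. \<zeta> x ^ (k + 1) * f x) <= nrm_on (half_ball R) f"
  if "f \<in> test_functions UNIV" for k f
  unfolding hn_def
 proof (rule nrm_mono)
  show "L2b (%x. ind (half_ball R) x * f x)" by (intro L2b_indicator test_L2b_UNIV that half_ball_borel)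
  have "L2b (%x. \<zeta> x ^ (k + 1) * f x)" by (intro test_L2b_UNIV test_weight[OF \<zeta> \<zeta>0 \<zeta>st L0 L] that)
  from L2b_upper[OF this]
  show "(%x. ind upper x * (\<zeta> x ^ (k + 1) * f x)) \<in> borel_measurable borel" by (simp add: L2b_def)
  show "\<bar>ind upper x * (\<zeta> x ^ (k + 1) * f x)\<bar> <= \<bar>ind (half_ball R) x * f x\<bar>" for x
  proof (cases "x \<in> half_ball R")
   case True
   have "\<zeta> x ^ (k + 1) <= 1" "0 <= \<zeta> x ^ (k + 1)" by (rule power_le_one[OF \<zeta>0 \<zeta>1]) (rule zero_le_power[OF \<zeta>0])
   then have "\<zeta> x ^ (k + 1) * \<bar>f x\<bar> <= \<bar>f x\<bar>" by (intro mult_left_le_one_le) auto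
   then show ?thesis using True \<zeta>0[of x] by (auto simp: abs_mult indicator_def)
  next
   case False
   then have "x \<notin> upper \<or> norm x > s" using s by (auto simp: half_ball_def upper_def)
   then show ?thesis using \<zeta>s[of x] by (auto simp: indicator_def)
  qed
 qed
 have unweight: "nrm_on (half_ball r) f <= (1 / d0) ^ k * hn (%x. \<zeta> x ^ k * f x)"
  if f: "f \<in> test_functions UNIV" for k f
 proof -
  have t: "L2b (%x. \<zeta> x ^ k * f x)" by (intro test_L2b_UNIV test_weight[OF \<zeta> \<zeta>0 \<zeta>st L0 L] f)
  have "nrm_on (half_ball r) f <= nrm (%x. (1 / d0) ^ k * (ind upper x * (\<zeta> x ^ k * f x)))"
  proof (rule nrm_mono)
   show "L2b (%x. (1 / d0) ^ k * (ind upper x * (\<zeta> x ^ k * f x)))" by (intro L2b_cmult L2b_upper t)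
   have "L2b (%x. ind (half_ball r) x * f x)" by (intro L2b_indicator test_L2b_UNIV f half_ball_borel)
   then show "(%x. ind (half_ball r) x * f x) \<in> borel_measurable borel" by (simp add: L2b_def)
   show "\<bar>ind (half_ball r) x * f x\<bar> <= \<bar>(1 / d0) ^ k * (ind upper x * (\<zeta> x ^ k * f x))\<bar>" for x
   proof (cases "x \<in> half_ball r")
    case True
    then have u: "x \<in> upper" "norm x < r" by (auto simp: half_ball_def upper_def)
    have "1 <= \<zeta> x / d0" using d0 u by simp
    then have "1 <= (\<zeta> x / d0) ^ k" by (rule one_le_power)
    then have "1 * \<bar>f x\<bar> <= (\<zeta> x / d0) ^ k * \<bar>f x\<bar>" by (intro mult_right_mono) auto
    then show ?thesis using True u d0 \<zeta>0[of x] by (simp add: abs_mult power_divide)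
   qed simp
  qed
  also have "\<dots> = (1 / d0) ^ k * hn (%x. \<zeta> x ^ k * f x)" using d0 by (simp add: nrm_cmult hn_def)
  finally show ?thesis .
 qed
 show ?thesis
 proof (intro exI[of _ "1 + (1 / d0) ^ (m + 1) * (C * K3)"] conjI allI impI)
  show "0 <= 1 + (1 / d0) ^ (m + 1) * (C * K3)" using d0 C K3 by simp
  fix a :: "'n coeffs" and v :: "'n rfun" and D and \<gamma>0 :: "'n multi_index"
  assume h: "a_priori_data m 0 c M R a v D" and g0: "len \<gamma>0 <= 2 * m"
  have ell: "elliptic_with m c a" and aM: "\<forall>\<alpha> \<beta>. len \<alpha> = m --> len \<beta> = m --> \<bar>a \<alpha> \<beta>\<bar> <= M"
   and v: "v \<in> test_functions UNIV"
   and vD: "\<forall>\<gamma>. len \<gamma> <= 2 * m --> \<gamma> lastix <= m --> nrm_on (half_ball R) (mi_partial \<gamma> v) <= D"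
   and AD: "\<forall>\<delta>. len \<delta> <= 0 --> nrm_on (half_ball R) (mi_partial \<delta> (Aop m a v)) <= D"
   using h unfolding a_priori_data_def by simp_all
  have AD: "nrm_on (half_ball R) (Aop m a v) <= D" using AD[rule_format, of "%_. 0"] by simp
  have D: "D >= 0" by (rule a_priori_data_nonneg[OF h])
  define g where "g = mi_partial (normal_ix m) v"
  have g: "mi_partial \<gamma> g \<in> test_functions UNIV" for \<gamma> unfolding g_def by (intro test_mi_partial v)
  have gC: "C_infinity g" using g[of "%_. 0"] test_smooth by simp
  have gv: "mi_partial \<gamma> g = mi_partial (%i. \<gamma> i + normal_ix m i) v" for \<gamma>
   unfolding g_def by (rule mi_partial_add[symmetric]) (rule test_smooth[OF v])
  have vt: "mi_partial \<gamma> v \<in> test_functions UNIV" for \<gamma> by (intro test_mi_partial v)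
  define X where "X \<gamma> = hn (%x. \<zeta> x ^ (len \<gamma> + 1) * mi_partial \<gamma> g x)" for \<gamma>
  define T where "T s j = (\<Sum>\<gamma> | len \<gamma> = s \<and> \<gamma> lastix = j. X \<gamma>)" for s j
  have X0: "X \<gamma> >= 0" for \<gamma> by (simp add: X_def)
  have T0: "T s j >= 0" for s j unfolding T_def by (intro sum_nonneg X0)
  have fin: "finite {\<gamma>::'n multi_index. len \<gamma> = s \<and> \<gamma> lastix = j}" for s j
   by (rule finite_subset[OF _ finite_mi_length_eq[of s]]) auto
  have XT: "X \<gamma> <= T s j" if "len \<gamma> = s" "\<gamma> lastix = j" for \<gamma> s j
   unfolding T_def by (rule member_le_sum) (use that X0 fin in auto)
  have TX: "T s j <= K * b" if "!!\<gamma>. len \<gamma> = s ==> \<gamma> lastix = j ==> X \<gamma> <= b" "b >= 0" "s <= 2 * m" for s j b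
   unfolding T_def K_def using that by (rule sum_index_le)
  have Tle: "T s j <= e * A + cc e * B"
   if x: "!!\<gamma>. len \<gamma> = s ==> \<gamma> lastix = j ==> X \<gamma> <= (e / K) * A + (4 * C1 + C1 / (e / K)) * B"
    and e: "e > 0" "A >= 0" "B >= 0" "s <= m" for s j e A B
  proof -
   have "T s j <= K * ((e / K) * A + (4 * C1 + C1 / (e / K)) * B)"
    by (rule TX[OF x]) (use e K C1 in auto)
   also have "\<dots> = e * A + cc e * B" using K by (simp add: cc_def distrib_left)
   finally show ?thesis .
  qed
  have tang: "T s 0 <= K * D" if "s <= m" for s
  proof (rule TX)
   fix \<gamma> :: "'n multi_index" assume h: "len \<gamma> = s" "\<gamma> lastix = 0"
   have "X \<gamma> <= nrm_on (half_ball R) (mi_partial \<gamma> g)"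
    unfolding X_def by (rule low[OF g])
   also have "\<dots> <= D" unfolding gv
    by (rule vD[rule_format]) (use h that in \<open>auto simp: mi_length_add\<close>)
   finally show "X \<gamma> <= D" .
  qed (use that D in auto)
  have row: "T m j <= e * T m (j + 1) + cc e * (T m (j - 1) + T (m - 1) j)" if e: "e > 0" and j: "1 <= j" "j < m" for e j
  proof (rule Tle)
   fix \<gamma> :: "'n multi_index" assume h: "len \<gamma> = m" "\<gamma> lastix = j"
   have "\<gamma> lastix > 0" using h j by simp
   then obtain \<gamma>1 where g1: "\<gamma> = inc \<gamma>1 lastix" by (rule exists_inc)
   have l1: "len \<gamma>1 + 1 = m" "\<gamma>1 lastix + 1 = j" using h by (auto simp: g1 inc_apply)
   have "\<exists>i. i ~= lastix \<and> \<gamma>1 i > 0"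
   proof (rule ccontr)
    assume "\<not> ?thesis"
    then have "\<gamma>1(lastix := 0) = (%_. 0)" by (auto simp: fun_eq_iff)
    then have "len (\<gamma>1(lastix := 0)) = 0" by (simp add: mi_length_def)
    then show False using mi_length_remove[of \<gamma>1 lastix] l1 j by simp
   qed
   then obtain i where i: "i ~= lastix" "\<gamma>1 i > 0" by blast
   obtain \<kappa> where k: "\<gamma>1 = inc \<kappa> i" using i(2) by (rule exists_inc)
   have l: "len \<kappa> + 2 = m" "\<kappa> lastix + 1 = j" using l1 i by (auto simp: k inc_apply)
   have w: "m + 1 = len (inc (inc \<kappa> i) i) + 1" "m + 1 = len (inc (inc \<kappa> lastix) lastix) + 1"
    "m = len (inc \<kappa> lastix) + 1" "m + 1 = len (inc (inc \<kappa> lastix) i) + 1" using l by auto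
   have \<gamma>e: "\<gamma> = inc (inc \<kappa> lastix) i" unfolding g1 k by (rule inc_commute)
   have p: "partial i (mi_partial \<kappa> g) = mi_partial (inc \<kappa> i) g"
    "partial i (mi_partial (inc \<kappa> i) g) = mi_partial (inc (inc \<kappa> i) i) g"
    "partial lastix (mi_partial \<kappa> g) = mi_partial (inc \<kappa> lastix) g"
    "partial lastix (mi_partial (inc \<kappa> lastix) g) = mi_partial (inc (inc \<kappa> lastix) lastix) g"
    "partial i (mi_partial (inc \<kappa> lastix) g) = mi_partial (inc (inc \<kappa> lastix) i) g"
    by (simp_all add: mi_partial_inc gC)
   have q: "hn (%x. \<zeta> x ^ (m + 1) * mi_partial (inc (inc \<kappa> i) i) g x) = X (inc (inc \<kappa> i) i)"
    "hn (%x. \<zeta> x ^ (m + 1) * mi_partial (inc (inc \<kappa> lastix) lastix) g x) = X (inc (inc \<kappa> lastix) lastix)"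
    "hn (%x. \<zeta> x ^ m * mi_partial (inc \<kappa> lastix) g x) = X (inc \<kappa> lastix)"
    "hn (%x. \<zeta> x ^ (m + 1) * mi_partial (inc (inc \<kappa> lastix) i) g x) = X \<gamma>"
    unfolding X_def \<gamma>e w[symmetric] by (rule refl)+
   define A B E where "A = X (inc (inc \<kappa> i) i)" and "B = X (inc (inc \<kappa> lastix) lastix)" and "E = X (inc \<kappa> lastix)"
   have n: "A >= 0" "B >= 0" "E >= 0" "X \<gamma> >= 0" by (simp_all add: A_def B_def E_def X0)
   have "(X \<gamma>)\<^sup>2 <= (56 + 142 * real (2 * (m + 1)) * L) * (A * (B + E) + X \<gamma> * E)"
    using interpolate_mixed[OF \<zeta> \<zeta>0 \<zeta>st L0 L g i(1), of m \<kappa>] unfolding p q A_def B_def E_def .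
   also have "\<dots> <= C1 * ((A + E) * B + (A + E)\<^sup>2 + X \<gamma> * (A + E))"
    unfolding C1_def[symmetric] using C1 n
    by (intro mult_left_mono) (auto simp: power2_eq_square algebra_simps intro!: add_nonneg_nonneg)
   finally have "X \<gamma> <= (e / K) * B + (4 * C1 + C1 / (e / K)) * (A + E)"
    by (intro quadratic_interp C1) (use n e K in auto)
   also have "\<dots> <= (e / K) * T m (j + 1) + (4 * C1 + C1 / (e / K)) * (T m (j - 1) + T (m - 1) j)"
   proof (intro add_mono mult_left_mono)
    show "B <= T m (j + 1)" unfolding B_def by (rule XT) (use l in \<open>auto simp: inc_apply\<close>)
    show "A <= T m (j - 1)" unfolding A_def by (rule XT) (use l i in \<open>auto simp: inc_apply\<close>)
    show "E <= T (m - 1) j" unfolding E_def by (rule XT) (use l in \<open>auto simp: inc_apply\<close>)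
   qed (use e K C1 in auto)
   finally show "X \<gamma> <= (e / K) * T m (j + 1) + (4 * C1 + C1 / (e / K)) * (T m (j - 1) + T (m - 1) j)" .
  qed (use e T0 in auto)
  have diag: "T s j <= e * T (s + 1) (j + 1) + cc e * T (s - 1) (j - 1)"
   if e: "e > 0" and j: "1 <= j" "j <= s" "s < m" for e s j
  proof (rule Tle)
   fix \<gamma> :: "'n multi_index" assume h: "len \<gamma> = s" "\<gamma> lastix = j"
   have "\<gamma> lastix > 0" using h j by simp
   then obtain \<kappa> where k: "\<gamma> = inc \<kappa> lastix" by (rule exists_inc)
   have l: "len \<kappa> + 1 = s" "\<kappa> lastix + 1 = j" using h by (auto simp: k inc_apply)
   have w: "s = len \<kappa> + 1" "s + 1 = len (inc \<kappa> lastix) + 1"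
    "s + 2 = len (inc (inc \<kappa> lastix) lastix) + 1" using l by auto
   have p: "partial lastix (mi_partial \<kappa> g) = mi_partial (inc \<kappa> lastix) g"
    "partial lastix (mi_partial (inc \<kappa> lastix) g) = mi_partial (inc (inc \<kappa> lastix) lastix) g"
    by (simp_all add: mi_partial_inc gC)
   have q: "hn (%x. \<zeta> x ^ s * mi_partial \<kappa> g x) = X \<kappa>"
    "hn (%x. \<zeta> x ^ (s + 1) * mi_partial (inc \<kappa> lastix) g x) = X \<gamma>"
    "hn (%x. \<zeta> x ^ (s + 2) * mi_partial (inc (inc \<kappa> lastix) lastix) g x) = X (inc (inc \<kappa> lastix) lastix)"
    unfolding X_def k w(2,3) using w(1) by simp_all
   define B where "B = X (inc (inc \<kappa> lastix) lastix)"
   have n: "X \<kappa> >= 0" "B >= 0" "X \<gamma> >= 0" by (simp_all add: B_def X0)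
   have "(X \<gamma>)\<^sup>2 <= (56 + 142 * real (2 * (s + 1)) * L) * (X \<kappa> * (B + X \<gamma>))"
    using interpolate_normal[OF \<zeta> \<zeta>0 \<zeta>st L0 L g, of s \<kappa>] unfolding p q B_def .
   also have "\<dots> <= C1 * (X \<kappa> * B + (X \<kappa>)\<^sup>2 + X \<gamma> * X \<kappa>)"
    using C1 n C1m[of s] j by (intro mult_mono) (auto simp: power2_eq_square algebra_simps intro!: add_nonneg_nonneg)
   finally have "X \<gamma> <= (e / K) * B + (4 * C1 + C1 / (e / K)) * X \<kappa>"
    by (intro quadratic_interp C1) (use n e K in auto)
   also have "\<dots> <= (e / K) * T (s + 1) (j + 1) + (4 * C1 + C1 / (e / K)) * T (s - 1) (j - 1)"
   proof (intro add_mono mult_left_mono)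
    show "B <= T (s + 1) (j + 1)" unfolding B_def by (rule XT) (use l in \<open>auto simp: inc_apply\<close>)
    show "X \<kappa> <= T (s - 1) (j - 1)" by (rule XT) (use l in auto)
   qed (use e K C1 in auto)
   finally show "X \<gamma> <= (e / K) * T (s + 1) (j + 1) + (4 * C1 + C1 / (e / K)) * T (s - 1) (j - 1)" .
  qed (use e T0 j in auto)
  define \<Sigma> where "\<Sigma> = (\<Sum>j\<in>{1..<m}. T m j)"
  have S0: "\<Sigma> >= 0" unfolding \<Sigma>_def by (intro sum_nonneg T0)
  have top: "T m m <= K3 * D + K1 / c * \<Sigma>"
  proof -
   have nn: "(%i. normal_ix m i + normal_ix m i) = (normal_ix (2 * m) :: 'n multi_index)" by (auto simp: normal_ix_def)
   have "T m m <= X (normal_ix m)"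
   proof -
    have "{\<gamma>::'n multi_index. len \<gamma> = m \<and> \<gamma> lastix = m} \<subseteq> {normal_ix m}"
    proof
     fix \<gamma> :: "'n multi_index" assume "\<gamma> \<in> {\<gamma>. len \<gamma> = m \<and> \<gamma> lastix = m}"
     then show "\<gamma> \<in> {normal_ix m}" using normal_ix_eqI[of \<gamma>] by simp
    qed
    then have "T m m <= (\<Sum>\<gamma>\<in>{normal_ix m}. X \<gamma>)" unfolding T_def using X0 by (intro sum_mono2) auto
    then show ?thesis by simp
   qed
   also have "X (normal_ix m) = nrm (%x. ind upper x * (\<zeta> x ^ (m + 1) * mi_partial (normal_ix (2 * m)) v x))"
    by (simp add: X_def hn_def gv nn)
   also have "\<dots> <= (1 / c) * (D + (real (card {\<alpha>::'n multi_index. len \<alpha> = m}))\<^sup>2 * \<bar>M\<bar> * (D + \<Sigma>))"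
   proof (rule solve_for_normal[OF ell c, where f = "%\<gamma> x. \<zeta> x ^ (m + 1) * mi_partial \<gamma> v x"
      and g = "%x. \<zeta> x ^ (m + 1) * Aop m a v x"])
    show "\<bar>a \<alpha> \<beta>\<bar> <= M" if "len \<alpha> = m" "len \<beta> = m" for \<alpha> \<beta> using aM that by blast
    show "L2b (%x. \<zeta> x ^ (m + 1) * mi_partial \<gamma> v x)" for \<gamma>
     by (intro test_L2b_UNIV test_weight[OF \<zeta> \<zeta>0 \<zeta>st L0 L] vt)
    show "\<zeta> x ^ (m + 1) * Aop m a v x = (\<Sum>\<alpha> | len \<alpha> = m. \<Sum>\<beta> | len \<beta> = m.
      a \<alpha> \<beta> * (\<zeta> x ^ (m + 1) * mi_partial (%i. \<alpha> i + \<beta> i) v x))" for x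
     unfolding Aop_def sum_distrib_left by (intro sum.cong refl) (simp add: mult_ac)
    show "nrm (%x. ind upper x * (\<zeta> x ^ (m + 1) * Aop m a v x)) <= D"
     using low[OF test_Aop[OF v], of m] AD unfolding hn_def by (rule order_trans)
    show "nrm (%x. ind upper x * (\<zeta> x ^ (m + 1) * mi_partial \<gamma> v x)) <= D + \<Sigma>"
     if h: "len \<gamma> = 2 * m" "\<gamma> lastix < 2 * m" for \<gamma>
    proof (cases "\<gamma> lastix <= m")
     case True
     have "nrm (%x. ind upper x * (\<zeta> x ^ (m + 1) * mi_partial \<gamma> v x)) <= nrm_on (half_ball R) (mi_partial \<gamma> v)"
      using low[OF vt, of m \<gamma>] unfolding hn_def .
     also have "\<dots> <= D" using vD h True by simp
     finally show ?thesis using S0 by simp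
    next
     case False
     then have "m <= \<gamma> lastix" by simp
     then obtain \<gamma>' where g': "\<gamma> = (%i. \<gamma>' i + normal_ix m i)" "len \<gamma>' + m = len \<gamma>" "\<gamma>' lastix + m = \<gamma> lastix"
      by (rule mi_minus_normal)
     have l: "len \<gamma>' = m" "\<gamma>' lastix \<in> {1..<m}" using g' h False by auto
     have "nrm (%x. ind upper x * (\<zeta> x ^ (m + 1) * mi_partial \<gamma> v x)) = X \<gamma>'"
      by (simp add: X_def hn_def gv l(1) flip: g'(1))
     also have "\<dots> <= T m (\<gamma>' lastix)" by (rule XT[OF l(1) refl])
     also have "\<dots> <= \<Sigma>" unfolding \<Sigma>_def by (rule member_le_sum[OF l(2)]) (use T0 in auto)
     finally show ?thesis using D by simp
    qed
   qed (use upper_borel D S0 in auto)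
   also have "\<dots> = (1 + K1) / c * D + K1 / c * \<Sigma>" using c unfolding K1_def[symmetric] by (simp add: field_simps)
   also have "(1 + K1) / c * D <= K3 * D" unfolding K3_def using K D by (intro mult_right_mono) auto
   finally show ?thesis by simp
  qed
  have K3D: "K * D <= K3 * D" unfolding K3_def using K1 c D by (intro mult_right_mono) auto
  have all: "\<forall>s\<le>m. \<forall>j\<le>s. T s j <= C * (K3 * D)"
  proof (rule absorb)
   show "0 <= K3 * D" using K3 D by simp
   show "\<forall>s\<le>m. T s 0 <= K3 * D" using tang K3D order_trans by blast
   show "T m m <= K3 * D + K1 / c * (\<Sum>j\<in>{1..<m}. T m j)" using top unfolding \<Sigma>_def .
  qed (use T0 row diag in auto)
  have DD: "0 <= (1 / d0) ^ (m + 1) * (C * K3) * D" using d0 C K3 D by simp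
  show "nrm (%x. ind (half_ball r) x * mi_partial \<gamma>0 v x) <= (1 + (1 / d0) ^ (m + 1) * (C * K3)) * D"
  proof (cases "\<gamma>0 lastix <= m")
   case True
   have "nrm (%x. ind (half_ball r) x * mi_partial \<gamma>0 v x) <= nrm (%x. ind (half_ball R) x * mi_partial \<gamma>0 v x)"
    by (rule nrm_mono[OF L2b_indicator[OF test_L2b_UNIV[OF vt] half_ball_borel]])
     (use L2b_indicator[OF test_L2b_UNIV[OF vt] half_ball_borel[of r], of \<gamma>0] half_ball_mono[of r R] r
      in \<open>auto simp: L2b_def indicator_def\<close>)
   also have "\<dots> <= D" using vD True g0 by blast
   finally show ?thesis using DD by (simp add: distrib_right)
  next
   case False
   then have "m <= \<gamma>0 lastix" by simp
   then obtain \<gamma>' where g': "\<gamma>0 = (%i. \<gamma>' i + normal_ix m i)" "len \<gamma>' + m = len \<gamma>0" "\<gamma>' lastix + m = \<gamma>0 lastix"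
    by (rule mi_minus_normal)
   have l: "len \<gamma>' <= m" "\<gamma>' lastix <= len \<gamma>'" using g' g0 mi_length_remove[of \<gamma>' lastix] by auto
   have "nrm (%x. ind (half_ball r) x * mi_partial \<gamma>0 v x) <= (1 / d0) ^ (len \<gamma>' + 1) * X \<gamma>'"
    using unweight[OF g, of \<gamma>' "len \<gamma>' + 1"] by (simp add: X_def gv flip: g'(1))
   also have "\<dots> <= (1 / d0) ^ (m + 1) * (C * (K3 * D))"
   proof (rule mult_mono)
    show "(1 / d0) ^ (len \<gamma>' + 1) <= (1 / d0) ^ (m + 1)" using d0 l by (intro power_increasing) auto
    show "X \<gamma>' <= C * (K3 * D)" using XT[OF refl refl, of \<gamma>'] all l by (meson order_trans)
   qed (use d0 X0 in auto)
   finally show ?thesis using D by (simp add: algebra_simps)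
  qed
 qed
qed

text \<open>Derivatives with at most \<open>2m\<close> normal ones are reduced to \<open>normal_estimate_base\<close> by splitting
  off tangential derivatives. Beyond that, each further normal derivative is obtained from the differentiated equation, solved for
  \<open>\<partial>\<^sub>N\<^sup>2\<^sup>m\<close>.\<close>

lemma normal_estimate:
 fixes c M r R :: real and m l :: nat
 assumes c: "c > 0" and r: "0 < r" "r < R"
 shows "\<exists>C\<ge>0. \<forall>(a :: 'n::{finite,wellorder} coeffs) v D \<gamma>. a_priori_data m l c M R a v D -->
  len \<gamma> <= 2 * m + l --> nrm_on (half_ball r) (mi_partial \<gamma> v) <= C * D"
proof -
 have ladder: "\<exists>C\<ge>0. \<forall>(a :: 'n coeffs) v D \<gamma>. a_priori_data m l c M R a v D --> len \<gamma> <= 2 * m + l -->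
  \<gamma> lastix <= 2 * m + p --> nrm_on (half_ball r) (mi_partial \<gamma> v) <= C * D" for p
 proof (induction p)
  case 0
  obtain C where C: "C >= 0" and base: "!!(a :: 'n coeffs) v D \<gamma>. a_priori_data m 0 c M R a v D ==>
   len \<gamma> <= 2 * m ==> nrm_on (half_ball r) (mi_partial \<gamma> v) <= C * D"
   using normal_estimate_base[OF c r, of m M, where 'n='n] by blast
  show ?case
  proof (intro exI[of _ C] conjI C allI impI)
   fix a :: "'n coeffs" and v :: "'n rfun" and D and \<gamma> :: "'n multi_index"
   assume h: "a_priori_data m l c M R a v D" and \<gamma>: "len \<gamma> <= 2 * m + l" "\<gamma> lastix <= 2 * m + 0"
   have v: "v \<in> test_functions UNIV" using h by (simp add: a_priori_data_def)
   have vC: "C_infinity v" by (rule test_smooth[OF v])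
   have "len \<gamma> - 2 * m <= len (\<gamma>(lastix := 0))" using mi_length_remove[of \<gamma> lastix] \<gamma> by simp
   from mi_below[OF this] obtain \<delta> where d: "!!j. \<delta> j <= (\<gamma>(lastix := 0)) j" "len \<delta> = len \<gamma> - 2 * m" by blast
   have dN: "\<delta> lastix = 0" using d(1)[of lastix] by simp
   have dg: "\<delta> j <= \<gamma> j" for j using d(1)[of j] by (cases "j = lastix") auto
   define \<gamma>' where "\<gamma>' j = \<gamma> j - \<delta> j" for j
   have g: "\<gamma> = (%j. \<gamma>' j + \<delta> j)" using dg by (simp add: \<gamma>'_def)
   have "len (%j. \<gamma>' j + \<delta> j) = len \<gamma>' + len \<delta>" by (rule mi_length_add)
   then have "len \<gamma> = len \<gamma>' + len \<delta>" by (simp flip: g)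
   then have l: "len \<gamma>' <= 2 * m" "len \<delta> <= l" using d(2) \<gamma> by auto
   have p: "mi_partial \<kappa> (mi_partial \<delta> v) = mi_partial (%j. \<kappa> j + \<delta> j) v" for \<kappa>
    by (rule mi_partial_add[symmetric]) (rule vC)
   have "nrm_on (half_ball r) (mi_partial \<gamma>' (mi_partial \<delta> v)) <= C * D"
   proof (rule base[OF _ l(1)], unfold a_priori_data_def, intro conjI)
    show "elliptic_with m c a" "\<forall>\<alpha> \<beta>. len \<alpha> = m --> len \<beta> = m --> \<bar>a \<alpha> \<beta>\<bar> <= M"
     using h by (simp_all add: a_priori_data_def)
    show "mi_partial \<delta> v \<in> test_functions UNIV" by (rule test_mi_partial[OF v])
    show "\<forall>\<gamma>. len \<gamma> <= 2 * m + 0 --> \<gamma> lastix <= m -->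
     nrm_on (half_ball R) (mi_partial \<gamma> (mi_partial \<delta> v)) <= D"
    proof (intro allI impI)
     fix \<kappa> :: "'n multi_index" assume k: "len \<kappa> <= 2 * m + 0" "\<kappa> lastix <= m"
     have "len (%j. \<kappa> j + \<delta> j) <= 2 * m + l" "(%j. \<kappa> j + \<delta> j) lastix <= m"
      using k l dN by (simp_all add: mi_length_add)
     then show "nrm_on (half_ball R) (mi_partial \<kappa> (mi_partial \<delta> v)) <= D"
      unfolding p using h unfolding a_priori_data_def by blast
    qed
    have "nrm_on (half_ball R) (Aop m a (mi_partial \<delta> v)) <= D"
     unfolding mi_partial_Aop[OF vC, symmetric] using h l(2) unfolding a_priori_data_def by blast
    then show "\<forall>\<kappa>. len \<kappa> <= 0 --> nrm_on (half_ball R) (mi_partial \<kappa> (Aop m a (mi_partial \<delta> v))) <= D"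
     by (simp add: mi_length_eq_0)
   qed
   then show "nrm_on (half_ball r) (mi_partial \<gamma> v) <= C * D" unfolding p g[symmetric] .
  qed
 next
  case (Suc p)
  then obtain C where C: "C >= 0" and IH: "!!(a :: 'n coeffs) v D \<gamma>. a_priori_data m l c M R a v D ==> len \<gamma> <= 2 * m + l ==>
   \<gamma> lastix <= 2 * m + p ==> nrm_on (half_ball r) (mi_partial \<gamma> v) <= C * D" by blast
  define C' where "C' = C + (1 / c) * (1 + (real (card {\<alpha>::'n multi_index. len \<alpha> = m}))\<^sup>2 * \<bar>M\<bar> * C)"
  have C': "C' >= 0" using C c by (simp add: C'_def)
  show ?case
  proof (intro exI[of _ C'] conjI C' allI impI)
   fix a :: "'n coeffs" and v :: "'n rfun" and D and \<gamma> :: "'n multi_index"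
   assume h: "a_priori_data m l c M R a v D" and \<gamma>: "len \<gamma> <= 2 * m + l" "\<gamma> lastix <= 2 * m + Suc p"
   have v: "v \<in> test_functions UNIV" and ell: "elliptic_with m c a" using h by (simp_all add: a_priori_data_def)
   have vC: "C_infinity v" by (rule test_smooth[OF v])
   have D: "D >= 0" by (rule a_priori_data_nonneg[OF h])
   show "nrm_on (half_ball r) (mi_partial \<gamma> v) <= C' * D"
   proof (cases "\<gamma> lastix <= 2 * m + p")
    case True
    have "nrm_on (half_ball r) (mi_partial \<gamma> v) <= C * D" by (rule IH[OF h \<gamma>(1) True])
    also have "\<dots> <= C' * D" using C c D by (intro mult_right_mono) (auto simp: C'_def)
    finally show ?thesis .
   next
    case False
    then have "2 * m <= \<gamma> lastix" by simp
    then obtain \<gamma>' where g': "\<gamma> = (%i. \<gamma>' i + normal_ix (2 * m) i)" "len \<gamma>' + 2 * m = len \<gamma>"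
     "\<gamma>' lastix + 2 * m = \<gamma> lastix" by (rule mi_minus_normal)
    have l: "len \<gamma>' <= l" "\<gamma>' lastix <= Suc p" using g' \<gamma> by auto
    have p: "mi_partial \<kappa> (mi_partial \<gamma>' v) = mi_partial (%j. \<gamma>' j + \<kappa> j) v" for \<kappa>
     unfolding mi_partial_add[OF vC, of \<kappa> \<gamma>', symmetric] by (simp add: add.commute)
    have "nrm_on (half_ball r) (mi_partial (normal_ix (2 * m)) (mi_partial \<gamma>' v))
     <= (1 / c) * (D + (real (card {\<alpha>::'n multi_index. len \<alpha> = m}))\<^sup>2 * \<bar>M\<bar> * (C * D))"
    proof (rule solve_for_normal[OF ell c, where f = "%\<kappa>. mi_partial \<kappa> (mi_partial \<gamma>' v)" and g = "Aop m a (mi_partial \<gamma>' v)"])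
     show "\<bar>a \<alpha> \<beta>\<bar> <= M" if "len \<alpha> = m" "len \<beta> = m" for \<alpha> \<beta>
      using h that unfolding a_priori_data_def by blast
     show "L2b (mi_partial \<kappa> (mi_partial \<gamma>' v))" for \<kappa> by (intro test_L2b_UNIV test_mi_partial v)
     show "Aop m a (mi_partial \<gamma>' v) x = (\<Sum>\<alpha> | len \<alpha> = m. \<Sum>\<beta> | len \<beta> = m.
       a \<alpha> \<beta> * mi_partial (%i. \<alpha> i + \<beta> i) (mi_partial \<gamma>' v) x)" for x
      by (rule Aop_def)
     have tA: "mi_partial \<gamma>' (Aop m a v) \<in> test_functions UNIV" by (intro test_mi_partial test_Aop v)
     have "nrm_on (half_ball r) (mi_partial \<gamma>' (Aop m a v))
       <= nrm_on (half_ball R) (mi_partial \<gamma>' (Aop m a v))"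
      by (rule nrm_mono[OF L2b_indicator[OF test_L2b_UNIV[OF tA] half_ball_borel]])
       (use L2b_indicator[OF test_L2b_UNIV[OF tA] half_ball_borel[of r]] half_ball_mono[of r R] r
        in \<open>auto simp: L2b_def indicator_def\<close>)
     also have "\<dots> <= D" using h l(1) unfolding a_priori_data_def by blast
     finally show "nrm_on (half_ball r) (Aop m a (mi_partial \<gamma>' v)) <= D"
      unfolding mi_partial_Aop[OF vC] .
     show "nrm_on (half_ball r) (mi_partial \<kappa> (mi_partial \<gamma>' v)) <= C * D"
      if k: "len \<kappa> = 2 * m" "\<kappa> lastix < 2 * m" for \<kappa>
      unfolding p by (rule IH[OF h]) (use k l in \<open>auto simp: mi_length_add\<close>)
    qed (use half_ball_borel C D in auto)
    also have "\<dots> = (1 / c) * (1 + (real (card {\<alpha>::'n multi_index. len \<alpha> = m}))\<^sup>2 * \<bar>M\<bar> * C) * D"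
     by (simp add: algebra_simps)
    also have "\<dots> <= C' * D" using C D by (intro mult_right_mono) (auto simp: C'_def)
    finally show ?thesis unfolding p g'(1)[symmetric] .
   qed
  qed
 qed
 obtain C where C: "C >= 0" and fin: "!!(a :: 'n coeffs) v D \<gamma>. a_priori_data m l c M R a v D ==>
   len \<gamma> <= 2 * m + l ==> \<gamma> lastix <= 2 * m + l ==> nrm_on (half_ball r) (mi_partial \<gamma> v) <= C * D"
  using ladder[of l] by blast
 have "\<gamma> lastix <= len \<gamma>" for \<gamma> :: "'n multi_index" using mi_length_remove[of \<gamma> lastix] by simp
 then show ?thesis using C fin by (meson order_trans)
qed

section \<open>Regularity up to the flat boundary\<close>

text \<open>The radii \<open>1 > 3/4 > 5/8 > 1/2\<close> leave room for the tangential estimate, the mollification and the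
  normal estimate.\<close>

lemma half_ball_regularity:
 fixes c M :: real and m l :: nat
 assumes m: "m >= 1" and c: "c > 0"
 shows "\<exists>C\<ge>0. \<forall>(a :: 'n::{finite,wellorder} coeffs) D F Z \<gamma>.
  half_ball_solution m l c M a D F Z --> len \<gamma> <= 2 * m + l -->
  (\<exists>E. L2b E \<and> wd (half_ball (1/2)) \<gamma> (D (%_. 0)) E \<and> nrm E <= C * Z)"
proof -
 obtain Ct where Ct: "Ct >= 0" and tang: "!!(a :: 'n coeffs) D F Z \<gamma>.
  half_ball_solution m l c M a D F Z ==> \<gamma> lastix <= m ==> len \<gamma> <= m + (m + l) ==>
  (\<exists>E. L2b E \<and> wd (ball 0 (3/4)) \<gamma> (D (%_. 0)) E \<and> nrm E <= Ct * Z \<and>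
   (\<forall>x. norm x > 3/4 \<or> x $ lastix < 0 --> E x = 0))"
  using tangential_regularity[OF m c, of "m + l" l "3/4" M, where 'n='n] by auto
 obtain Cn where Cn: "Cn >= 0" and norml: "!!(a :: 'n coeffs) v D \<gamma>. a_priori_data m l c M (5/8) a v D ==>
  len \<gamma> <= 2 * m + l ==> nrm_on (half_ball (1/2)) (mi_partial \<gamma> v) <= Cn * D"
  using normal_estimate[OF c, of "1/2" "5/8" m l M, where 'n='n] by auto
 define C where "C = Cn * (Ct + 1)"
 have C: "C >= 0" using Cn Ct by (simp add: C_def)
 show ?thesis
 proof (intro exI[of _ C] conjI C allI impI)
  fix a :: "'n coeffs" and D F :: "'n multi_index => 'n rfun" and Z and \<gamma> :: "'n multi_index"
  assume h: "half_ball_solution m l c M a D F Z" and \<gamma>: "len \<gamma> <= 2 * m + l"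
  have ell: "elliptic_with m c a"
   and aM: "\<forall>\<alpha> \<beta>. len \<alpha> = m --> len \<beta> = m --> \<bar>a \<alpha> \<beta>\<bar> <= M"
   and jD: "jet m (ball 0 1) D"
   and D0: "\<forall>\<alpha> x. len \<alpha> <= m --> norm x > 1 \<or> x $ lastix < 0 --> D \<alpha> x = 0"
   and DZ: "\<forall>\<alpha>. len \<alpha> = m --> nrm (D \<alpha>) <= Z"
   and jF: "jet l (half_ball 1) F" and FZ: "\<forall>\<gamma>. len \<gamma> <= l --> nrm (F \<gamma>) <= Z"
   and eq: "\<forall>\<phi>\<in>test_functions (half_ball 1). (\<Sum>\<alpha> | len \<alpha> = m. \<Sum>\<beta> | len \<beta> = m.
    a \<alpha> \<beta> * ip (D \<alpha>) (mi_partial \<beta> \<phi>)) = ip (F (%_. 0)) \<phi>"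
   using h unfolding half_ball_solution_def by simp_all
  define u where "u = D (%_. 0)"
  have Lu: "L2b u" unfolding u_def by (rule jet_L2b[OF jD]) simp
  have u0: "u x = 0" if "norm x > 1" for x using D0[rule_format, of "%_. 0" x] that by (simp add: u_def)
  have "nrm (D (normal_ix m)) <= Z" using DZ by simp
  then have Z: "Z >= 0" by (rule order_trans[OF nrm_nonneg])
  define B where "B = (Ct + 1) * Z"
  have BZ: "Ct * Z <= B" "Z <= B" using Ct Z by (simp_all add: B_def algebra_simps)
  have "\<forall>\<gamma>. \<exists>E. \<gamma> lastix <= m \<and> len \<gamma> <= 2 * m + l -->
    L2b E \<and> wd (ball 0 (3/4)) \<gamma> u E \<and> nrm E <= Ct * Z"
  proof
   fix \<gamma> :: "'n multi_index"
   show "\<exists>E. \<gamma> lastix <= m \<and> len \<gamma> <= 2 * m + l --> L2b E \<and> wd (ball 0 (3/4)) \<gamma> u E \<and> nrm E <= Ct * Z"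
    using tang[OF h, of \<gamma>] unfolding u_def by (cases "\<gamma> lastix <= m \<and> len \<gamma> <= 2 * m + l") auto
  qed
  from choice[OF this] obtain G where G: "\<forall>\<gamma>. \<gamma> lastix <= m \<and> len \<gamma> <= 2 * m + l -->
    L2b (G \<gamma>) \<and> wd (ball 0 (3/4)) \<gamma> u (G \<gamma>) \<and> nrm (G \<gamma>) <= Ct * Z" ..
  obtain \<rho> where os: "one_sided (-1) (\<rho> :: nat => 'n rfun)"
   using one_sided_exists[of "-1"] by blast
  note \<rho> = one_sidedD[OF os]
  have \<rho>t: "\<rho> n \<in> test_functions UNIV" for n by (rule mollifier_test[OF \<rho>(1)])
  have \<rho>C: "C_infinity (\<rho> n)" for n by (rule test_smooth[OF \<rho>t])
  have \<rho>S: "z \<in> cball 0 (3 / real (Suc n)) \<inter> {z. z $ lastix <= - (1 / real (Suc n))}" if "\<rho> n z ~= 0" for n z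
   using \<rho>(2)[OF that] \<rho>(3)[OF that] by auto
  have cS: "compact (cball 0 (3 / real (Suc n)) \<inter> {z::real^'n::_. z $ lastix <= - (1 / real (Suc n))})" for n
   by (intro compact_Int_closed compact_cball closed_Collect_le continuous_intros)
  define v where "v n = conv u (\<rho> n)" for n
  have vt: "v n \<in> test_functions UNIV" for n
  proof (rule test_functionsI)
   show "C_infinity (v n)" unfolding v_def by (rule C_infinity_conv[OF Lu \<rho>t])
   show "compact (cball 0 (1 + 3 / real (Suc n)) :: (real^'n::_) set)" by simp
   show "v n x = 0" if "x \<notin> cball 0 (1 + 3 / real (Suc n))" for x
    unfolding v_def
   proof (rule conv_eq_0)
    fix y assume "\<rho> n (x - y) ~= 0"
    then have "norm y > 1" using \<rho>(2)[of n "x - y"] that norm_triangle_ineq2[of x y] by simp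
    then show "u y = 0" by (rule u0)
   qed
  qed simp
  have bound: "nrm_on (half_ball (1/2)) (mi_partial \<gamma> (v n)) <= Cn * B"
   if n: "3 / real (Suc n) < 1/8" for n
  proof (rule norml[OF _ \<gamma>], unfold a_priori_data_def, intro conjI)
   show "elliptic_with m c a" by (rule ell)
   show "\<forall>\<alpha> \<beta>. len \<alpha> = m --> len \<beta> = m --> \<bar>a \<alpha> \<beta>\<bar> <= M" by (rule aM)
   show "v n \<in> test_functions UNIV" by (rule vt)
   \<comment> \<open>the kernel only sees points above \<open>x\<close>, and none outside the ball of radius \<open>3/4\<close>\<close>
   have near: "norm (x - z) < 3/4" "0 < (x - z) $ lastix" if "x \<in> half_ball (5/8)"
    "z \<in> cball 0 (3 / real (Suc n)) \<inter> {z. z $ lastix <= - (1 / real (Suc n))}" for x z :: "real^'n::_"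
   proof -
    have "norm (x - z) <= norm x + norm z" by (rule norm_triangle_ineq4)
    moreover have "norm x < 5/8" using that(1) by (simp add: half_ball_def)
    moreover have "norm z <= 3 / real (Suc n)" using that(2) by (simp del: of_nat_Suc)
    ultimately show "norm (x - z) < 3/4" using n by linarith
    have "0 < 1 / real (Suc n)" by simp
    moreover have "0 < x $ lastix" using that(1) by (simp add: half_ball_def)
    moreover have "z $ lastix <= - (1 / real (Suc n))" using that(2) by simp
    ultimately show "0 < (x - z) $ lastix" unfolding vector_minus_component by linarith
   qed
   have tb: "(%y. \<rho> n (x - y)) \<in> test_functions (ball 0 (3/4))" if x: "x \<in> half_ball (5/8)" for x
   proof (rule test_reflect_support[OF \<rho>t \<rho>S cS])
    fix z :: "real^'n::_" assume z: "z \<in> cball 0 (3 / real (Suc n)) \<inter> {z. z $ lastix <= - (1 / real (Suc n))}"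
    show "x - z \<in> ball 0 (3/4)" using near(1)[OF x z] by simp
   qed
   have th: "(%y. \<rho> n (x - y)) \<in> test_functions (half_ball 1)" if x: "x \<in> half_ball (5/8)" for x
   proof (rule test_reflect_support[OF \<rho>t \<rho>S cS])
    fix z :: "real^'n::_" assume z: "z \<in> cball 0 (3 / real (Suc n)) \<inter> {z. z $ lastix <= - (1 / real (Suc n))}"
    show "x - z \<in> half_ball 1" using near[OF x z] by (simp add: half_ball_def)
   qed
   have bd: "nrm_on (half_ball (5/8)) f <= B"
    if g: "L2b g" "nrm g <= B" and f: "!!x. x \<in> half_ball (5/8) ==> \<bar>f x\<bar> = \<bar>conv g (\<rho> n) x\<bar>" and fm: "f \<in> test_functions UNIV" for f g
   proof -
    have "nrm_on (half_ball (5/8)) f <= nrm (conv g (\<rho> n))"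
    proof (rule nrm_mono[OF L2b_conv[OF g(1) \<rho>(1)]])
     show "(%x. ind (half_ball (5/8)) x * f x) \<in> borel_measurable borel"
      using L2b_indicator[OF test_L2b_UNIV[OF fm] half_ball_borel, of "5/8"] by (simp add: L2b_def)
     show "\<bar>ind (half_ball (5/8)) x * f x\<bar> <= \<bar>conv g (\<rho> n) x\<bar>" for x
      using f[of x] by (auto simp: indicator_def)
    qed
    also have "\<dots> <= nrm g" by (rule nrm_conv[OF g(1) \<rho>(1)])
    finally show ?thesis using g(2) by simp
   qed
   show "\<forall>\<gamma>. len \<gamma> <= 2 * m + l --> \<gamma> lastix <= m -->
    nrm_on (half_ball (5/8)) (mi_partial \<gamma> (v n)) <= B"
   proof (intro allI impI)
    fix \<gamma> :: "'n multi_index" assume "len \<gamma> <= 2 * m + l" "\<gamma> lastix <= m"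
    then have Gg: "L2b (G \<gamma>)" "wd (ball 0 (3/4)) \<gamma> u (G \<gamma>)" "nrm (G \<gamma>) <= Ct * Z" using G by blast+
    show "nrm_on (half_ball (5/8)) (mi_partial \<gamma> (v n)) <= B"
    proof (rule bd[OF Gg(1)])
     show "nrm (G \<gamma>) <= B" using Gg(3) BZ by simp
     fix x :: "real^'n::_" assume x: "x \<in> half_ball (5/8)"
     show "\<bar>mi_partial \<gamma> (v n) x\<bar> = \<bar>conv (G \<gamma>) (\<rho> n) x\<bar>"
      unfolding v_def by (simp only: mi_partial_conv_wd[OF Lu \<rho>t Gg(2) tb[OF x]])
    qed (rule test_mi_partial[OF vt])
   qed
   show "\<forall>\<delta>. len \<delta> <= l -->
    nrm_on (half_ball (5/8)) (mi_partial \<delta> (Aop m a (v n))) <= B"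
   proof (intro allI impI)
    fix \<delta> :: "'n multi_index" assume \<delta>: "len \<delta> <= l"
    show "nrm_on (half_ball (5/8)) (mi_partial \<delta> (Aop m a (v n))) <= B"
    proof (rule bd[OF jet_L2b[OF jF \<delta>]])
     show "nrm (F \<delta>) <= B" using FZ \<delta> BZ by force
     show "mi_partial \<delta> (Aop m a (v n)) \<in> test_functions UNIV" by (intro test_mi_partial test_Aop vt)
     fix x :: "real^'n::_" assume x: "x \<in> half_ball (5/8)"
     define \<rho>' where "\<rho>' = mi_partial \<delta> (\<rho> n)"
     have \<rho>'t: "\<rho>' \<in> test_functions UNIV" unfolding \<rho>'_def by (rule test_mi_partial[OF \<rho>t])
     have \<rho>'C: "C_infinity \<rho>'" by (rule test_smooth[OF \<rho>'t])
     define \<psi> where "\<psi> y = \<rho>' (x - y)" for y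
     have rfl: "mi_partial \<delta> (%y. \<rho> n (x - y)) = (%y. (-1) ^ len \<delta> * \<psi> y)"
      unfolding \<psi>_def \<rho>'_def by (rule mi_partial_reflect[OF \<rho>C])
     have "(%y. (-1) ^ len \<delta> * mi_partial \<delta> (%y. \<rho> n (x - y)) y) \<in> test_functions (half_ball 1)"
      by (intro test_cmult test_mi_partial th x)
     moreover have "(-1) ^ k * ((-1) ^ k * t) = t" for k and t :: real
      by (simp add: mult.assoc[symmetric] power_mult_distrib[symmetric])
     ultimately have \<psi>t: "\<psi> \<in> test_functions (half_ball 1)" unfolding rfl by simp
     have R: "mi_partial \<beta> \<psi> = (%y. (-1) ^ m * mi_partial \<beta> \<rho>' (x - y))" if "len \<beta> = m" for \<beta>
      unfolding \<psi>_def using mi_partial_reflect[OF \<rho>'C, of \<beta> x] by (simp add: that)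
     have T: "ip (D \<alpha>) (mi_partial \<beta> \<psi>) = (-1) ^ m * mi_partial (%i. \<alpha> i + \<beta> i) (mi_partial \<delta> (v n)) x"
      if ab: "len \<alpha> = m" "len \<beta> = m" for \<alpha> \<beta>
     proof -
      have "mi_partial (%i. \<alpha> i + \<beta> i) (mi_partial \<delta> (v n)) = mi_partial \<alpha> (mi_partial \<beta> (mi_partial \<delta> (v n)))"
       by (rule mi_partial_add) (intro C_infinity_mi_partial test_smooth[OF vt])
      also have "mi_partial \<beta> (mi_partial \<delta> (v n)) = conv u (mi_partial \<beta> \<rho>')"
       unfolding v_def \<rho>'_def by (simp only: mi_partial_conv[OF Lu \<rho>t] mi_partial_conv[OF Lu test_mi_partial[OF \<rho>t]])
      finally have e0: "mi_partial (%i. \<alpha> i + \<beta> i) (mi_partial \<delta> (v n)) = mi_partial \<alpha> (conv u (mi_partial \<beta> \<rho>'))" .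
      have e: "mi_partial (%i. \<alpha> i + \<beta> i) (mi_partial \<delta> (v n)) x = conv (D \<alpha>) (mi_partial \<beta> \<rho>') x"
       unfolding e0
      proof (rule mi_partial_conv_wd[OF Lu test_mi_partial[OF \<rho>'t]])
       show "wd (ball 0 1) \<alpha> u (D \<alpha>)" unfolding u_def by (rule jet_wd[OF jD]) (simp add: ab)
       have "(%y. (-1) ^ m * mi_partial \<beta> \<psi> y) \<in> test_functions (ball 0 1)"
        by (intro test_cmult test_mi_partial test_mono[OF \<psi>t half_ball_subset])
       then show "(%y. mi_partial \<beta> \<rho>' (x - y)) \<in> test_functions (ball 0 1)"
        unfolding R[OF ab(2)] by (simp add: mult.assoc[symmetric] power_mult_distrib[symmetric])
      qed
      show ?thesis unfolding e R[OF ab(2)] by (simp add: conv_def ip_cmult_right)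
     qed
     have "(\<Sum>\<alpha> | len \<alpha> = m. \<Sum>\<beta> | len \<beta> = m. a \<alpha> \<beta> * ip (D \<alpha>) (mi_partial \<beta> \<psi>))
      = (\<Sum>\<alpha> | len \<alpha> = m. \<Sum>\<beta> | len \<beta> = m.
        (-1) ^ m * (a \<alpha> \<beta> * mi_partial (%i. \<alpha> i + \<beta> i) (mi_partial \<delta> (v n)) x))"
      by (rule sum.cong[OF refl], rule sum.cong[OF refl]) (simp add: T mult.left_commute)
     also have "\<dots> = (-1) ^ m * Aop m a (mi_partial \<delta> (v n)) x"
      by (simp only: Aop_def sum_distrib_left)
     finally have "(-1) ^ m * Aop m a (mi_partial \<delta> (v n)) x = ip (F (%_. 0)) \<psi>"
      using eq \<psi>t by simp
     also have "\<dots> = conv (F (%_. 0)) (mi_partial \<delta> (\<rho> n)) x" by (simp add: conv_def \<psi>_def[abs_def] \<rho>'_def)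
     also have "\<dots> = conv (F \<delta>) (\<rho> n) x" by (rule conv_wd[OF jet_wd[OF jF \<delta>] \<rho>C th[OF x]])
     finally have "\<bar>(-1) ^ m * Aop m a (mi_partial \<delta> (v n)) x\<bar> = \<bar>conv (F \<delta>) (\<rho> n) x\<bar>" by simp
     then show "\<bar>mi_partial \<delta> (Aop m a (v n)) x\<bar> = \<bar>conv (F \<delta>) (\<rho> n) x\<bar>"
      by (simp add: mi_partial_Aop[OF test_smooth[OF vt]] abs_mult power_abs)
    qed
   qed
  qed
  have CB: "Cn * B = C * Z" by (simp add: C_def B_def)
  have lim: "\<bar>ip u (mi_partial \<gamma> \<phi>)\<bar> <= C * Z * nrm \<phi>" if \<phi>: "\<phi> \<in> test_functions (half_ball (1/2))" for \<phi>
  proof (rule tendsto_upperbound)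
   have L\<phi>: "L2b \<phi>" by (rule test_L2b[OF \<phi>])
   show "(%n. \<bar>ip (v n) (mi_partial \<gamma> \<phi>)\<bar>) \<longlonglongrightarrow> \<bar>ip u (mi_partial \<gamma> \<phi>)\<bar>"
    unfolding v_def
    by (intro tendsto_rabs ip_tendsto L2b_conv Lu \<rho>(1) conv_tendsto[OF Lu \<rho>(1,2) three_over_Suc_tendsto]
      test_L2b[OF test_mi_partial[OF \<phi>]])
   have "\<forall>\<^sub>F n in sequentially. 3 / real (Suc n) < 1/8"
    using order_tendstoD(2)[OF three_over_Suc_tendsto] by simp
   then show "\<forall>\<^sub>F n in sequentially. \<bar>ip (v n) (mi_partial \<gamma> \<phi>)\<bar> <= C * Z * nrm \<phi>"
   proof eventually_elim
    fix n :: nat assume n: "3 / real (Suc n) < 1/8"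
    let ?g = "%x. ind (half_ball (1/2)) x * mi_partial \<gamma> (v n) x"
    have Lg: "L2b ?g" by (intro L2b_indicator test_L2b_UNIV test_mi_partial vt half_ball_borel)
    have "\<phi> x = 0" if "x \<notin> half_ball (1/2)" for x
     by (rule test_functionsE[OF \<phi>]) (use that in blast)
    then have "ip (mi_partial \<gamma> (v n)) \<phi> = ip ?g \<phi>"
     unfolding ip_def by (intro Bochner_Integration.integral_cong refl) (auto simp: indicator_def)
    then have "\<bar>ip (v n) (mi_partial \<gamma> \<phi>)\<bar> = \<bar>ip ?g \<phi>\<bar>"
     by (simp add: ip_mi_partial[OF test_smooth[OF vt] \<phi>] abs_mult power_abs)
    also have "\<dots> <= nrm ?g * nrm \<phi>" by (rule ip_Cauchy_Schwarz[OF Lg L\<phi>])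
    also have "\<dots> <= C * Z * nrm \<phi>" using bound[OF n] unfolding CB by (rule mult_right_mono) simp
    finally show "\<bar>ip (v n) (mi_partial \<gamma> \<phi>)\<bar> <= C * Z * nrm \<phi>" .
   qed
  qed simp
  have "C * Z >= 0" using C Z by simp
  from wd_from_bound[OF Lu this lim] obtain E where "L2b E" "wd (half_ball (1/2)) \<gamma> u E" "nrm E <= C * Z" by blast
  then show "\<exists>E. L2b E \<and> wd (half_ball (1/2)) \<gamma> (D (%_. 0)) E \<and> nrm E <= C * Z" unfolding u_def by blast
 qed
qed

section \<open>Sobolev functions and their Borel representatives\<close>

context
 fixes U :: "(real^'n::finite) set" and h k :: "'n rfun"
 assumes U: "U \<in> sets borel" and h: "h \<in> borel_measurable borel"
  and ae: "AE x in lborel. x \<in> U --> k x = h x"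
begin

lemma lebesgue_on_cong:
 shows lebesgue_on_measurable: "k \<in> borel_measurable (lebesgue_on U)"
  and lebesgue_on_integrable: "integrable (lebesgue_on U) k \<longleftrightarrow> integrable lborel (%x. ind U x * h x)"
  and lebesgue_on_integral: "(LINT x|lebesgue_on U. k x) = (LINT x|lborel. ind U x * h x)"
proof -
 have Ul: "U \<inter> space lebesgue \<in> sets lebesgue" using U by simp
 have hm: "(%x. ind U x * h x) \<in> borel_measurable lborel" using U h by measurable
 then have hl: "(%x. ind U x * h x) \<in> borel_measurable lebesgue" by (rule measurable_completion)
 have e: "AE x in lebesgue. ind U x * h x = ind U x *\<^sub>R k x"
  unfolding AE_completion_iff using ae by eventually_elim (auto simp: indicator_def)
 have kl: "(%x. ind U x *\<^sub>R k x) \<in> borel_measurable lebesgue" by (rule borel_measurable_AE[OF hl e])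
 show "k \<in> borel_measurable (lebesgue_on U)"
  using borel_measurable_restrict_space_iff[OF Ul, of k] kl by simp
 have "integrable (lebesgue_on U) k \<longleftrightarrow> integrable lebesgue (%x. ind U x * h x)"
  unfolding integrable_restrict_space[OF Ul] by (rule integrable_cong_AE[OF kl hl]) (use e in \<open>auto elim: eventually_mono\<close>)
 then show "integrable (lebesgue_on U) k \<longleftrightarrow> integrable lborel (%x. ind U x * h x)"
  by (simp only: integrable_completion[OF hm])
 have "(LINT x|lebesgue_on U. k x) = (LINT x|lebesgue. ind U x * h x)"
  unfolding integral_restrict_space[OF Ul] by (rule integral_cong_AE[OF kl hl]) (use e in \<open>auto elim: eventually_mono\<close>)
 then show "(LINT x|lebesgue_on U. k x) = (LINT x|lborel. ind U x * h x)"
  by (simp only: integral_completion[OF hm])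
qed

end

definition agrees :: "(real^'n::finite) set => 'n rfun => 'n rfun => bool" where
 "agrees U w g \<longleftrightarrow> L2b g \<and> (AE x in lborel. x \<in> U --> w x = g x)"

lemma agrees_refl: "L2b g ==> agrees U g g" by (simp add: agrees_def)

lemma agrees_mono: "agrees V w g ==> U \<subseteq> V ==> agrees U w g"
 unfolding agrees_def by (auto elim: eventually_mono)

lemma agrees_norm:
 assumes "U \<in> sets borel" "agrees U w g"
 shows "w \<in> L2 U" "(L2_norm_on U w)\<^sup>2 = (nrm_on U g)\<^sup>2"
  "integrable (lebesgue_on U) (%x. (w x)\<^sup>2)" "L2_norm_on U w = nrm_on U g"
proof -
 have g: "L2b g" and ae: "AE x in lborel. x \<in> U --> w x = g x" using assms(2) by (simp_all add: agrees_def)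
 have gm: "g \<in> borel_measurable borel" by (rule L2b_borel[OF g])
 have g2: "(%x. (g x)\<^sup>2) \<in> borel_measurable borel" using gm by measurable
 have ae2: "AE x in lborel. x \<in> U --> (w x)\<^sup>2 = (g x)\<^sup>2" using ae by eventually_elim simp
 have sq: "ind U x * (g x)\<^sup>2 = (ind U x * g x)\<^sup>2" for x by (simp add: indicator_def)
 show i: "integrable (lebesgue_on U) (%x. (w x)\<^sup>2)"
  using lebesgue_on_integrable[OF assms(1) g2 ae2] L2b_indicator[OF g assms(1)] by (simp add: sq L2b_def)
 then show "w \<in> L2 U" using lebesgue_on_measurable[OF assms(1) gm ae] by (simp add: L2_def)
 show n: "L2_norm_on U w = nrm_on U g"
  unfolding L2_norm_on_def nrm_def lebesgue_on_integral[OF assms(1) g2 ae2] sq ..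
 then show "(L2_norm_on U w)\<^sup>2 = (nrm_on U g)\<^sup>2" by simp
qed

lemma L2_agrees:
 assumes U: "U \<in> sets borel" and w: "w \<in> L2 U" obtains g where "agrees U w g"
proof -
 have Ul: "U \<inter> space lebesgue \<in> sets lebesgue" using U by simp
 have "(%x. ind U x *\<^sub>R w x) \<in> borel_measurable lebesgue"
  using borel_measurable_restrict_space_iff[OF Ul, of w] w by (simp add: L2_def)
 from completion_ex_borel_measurable_real[OF this] obtain g where g: "g \<in> borel_measurable lborel"
  "AE x in lborel. ind U x *\<^sub>R w x = g x" by blast
 have gm: "g \<in> borel_measurable borel" using g(1) by simp
 then have g2: "(%x. (g x)\<^sup>2) \<in> borel_measurable borel" by measurable
 have ae: "AE x in lborel. x \<in> U --> w x = g x" using g(2) by eventually_elim (auto simp: indicator_def)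
 have ae2: "AE x in lborel. x \<in> U --> (w x)\<^sup>2 = (g x)\<^sup>2" using ae by eventually_elim simp
 have sq: "ind U x * (g x)\<^sup>2 = (ind U x * g x)\<^sup>2" for x by (simp add: indicator_def)
 have "integrable lborel (%x. (ind U x * g x)\<^sup>2)"
  using lebesgue_on_integrable[OF U g2 ae2] w by (simp add: L2_def sq)
 moreover have "(%x. ind U x * g x) \<in> borel_measurable borel" using U gm by measurable
 ultimately have "agrees U w (%x. ind U x * g x)"
  unfolding agrees_def L2b_def using ae by (auto elim: eventually_mono simp: indicator_def)
 then show ?thesis by (rule that)
qed

lemma agrees_L1_loc:
 fixes U :: "(real^'n::finite) set"
 assumes "agrees U w g" shows "w \<in> L1_loc U"
 unfolding L1_loc_def
proof (intro CollectI allI impI)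
 fix K :: "(real^'n) set" assume K: "compact K \<and> K \<subseteq> U"
 then have Kb: "K \<in> sets borel" by (intro borel_closed compact_imp_closed) simp
 have g: "L2b g" and ae: "AE x in lborel. x \<in> K --> w x = g x"
  using agrees_mono[OF assms, of K] K by (simp_all add: agrees_def)
 obtain R where "!!x. x \<in> K ==> norm x <= R"
  using compact_imp_bounded[of K] K by (auto simp: bounded_pos)
 then have "(%x. ind K x * ind (cball 0 R) x) = (ind K :: 'n rfun)"
  by (auto simp: indicator_def fun_eq_iff)
 then have "L2b (ind K)" using L2b_indicator[OF L2b_indicator_cball Kb, of 0 R] by simp
 then show "integrable (lebesgue_on K) w"
  using lebesgue_on_integrable[OF Kb L2b_borel[OF g] ae] L2b_integrable_mult[OF _ g] by blast
qed

lemma agrees_pairing: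
 assumes U: "U \<in> sets borel" and w: "agrees U w g" and \<phi>: "\<phi> \<in> test_functions U"
 shows "(LINT x|lebesgue_on U. w x * \<phi> x) = ip g \<phi>"
proof -
 have g: "L2b g" and ae: "AE x in lborel. x \<in> U --> w x = g x" using w by (simp_all add: agrees_def)
 have gm: "g \<in> borel_measurable borel" by (rule L2b_borel[OF g])
 have m: "(%x. g x * \<phi> x) \<in> borel_measurable borel" using gm test_borel[OF \<phi>] by measurable
 have ae': "AE x in lborel. x \<in> U --> w x * \<phi> x = g x * \<phi> x" using ae by eventually_elim simp
 have "\<phi> x = 0" if "x \<notin> U" for x by (rule test_functionsE[OF \<phi>]) (use that in blast)
 then have "(%x. ind U x * (g x * \<phi> x)) = (%x. g x * \<phi> x)" by (auto simp: indicator_def fun_eq_iff)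
 then show ?thesis unfolding ip_def lebesgue_on_integral[OF U m ae'] by simp
qed

lemma agrees_is_weak_deriv:
 fixes U :: "(real^'n::{finite,wellorder}) set"
 assumes U: "U \<in> sets borel" and u: "agrees U u g" and v: "agrees U v h"
 shows "is_weak_deriv U \<alpha> u v \<longleftrightarrow> wd U \<alpha> g h"
 using agrees_L1_loc[OF u] agrees_L1_loc[OF v] agrees_pairing[OF U u test_mi_partial] agrees_pairing[OF U v]
 by (simp add: is_weak_deriv_def wd_def)

text \<open>Weak derivatives are only locally integrable by definition, which is why the fundamental lemma is needed in this
  generality.\<close>

lemma weak_deriv_unique:
 fixes U :: "(real^'n::{finite,wellorder}) set"
 assumes U: "open U" and v: "is_weak_deriv U \<alpha> u v" and v': "is_weak_deriv U \<alpha> u v'"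
 shows "AE x in lborel. x \<in> U --> v x = v' x"
proof -
 have Ul: "U \<inter> space lebesgue \<in> sets lebesgue" using U by simp
 have K: "integrable lebesgue (%x. ind K x * w x)" if "compact K" "K \<subseteq> U" "w \<in> L1_loc U" for K w
 proof -
  have "K \<in> sets borel" using that(1) by (intro borel_closed compact_imp_closed)
  then have "K \<inter> space lebesgue \<in> sets lebesgue" by simp
  from integrable_restrict_space[OF this, of w] show ?thesis using that by (simp add: L1_loc_def)
 qed
 have L: "v \<in> L1_loc U" "v' \<in> L1_loc U" using v v' by (simp_all add: is_weak_deriv_def)
 have "AE x in lebesgue. x \<in> U --> v x - v' x = 0"
 proof (rule fundamental_lemma[OF U])
  fix K :: "(real^'n::_) set" assume "compact K" "K \<subseteq> U"
  then have "integrable lebesgue (%x. ind K x * v x - ind K x * v' x)"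
   by (intro Bochner_Integration.integrable_diff K L)
  then show "integrable lebesgue (%x. ind K x * (v x - v' x))" by (simp add: right_diff_distrib)
 next
  fix \<phi> :: "'n rfun" assume \<phi>: "\<phi> \<in> test_functions U"
  obtain C where C: "compact C" "C \<subseteq> U" "!!x. x \<notin> C ==> \<phi> x = 0" using test_functionsE[OF \<phi>] by metis
  obtain B where B: "B > 0" "!!x. \<bar>\<phi> x\<bar> <= B" using test_bounded[OF \<phi>] by metis
  have \<phi>l: "\<phi> \<in> borel_measurable lebesgue"
   by (rule measurable_completion) (use test_borel[OF \<phi>] in simp)
  have I: "integrable lebesgue (%x. w x * \<phi> x)"
   "(LINT x|lebesgue_on U. w x * \<phi> x) = (LINT x|lebesgue. w x * \<phi> x)" if "w \<in> L1_loc U" for w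
  proof -
   have e: "w x * \<phi> x = \<phi> x * (ind C x * w x)" for x using C(3)[of x] by (auto simp: indicator_def)
   have i: "integrable lebesgue (%x. B * (ind C x * w x))"
    by (intro integrable_mult_right K C that)
   show "integrable lebesgue (%x. w x * \<phi> x)"
    unfolding e
   proof (rule Bochner_Integration.integrable_bound[OF i])
    show "(%x. \<phi> x * (ind C x * w x)) \<in> borel_measurable lebesgue"
     by (intro borel_measurable_times \<phi>l borel_measurable_integrable K C that)
    show "AE x in lebesgue. norm (\<phi> x * (ind C x * w x)) <= norm (B * (ind C x * w x))"
     using B by (intro AE_I2) (auto simp: abs_mult intro!: mult_right_mono)
   qed
   have "ind U x *\<^sub>R (w x * \<phi> x) = w x * \<phi> x" for x
    using C(2) C(3)[of x] by (auto simp: indicator_def)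
   then have "(%x. ind U x *\<^sub>R (w x * \<phi> x)) = (%x. w x * \<phi> x)" by (rule ext)
   then show "(LINT x|lebesgue_on U. w x * \<phi> x) = (LINT x|lebesgue. w x * \<phi> x)"
    unfolding integral_restrict_space[OF Ul] by simp
  qed
  have s: "(-1) ^ k * ((-1) ^ k * t) = t" for k and t :: real
   by (simp add: mult.assoc[symmetric] power_mult_distrib[symmetric])
  have "(-1) ^ len \<alpha> * (LINT x|lebesgue_on U. v x * \<phi> x) = (-1) ^ len \<alpha> * (LINT x|lebesgue_on U. v' x * \<phi> x)"
   using v v' \<phi> by (simp add: is_weak_deriv_def)
  then have "(LINT x|lebesgue. v x * \<phi> x) = (LINT x|lebesgue. v' x * \<phi> x)"
   unfolding I(2)[OF L(1)] I(2)[OF L(2)] using s by metis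
  then show "(LINT x|lebesgue. (v x - v' x) * \<phi> x) = 0"
   by (simp add: left_diff_distrib Bochner_Integration.integral_diff[OF I(1)[OF L(1)] I(1)[OF L(2)]])
 qed
 then show ?thesis unfolding AE_completion_iff by (auto elim: eventually_mono)
qed

text \<open>The representative chosen by \<open>weak_deriv\<close> is determined up to a null set of \<open>U\<close>, hence every
  norm and integral that contains it can be computed with a known weak derivative.\<close>

lemma weak_deriv_agrees:
 fixes U :: "(real^'n::{finite,wellorder}) set"
 assumes U: "open U" and u: "agrees U u g" and E: "L2b E" "wd U \<alpha> g E"
 shows "agrees U (weak_deriv U \<alpha> u) E"
proof -
 have w: "is_weak_deriv U \<alpha> u E"
  using agrees_is_weak_deriv[OF borel_open[OF U] u agrees_refl[OF E(1)]] E(2) by blast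
 then have "is_weak_deriv U \<alpha> u (weak_deriv U \<alpha> u)" unfolding weak_deriv_def by (rule someI[of "is_weak_deriv U \<alpha> u"])
 from weak_deriv_unique[OF U this w] show ?thesis using E(1) by (simp add: agrees_def)
qed

lemma sobolev_jet:
 fixes U :: "(real^'n::{finite,wellorder}) set"
 assumes U: "open U" and u: "u \<in> sobolev k U" and g: "agrees U u g"
 obtains D where "D (%_. 0) = g" "jet k U D"
proof -
 have Ub: "U \<in> sets borel" by (rule borel_open[OF U])
 have "\<exists>h. len \<alpha> <= k --> L2b h \<and> wd U \<alpha> g h" for \<alpha> :: "'n multi_index"
 proof (cases "len \<alpha> <= k")
  case True
  then obtain v where v: "v \<in> L2 U" "is_weak_deriv U \<alpha> u v" using u by (auto simp: sobolev_def)
  obtain h where h: "agrees U v h" by (rule L2_agrees[OF Ub v(1)])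
  then show ?thesis using agrees_is_weak_deriv[OF Ub g h] v(2) by (auto simp: agrees_def)
 qed simp
 then have "\<forall>\<alpha>. \<exists>h. len \<alpha> <= k --> L2b h \<and> wd U \<alpha> g h" by blast
 from choice[OF this] obtain H where H: "\<forall>\<alpha>. len \<alpha> <= k --> L2b (H \<alpha>) \<and> wd U \<alpha> g (H \<alpha>)" ..
 show ?thesis
 proof (rule that[of "H((%_. 0) := g)"])
  show "jet k U (H((%_. 0) := g))"
   using H g by (auto simp: jet_def wd_zero agrees_def)
 qed simp
qed

lemma sobolev_norm_agrees:
 fixes U :: "(real^'n::{finite,wellorder}) set"
 assumes U: "open U" and u: "agrees U u g"
  and D: "!!\<alpha>. len \<alpha> <= k ==> L2b (D \<alpha>)" "!!\<alpha>. len \<alpha> <= k ==> wd U \<alpha> g (D \<alpha>)"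
 shows "u \<in> sobolev k U"
  and "sobolev_norm k U u = sqrt (\<Sum>\<alpha> | len \<alpha> <= k. (nrm_on U (D \<alpha>))\<^sup>2)"
proof -
 have Ub: "U \<in> sets borel" by (rule borel_open[OF U])
 have "\<exists>v\<in>L2 U. is_weak_deriv U \<alpha> u v" if "len \<alpha> <= k" for \<alpha>
  using agrees_norm(1)[OF Ub agrees_refl[OF D(1)[OF that]]]
   agrees_is_weak_deriv[OF Ub u agrees_refl[OF D(1)[OF that]]] D(2)[OF that] by blast
 then show "u \<in> sobolev k U" using agrees_norm(1)[OF Ub u] by (simp add: sobolev_def)
 show "sobolev_norm k U u = sqrt (\<Sum>\<alpha> | len \<alpha> <= k. (nrm_on U (D \<alpha>))\<^sup>2)"
  unfolding sobolev_norm_def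
  by (intro arg_cong[of _ _ sqrt] sum.cong refl agrees_norm(2)[OF Ub] weak_deriv_agrees[OF U u] D) auto
qed

lemma wd_test:
 fixes \<phi> :: "'n::{finite,wellorder} rfun"
 assumes "\<phi> \<in> test_functions V" shows "wd U \<alpha> \<phi> (mi_partial \<alpha> \<phi>)"
 unfolding wd_def using ip_mi_partial[OF test_smooth[OF assms]] by blast

text \<open>A test function is its own approximation, but \<open>sobolev_norm\<close> of the zero function has to be shown to be
  \<open>0\<close>, as it involves the representatives chosen by \<open>weak_deriv\<close>.\<close>

lemma test_sobolev_zero:
 fixes \<phi> :: "'n::{finite,wellorder} rfun"
 assumes U: "open U" and \<phi>: "\<phi> \<in> test_functions U" shows "\<phi> \<in> sobolev_zero k U"
proof -
 have L: "L2b (mi_partial \<alpha> \<phi>)" for \<alpha> by (rule test_L2b[OF test_mi_partial[OF \<phi>]])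
 have "\<phi> \<in> sobolev k U"
  by (rule sobolev_norm_agrees(1)[OF U agrees_refl[OF test_L2b[OF \<phi>]] L wd_test[OF \<phi>]])
 moreover have "sobolev_norm k U (%x. \<phi> x - \<phi> x) = 0"
  using sobolev_norm_agrees(2)[OF U agrees_refl[OF L2b_zero], of k "%_ _. 0"]
  by (simp add: L2b_zero wd_def ip_def nrm_def)
 ultimately show ?thesis unfolding sobolev_zero_def using \<phi> by force
qed

section \<open>The regularity theorem\<close>

text \<open>The derivatives \<open>D\<close> are taken on the whole ball, where \<open>u\<close> has them by assumption, and set
  to \<open>0\<close> below the boundary, where \<open>u\<close> vanishes. On the half-ball they agree with the weak derivatives
  in the norm and in the equation, and the hyperplane between the two parts is a null set.\<close>

lemma weak_solution_imp_half_ball_solution: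
 fixes a :: "'n::{finite,wellorder} coeffs" and u f :: "'n rfun"
 assumes m: "m >= 1" and ell: "elliptic_with m c a" and M: "max_coeff m a = M"
  and u: "u \<in> sobolev m (ball 0 1)" and f: "f \<in> sobolev l (half_ball 1)"
  and sol: "weak_solution m a (half_ball 1) u f"
  and u0: "AE x in lebesgue_on (ball 0 1 \<inter> {x. x $ Max UNIV < 0}). u x = 0"
 obtains D F where "agrees (half_ball 1) u (D (%_. 0))"
  "half_ball_solution m l c M a D F (grad_L2_norm m (half_ball 1) u + sobolev_norm l (half_ball 1) f)"
proof -
 let ?H = "half_ball 1 :: (real^'n::_) set" and ?L = "{x::real^'n::_. x $ lastix < 0}"
 let ?Z = "grad_L2_norm m ?H u + sobolev_norm l ?H f"
 have B: "ball 0 1 \<in> sets (borel :: (real^'n::_) measure)" by simp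
 have H: "open ?H" "?H \<in> sets borel" by (rule open_half_ball half_ball_borel)+
 have Lb: "?L \<in> sets borel" by (rule borel_open[OF open_lower])
 have z0: "(%_. 0) ~= \<alpha>" if "len \<alpha> = m" for \<alpha> :: "'n multi_index" using that m by auto
 have "u \<in> L2 (ball 0 1)" using u by (simp add: sobolev_def)
 then obtain g where g: "agrees (ball 0 1) u g" by (rule L2_agrees[OF B])
 define g0 where "g0 x = ind (ball 0 1 - ?L) x * g x" for x
 have g0: "agrees (ball 0 1) u g0"
 proof -
  have "AE x in lebesgue. x \<in> ball 0 1 \<inter> ?L --> u x = 0"
   using u0 AE_restrict_space_iff[of "ball 0 1 \<inter> ?L" lebesgue] B Lb by simp
  then have "AE x in lborel. x \<in> ball 0 1 \<inter> ?L --> u x = 0" by (simp only: AE_completion_iff)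
  moreover have "AE x in lborel. x \<in> ball 0 1 --> u x = g x" using g by (simp add: agrees_def)
  ultimately have "AE x in lborel. x \<in> ball 0 1 --> u x = g0 x"
   by eventually_elim (auto simp: g0_def indicator_def)
  moreover have "L2b g0" unfolding g0_def using g B Lb by (intro L2b_indicator) (auto simp: agrees_def)
  ultimately show ?thesis by (simp add: agrees_def)
 qed
 obtain D' where D'0: "D' (%_. 0) = g0" and D': "jet m (ball 0 1) D'"
  using sobolev_jet[OF open_ball u g0] by blast
 define D where "D \<alpha> x = ind (ball 0 1 - ?L) x * D' \<alpha> x" for \<alpha> x
 have D0: "D (%_. 0) = g0" by (auto simp: D_def D'0 g0_def indicator_def fun_eq_iff)
 have LD: "L2b (D \<alpha>)" if "len \<alpha> <= m" for \<alpha>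
  unfolding D_def using B Lb by (intro L2b_indicator jet_L2b[OF D' that]) auto
 have wD: "wd (ball 0 1) \<alpha> g0 (D \<alpha>)" if "len \<alpha> <= m" for \<alpha>
  unfolding D_def
  by (rule wd_restrict[OF _ jet_L2b[OF D' that] open_ball open_lower])
   (use jet_wd[OF D' that] in \<open>simp_all add: D'0 g0_def\<close>)
 have uH: "agrees ?H u g0" by (rule agrees_mono[OF g0 half_ball_subset])
 have aD: "agrees ?H (weak_deriv ?H \<alpha> u) (D \<alpha>)" if "len \<alpha> <= m" for \<alpha>
  by (rule weak_deriv_agrees[OF H(1) uH LD[OF that] wd_mono[OF wD[OF that] half_ball_subset]])
 have nD: "nrm_on ?H (D \<alpha>) = nrm (D \<alpha>)" if "len \<alpha> <= m" for \<alpha>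
 proof (rule nrm_cong_AE)
  show "D \<alpha> \<in> borel_measurable borel" "(%x. ind ?H x * D \<alpha> x) \<in> borel_measurable borel"
   by (intro L2b_borel L2b_indicator LD that H(2))+
  show "AE x in lborel. ind ?H x * D \<alpha> x = D \<alpha> x"
   using AE_last_neq_0 by eventually_elim (auto simp: D_def indicator_def half_ball_def)
 qed
 have grad: "(grad_L2_norm m ?H u)\<^sup>2 = (\<Sum>\<alpha> | len \<alpha> = m. (nrm (D \<alpha>))\<^sup>2)"
 proof -
  have i: "integrable (lebesgue_on ?H) (%x. (weak_deriv ?H \<alpha> u x)\<^sup>2)" if "len \<alpha> = m" for \<alpha>
   by (rule agrees_norm(3)[OF H(2) aD]) (use that in simp)
  have "(LINT x|lebesgue_on ?H. (\<Sum>\<alpha> | len \<alpha> = m. (weak_deriv ?H \<alpha> u x)\<^sup>2))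
   = (\<Sum>\<alpha> | len \<alpha> = m. LINT x|lebesgue_on ?H. (weak_deriv ?H \<alpha> u x)\<^sup>2)"
   by (rule Bochner_Integration.integral_sum) (use i in simp)
  also have "\<dots> = (\<Sum>\<alpha> | len \<alpha> = m. (nrm (D \<alpha>))\<^sup>2)"
  proof (rule sum.cong[OF refl])
   fix \<alpha> :: "'n multi_index" assume "\<alpha> \<in> {\<alpha>. len \<alpha> = m}"
   then have le: "len \<alpha> <= m" by simp
   have "(L2_norm_on ?H (weak_deriv ?H \<alpha> u))\<^sup>2 = (nrm (D \<alpha>))\<^sup>2"
    using agrees_norm(2)[OF H(2) aD[OF le]] by (simp add: nD[OF le])
   then show "(LINT x|lebesgue_on ?H. (weak_deriv ?H \<alpha> u x)\<^sup>2) = (nrm (D \<alpha>))\<^sup>2"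
    by (simp add: L2_norm_on_def integral_nonneg_AE)
  qed
  finally show ?thesis by (simp add: grad_L2_norm_def sum_nonneg)
 qed
 have grad0: "grad_L2_norm m ?H u >= 0"
  unfolding grad_L2_norm_def by (intro real_sqrt_ge_zero integral_nonneg_AE) (simp add: sum_nonneg)
 have DZ: "nrm (D \<alpha>) <= grad_L2_norm m ?H u" if "len \<alpha> = m" for \<alpha>
 proof (rule power2_le_imp_le[OF _ grad0])
  show "(nrm (D \<alpha>))\<^sup>2 <= (grad_L2_norm m ?H u)\<^sup>2"
   unfolding grad by (rule member_le_sum) (use that in \<open>auto simp: finite_mi_length_eq\<close>)
 qed
 have "f \<in> L2 ?H" using f by (simp add: sobolev_def)
 then obtain f0 where f0': "agrees ?H f f0" by (rule L2_agrees[OF H(2)])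
 obtain F' where F'0: "F' (%_. 0) = f0" and F': "jet l ?H F'"
  using sobolev_jet[OF H(1) f f0'] by blast
 define F where "F \<gamma> x = ind ?H x * F' \<gamma> x" for \<gamma> x
 have LF: "L2b (F \<gamma>)" if "len \<gamma> <= l" for \<gamma>
  unfolding F_def by (intro L2b_indicator jet_L2b[OF F' that] H(2))
 have aF: "agrees ?H (F' \<gamma>) (F \<gamma>)" if "len \<gamma> <= l" for \<gamma>
  using LF[OF that] by (simp add: agrees_def F_def)
 have aF0: "agrees ?H f (F (%_. 0))"
  using f0' LF[of "%_. 0"] by (auto simp: agrees_def F_def F'0 elim: eventually_mono)
 have wF: "wd ?H \<gamma> (F (%_. 0)) (F \<gamma>)" if "len \<gamma> <= l" for \<gamma>
 proof -
  have "is_weak_deriv ?H \<gamma> f (F' \<gamma>)"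
   using agrees_is_weak_deriv[OF H(2) f0' agrees_refl[OF jet_L2b[OF F' that]]] jet_wd[OF F' that] F'0 by simp
  then show ?thesis using agrees_is_weak_deriv[OF H(2) aF0 aF[OF that]] by simp
 qed
 have FF: "(%x. ind ?H x * F \<gamma> x) = F \<gamma>" for \<gamma> by (auto simp: F_def indicator_def fun_eq_iff)
 have sob: "sobolev_norm l ?H f = sqrt (\<Sum>\<gamma> | len \<gamma> <= l. (nrm (F \<gamma>))\<^sup>2)"
  using sobolev_norm_agrees(2)[OF H(1) aF0 LF wF] unfolding FF by simp
 have FZ: "nrm (F \<gamma>) <= sobolev_norm l ?H f" if "len \<gamma> <= l" for \<gamma>
 proof -
  have "(nrm (F \<gamma>))\<^sup>2 <= (\<Sum>\<gamma> | len \<gamma> <= l. (nrm (F \<gamma>))\<^sup>2)"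
   by (rule member_le_sum) (use that in \<open>auto simp: finite_mi_length_le\<close>)
  then show ?thesis unfolding sob by (rule real_le_rsqrt)
 qed
 have "sobolev_norm l ?H f >= 0" unfolding sob by (simp add: sum_nonneg)
 then have Z: "grad_L2_norm m ?H u <= ?Z" "sobolev_norm l ?H f <= ?Z" using grad0 by simp_all
 have eq: "(\<Sum>\<alpha> | len \<alpha> = m. \<Sum>\<beta> | len \<beta> = m. a \<alpha> \<beta> * ip (D \<alpha>) (mi_partial \<beta> \<phi>)) = ip (F (%_. 0)) \<phi>"
  if \<phi>: "\<phi> \<in> test_functions ?H" for \<phi>
 proof -
  let ?I = "{\<alpha>::'n multi_index. len \<alpha> = m}"
  have L\<phi>: "L2b (mi_partial \<beta> \<phi>)" for \<beta> by (rule test_L2b[OF test_mi_partial[OF \<phi>]])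
  have a\<phi>: "agrees ?H (weak_deriv ?H \<beta> \<phi>) (mi_partial \<beta> \<phi>)" for \<beta>
   by (rule weak_deriv_agrees[OF H(1) agrees_refl[OF test_L2b[OF \<phi>]] L\<phi> wd_test[OF \<phi>]])
  have "AE x in lborel. \<forall>\<alpha>\<in>?I. x \<in> ?H --> weak_deriv ?H \<alpha> u x = D \<alpha> x"
   using aD by (intro AE_finite_allI finite_mi_length_eq) (auto simp: agrees_def)
  moreover have "AE x in lborel. \<forall>\<beta>\<in>?I. x \<in> ?H --> weak_deriv ?H \<beta> \<phi> x = mi_partial \<beta> \<phi> x"
   using a\<phi> by (intro AE_finite_allI finite_mi_length_eq) (auto simp: agrees_def)
  ultimately have ae: "AE x in lborel. x \<in> ?H -->
   (\<Sum>\<alpha>\<in>?I. \<Sum>\<beta>\<in>?I. a \<alpha> \<beta> * weak_deriv ?H \<alpha> u x * weak_deriv ?H \<beta> \<phi> x) =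
   (\<Sum>\<alpha>\<in>?I. \<Sum>\<beta>\<in>?I. a \<alpha> \<beta> * D \<alpha> x * mi_partial \<beta> \<phi> x)"
   by eventually_elim (auto intro!: sum.cong)
  have Dm: "D \<alpha> \<in> borel_measurable borel" if "\<alpha> \<in> ?I" for \<alpha> using L2b_borel[OF LD] that by simp
  have \<phi>m: "mi_partial \<beta> \<phi> \<in> borel_measurable borel" for \<beta> by (rule L2b_borel[OF L\<phi>])
  have meas: "(%x. \<Sum>\<alpha>\<in>?I. \<Sum>\<beta>\<in>?I. a \<alpha> \<beta> * D \<alpha> x * mi_partial \<beta> \<phi> x) \<in> borel_measurable borel"
   by (intro borel_measurable_sum borel_measurable_times borel_measurable_const Dm \<phi>m)
  have \<phi>0: "mi_partial \<beta> \<phi> x = 0" if "x \<notin> ?H" for \<beta> x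
   by (rule test_functionsE[OF test_mi_partial[OF \<phi>, of \<beta>]]) (use that in blast)
  have int: "integrable lborel (%x. D \<alpha> x * mi_partial \<beta> \<phi> x)" if "\<alpha> \<in> ?I" for \<alpha> \<beta>
   using that by (intro L2b_integrable_mult LD L\<phi>) simp
  have "(LINT x|lebesgue_on ?H. (\<Sum>\<alpha>\<in>?I. \<Sum>\<beta>\<in>?I. a \<alpha> \<beta> * weak_deriv ?H \<alpha> u x * weak_deriv ?H \<beta> \<phi> x))
   = (LINT x|lborel. ind ?H x * (\<Sum>\<alpha>\<in>?I. \<Sum>\<beta>\<in>?I. a \<alpha> \<beta> * D \<alpha> x * mi_partial \<beta> \<phi> x))"
   by (rule lebesgue_on_integral[OF H(2) meas ae])
  also have "\<dots> = (LINT x|lborel. (\<Sum>\<alpha>\<in>?I. \<Sum>\<beta>\<in>?I. a \<alpha> \<beta> * (D \<alpha> x * mi_partial \<beta> \<phi> x)))"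
  proof (rule Bochner_Integration.integral_cong[OF refl])
   fix x
   show "ind ?H x * (\<Sum>\<alpha>\<in>?I. \<Sum>\<beta>\<in>?I. a \<alpha> \<beta> * D \<alpha> x * mi_partial \<beta> \<phi> x)
    = (\<Sum>\<alpha>\<in>?I. \<Sum>\<beta>\<in>?I. a \<alpha> \<beta> * (D \<alpha> x * mi_partial \<beta> \<phi> x))"
    using \<phi>0[of x] by (cases "x \<in> ?H") (simp_all add: mult.assoc)
  qed
  also have "\<dots> = (\<Sum>\<alpha>\<in>?I. LINT x|lborel. (\<Sum>\<beta>\<in>?I. a \<alpha> \<beta> * (D \<alpha> x * mi_partial \<beta> \<phi> x)))"
   by (intro Bochner_Integration.integral_sum Bochner_Integration.integrable_sum integrable_mult_right int)
  also have "\<dots> = (\<Sum>\<alpha>\<in>?I. \<Sum>\<beta>\<in>?I. a \<alpha> \<beta> * ip (D \<alpha>) (mi_partial \<beta> \<phi>))"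
  proof (rule sum.cong[OF refl])
   fix \<alpha> assume \<alpha>: "\<alpha> \<in> ?I"
   have "(LINT x|lborel. (\<Sum>\<beta>\<in>?I. a \<alpha> \<beta> * (D \<alpha> x * mi_partial \<beta> \<phi> x)))
    = (\<Sum>\<beta>\<in>?I. LINT x|lborel. a \<alpha> \<beta> * (D \<alpha> x * mi_partial \<beta> \<phi> x))"
    by (intro Bochner_Integration.integral_sum integrable_mult_right int \<alpha>)
   then show "(LINT x|lborel. (\<Sum>\<beta>\<in>?I. a \<alpha> \<beta> * (D \<alpha> x * mi_partial \<beta> \<phi> x)))
    = (\<Sum>\<beta>\<in>?I. a \<alpha> \<beta> * ip (D \<alpha>) (mi_partial \<beta> \<phi>))" by (simp add: ip_def)
  qed
  finally have lhs: "(LINT x|lebesgue_on ?H. (\<Sum>\<alpha>\<in>?I. \<Sum>\<beta>\<in>?I. a \<alpha> \<beta> * weak_deriv ?H \<alpha> u x * weak_deriv ?H \<beta> \<phi> x))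
   = (\<Sum>\<alpha>\<in>?I. \<Sum>\<beta>\<in>?I. a \<alpha> \<beta> * ip (D \<alpha>) (mi_partial \<beta> \<phi>))" .
  have "(LINT x|lebesgue_on ?H. (\<Sum>\<alpha>\<in>?I. \<Sum>\<beta>\<in>?I. a \<alpha> \<beta> * weak_deriv ?H \<alpha> u x * weak_deriv ?H \<beta> \<phi> x))
   = (LINT x|lebesgue_on ?H. f x * \<phi> x)"
   using sol test_sobolev_zero[OF H(1) \<phi>, of m] by (simp add: weak_solution_def)
  also have "\<dots> = ip (F (%_. 0)) \<phi>" by (rule agrees_pairing[OF H(2) aF0 \<phi>])
  finally show ?thesis unfolding lhs .
 qed
 have aM: "\<bar>a \<alpha> \<beta>\<bar> <= M" if "len \<alpha> = m" "len \<beta> = m" for \<alpha> \<beta>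
 proof -
  have "finite {\<bar>a \<alpha> \<beta>\<bar> | \<alpha> \<beta>. len \<alpha> = m \<and> len \<beta> = m}"
   by (rule finite_image_set2) (rule finite_mi_length_eq)+
  then show ?thesis unfolding M[symmetric] max_coeff_def by (rule Max_ge) (use that in blast)
 qed
 have "half_ball_solution m l c M a D F ?Z"
  unfolding half_ball_solution_def
 proof (intro conjI allI impI ballI)
  show "jet m (ball 0 1) D" unfolding jet_def D0 using LD wD by blast
  show "D \<alpha> x = 0" if "norm x > 1 \<or> x $ lastix < 0" for \<alpha> x
   using that by (auto simp: D_def indicator_def)
  show "nrm (D \<alpha>) <= ?Z" if "len \<alpha> = m" for \<alpha> using DZ[OF that] Z(1) by (rule order_trans)
  show "jet l ?H F" unfolding jet_def using LF wF by blast
  show "nrm (F \<gamma>) <= ?Z" if "len \<gamma> <= l" for \<gamma> using FZ[OF that] Z(2) by (rule order_trans)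
 qed (use ell aM eq in auto)
 moreover have "agrees ?H u (D (%_. 0))" unfolding D0 by (rule uH)
 ultimately show ?thesis by (rule that[rotated])
qed

theorem theorem1p2:
  fixes m l :: nat and c M :: real
  assumes "m \<ge> 1" and "c > 0"
  shows "\<exists>C>0. \<forall>(a :: 'n::{finite,wellorder} coeffs) u f.
    symmetric_coeffs m a \<and> elliptic_with m c a \<and> max_coeff m a = M \<and>
    u \<in> sobolev m (ball 0 1) \<and> f \<in> sobolev l (half_ball 1) \<and>
    weak_solution m a (half_ball 1) u f \<and>
    (AE x in lebesgue_on (ball 0 1 \<inter> {x. x $ Max UNIV < 0}). u x = 0)
    \<longrightarrow> u \<in> sobolev (2 * m + l) (half_ball (1/2)) \<and>
        sobolev_norm (2 * m + l) (half_ball (1/2)) u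
          \<le> C * (grad_L2_norm m (half_ball 1) u + sobolev_norm l (half_ball 1) f)"
proof -
 let ?n = "2 * m + l" and ?h = "half_ball (1/2) :: (real^'n::_) set"
 obtain C where C: "C >= 0" and reg: "!!(a :: 'n coeffs) D F Z \<gamma>.
  half_ball_solution m l c M a D F Z ==> len \<gamma> <= ?n ==>
  (\<exists>E. L2b E \<and> wd ?h \<gamma> (D (%_. 0)) E \<and> nrm E <= C * Z)"
  using half_ball_regularity[OF assms, of l M, where 'n='n] by blast
 define K where "K = sqrt (real (card {\<gamma>::'n multi_index. len \<gamma> <= ?n}))"
 have K: "K >= 0" by (simp add: K_def)
 show ?thesis
 proof (intro exI[of _ "K * C + 1"] conjI allI impI; (elim conjE)?)
  show "0 < K * C + 1" using K C by (simp add: add_nonneg_pos)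
  fix a :: "'n coeffs" and u f :: "'n rfun"
  assume h: "elliptic_with m c a" "max_coeff m a = M" "u \<in> sobolev m (ball 0 1)" "f \<in> sobolev l (half_ball 1)"
   "weak_solution m a (half_ball 1) u f" "AE x in lebesgue_on (ball 0 1 \<inter> {x. x $ Max UNIV < 0}). u x = 0"
  let ?Z = "grad_L2_norm m (half_ball 1) u + sobolev_norm l (half_ball 1) f"
  obtain D F where D: "agrees (half_ball 1) u (D (%_. 0))" and sol: "half_ball_solution m l c M a D F ?Z"
   by (rule weak_solution_imp_half_ball_solution[OF assms(1) h])
  have Z: "?Z >= 0"
  proof (rule order_trans[OF nrm_nonneg])
   show "nrm (D (normal_ix m)) <= ?Z" using sol unfolding half_ball_solution_def by simp
  qed
  have ag: "agrees ?h u (D (%_. 0))" by (rule agrees_mono[OF D]) (rule half_ball_mono, simp)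
  have "\<forall>\<gamma>. \<exists>E. len \<gamma> <= ?n --> L2b E \<and> wd ?h \<gamma> (D (%_. 0)) E \<and> nrm E <= C * ?Z"
   using reg[OF sol] by blast
  from choice[OF this] obtain E where "\<forall>\<gamma>. len \<gamma> <= ?n -->
   L2b (E \<gamma>) \<and> wd ?h \<gamma> (D (%_. 0)) (E \<gamma>) \<and> nrm (E \<gamma>) <= C * ?Z" ..
  then have E: "!!\<gamma>. len \<gamma> <= ?n ==> L2b (E \<gamma>)" "!!\<gamma>. len \<gamma> <= ?n ==> wd ?h \<gamma> (D (%_. 0)) (E \<gamma>)"
   "!!\<gamma>. len \<gamma> <= ?n ==> nrm (E \<gamma>) <= C * ?Z" by blast+
  show "u \<in> sobolev ?n ?h" by (rule sobolev_norm_agrees(1)[OF open_half_ball ag E(1,2)])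
  have eq: "sobolev_norm ?n ?h u = sqrt (\<Sum>\<gamma> | len \<gamma> <= ?n. (nrm_on ?h (E \<gamma>))\<^sup>2)"
   by (rule sobolev_norm_agrees(2)[OF open_half_ball ag E(1,2)])
  have "(\<Sum>\<gamma> | len \<gamma> <= ?n. (nrm_on ?h (E \<gamma>))\<^sup>2) <= (\<Sum>\<gamma>::'n multi_index | len \<gamma> <= ?n. (C * ?Z)\<^sup>2)"
  proof (intro sum_mono power_mono)
   fix \<gamma> :: "'n multi_index" assume "\<gamma> \<in> {\<gamma>. len \<gamma> <= ?n}"
   then have g: "len \<gamma> <= ?n" by simp
   show "nrm_on ?h (E \<gamma>) <= C * ?Z"
    using nrm_indicator_le[OF E(1)[OF g] half_ball_borel] E(3)[OF g] by (rule order_trans)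
  qed simp
  also have "\<dots> = (K * (C * ?Z))\<^sup>2" by (simp add: K_def power_mult_distrib)
  finally have "sobolev_norm ?n ?h u <= K * (C * ?Z)"
   unfolding eq using K C Z by (intro real_le_lsqrt) auto
  also have "\<dots> <= (K * C + 1) * ?Z" using Z by (simp add: distrib_right mult.assoc)
  finally show "sobolev_norm ?n ?h u <= (K * C + 1) * ?Z" .
 qed
qed

end
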